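(* Let $z\mapsto e^{zN}.F$ be a nilpotent orbit of graded-polarized mixed Hodge structure (with weight filtration $W$) such that the induced graded orbits $e^{zN}.F\,Gr^W_k$ are split for every $k$. Then $e^{zN}.F$ is admissible and split if and only if the limit $$Y_\infty=\lim_{\mathrm{Im}(z)\to\infty}\mathrm{Ad}(e^{-zN})\,Y_{(e^{zN}.F,W)}$$ exists (as a grading of $W$) and is defined over $\mathbb R$.
   Context: Let $V=V_{\mathbb R}\otimes\mathbb C$ be a finite-dimensional complex vector space with real structure (coming from a rational structure), $W$ an increasing filtration of $V$ defined over $\mathbb Q$, $\mathcal S_k$ rational nondegenerate bilinear forms on $Gr^W_k$ of parity $(-1)^k$, and $h^{p,q}$ a collection of Hodge numbers. $\mathcal M$ is the set of decreasing filtrations $F$ of $V$ such that $(F,W)$ is a mixed Hodge structure, graded-polarized by $\mathcal S$ (the pure Hodge structure of weight $k$ induced on $Gr^W_k$ is polarized by $\mathcal S_k$), with $\dim F^pGr^W_k=\sum_{r\ge p}h^{r,k-r}$. $\check{\mathcal M}\supseteq\mathcal M$ is the set of decreasing filtrations with the same dimensions $\dim F^pGr^W_k$ that satisfy Riemann's first bilinear relation on each $Gr^W_k$ with respect to $\mathcal S_k$. $G_{\mathbb R}$ is the group of $g\in GL(V_{\mathbb R})$ preserving $W$ and acting on each $Gr^W_k$ by isometries of $\mathcal S_k$. A nilpotent orbit of graded-polarized mixed Hodge structure consists of $F\in\check{\mathcal M}$ and a nilpotent $N\in Lie(G_{\mathbb R})$ such that $N(F^p)\subseteq F^{p-1}$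 for all $p$ and there is a constant $\alpha$ with $e^{zN}.F\in\mathcal M$ whenever $\mathrm{Im}(z)>\alpha$. A mixed Hodge structure $(F,W)$ determines a unique bigrading $V=\bigoplus_{p,q}I^{p,q}$ with $F^p=\bigoplus_{a\ge p,b}I^{a,b}$, $W_k=\bigoplus_{a+b\le k}I^{a,b}$ and $\overline{I^{p,q}}\equiv I^{q,p}\mod\bigoplus_{r<q,s<p}I^{r,s}$. It is split over $\mathbb R$ if $\overline{I^{p,q}}=I^{q,p}$ for all $p,q$. $Y_{(F,W)}$ is the semisimple endomorphism acting as $k$ on $\bigoplus_{p+q=k}I^{p,q}$. A grading of $W$ is a semisimple endomorphism $Y$ with integer eigenvalues such that $W_k=\bigoplus_{j\le k}E_j(Y)$ ($E_j$ denoting the $j$-eigenspace); it is defined over $\mathbb R$ if it preserves $V_{\mathbb R}$. For a nilpotent $N$, $W(N)$ is the monodromy weight filtration: the unique increasing filtration with $NW_\ell(N)\subseteq W_{\ell-2}(N)$ and $N^\ell:Gr^{W(N)}_\ell\to Gr^{W(N)}_{-\ell}$ an isomorphism for $\ell\ge0$. The shift is $W[\ell]_j=W_{j+\ell}$. The relative weight filtration ${}^rW={}^rW(N,W)$ is the (unique if it exists) increasing filtration of $V$ with $N\,{}^rW_k\subseteq{}^rW_{k-2}$ inducing on each $Gr^W_k$ the filtration $W(N:Gr^W_k\to Gr^W_k)[-k]$. The nilpotent orbit is admissible if ${}^rW(N,W)$ exists (its limiting Hodge filtration is $F$); in that case $(F,{}^rW)$ is a mixed Hodge structure, and the admissible orbit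 is called split if $(F,{}^rW)$ is split over $\mathbb R$. The graded orbit $e^{zN}.F\,Gr^W_k$ is split if the limiting mixed Hodge structure $(F\,Gr^W_k,\;W(N:Gr^W_k\to Gr^W_k)[-k])$ on $Gr^W_k$ is split over $\mathbb R$. *)

theory Defs
  imports Complex_Main
begin

text \<open>
  A finite-dimensional complex vector space with a rational structure is given by a type
  \<^typ>\<open>'v\<close> with a scalar multiplication and a finite basis \<open>B\<close>: the rational (real) structure is the
  rational (real) span of \<open>B\<close>.  Every rational structure has such a basis.

  Quotients: a quotient \<open>A / A'\<close> of subspaces \<open>A' \<subseteq> A\<close> is represented by the pair \<open>A' A\<close>, and
  a subspace of \<open>A / A'\<close> by its preimage in \<open>A\<close>, that is, by a subspace between \<open>A'\<close> and \<open>A\<close>.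
  The whole space is the pair \<open>{0} UNIV\<close>; the graded piece of weight \<open>k\<close> of \<open>W\<close> is the pair
  \<open>W (k - 1)\<close>, \<open>W k\<close>.
\<close>

locale rational_structure = finite_dimensional_vector_space scale B
  for scale :: "complex \<Rightarrow> 'v::ab_group_add \<Rightarrow> 'v" (infixr \<open>*\<^sub>C\<close> 75)
    and B :: "'v set"
begin

definition V_Q :: "'v set" where
  "V_Q = {v. \<forall>b\<in>B. representation B v b \<in> \<rat>}"

definition V_R :: "'v set" where
  "V_R = {v. \<forall>b\<in>B. representation B v b \<in> \<real>}"

definition vconj :: "'v \<Rightarrow> 'v" where
  "vconj v = (\<Sum>b\<in>B. cnj (representation B v b) *\<^sub>C b)"

definition endomorphism :: "('v \<Rightarrow> 'v) \<Rightarrow> bool" where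
  "endomorphism X \<longleftrightarrow> Vector_Spaces.linear scale scale X"

definition defined_over_R :: "('v \<Rightarrow> 'v) \<Rightarrow> bool" where
  "defined_over_R X \<longleftrightarrow> X ` V_R \<subseteq> V_R"

definition nilpotent :: "('v \<Rightarrow> 'v) \<Rightarrow> bool" where
  "nilpotent X \<longleftrightarrow> endomorphism X \<and> (\<exists>n. \<forall>v. (X ^^ n) v = 0)"

definition exp_end :: "('v \<Rightarrow> 'v) \<Rightarrow> 'v \<Rightarrow> 'v" where
  "exp_end X v = (\<Sum>b\<in>B. (\<Sum>n. representation B ((X ^^ n) v) b / fact n) *\<^sub>C b)"

definition Ad :: "('v \<Rightarrow> 'v) \<Rightarrow> ('v \<Rightarrow> 'v) \<Rightarrow> 'v \<Rightarrow> 'v" where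
  "Ad g X = g \<circ> X \<circ> inv g"

definition exp_mult :: "complex \<Rightarrow> ('v \<Rightarrow> 'v) \<Rightarrow> 'v \<Rightarrow> 'v" where
  "exp_mult z N = exp_end (\<lambda>v. z *\<^sub>C N v)"

text \<open>Convergence in \<open>End V\<close>: convergence of all coordinates with respect to the basis \<open>B\<close>.\<close>

definition end_tendsto :: "('a \<Rightarrow> 'v \<Rightarrow> 'v) \<Rightarrow> ('v \<Rightarrow> 'v) \<Rightarrow> 'a filter \<Rightarrow> bool" where
  "end_tendsto X L \<F> \<longleftrightarrow>
     (\<forall>v. \<forall>b\<in>B. ((\<lambda>z. representation B (X z v) b) \<longlongrightarrow> representation B (L v) b) \<F>)"

definition subspace_sum :: "'v set \<Rightarrow> 'v set \<Rightarrow> 'v set" where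
  "subspace_sum U U' = {u + u' | u u'. u \<in> U \<and> u' \<in> U'}"


subsection \<open>Filtrations\<close>

definition increasing_filtration :: "'v set \<Rightarrow> 'v set \<Rightarrow> (int \<Rightarrow> 'v set) \<Rightarrow> bool" where
  "increasing_filtration A' A W \<longleftrightarrow>
     (\<forall>k. subspace (W k) \<and> A' \<subseteq> W k \<and> W k \<subseteq> A) \<and> mono W \<and>
     (\<exists>k. W k = A') \<and> (\<exists>k. W k = A)"

definition decreasing_filtration :: "'v set \<Rightarrow> 'v set \<Rightarrow> (int \<Rightarrow> 'v set) \<Rightarrow> bool" where
  "decreasing_filtration A' A F \<longleftrightarrow>
     (\<forall>p. subspace (F p) \<and> A' \<subseteq> F p \<and> F p \<subseteq> A) \<and> antimono F \<and>
     (\<exists>p. F p = A') \<and> (\<exists>p. F p = A)"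

definition filtration_over_Q :: "(int \<Rightarrow> 'v set) \<Rightarrow> bool" where
  "filtration_over_Q W \<longleftrightarrow> (\<forall>k. W k = span (W k \<inter> V_Q))"

definition shift :: "(int \<Rightarrow> 'v set) \<Rightarrow> int \<Rightarrow> int \<Rightarrow> 'v set" where
  "shift W l j = W (j + l)"

text \<open>The filtration induced by \<open>F\<close> on \<open>U / U'\<close>; \<open>Gr_filtration F W k\<close> is \<open>F Gr\<^sup>W\<^sub>k\<close>.\<close>

definition induced_filtration :: "'v set \<Rightarrow> 'v set \<Rightarrow> (int \<Rightarrow> 'v set) \<Rightarrow> int \<Rightarrow> 'v set" where
  "induced_filtration U' U F p = subspace_sum (F p \<inter> U) U'"

definition Gr_filtration :: "(int \<Rightarrow> 'v set) \<Rightarrow> (int \<Rightarrow> 'v set) \<Rightarrow> int \<Rightarrow> int \<Rightarrow> 'v set" where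
  "Gr_filtration F W k = induced_filtration (W (k - 1)) (W k) F"

definition act :: "('v \<Rightarrow> 'v) \<Rightarrow> (int \<Rightarrow> 'v set) \<Rightarrow> int \<Rightarrow> 'v set" where
  "act g F p = g ` F p"


subsection \<open>Mixed Hodge structures\<close>

definition pure_hodge_structure :: "'v set \<Rightarrow> 'v set \<Rightarrow> int \<Rightarrow> (int \<Rightarrow> 'v set) \<Rightarrow> bool" where
  "pure_hodge_structure A' A k F \<longleftrightarrow>
     decreasing_filtration A' A F \<and>
     (\<forall>p. F p \<inter> vconj ` F (k - p + 1) = A' \<and> subspace_sum (F p) (vconj ` F (k - p + 1)) = A)"

definition mixed_hodge_structure ::
  "'v set \<Rightarrow> 'v set \<Rightarrow> (int \<Rightarrow> 'v set) \<Rightarrow> (int \<Rightarrow> 'v set) \<Rightarrow> bool" where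
  "mixed_hodge_structure A' A F W \<longleftrightarrow>
     decreasing_filtration A' A F \<and> increasing_filtration A' A W \<and>
     (\<forall>k. vconj ` W k = W k) \<and>
     (\<forall>k. pure_hodge_structure (W (k - 1)) (W k) k (Gr_filtration F W k))"

text \<open>The span of the summands of a bigrading with index in \<open>P\<close>, as a subspace of \<open>A / A'\<close>.\<close>

definition bispan :: "'v set \<Rightarrow> (int \<Rightarrow> int \<Rightarrow> 'v set) \<Rightarrow> (int \<times> int) set \<Rightarrow> 'v set" where
  "bispan A' I P = span (A' \<union> (\<Union>(a, b)\<in>P. I a b))"

definition is_deligne_bigrading :: "'v set \<Rightarrow> 'v set \<Rightarrow> (int \<Rightarrow> 'v set) \<Rightarrow> (int \<Rightarrow> 'v set) \<Rightarrow>
    (int \<Rightarrow> int \<Rightarrow> 'v set) \<Rightarrow> bool" where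
  "is_deligne_bigrading A' A F W I \<longleftrightarrow>
     (\<forall>p q. subspace (I p q) \<and> A' \<subseteq> I p q \<and> I p q \<subseteq> A) \<and>
     bispan A' I UNIV = A \<and>
     (\<forall>P u. finite P \<longrightarrow> (\<forall>(p, q)\<in>P. u p q \<in> I p q) \<longrightarrow> (\<Sum>(p, q)\<in>P. u p q) \<in> A' \<longrightarrow>
        (\<forall>(p, q)\<in>P. u p q \<in> A')) \<and>
     (\<forall>p. F p = bispan A' I {(a, b). a \<ge> p}) \<and>
     (\<forall>k. W k = bispan A' I {(a, b). a + b \<le> k}) \<and>
     (\<forall>p q. subspace_sum (vconj ` I p q) (bispan A' I {(r, s). r < q \<and> s < p}) =
            subspace_sum (I q p) (bispan A' I {(r, s). r < q \<and> s < p}))"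

definition deligne_bigrading ::
  "'v set \<Rightarrow> 'v set \<Rightarrow> (int \<Rightarrow> 'v set) \<Rightarrow> (int \<Rightarrow> 'v set) \<Rightarrow> int \<Rightarrow> int \<Rightarrow> 'v set" where
  "deligne_bigrading A' A F W = (THE I. is_deligne_bigrading A' A F W I)"

definition split_over_R ::
  "'v set \<Rightarrow> 'v set \<Rightarrow> (int \<Rightarrow> 'v set) \<Rightarrow> (int \<Rightarrow> 'v set) \<Rightarrow> bool" where
  "split_over_R A' A F W \<longleftrightarrow> mixed_hodge_structure A' A F W \<and>
     (\<forall>p q. vconj ` deligne_bigrading A' A F W p q = deligne_bigrading A' A F W q p)"

text \<open>The grading \<open>Y\<^bsub>(F,W)\<^esub>\<close> of a mixed Hodge structure \<open>(F, W)\<close> on the whole space.\<close>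

definition hodge_grading :: "(int \<Rightarrow> 'v set) \<Rightarrow> (int \<Rightarrow> 'v set) \<Rightarrow> 'v \<Rightarrow> 'v" where
  "hodge_grading F W = (THE Y. endomorphism Y \<and>
     (\<forall>p q. \<forall>v \<in> deligne_bigrading {0} UNIV F W p q. Y v = of_int (p + q) *\<^sub>C v))"

definition eigenspace :: "('v \<Rightarrow> 'v) \<Rightarrow> complex \<Rightarrow> 'v set" where
  "eigenspace Y c = {v. Y v = c *\<^sub>C v}"

definition semisimple :: "('v \<Rightarrow> 'v) \<Rightarrow> bool" where
  "semisimple Y \<longleftrightarrow> endomorphism Y \<and> span (\<Union>c. eigenspace Y c) = UNIV"

definition grading :: "(int \<Rightarrow> 'v set) \<Rightarrow> ('v \<Rightarrow> 'v) \<Rightarrow> bool" where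
  "grading W Y \<longleftrightarrow> semisimple Y \<and> (\<forall>c. eigenspace Y c \<noteq> {0} \<longrightarrow> c \<in> \<int>) \<and>
     (\<forall>k. W k = span (\<Union>j\<in>{..k}. eigenspace Y (of_int j)))"


subsection \<open>Graded polarizations and the classifying spaces\<close>

text \<open>A bilinear form on \<open>A / A'\<close> is a bilinear form on \<open>A\<close> that vanishes if one of the arguments
  is in \<open>A'\<close>; the values outside \<open>A\<close> are irrelevant.\<close>

definition bilinear_form :: "'v set \<Rightarrow> 'v set \<Rightarrow> ('v \<Rightarrow> 'v \<Rightarrow> complex) \<Rightarrow> bool" where
  "bilinear_form A' A Q \<longleftrightarrow>
     (\<forall>u\<in>A. \<forall>u'\<in>A. \<forall>v\<in>A. Q (u + u') v = Q u v + Q u' v \<and> Q v (u + u') = Q v u + Q v u') \<and>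
     (\<forall>c. \<forall>u\<in>A. \<forall>v\<in>A. Q (c *\<^sub>C u) v = c * Q u v \<and> Q u (c *\<^sub>C v) = c * Q u v) \<and>
     (\<forall>u\<in>A'. \<forall>v\<in>A. Q u v = 0 \<and> Q v u = 0)"

definition nondegenerate :: "'v set \<Rightarrow> 'v set \<Rightarrow> ('v \<Rightarrow> 'v \<Rightarrow> complex) \<Rightarrow> bool" where
  "nondegenerate A' A Q \<longleftrightarrow>
     (\<forall>u\<in>A. (\<forall>v\<in>A. Q u v = 0) \<longrightarrow> u \<in> A') \<and> (\<forall>v\<in>A. (\<forall>u\<in>A. Q u v = 0) \<longrightarrow> v \<in> A')"

definition rational_form :: "'v set \<Rightarrow> ('v \<Rightarrow> 'v \<Rightarrow> complex) \<Rightarrow> bool" where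
  "rational_form A Q \<longleftrightarrow> (\<forall>u\<in>A \<inter> V_Q. \<forall>v\<in>A \<inter> V_Q. Q u v \<in> \<rat>)"

definition graded_forms :: "(int \<Rightarrow> 'v set) \<Rightarrow> (int \<Rightarrow> 'v \<Rightarrow> 'v \<Rightarrow> complex) \<Rightarrow> bool" where
  "graded_forms W S \<longleftrightarrow> (\<forall>k.
     bilinear_form (W (k - 1)) (W k) (S k) \<and> nondegenerate (W (k - 1)) (W k) (S k) \<and>
     rational_form (W k) (S k) \<and>
     (\<forall>u\<in>W k. \<forall>v\<in>W k. S k v u = (-1) powi k * S k u v))"

definition first_bilinear_relation ::
  "int \<Rightarrow> (int \<Rightarrow> 'v set) \<Rightarrow> ('v \<Rightarrow> 'v \<Rightarrow> complex) \<Rightarrow> bool" where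
  "first_bilinear_relation k F Q \<longleftrightarrow> (\<forall>p. \<forall>u \<in> F p. \<forall>v \<in> F (k - p + 1). Q u v = 0)"

text \<open>Sign convention: the Weil operator acts on \<open>H\<^bsup>p,q\<^esup> = F\<^sup>p \<inter> vconj F\<^sup>q\<close> as \<open>\<i>\<close> to the power \<open>p - q\<close>.\<close>

definition polarized :: "'v set \<Rightarrow> int \<Rightarrow> (int \<Rightarrow> 'v set) \<Rightarrow> ('v \<Rightarrow> 'v \<Rightarrow> complex) \<Rightarrow> bool" where
  "polarized A' k F Q \<longleftrightarrow> first_bilinear_relation k F Q \<and>
     (\<forall>p q. p + q = k \<longrightarrow> (\<forall>v \<in> F p \<inter> vconj ` F q. v \<notin> A' \<longrightarrow>
        (\<exists>r>0. \<i> powi (p - q) * Q v (vconj v) = complex_of_real r)))"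

text \<open>The collection \<open>h\<close> is finitely supported, so the sum over the nonzero terms is
  \<open>\<Sum>\<^bsub>r \<ge> p\<^esub> h\<^bsup>r, k - r\<^esup>\<close>.\<close>

definition hodge_dims ::
  "(int \<Rightarrow> 'v set) \<Rightarrow> (int \<Rightarrow> int \<Rightarrow> nat) \<Rightarrow> (int \<Rightarrow> 'v set) \<Rightarrow> bool" where
  "hodge_dims W h F \<longleftrightarrow> (\<forall>p k. dim (Gr_filtration F W k p) - dim (W (k - 1)) =
     (\<Sum>r | r \<ge> p \<and> h r (k - r) \<noteq> 0. h r (k - r)))"

definition classifying_space :: "(int \<Rightarrow> 'v set) \<Rightarrow> (int \<Rightarrow> 'v \<Rightarrow> 'v \<Rightarrow> complex) \<Rightarrow>
    (int \<Rightarrow> int \<Rightarrow> nat) \<Rightarrow> (int \<Rightarrow> 'v set) set" where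
  "classifying_space W S h = {F. mixed_hodge_structure {0} UNIV F W \<and>
     (\<forall>k. polarized (W (k - 1)) k (Gr_filtration F W k) (S k)) \<and> hodge_dims W h F}"

definition compact_dual :: "(int \<Rightarrow> 'v set) \<Rightarrow> (int \<Rightarrow> 'v \<Rightarrow> 'v \<Rightarrow> complex) \<Rightarrow>
    (int \<Rightarrow> int \<Rightarrow> nat) \<Rightarrow> (int \<Rightarrow> 'v set) set" where
  "compact_dual W S h = {F. decreasing_filtration {0} UNIV F \<and> hodge_dims W h F \<and>
     (\<forall>k. first_bilinear_relation k (Gr_filtration F W k) (S k))}"

definition G_R :: "(int \<Rightarrow> 'v set) \<Rightarrow> (int \<Rightarrow> 'v \<Rightarrow> 'v \<Rightarrow> complex) \<Rightarrow> ('v \<Rightarrow> 'v) set" where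
  "G_R W S = {g. endomorphism g \<and> bij g \<and> g ` V_R = V_R \<and> (\<forall>k. g ` W k = W k) \<and>
     (\<forall>k. \<forall>u\<in>W k. \<forall>v\<in>W k. S k (g u) (g v) = S k u v)}"

definition Lie :: "('v \<Rightarrow> 'v) set \<Rightarrow> ('v \<Rightarrow> 'v) set" where
  "Lie G = {X. endomorphism X \<and> (\<forall>t::real. exp_mult (of_real t) X \<in> G)}"


subsection \<open>Nilpotent orbits\<close>

definition nilpotent_orbit :: "(int \<Rightarrow> 'v set) \<Rightarrow> (int \<Rightarrow> 'v \<Rightarrow> 'v \<Rightarrow> complex) \<Rightarrow>
    (int \<Rightarrow> int \<Rightarrow> nat) \<Rightarrow> (int \<Rightarrow> 'v set) \<Rightarrow> ('v \<Rightarrow> 'v) \<Rightarrow> bool" where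
  "nilpotent_orbit W S h F N \<longleftrightarrow>
     F \<in> compact_dual W S h \<and> N \<in> Lie (G_R W S) \<and> nilpotent N \<and>
     (\<forall>p. N ` F p \<subseteq> F (p - 1)) \<and>
     (\<exists>\<alpha>. \<forall>z. Im z > \<alpha> \<longrightarrow> act (exp_mult z N) F \<in> classifying_space W S h)"

definition is_monodromy_weight_filtration ::
  "'v set \<Rightarrow> 'v set \<Rightarrow> ('v \<Rightarrow> 'v) \<Rightarrow> (int \<Rightarrow> 'v set) \<Rightarrow> bool" where
  "is_monodromy_weight_filtration A' A N M \<longleftrightarrow>
     increasing_filtration A' A M \<and> (\<forall>l. N ` M l \<subseteq> M (l - 2)) \<and>
     (\<forall>l::nat. (\<forall>v \<in> M (int l). (N ^^ l) v \<in> M (- int l - 1) \<longrightarrow> v \<in> M (int l - 1)) \<and>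
        subspace_sum ((N ^^ l) ` M (int l)) (M (- int l - 1)) = M (- int l))"

definition monodromy_weight_filtration :: "'v set \<Rightarrow> 'v set \<Rightarrow> ('v \<Rightarrow> 'v) \<Rightarrow> int \<Rightarrow> 'v set" where
  "monodromy_weight_filtration A' A N = (THE M. is_monodromy_weight_filtration A' A N M)"

text \<open>\<open>W(N : Gr\<^sup>W\<^sub>k \<rightarrow> Gr\<^sup>W\<^sub>k)[-k]\<close>\<close>

definition Gr_limit_weight_filtration ::
  "('v \<Rightarrow> 'v) \<Rightarrow> (int \<Rightarrow> 'v set) \<Rightarrow> int \<Rightarrow> int \<Rightarrow> 'v set" where
  "Gr_limit_weight_filtration N W k =
     shift (monodromy_weight_filtration (W (k - 1)) (W k) N) (- k)"

definition is_relative_weight_filtration ::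
  "('v \<Rightarrow> 'v) \<Rightarrow> (int \<Rightarrow> 'v set) \<Rightarrow> (int \<Rightarrow> 'v set) \<Rightarrow> bool" where
  "is_relative_weight_filtration N W M \<longleftrightarrow>
     increasing_filtration {0} UNIV M \<and> (\<forall>k. N ` M k \<subseteq> M (k - 2)) \<and>
     (\<forall>k. Gr_filtration M W k = Gr_limit_weight_filtration N W k)"

definition relative_weight_filtration ::
  "('v \<Rightarrow> 'v) \<Rightarrow> (int \<Rightarrow> 'v set) \<Rightarrow> int \<Rightarrow> 'v set" where
  "relative_weight_filtration N W = (THE M. is_relative_weight_filtration N W M)"

definition admissible :: "('v \<Rightarrow> 'v) \<Rightarrow> (int \<Rightarrow> 'v set) \<Rightarrow> bool" where
  "admissible N W \<longleftrightarrow> (\<exists>M. is_relative_weight_filtration N W M)"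

definition split_orbit :: "(int \<Rightarrow> 'v set) \<Rightarrow> (int \<Rightarrow> 'v set) \<Rightarrow> ('v \<Rightarrow> 'v) \<Rightarrow> bool" where
  "split_orbit W F N \<longleftrightarrow> split_over_R {0} UNIV F (relative_weight_filtration N W)"

definition Gr_split_orbit ::
  "(int \<Rightarrow> 'v set) \<Rightarrow> (int \<Rightarrow> 'v set) \<Rightarrow> ('v \<Rightarrow> 'v) \<Rightarrow> int \<Rightarrow> bool" where
  "Gr_split_orbit W F N k \<longleftrightarrow>
     split_over_R (W (k - 1)) (W k) (Gr_filtration F W k) (Gr_limit_weight_filtration N W k)"

end

end

theory Submission
  imports Defs "HOL-Library.Function_Algebras" "HOL-Library.Product_Plus"
begin

text \<open>
  Write \<open>Ad(exp(-z N))\<close> of the grading of the orbit at \<open>z\<close> as \<open>f = Y + g\<close> for a fixed grading \<open>Y\<close> of \<open>W\<close> that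
  preserves \<open>F\<close> and its conjugate.  Such a \<open>Y\<close> lifts the Deligne bigradings of the split limits on the
  graded pieces, so that the whole space is graded by triples \<open>(k, p, q)\<close> and \<open>N\<close> splits into components
  of degrees \<open>(-j, a, b)\<close>.  Both \<open>f\<close> and \<open>Ad(exp((z - cnj z) N)) f\<close> are restricted by the Hodge
  filtration and its conjugate, and together with opposedness on \<open>Gr\<^sup>W\<close> this determines \<open>g\<close>, one weight
  \<open>-j\<close> after the other, from the components of \<open>N\<close>.

  If the orbit is admissible and split, \<open>Y\<close> is the part of \<open>f\<close> of type \<open>(0, 0)\<close> at one point of the orbit.
  The equations then say that \<open>Y\<close> is Deligne's grading: \<open>N\<close> has type \<open>(-1, -1)\<close> and its components of negative
  weight are of highest weight for the component \<open>N0\<close> of weight \<open>0\<close>.  Hence \<open>f = Y\<close> everywhere on the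
  orbit, and the same holds for the conjugate of \<open>Y\<close>.  Conversely, if \<open>Y\<close> is a real limit, then \<open>g\<close> is a
  Laurent polynomial in \<open>Im z\<close> that tends to zero, which leaves only the type \<open>(-1, -1)\<close> for \<open>N\<close>; the weight
  filtration of the bigrading by \<open>(p, q)\<close> is then the relative weight filtration.
\<close>


text \<open>The grading of a mixed Hodge structure preserves the Hodge filtration, but its conjugate
  only up to the correction terms of Deligne's formula. So the conjugate condition on
  \<open>Ad(exp((z - cnj z) N)) f - Y\<close> is the bound \<open>b \<ge> l + 1\<close> on
  components of degree \<open>(l, a, b)\<close>, and in weight \<open>-j\<close> only those with
  \<open>b \<le> -j\<close> give equations. A priori these are nonlinear in the parts of
  \<open>N\<close>. Induction over \<open>j\<close> removes this obstacle: once the parts of weight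
  strictly between \<open>-j\<close> and \<open>0\<close> are of type \<open>(-1, -1)\<close> and of
  highest weight, all their iterated brackets respect the same bound and drop out. What remains is
  linear: \<open>ad(N0)^n\<close> of the weight \<open>-j\<close> part of \<open>g\<close>, plus
  \<open>j ad(N0)^(n-1) N_j\<close>, the factor \<open>j\<close> coming from
  \<open>[N_j, Y] = j N_j\<close>. As \<open>ad(N0)\<close> fixes \<open>a - b\<close>, the
  equations decouple along diagonals \<open>a - b = d\<close>, and opposedness provides an
  injectivity of Lefschetz type that makes solutions unique. They are homogeneous in
  \<open>z - cnj z = 2 i Im z\<close>, so a component of \<open>N\<close> of first Hodge degree
  \<open>c\<close> contributes the power \<open>1 + c - a\<close> of \<open>Im z\<close> in degree
  \<open>a\<close>.\<close>

context rational_structure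
begin

section \<open>Linear algebra of endomorphisms\<close>

lemma endomorphism_iff:
  "endomorphism X \<longleftrightarrow> (\<forall>x y. X (x + y) = X x + X y) \<and> (\<forall>c x. X (c *\<^sub>C x) = c *\<^sub>C X x)"
  unfolding endomorphism_def Vector_Spaces.linear_iff using vector_space_axioms by auto

lemma endomorphismI:
  assumes "\<And>x y. X (x + y) = X x + X y" and "\<And>c x. X (c *\<^sub>C x) = c *\<^sub>C X x"
  shows "endomorphism X"
  using assms by (simp add: endomorphism_iff)

context
  fixes X assumes X: "endomorphism X"
begin

lemma endo_add: "X (x + y) = X x + X y"
  using X by (simp add: endomorphism_iff)

lemma endo_scale: "X (c *\<^sub>C x) = c *\<^sub>C X x"
  using X by (simp add: endomorphism_iff)

lemma endo_zero: "X 0 = 0"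
  using endo_add[of 0 0] by simp

lemma endo_neg: "X (- x) = - X x"
  using endo_add[of x "- x"] endo_zero by (simp add: eq_neg_iff_add_eq_0 add.commute)

lemma endo_diff: "X (x - y) = X x - X y"
  using endo_add[of x "- y"] endo_neg by simp

lemma endo_sum: "X (sum f S) = (\<Sum>i\<in>S. X (f i))"
  by (induction S rule: infinite_finite_induct) (simp_all add: endo_zero endo_add)

lemma endo_subspace_image: "subspace S \<Longrightarrow> subspace (X ` S)"
  using X unfolding endomorphism_def
  by (metis Vector_Spaces.linear.axioms(3) module_hom.subspace_image)

lemma endo_subspace_vimage: "subspace S \<Longrightarrow> subspace {v. X v \<in> S}"
  by (auto simp: subspace_def endo_zero endo_add endo_scale)

lemma endo_funpow: "endomorphism (X ^^ n)"
  by (induction n) (auto simp: endomorphism_iff endo_add endo_scale)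

lemma endo_span_subset:
  assumes "subspace T" and "\<And>v. v \<in> S \<Longrightarrow> X v \<in> T" and "v \<in> span S"
  shows "X v \<in> T"
proof -
  have "span S \<subseteq> {v. X v \<in> T}"
    using assms by (intro span_minimal endo_subspace_vimage) auto
  then show ?thesis using assms(3) by auto
qed

end

lemma endo_id: "endomorphism (\<lambda>v. v)"
  by (rule endomorphismI) auto

lemma endo_const_zero: "endomorphism (\<lambda>v. 0)"
  by (rule endomorphismI) auto

lemma endo_plus: "endomorphism X \<Longrightarrow> endomorphism Y \<Longrightarrow> endomorphism (\<lambda>v. X v + Y v)"
  by (auto simp: endomorphism_iff scale_right_distrib algebra_simps)

lemma endo_minus: "endomorphism X \<Longrightarrow> endomorphism Y \<Longrightarrow> endomorphism (\<lambda>v. X v - Y v)"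
  by (auto simp: endomorphism_iff scale_right_diff_distrib algebra_simps)

lemma endo_scaled: "endomorphism X \<Longrightarrow> endomorphism (\<lambda>v. c *\<^sub>C X v)"
  by (auto simp: endomorphism_iff scale_right_distrib algebra_simps)

lemma endo_comp: "endomorphism X \<Longrightarrow> endomorphism Y \<Longrightarrow> endomorphism (\<lambda>v. X (Y v))"
  by (auto simp: endomorphism_iff)

lemma endo_sum_fun:
  "(\<And>i. i \<in> S \<Longrightarrow> endomorphism (X i)) \<Longrightarrow> endomorphism (\<lambda>v. \<Sum>i\<in>S. X i v)"
  by (induction S rule: infinite_finite_induct) (simp_all add: endo_const_zero endo_plus)

lemma endo_eq_on_span:
  assumes "endomorphism X" "endomorphism Y" "\<And>v. v \<in> S \<Longrightarrow> X v = Y v" "v \<in> span S"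
  shows "X v = Y v"
proof -
  have "X v - Y v \<in> {0}"
    by (rule endo_span_subset[of "\<lambda>v. X v - Y v" "{0}" S]) (use assms in \<open>auto intro: endo_minus\<close>)
  then show ?thesis by simp
qed

subsection \<open>Complex conjugation\<close>

lemma rep_sum: "v = (\<Sum>b\<in>B. representation B v b *\<^sub>C b)"
  using sum_representation_eq[OF independent_Basis, of v B] finite_Basis span_Basis by simp

lemma rep_of_sum:
  assumes "b \<in> B"
  shows "representation B (\<Sum>b\<in>B. f b *\<^sub>C b) b = f b"
proof -
  have "representation B (\<Sum>b\<in>B. f b *\<^sub>C b) b = (\<Sum>b'\<in>B. f b' * representation B b' b)"
    by (subst representation_sum)
      (auto simp: independent_Basis span_Basis representation_scale)
  also have "\<dots> = (\<Sum>b'\<in>B. if b' = b then f b' else 0)"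
    by (rule sum.cong) (auto simp: representation_basis[OF independent_Basis])
  finally show ?thesis using assms finite_Basis by simp
qed

lemma rep_eqI:
  assumes "\<And>b. b \<in> B \<Longrightarrow> representation B u b = representation B v b"
  shows "u = v"
  using rep_sum[of u] rep_sum[of v] assms by simp

lemma rep_add: "representation B (u + v) b = representation B u b + representation B v b"
  by (simp add: representation_add independent_Basis span_Basis)

lemma rep_scale: "representation B (c *\<^sub>C v) b = c * representation B v b"
  by (simp add: representation_scale independent_Basis span_Basis)

lemma rep_zero: "representation B 0 b = 0"
  by (simp add: representation_zero)

lemma rep_diff: "representation B (u - v) b = representation B u b - representation B v b"
  by (simp add: representation_diff independent_Basis span_Basis)

lemma rep_sum_fun: "representation B (sum f S) b = (\<Sum>i\<in>S. representation B (f i) b)"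
  by (induction S rule: infinite_finite_induct) (simp_all add: rep_zero rep_add)

lemma rep_vconj: "b \<in> B \<Longrightarrow> representation B (vconj v) b = cnj (representation B v b)"
  unfolding vconj_def by (rule rep_of_sum)

lemma vconj_add: "vconj (u + v) = vconj u + vconj v"
  by (rule rep_eqI) (simp add: rep_vconj rep_add)

lemma vconj_scale: "vconj (c *\<^sub>C v) = cnj c *\<^sub>C vconj v"
  by (rule rep_eqI) (simp add: rep_vconj rep_scale)

lemma vconj_zero [simp]: "vconj 0 = 0"
  by (rule rep_eqI) (simp add: rep_vconj rep_zero)

lemma vconj_diff: "vconj (u - v) = vconj u - vconj v"
  by (rule rep_eqI) (simp add: rep_vconj rep_diff)

lemma vconj_vconj [simp]: "vconj (vconj v) = v"
  by (rule rep_eqI) (simp add: rep_vconj)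

lemma vconj_eq_iff [simp]: "vconj u = vconj v \<longleftrightarrow> u = v"
  by (metis vconj_vconj)

lemma vconj_sum: "vconj (sum f S) = (\<Sum>i\<in>S. vconj (f i))"
  by (induction S rule: infinite_finite_induct) (simp_all add: vconj_add)

lemma mem_vconj_image: "v \<in> vconj ` S \<longleftrightarrow> vconj v \<in> S"
  by (metis image_iff vconj_vconj)

lemma vconj_image_image [simp]: "vconj ` (vconj ` S) = S"
  by (auto simp: image_iff)

lemma subspace_vconj: "subspace S \<Longrightarrow> subspace (vconj ` S)"
  by (auto simp: subspace_def mem_vconj_image vconj_add vconj_scale)

lemma V_R_iff: "v \<in> V_R \<longleftrightarrow> vconj v = v"
proof
  assume "v \<in> V_R"
  then show "vconj v = v"
    unfolding V_R_def by (intro rep_eqI) (auto simp: rep_vconj Reals_cnj_iff)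
next
  assume v: "vconj v = v"
  have "cnj (representation B v b) = representation B v b" if "b \<in> B" for b
    using rep_vconj[OF that, of v] v by simp
  then show "v \<in> V_R"
    unfolding V_R_def by (auto simp: Reals_cnj_iff)
qed

lemma endo_vconj: "endomorphism X \<Longrightarrow> endomorphism (\<lambda>v. vconj (X (vconj v)))"
  by (auto simp: endomorphism_iff vconj_add vconj_scale)

lemma vconj_span: "vconj ` span S = span (vconj ` S)"
proof -
  have *: "vconj ` span S \<subseteq> span (vconj ` S)" for S
  proof -
    have "span S \<subseteq> vconj ` span (vconj ` S)"
      by (rule span_minimal) (auto simp: mem_vconj_image intro!: span_base subspace_vconj)
    then show ?thesis by (metis image_mono vconj_image_image)
  qed
  have "span (vconj ` S) \<subseteq> vconj ` span S"
    using *[of "vconj ` S"] by (metis image_mono vconj_image_image)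
  with * show ?thesis by blast
qed

text \<open>Every vector is a complex combination of two real ones, so reality on \<open>V_R\<close>
  propagates by linearity. The form with \<open>vconj\<close> is the one that carries components and
  gradings through conjugation.\<close>

lemma defined_over_R_iff:
  assumes X: "endomorphism X"
  shows "defined_over_R X \<longleftrightarrow> (\<forall>v. X (vconj v) = vconj (X v))"
proof
  assume X': "defined_over_R X"
  show "\<forall>v. X (vconj v) = vconj (X v)"
  proof
    fix v
    have re: "vconj (X w) = X w" if "vconj w = w" for w
      using X' that unfolding defined_over_R_def V_R_iff[symmetric] by auto
    \<comment> \<open>\<open>a\<close> and \<open>b\<close> are the real and the imaginary part of
      \<open>v\<close>.\<close>
    define a where "a = (1/2) *\<^sub>C (v + vconj v)"
    define b where "b = (1/(2*\<i>)) *\<^sub>C (v - vconj v)"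
    have "(1/2::complex) *\<^sub>C v + (1/2) *\<^sub>C v = (1/2 + 1/2) *\<^sub>C v"
      unfolding scale_left_distrib ..
    then have half: "(1/2::complex) *\<^sub>C v + (1/2) *\<^sub>C v = v" by simp
    have v: "v = a + \<i> *\<^sub>C b"
      using half by (simp add: a_def b_def scale_right_distrib scale_right_diff_distrib)
    have a: "vconj a = a" by (simp add: a_def vconj_scale vconj_add add.commute)
    have "vconj b = (- (1/(2*\<i>))) *\<^sub>C (vconj v - v)"
      unfolding b_def vconj_scale vconj_diff by simp
    also have "\<dots> = b" unfolding b_def
      by (metis minus_diff_eq scale_minus_left scale_minus_right minus_minus)
    finally have b: "vconj b = b" .
    have "vconj v = a - \<i> *\<^sub>C b"
      unfolding v by (simp add: vconj_add vconj_scale a b)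
    then have "X (vconj v) = X a - \<i> *\<^sub>C X b"
      by (simp only: endo_diff[OF X] endo_scale[OF X])
    also have "\<dots> = vconj (X a + \<i> *\<^sub>C X b)"
      using re[OF a] re[OF b] by (simp add: vconj_add vconj_scale)
    also have "X a + \<i> *\<^sub>C X b = X v"
      unfolding v by (simp only: endo_add[OF X] endo_scale[OF X])
    finally show "X (vconj v) = vconj (X v)" .
  qed
next
  assume "\<forall>v. X (vconj v) = vconj (X v)"
  then show "defined_over_R X"
    unfolding defined_over_R_def by (auto simp: V_R_iff) metis
qed

subsection \<open>Sums of subspaces\<close>

lemma mem_subspace_sum: "v \<in> subspace_sum U U' \<longleftrightarrow> (\<exists>u\<in>U. \<exists>u'\<in>U'. v = u + u')"
  unfolding subspace_sum_def by auto

lemma subspace_sumI: "u \<in> U \<Longrightarrow> u' \<in> U' \<Longrightarrow> u + u' \<in> subspace_sum U U'"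
  unfolding mem_subspace_sum by blast

lemma subspace_sumE:
  assumes "v \<in> subspace_sum U U'"
  obtains u u' where "u \<in> U" "u' \<in> U'" "v = u + u'"
  using assms unfolding mem_subspace_sum by blast

lemma subspace_sum_alt:
  assumes "subspace U" "subspace U'"
  shows "v \<in> subspace_sum U U' \<longleftrightarrow> (\<exists>u\<in>U. v - u \<in> U')"
  unfolding mem_subspace_sum by (metis add_diff_cancel_left' add_diff_eq)

lemma subspace_subspace_sum: "subspace U \<Longrightarrow> subspace U' \<Longrightarrow> subspace (subspace_sum U U')"
  unfolding subspace_sum_def using subspace_sums by auto

lemma subspace_sum_upper1: "subspace U' \<Longrightarrow> U \<subseteq> subspace_sum U U'"
  by (force simp: mem_subspace_sum dest: subspace_0)

lemma subspace_sum_upper2: "subspace U \<Longrightarrow> U' \<subseteq> subspace_sum U U'"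
  by (force simp: mem_subspace_sum dest: subspace_0)

lemma subspace_sum_least: "subspace T \<Longrightarrow> U \<subseteq> T \<Longrightarrow> U' \<subseteq> T \<Longrightarrow> subspace_sum U U' \<subseteq> T"
  unfolding subspace_sum_def by (blast intro: subspace_add)

lemma subspace_sum_mono: "U \<subseteq> T \<Longrightarrow> U' \<subseteq> T' \<Longrightarrow> subspace_sum U U' \<subseteq> subspace_sum T T'"
  unfolding subspace_sum_def by blast

lemma vconj_subspace_sum: "vconj ` subspace_sum U U' = subspace_sum (vconj ` U) (vconj ` U')"
  by (force simp: mem_subspace_sum vconj_add image_iff)

subsection \<open>Exponentials of nilpotent endomorphisms\<close>

text \<open>The truncated exponential series. It is \<open>exp_end X\<close> as soon as
  \<open>X ^^ m\<close> vanishes, and as a finite sum it needs no convergence argument.\<close>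

definition nexp :: "nat \<Rightarrow> ('v \<Rightarrow> 'v) \<Rightarrow> 'v \<Rightarrow> 'v" where
  "nexp m X v = (\<Sum>n<m. (1 / fact n) *\<^sub>C (X ^^ n) v)"

lemma funpow_zero_ge:
  assumes "endomorphism X" and "\<And>v. (X ^^ m) v = 0" and "m \<le> n"
  shows "(X ^^ n) v = 0"
proof -
  have "(X ^^ n) v = (X ^^ m) ((X ^^ (n - m)) v)"
    using assms(3) by (metis comp_apply funpow_add le_add_diff_inverse)
  then show ?thesis using assms(2) by simp
qed

lemma exp_end_eq_nexp:
  assumes X: "endomorphism X" and nil: "\<And>v. (X ^^ m) v = 0"
  shows "exp_end X = nexp m X"
proof
  fix v
  have z: "(X ^^ n) v = 0" if "n \<ge> m" for n using funpow_zero_ge[OF X nil that] .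
  have "(\<Sum>n. representation B ((X ^^ n) v) b / fact n)
      = (\<Sum>n<m. representation B ((X ^^ n) v) b / fact n)" for b
    by (rule suminf_finite) (use z in \<open>auto simp: rep_zero\<close>)
  then have "exp_end X v = (\<Sum>b\<in>B. representation B (nexp m X v) b *\<^sub>C b)"
    unfolding exp_end_def nexp_def by (simp add: rep_sum_fun rep_scale)
  then show "exp_end X v = nexp m X v" using rep_sum by metis
qed

lemma endo_nexp: "endomorphism X \<Longrightarrow> endomorphism (nexp m X)"
  unfolding nexp_def[abs_def] by (intro endo_sum_fun endo_scaled endo_funpow)

text \<open>The iterates of \<open>A \<mapsto> X A + A T\<close>. Left and right multiplication
  commute, whence the binomial formula; for \<open>T = -X\<close> this is the iterated commutator
  with \<open>X\<close>.\<close>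

fun twist :: "('v \<Rightarrow> 'v) \<Rightarrow> ('v \<Rightarrow> 'v) \<Rightarrow> ('v \<Rightarrow> 'v) \<Rightarrow> nat \<Rightarrow> 'v \<Rightarrow> 'v" where
  "twist X T A 0 = A"
| "twist X T A (Suc n) = (\<lambda>v. X (twist X T A n v) + twist X T A n (T v))"

lemma twist_binomial:
  assumes X: "endomorphism X"
  shows "twist X T A n v = (\<Sum>k\<le>n. of_nat (n choose k) *\<^sub>C (X ^^ k) (A ((T ^^ (n - k)) v)))"
proof (induction n arbitrary: v)
  case (Suc n)
  let ?t = "\<lambda>k. (X ^^ k) (A ((T ^^ (Suc n - k)) v))"
  have 1: "X (twist X T A n v) = (\<Sum>k\<le>n. of_nat (n choose k) *\<^sub>C ?t (Suc k))"
    by (subst Suc.IH) (simp add: endo_sum[OF X] endo_scale[OF X])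
  have 2: "twist X T A n (T v) = (\<Sum>k\<le>n. of_nat (n choose k) *\<^sub>C ?t k)"
    by (subst Suc.IH) (rule sum.cong, auto simp: Suc_diff_le funpow_swap1)
  have 3: "(\<Sum>k\<le>n. of_nat (n choose k) *\<^sub>C ?t k)
      = ?t 0 + (\<Sum>k\<le>n. of_nat (n choose Suc k) *\<^sub>C ?t (Suc k))"
  proof -
    have "(\<Sum>k\<le>n. of_nat (n choose k) *\<^sub>C ?t k) = (\<Sum>k\<le>Suc n. of_nat (n choose k) *\<^sub>C ?t k)"
      by simp
    also have "\<dots> = ?t 0 + (\<Sum>k\<le>n. of_nat (n choose Suc k) *\<^sub>C ?t (Suc k))"
      by (subst sum.atMost_Suc_shift) simp
    finally show ?thesis .
  qed
  have "(\<Sum>k\<le>Suc n. of_nat (Suc n choose k) *\<^sub>C ?t k)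
      = ?t 0 + (\<Sum>k\<le>n. of_nat (Suc n choose Suc k) *\<^sub>C ?t (Suc k))"
    by (subst sum.atMost_Suc_shift) simp
  also have "\<dots> = twist X T A (Suc n) v"
    using 1 2 3 by (simp add: scale_left_distrib sum.distrib)
  finally show ?case ..
qed simp

text \<open>The left side is the exponential series of \<open>A \<mapsto> X A + A T\<close>. Terms
  of total order \<open>2 * m\<close> or more vanish, since one of the two powers has reached
  \<open>m\<close>.\<close>

lemma nexp_conj:
  assumes X: "endomorphism X" and A: "endomorphism A" and T: "endomorphism T"
    and nX: "\<And>v. (X ^^ m) v = 0" and nT: "\<And>v. (T ^^ m) v = 0"
  shows "nexp m X (A (nexp m T v)) = (\<Sum>n<2 * m. (1 / fact n) *\<^sub>C twist X T A n v)"
proof -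
  let ?f = "\<lambda>k l. (1 / (fact k * fact l)) *\<^sub>C (X ^^ k) (A ((T ^^ l) v))"
  have z: "?f k l = 0" if "k \<ge> m \<or> l \<ge> m" for k l
    using that funpow_zero_ge[OF X nX, of k] funpow_zero_ge[OF T nT, of l]
      endo_zero[OF A] endo_zero[OF endo_funpow[OF X]] by auto
  have "nexp m X (A (nexp m T v)) = (\<Sum>k<m. \<Sum>l<m. ?f k l)"
    unfolding nexp_def
    by (simp add: endo_sum[OF A] endo_scale[OF A] endo_sum[OF endo_funpow[OF X]]
        endo_scale[OF endo_funpow[OF X]] scale_sum_right)
  also have "\<dots> = (\<Sum>(k,l)\<in>{..<m} \<times> {..<m}. ?f k l)"
    by (simp add: sum.cartesian_product)
  \<comment> \<open>The square is enlarged to a triangle, so that terms can be collected by total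
    order; every added term contains a vanishing power.\<close>
  also have "\<dots> = (\<Sum>(k,l)\<in>{(k,l). k + l < 2 * m}. ?f k l)"
  proof (rule sum.mono_neutral_left)
    show "finite {(k::nat, l). k + l < 2 * m}"
      by (rule finite_subset[of _ "{..2*m} \<times> {..2*m}"]) auto
    show "\<forall>i\<in>{(k, l). k + l < 2 * m} - {..<m} \<times> {..<m}. (case i of (k, l) \<Rightarrow> ?f k l) = 0"
      using z by (auto simp flip: not_le)
  qed auto
  also have "\<dots> = (\<Sum>n<2*m. \<Sum>k\<le>n. ?f k (n - k))"
    by (rule sum.triangle_reindex[of "\<lambda>k l. ?f k l"])
  also have "\<dots> = (\<Sum>n<2 * m. (1 / fact n) *\<^sub>C twist X T A n v)"
    by (intro sum.cong refl)
      (auto simp add: twist_binomial[OF X] scale_sum_right binomial_fact intro!: sum.cong)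
  finally show ?thesis .
qed

end


section \<open>Spans of families of subspaces\<close>

context rational_structure
begin

text \<open>The family \<open>u\<close> is required to vanish outside its finite support, so that
  two decompositions can be added over the union of their supports.\<close>

lemma span_family:
  fixes I :: "'i \<Rightarrow> 'v set"
  assumes A': "subspace A'" and I: "\<And>i. i \<in> P \<Longrightarrow> subspace (I i)"
    and x: "x \<in> span (A' \<union> (\<Union>i\<in>P. I i))"
  shows "\<exists>P0 u. finite P0 \<and> P0 \<subseteq> P \<and> (\<forall>i\<in>P0. u i \<in> I i) \<and> (\<forall>i. i \<notin> P0 \<longrightarrow> u i = 0) \<and>
    x - (\<Sum>i\<in>P0. u i) \<in> A'"
proof -
  define Q where "Q x P0 u \<longleftrightarrow> finite P0 \<and> P0 \<subseteq> P \<and> (\<forall>i\<in>P0. u i \<in> I i) \<and>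
    (\<forall>i. i \<notin> P0 \<longrightarrow> u i = 0) \<and> x - (\<Sum>i\<in>P0. u i) \<in> A'" for x P0 u
  have "subspace {x. \<exists>P0 u. Q x P0 u}"
  proof (rule subspaceI)
    have "Q 0 {} (\<lambda>_. 0)" using subspace_0[OF A'] by (simp add: Q_def)
    then show "0 \<in> {x. \<exists>P0 u. Q x P0 u}" by blast
  next
    fix x y assume "x \<in> {x. \<exists>P0 u. Q x P0 u}" "y \<in> {x. \<exists>P0 u. Q x P0 u}"
    then obtain P0 u P1 v where xy: "Q x P0 u" "Q y P1 v" by blast
    have u: "(\<Sum>i\<in>P0 \<union> P1. u i) = (\<Sum>i\<in>P0. u i)"
      by (rule sum.mono_neutral_right) (use xy in \<open>auto simp: Q_def\<close>)
    have v: "(\<Sum>i\<in>P0 \<union> P1. v i) = (\<Sum>i\<in>P1. v i)"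
      by (rule sum.mono_neutral_right) (use xy in \<open>auto simp: Q_def\<close>)
    have in_I: "u i \<in> I i" "v i \<in> I i" if "i \<in> P0 \<union> P1" for i
      using xy that subspace_0[OF I] unfolding Q_def by (metis Un_iff subsetD)+
    have "x + y - (\<Sum>i\<in>P0 \<union> P1. u i + v i) = (x - (\<Sum>i\<in>P0. u i)) + (y - (\<Sum>i\<in>P1. v i))"
      by (simp add: sum.distrib u v)
    moreover have "(x - (\<Sum>i\<in>P0. u i)) + (y - (\<Sum>i\<in>P1. v i)) \<in> A'"
      using xy by (intro subspace_add[OF A']) (auto simp: Q_def)
    ultimately have "x + y - (\<Sum>i\<in>P0 \<union> P1. u i + v i) \<in> A'" by (elim ssubst)
    moreover have "u i + v i \<in> I i" if "i \<in> P0 \<union> P1" for i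
      using in_I[OF that] subspace_add[OF I] xy that unfolding Q_def by blast
    ultimately have "Q (x + y) (P0 \<union> P1) (\<lambda>i. u i + v i)"
      using xy by (auto simp: Q_def)
    then show "x + y \<in> {x. \<exists>P0 u. Q x P0 u}" by blast
  next
    fix c x assume "x \<in> {x. \<exists>P0 u. Q x P0 u}"
    then obtain P0 u where x: "Q x P0 u" by blast
    have "c *\<^sub>C x - (\<Sum>i\<in>P0. c *\<^sub>C u i) = c *\<^sub>C (x - (\<Sum>i\<in>P0. u i))"
      by (simp add: scale_sum_right scale_right_diff_distrib)
    then have "Q (c *\<^sub>C x) P0 (\<lambda>i. c *\<^sub>C u i)"
      using x subspace_scale[OF A'] subspace_scale[OF I] unfolding Q_def by auto
    then show "c *\<^sub>C x \<in> {x. \<exists>P0 u. Q x P0 u}" by blast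
  qed
  moreover have "A' \<union> (\<Union>i\<in>P. I i) \<subseteq> {x. \<exists>P0 u. Q x P0 u}"
  proof
    fix x assume "x \<in> A' \<union> (\<Union>i\<in>P. I i)"
    then consider "x \<in> A'" | i where "i \<in> P" "x \<in> I i" by blast
    then show "x \<in> {x. \<exists>P0 u. Q x P0 u}"
    proof cases
      case 1
      then have "Q x {} (\<lambda>_. 0)" by (simp add: Q_def)
      then show ?thesis by blast
    next
      case 2
      then have "Q x {i} (\<lambda>j. if j = i then x else 0)"
        using subspace_0[OF A'] by (simp add: Q_def)
      then show ?thesis by blast
    qed
  qed
  ultimately have "span (A' \<union> (\<Union>i\<in>P. I i)) \<subseteq> {x. \<exists>P0 u. Q x P0 u}"
    by (rule span_minimal[rotated])
  with x show ?thesis unfolding Q_def by blast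
qed

lemma bispan_alt: "bispan A' I P = span (A' \<union> (\<Union>i\<in>P. I (fst i) (snd i)))"
  unfolding bispan_def by (simp add: case_prod_beta)

lemma subspace_bispan: "subspace (bispan A' I P)"
  unfolding bispan_def by simp

lemma bispan_mono: "P \<subseteq> Q \<Longrightarrow> bispan A' I P \<subseteq> bispan A' I Q"
  unfolding bispan_def by (intro span_mono) auto

lemma bispan_base: "(a, b) \<in> P \<Longrightarrow> x \<in> I a b \<Longrightarrow> x \<in> bispan A' I P"
  unfolding bispan_def by (intro span_base) auto

lemma bispan_bottom: "x \<in> A' \<Longrightarrow> x \<in> bispan A' I P"
  unfolding bispan_def by (intro span_base) auto

lemma bispan_least:
  "subspace S \<Longrightarrow> A' \<subseteq> S \<Longrightarrow> (\<And>a b. (a, b) \<in> P \<Longrightarrow> I a b \<subseteq> S) \<Longrightarrow> bispan A' I P \<subseteq> S"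
  unfolding bispan_def by (intro span_minimal) auto

lemma vconj_bispan:
  assumes "vconj ` A' = A'"
  shows "vconj ` bispan A' I P = bispan A' (\<lambda>a b. vconj ` I b a) (prod.swap ` P)"
proof -
  have "vconj ` (A' \<union> (\<Union>(a, b)\<in>P. I a b)) = A' \<union> (\<Union>(a, b)\<in>prod.swap ` P. vconj ` I b a)"
    using assms by (auto simp: image_Un image_UN)
  then show ?thesis unfolding bispan_def vconj_span by simp
qed

end

section \<open>Deligne's bigrading of a mixed Hodge structure\<close>

locale mhs = rational_structure scale B
  for scale :: "complex \<Rightarrow> 'v::ab_group_add \<Rightarrow> 'v" (infixr "*\<^sub>C" 75) and B :: "'v set" +
  fixes A' A :: "'v set" and F W :: "int \<Rightarrow> 'v set"
  assumes mhs: "mixed_hodge_structure A' A F W"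
begin

lemma filtF: "decreasing_filtration A' A F" and filtW: "increasing_filtration A' A W"
  and conjW: "vconj ` W k = W k"
  using mhs unfolding mixed_hodge_structure_def by auto

lemma subF: "subspace (F p)" and A'F: "A' \<subseteq> F p" and FA: "F p \<subseteq> A"
  and antiF: "p \<le> q \<Longrightarrow> F q \<subseteq> F p"
  using filtF unfolding decreasing_filtration_def by (auto dest: antimonoD)

lemma subW: "subspace (W k)" and A'W: "A' \<subseteq> W k" and WA: "W k \<subseteq> A"
  and monoW: "k \<le> l \<Longrightarrow> W k \<subseteq> W l"
  using filtW unfolding increasing_filtration_def by (auto dest: monoD)

lemma F_high: "\<exists>p0. \<forall>p\<ge>p0. F p = A'"
  using filtF antiF A'F unfolding decreasing_filtration_def by (metis subset_antisym)

lemma F_low: "\<exists>p0. \<forall>p\<le>p0. F p = A"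
  using filtF antiF FA unfolding decreasing_filtration_def by (metis subset_antisym)

lemma W_low: "\<exists>k0. \<forall>k\<le>k0. W k = A'"
  using filtW monoW A'W unfolding increasing_filtration_def by (metis subset_antisym)

lemma W_high: "\<exists>k0. \<forall>k\<ge>k0. W k = A"
  using filtW monoW WA unfolding increasing_filtration_def by (metis subset_antisym)

lemma subA': "subspace A'" and subA: "subspace A"
  using W_low W_high subW by (metis order_refl)+

lemma conjA': "vconj ` A' = A'" and conjA: "vconj ` A = A"
  using W_low W_high conjW by (metis order_refl)+

lemma vconj_W: "vconj x \<in> W k \<longleftrightarrow> x \<in> W k"
  using mem_vconj_image[of x "W k"] by (simp add: conjW)

definition Fb :: "int \<Rightarrow> 'v set" where "Fb p = vconj ` F p"

lemma mem_Fb: "x \<in> Fb p \<longleftrightarrow> vconj x \<in> F p"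
  unfolding Fb_def mem_vconj_image ..

lemma subFb: "subspace (Fb p)" and A'Fb: "A' \<subseteq> Fb p" and antiFb: "p \<le> q \<Longrightarrow> Fb q \<subseteq> Fb p"
proof -
  show "subspace (Fb p)" unfolding Fb_def by (intro subspace_vconj subF)
  show "A' \<subseteq> Fb p" unfolding Fb_def using image_mono[OF A'F, of vconj] conjA' by simp
  show "p \<le> q \<Longrightarrow> Fb q \<subseteq> Fb p" unfolding Fb_def by (intro image_mono antiF)
qed

lemma subFW: "subspace (F p \<inter> W k)" and subFbW: "subspace (Fb p \<inter> W k)"
  using subF subFb subW subspace_inter by blast+

lemma pure: "pure_hodge_structure (W (k - 1)) (W k) k (Gr_filtration F W k)"
  using mhs unfolding mixed_hodge_structure_def by auto

lemma Gr_alt: "Gr_filtration F W k p = subspace_sum (F p \<inter> W k) (W (k - 1))"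
  unfolding Gr_filtration_def induced_filtration_def ..

lemma vconj_Gr: "vconj ` Gr_filtration F W k p = subspace_sum (Fb p \<inter> W k) (W (k - 1))"
proof -
  have "vconj ` (F p \<inter> W k) = Fb p \<inter> W k"
    by (auto simp: mem_Fb mem_vconj_image vconj_W)
  then show ?thesis unfolding Gr_alt vconj_subspace_sum conjW by simp
qed

text \<open>Purity of \<open>Gr k\<close> says that \<open>F\<close> and its conjugate are opposed
  there. This is unwound to representatives in \<open>W k\<close>, so that the arguments below never
  form quotients.\<close>

lemma opposed_zero:
  assumes f: "f \<in> F p \<inter> W k" and y: "y \<in> Fb q \<inter> W k" and pq: "p + q \<ge> k + 1"
    and d: "f - y \<in> W (k - 1)"
  shows "f \<in> W (k - 1)"
proof -
  have y': "y \<in> Fb (k - p + 1) \<inter> W k" using y antiFb[of "k - p + 1" q] pq by auto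
  have "f \<in> Gr_filtration F W k p"
    unfolding Gr_alt using f subspace_sum_upper1[OF subW] by blast
  moreover have "f \<in> vconj ` Gr_filtration F W k (k - p + 1)"
    unfolding vconj_Gr subspace_sum_alt[OF subFbW subW] using y' d by blast
  ultimately show ?thesis using pure[of k] unfolding pure_hodge_structure_def by blast
qed

lemma opposed_sum:
  assumes v: "v \<in> W k" and pq: "p + q \<le> k + 1"
  obtains f y w where "f \<in> F p \<inter> W k" "y \<in> Fb q \<inter> W k" "w \<in> W (k - 1)" "v = f + y + w"
proof -
  have "v \<in> subspace_sum (Gr_filtration F W k p) (vconj ` Gr_filtration F W k (k - p + 1))"
    using pure[of k] v unfolding pure_hodge_structure_def by auto
  then obtain f w y w' where *: "f \<in> F p \<inter> W k" "w \<in> W (k - 1)" "y \<in> Fb (k - p + 1) \<inter> W k"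
    "w' \<in> W (k - 1)" "v = (f + w) + (y + w')"
    unfolding vconj_Gr unfolding Gr_alt by (elim subspace_sumE) blast
  then have "y \<in> Fb q \<inter> W k" using antiFb[of q "k - p + 1"] pq by auto
  with * show thesis using subspace_add[OF subW] by (intro that[of f y "w + w'"]) (auto simp: algebra_simps)
qed

text \<open>\<open>D p q\<close> is Deligne's explicit formula for the summand of type
  \<open>(p, q)\<close>. \<open>Lq\<close> collects its correction terms and \<open>Kq\<close> is
  its third factor. The corrections lie in \<open>W (k - 2)\<close>, so they are invisible on
  \<open>Gr k\<close> and on the next graded piece.\<close>

definition Lq :: "int \<Rightarrow> int \<Rightarrow> 'v set" where
  "Lq q k = span (\<Union>i\<in>{1..}. Fb (q - i) \<inter> W (k - i - 1))"

definition Kq :: "int \<Rightarrow> int \<Rightarrow> 'v set" where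
  "Kq q k = subspace_sum (Fb q \<inter> W k) (Lq q k)"

definition D :: "int \<Rightarrow> int \<Rightarrow> 'v set" where
  "D p q = F p \<inter> W (p + q) \<inter> Kq q (p + q)"

lemma subLq: "subspace (Lq q k)" unfolding Lq_def by simp

lemma subKq: "subspace (Kq q k)" unfolding Kq_def by (intro subspace_subspace_sum subFbW subLq)

lemma subD: "subspace (D p q)"
  unfolding D_def using subspace_inter[OF subspace_inter[OF subF subW] subKq] .

lemma Lq_base: "i \<ge> 1 \<Longrightarrow> x \<in> Fb (q - i) \<Longrightarrow> x \<in> W (k - i - 1) \<Longrightarrow> x \<in> Lq q k"
  unfolding Lq_def by (intro span_base) auto

lemma Kq_base1: "x \<in> Fb q \<Longrightarrow> x \<in> W k \<Longrightarrow> x \<in> Kq q k"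
  unfolding Kq_def using subspace_sum_upper1[OF subLq] by blast

lemma Kq_base2: "x \<in> Lq q k \<Longrightarrow> x \<in> Kq q k"
  unfolding Kq_def using subspace_sum_upper2[OF subFbW] by blast

lemma A'Kq: "A' \<subseteq> Kq q k"
  using A'Fb A'W Kq_base1 by blast

lemma A'D: "A' \<subseteq> D p q"
  unfolding D_def using A'F A'W A'Kq by blast

lemma Lq_W: "Lq q k \<subseteq> W (k - 2)"
  unfolding Lq_def
proof (rule span_minimal)
  show "(\<Union>i\<in>{1..}. Fb (q - i) \<inter> W (k - i - 1)) \<subseteq> W (k - 2)"
  proof
    fix x assume "x \<in> (\<Union>i\<in>{1..}. Fb (q - i) \<inter> W (k - i - 1))"
    then obtain i where "i \<ge> 1" "x \<in> W (k - i - 1)" by auto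
    then show "x \<in> W (k - 2)" using monoW[of "k - i - 1" "k - 2"] by auto
  qed
qed (rule subW)

lemma Lq_mono: "q \<le> q' \<Longrightarrow> k' \<le> k \<Longrightarrow> Lq q' k' \<subseteq> Lq q k"
  unfolding Lq_def
  using antiFb monoW by (intro span_mono UN_mono Int_mono) auto

lemma Lq_rec: "Lq q k \<subseteq> subspace_sum (Fb (q - 1) \<inter> W (k - 2)) (Lq (q - 1) (k - 1))"
  (is "_ \<subseteq> ?S")
  unfolding Lq_def[of q k]
proof (rule span_minimal)
  show "subspace ?S" by (intro subspace_subspace_sum subFbW subLq)
  show "(\<Union>i\<in>{1..}. Fb (q - i) \<inter> W (k - i - 1)) \<subseteq> ?S"
  proof
    fix x assume "x \<in> (\<Union>i\<in>{1..}. Fb (q - i) \<inter> W (k - i - 1))"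
    then obtain i where i: "i \<ge> 1" "x \<in> Fb (q - i)" "x \<in> W (k - i - 1)" by auto
    show "x \<in> ?S"
    proof (cases "i = 1")
      case True
      then have "x \<in> Fb (q - 1) \<inter> W (k - 2)" using i by (simp add: algebra_simps)
      then show ?thesis using subspace_sum_upper1[OF subLq] by blast
    next
      case False
      then have "x \<in> Lq (q - 1) (k - 1)"
        using i by (intro Lq_base[of "i - 1"]) (auto simp: algebra_simps)
      then show ?thesis using subspace_sum_upper2[OF subFbW] by blast
    qed
  qed
qed

text \<open>The shape that an element of \<open>Kq q k\<close> takes once it is known to lie in
  \<open>W (k - m)\<close>: the leading terms have merged into one in \<open>Fb (q - m + 1)\<close>,
  the only part visible modulo \<open>W (k - m - 1)\<close>.\<close>

definition Qf :: "int \<Rightarrow> int \<Rightarrow> int \<Rightarrow> 'v set" where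
  "Qf q k m = subspace_sum (Fb (q - m + 1) \<inter> W (k - m)) (Lq (q - m + 1) (k - m + 1))"

lemma subQf: "subspace (Qf q k m)"
  unfolding Qf_def by (intro subspace_subspace_sum subFbW subLq)

lemma A'Qf: "A' \<subseteq> Qf q k m"
  using A'Fb A'W subspace_sum_upper1[OF subLq] unfolding Qf_def by blast

lemma Qf_start: "x \<in> Kq q k \<Longrightarrow> x \<in> W (k - 1) \<Longrightarrow> x \<in> Qf q k 1"
proof -
  assume x: "x \<in> Kq q k" "x \<in> W (k - 1)"
  then obtain y z where yz: "y \<in> Fb q" "z \<in> Lq q k" "x = y + z"
    unfolding Kq_def mem_subspace_sum by auto
  have "z \<in> W (k - 1)" using yz Lq_W monoW[of "k - 2" "k - 1"] by auto
  then have "y \<in> W (k - 1)" using x yz subspace_diff[OF subW, of x "k - 1" z] by auto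
  then show ?thesis unfolding Qf_def using yz by (auto intro!: subspace_sumI)
qed

lemma Qf_next:
  assumes x: "x \<in> Qf q k m" "x \<in> W (k - m - 1)"
  shows "x \<in> Qf q k (m + 1)"
proof -
  obtain y z where yz: "y \<in> Fb (q - m + 1)" "z \<in> Lq (q - m + 1) (k - m + 1)" "x = y + z"
    using x unfolding Qf_def mem_subspace_sum by auto
  have "z \<in> W (k - m - 1)" using yz Lq_W[of "q - m + 1" "k - m + 1"] by auto
  then have yW: "y \<in> W (k - m - 1)" using x yz subspace_diff[OF subW, of x "k - m - 1" z] by auto
  obtain y1 z1 where *: "y1 \<in> Fb (q - m) \<inter> W (k - m - 1)" "z1 \<in> Lq (q - m) (k - m)" "z = y1 + z1"
    using yz(2) Lq_rec[of "q - m + 1" "k - m + 1"] unfolding mem_subspace_sum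
    by (force simp: mem_subspace_sum)
  have "y + y1 \<in> Fb (q - m) \<inter> W (k - m - 1)"
    using yz yW * antiFb[of "q - m" "q - m + 1"] by (intro subspace_add[OF subFbW]) auto
  moreover have "x = (y + y1) + z1" using yz * by simp
  ultimately show ?thesis
    unfolding Qf_def using *(2) subspace_sumI[of "y + y1" _ z1] by (simp add: algebra_simps)
qed

lemma Qf_Gr:
  assumes "x \<in> Qf q k m"
  obtains y where "y \<in> Fb (q - m + 1) \<inter> W (k - m)" "x - y \<in> W (k - m - 1)"
proof -
  obtain y z where yz: "y \<in> Fb (q - m + 1) \<inter> W (k - m)" "z \<in> Lq (q - m + 1) (k - m + 1)" "x = y + z"
    using assms unfolding Qf_def mem_subspace_sum by auto
  moreover have "z \<in> W (k - m - 1)" using yz Lq_W[of "q - m + 1" "k - m + 1"] by auto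
  ultimately show thesis by (intro that[of y]) auto
qed

lemma Qf_W: "Qf q k m \<subseteq> W (k - m)"
proof
  fix x assume "x \<in> Qf q k m"
  then obtain y where y: "y \<in> Fb (q - m + 1) \<inter> W (k - m)" "x - y \<in> W (k - m - 1)" by (rule Qf_Gr)
  then have "y + (x - y) \<in> W (k - m)"
    using monoW[of "k - m - 1" "k - m"] by (intro subspace_add[OF subW]) auto
  then show "x \<in> W (k - m)" by simp
qed

text \<open>Descent through the weights: on \<open>Gr (p + q - m)\<close> the element lies in
  \<open>F p\<close> and in the conjugate of \<open>F (q - m + 1)\<close>. The indices add up to one
  more than the weight, so it vanishes there and drops one step.\<close>

lemma D_inj:
  assumes x: "x \<in> D p q" and xW: "x \<in> W (p + q - 1)"
  shows "x \<in> A'"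
proof -
  have Q: "x \<in> Qf q (p + q) (int n + 1)" for n
  proof (induction n)
    case 0
    then show ?case using x xW Qf_start unfolding D_def by auto
  next
    case (Suc n)
    let ?m = "int n + 1"
    obtain y where y: "y \<in> Fb (q - ?m + 1) \<inter> W (p + q - ?m)" "x - y \<in> W (p + q - ?m - 1)"
      using Qf_Gr[OF Suc] by blast
    have "x \<in> W (p + q - ?m - 1)"
    proof (rule opposed_zero[OF _ y(1)])
      show "x \<in> F p \<inter> W (p + q - ?m)" using x Suc Qf_W unfolding D_def by blast
    qed (use y in auto)
    then have "x \<in> Qf q (p + q) (?m + 1)" by (rule Qf_next[OF Suc])
    then show ?case by (simp add: algebra_simps)
  qed
  obtain k0 where k0: "\<And>k. k \<le> k0 \<Longrightarrow> W k = A'" using W_low by blast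
  have "x \<in> W (p + q - (int (nat (p + q - k0)) + 1))" using Q Qf_W by blast
  also have "W (p + q - (int (nat (p + q - k0)) + 1)) = A'" by (rule k0) linarith
  finally show ?thesis .
qed

text \<open>Successive approximation. The difference between a representative in \<open>F p\<close>
  and one in \<open>Kq\<close> is split by opposedness, one weight lower each time; the part in
  \<open>F p\<close> corrects the first representative, and the conjugate part is absorbed by the
  next term of \<open>Kq\<close>.\<close>

lemma D_surj:
  assumes f: "f \<in> F p \<inter> W (p + q)" and y: "y \<in> Fb q \<inter> W (p + q)"
    and xf: "x - f \<in> W (p + q - 1)" and xy: "x - y \<in> W (p + q - 1)"
  obtains d where "d \<in> D p q" "x - d \<in> W (p + q - 1)"
proof -
  let ?k = "p + q"
  have *: "\<exists>f\<in>F p \<inter> W ?k. \<exists>\<kappa>\<in>Kq q ?k. x - f \<in> W (?k - 1) \<and> f - \<kappa> \<in> W (?k - 1 - int n)" for n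
  proof (induction n)
    case 0
    have "f - y = (x - y) - (x - f)" by simp
    then have "f - y \<in> W (?k - 1)" using subspace_diff[OF subW] xf xy by metis
    moreover have "y \<in> Kq q ?k" using y by (intro Kq_base1) auto
    ultimately show ?case using f xf by (intro bexI[of _ f] bexI[of _ y]) auto
  next
    case (Suc n)
    then obtain f \<kappa> where f: "f \<in> F p \<inter> W ?k" "\<kappa> \<in> Kq q ?k" "x - f \<in> W (?k - 1)"
      "f - \<kappa> \<in> W (?k - 1 - int n)" by blast
    \<comment> \<open>The index \<open>q - int n\<close> is forced: together with \<open>p\<close>
      it exceeds the weight \<open>?k - 1 - int n\<close> by one, and for positive \<open>n\<close>
      it is that of the correction term \<open>i = int n\<close> of \<open>Lq\<close>.\<close>
    obtain a b c where abc: "a \<in> F p \<inter> W (?k - 1 - int n)" "b \<in> Fb (q - int n) \<inter> W (?k - 1 - int n)"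
      "c \<in> W (?k - 1 - int n - 1)" "f - \<kappa> = a + b + c"
      by (rule opposed_sum[OF f(4), of p "q - int n"]) auto
    have le: "W (?k - 1 - int n) \<subseteq> W (?k - 1)" "W (?k - 1) \<subseteq> W ?k" by (rule monoW, simp)+
    have "b \<in> Kq q ?k"
    proof (cases n)
      case 0
      then show ?thesis using abc le by (intro Kq_base1) auto
    next
      case (Suc n')
      then show ?thesis using abc by (intro Kq_base2 Lq_base[of "int n"]) (auto simp: algebra_simps)
    qed
    then have "\<kappa> + b \<in> Kq q ?k" using f by (intro subspace_add[OF subKq])
    moreover have "f - a \<in> F p \<inter> W ?k" using f abc le by (intro subspace_diff[OF subFW]) auto
    moreover have "x - (f - a) \<in> W (?k - 1)"
      using f(3) abc(1) le subspace_add[OF subW, of "x - f" "?k - 1" a] by (auto simp: algebra_simps)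
    moreover have "(f - a) - (\<kappa> + b) = c" using abc(4) by (simp add: algebra_simps)
    ultimately show ?case using abc(3) by (force simp: algebra_simps)
  qed
  obtain k0 where k0: "\<And>k. k \<le> k0 \<Longrightarrow> W k = A'" using W_low by blast
  obtain f \<kappa> where f: "f \<in> F p \<inter> W ?k" "\<kappa> \<in> Kq q ?k" "x - f \<in> W (?k - 1)"
    "f - \<kappa> \<in> W (?k - 1 - int (nat (?k - k0)))" using *[of "nat (?k - k0)"] by blast
  have "f - \<kappa> \<in> A'" using f(4) k0[of "?k - 1 - int (nat (?k - k0))"] by simp
  then have "\<kappa> + (f - \<kappa>) \<in> Kq q ?k" using A'Kq f by (intro subspace_add[OF subKq]) auto
  then have "f \<in> D p q" using f unfolding D_def by simp
  then show thesis using f that by blast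
qed

text \<open>The part of type \<open>(a0, k - a0)\<close> is peeled off and \<open>a0\<close> is
  raised by one; as soon as \<open>a0 + b0\<close> exceeds \<open>k\<close>, opposedness makes the
  class zero.\<close>

lemma D_Gr_span:
  assumes f: "f \<in> F a0 \<inter> W k" and y: "y \<in> Fb b0 \<inter> W k"
    and xf: "x - f \<in> W (k - 1)" and xy: "x - y \<in> W (k - 1)"
  obtains d where "d \<in> bispan A' D {(a, b). a \<ge> a0 \<and> b \<ge> b0 \<and> a + b = k}" "x - d \<in> W (k - 1)"
proof -
  have "\<exists>d\<in>bispan A' D {(a, b). a \<ge> a0 \<and> b \<ge> b0 \<and> a + b = k}. x - d \<in> W (k - 1)"
    using assms
  proof (induction "nat (k + 1 - a0 - b0)" arbitrary: a0 x f y)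
    case 0
    have "f - y = (x - y) - (x - f)" by simp
    then have "f - y \<in> W (k - 1)" using subspace_diff[OF subW] 0(4,5) by metis
    then have "f \<in> W (k - 1)" using 0 by (intro opposed_zero[OF 0(2,3)]) auto
    then have "x - f + f \<in> W (k - 1)" using 0 subspace_add[OF subW] by blast
    then show ?case using subspace_0[OF subspace_bispan] by (intro bexI[of _ 0]) auto
  next
    case (Suc n)
    have xW: "x \<in> W k"
    proof -
      have "x - f \<in> W k" using Suc.prems monoW[of "k - 1" k] by auto
      then have "x - f + f \<in> W k" using Suc.prems by (intro subspace_add[OF subW]) auto
      then show ?thesis by simp
    qed
    \<comment> \<open>Opposed splitting with indices \<open>a0 + 1\<close> and
      \<open>k - a0\<close>. On \<open>Gr k\<close> the vectors \<open>f - g\<close> and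
      \<open>z\<close> then agree, so they represent a class of type
      \<open>(a0, k - a0)\<close>.\<close>
    obtain g z w where g: "g \<in> F (a0 + 1) \<inter> W k" "z \<in> Fb (k - a0) \<inter> W k" "w \<in> W (k - 1)"
      "x = g + z + w"
      by (rule opposed_sum[OF xW, of "a0 + 1" "k - a0"]) auto
    have fg: "f - g \<in> F a0 \<inter> W (a0 + (k - a0))"
      using Suc.prems g antiF[of a0 "a0 + 1"] subspace_diff[OF subFW, of f a0 k g] by auto
    have z': "z \<in> Fb (k - a0) \<inter> W (a0 + (k - a0))" using g by simp
    have 1: "x - g - (f - g) \<in> W (a0 + (k - a0) - 1)" using Suc.prems by simp
    have 2: "x - g - z \<in> W (a0 + (k - a0) - 1)" using g by simp
    obtain d1 where d1: "d1 \<in> D a0 (k - a0)" "x - g - d1 \<in> W (k - 1)"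
      by (rule D_surj[OF fg z' 1 2]) auto
    have b0: "b0 \<le> k - a0" using Suc.hyps(2) by linarith
    have "\<exists>d\<in>bispan A' D {(a, b). a \<ge> a0 + 1 \<and> b \<ge> b0 \<and> a + b = k}. g - d \<in> W (k - 1)"
    proof (rule Suc.hyps(1))
      show "n = nat (k + 1 - (a0 + 1) - b0)" using Suc.hyps(2) by linarith
      show "g \<in> F (a0 + 1) \<inter> W k" by (rule g(1))
      show "y - z \<in> Fb b0 \<inter> W k"
        using Suc.prems g antiFb[OF b0] by (intro subspace_diff[OF subFbW]) auto
      show "g - g \<in> W (k - 1)" using subspace_0[OF subW] by simp
      have "g - (y - z) = (x - y) - w" using g by simp
      then show "g - (y - z) \<in> W (k - 1)" using Suc.prems g subspace_diff[OF subW] by metis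
    qed
    then obtain d2 where d2: "d2 \<in> bispan A' D {(a, b). a \<ge> a0 + 1 \<and> b \<ge> b0 \<and> a + b = k}"
      "g - d2 \<in> W (k - 1)" by blast
    have "d2 \<in> bispan A' D {(a, b). a \<ge> a0 \<and> b \<ge> b0 \<and> a + b = k}"
      using d2(1) by (rule subsetD[OF bispan_mono, rotated]) auto
    moreover have "d1 \<in> bispan A' D {(a, b). a \<ge> a0 \<and> b \<ge> b0 \<and> a + b = k}"
      using d1(1) b0 by (intro bispan_base[of a0 "k - a0"]) auto
    ultimately have "d1 + d2 \<in> bispan A' D {(a, b). a \<ge> a0 \<and> b \<ge> b0 \<and> a + b = k}"
      by (intro subspace_add[OF subspace_bispan])
    moreover have "x - (d1 + d2) = (x - g - d1) + (g - d2)" by simp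
    then have "x - (d1 + d2) \<in> W (k - 1)" using d1 d2 subspace_add[OF subW] by metis
    ultimately show ?case by blast
  qed
  then show thesis using that by blast
qed

lemma FW_span: "F p \<inter> W k = bispan A' D {(a, b). a \<ge> p \<and> a + b \<le> k}" (is "?L k = ?R k")
proof
  show RL: "?R k \<subseteq> ?L k" for k
  proof (rule bispan_least[OF subFW])
    show "A' \<subseteq> F p \<inter> W k" using A'F A'W by blast
    fix a b assume "(a, b) \<in> {(a, b). a \<ge> p \<and> a + b \<le> k}"
    then show "D a b \<subseteq> F p \<inter> W k" using antiF[of p a] monoW[of "a + b" k] unfolding D_def by auto
  qed
  obtain k0 where k0: "\<And>k. k \<le> k0 \<Longrightarrow> W k = A'" using W_low by blast
  obtain b0 where b0: "\<And>p. p \<le> b0 \<Longrightarrow> F p = A" using F_low by blast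
  have Fb0: "Fb b0 = A" using b0[of b0] conjA unfolding Fb_def by simp
  have "x \<in> ?L k \<Longrightarrow> x \<in> ?R k" for x
  proof (induction "nat (k - k0)" arbitrary: k x)
    case 0
    then have "x \<in> A'" using k0[of k] by auto
    then show ?case by (rule bispan_bottom)
  next
    case (Suc n)
    have x1: "x \<in> Fb b0 \<inter> W k" using Suc.prems WA Fb0 by auto
    have x2: "x - x \<in> W (k - 1)" using subspace_0[OF subW] by simp
    obtain d where d: "d \<in> bispan A' D {(a, b). a \<ge> p \<and> b \<ge> b0 \<and> a + b = k}"
      "x - d \<in> W (k - 1)" by (rule D_Gr_span[OF Suc.prems x1 x2 x2])
    have d1: "d \<in> ?R k" using d(1) by (rule subsetD[OF bispan_mono, rotated]) auto
    then have "d \<in> F p" using RL by blast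
    then have "x - d \<in> ?L (k - 1)" using Suc.prems d subspace_diff[OF subF] by auto
    then have "x - d \<in> ?R (k - 1)" using Suc.hyps(2) by (intro Suc.hyps(1)) linarith+
    then have "x - d \<in> ?R k" by (rule subsetD[OF bispan_mono, rotated]) auto
    then have "x - d + d \<in> ?R k" using d1 by (intro subspace_add[OF subspace_bispan])
    then show ?case by simp
  qed
  then show "?L k \<subseteq> ?R k" by blast
qed

lemma F_span: "F p = bispan A' D {(a, b). a \<ge> p}"
proof
  obtain k0 where "W k0 = A" using W_high by blast
  then have "F p = F p \<inter> W k0" using FA by blast
  also have "\<dots> \<subseteq> bispan A' D {(a, b). a \<ge> p}"
    unfolding FW_span by (rule bispan_mono) auto
  finally show "F p \<subseteq> bispan A' D {(a, b). a \<ge> p}" .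
  show "bispan A' D {(a, b). a \<ge> p} \<subseteq> F p"
    by (rule bispan_least[OF subF A'F]) (use antiF in \<open>auto simp: D_def\<close>)
qed

lemma W_span: "W k = bispan A' D {(a, b). a + b \<le> k}"
proof
  obtain p0 where "F p0 = A" using F_low by blast
  then have "W k = F p0 \<inter> W k" using WA by blast
  also have "\<dots> \<subseteq> bispan A' D {(a, b). a + b \<le> k}"
    unfolding FW_span by (rule bispan_mono) auto
  finally show "W k \<subseteq> bispan A' D {(a, b). a + b \<le> k}" .
  show "bispan A' D {(a, b). a + b \<le> k} \<subseteq> W k"
    by (rule bispan_least[OF subW A'W]) (use monoW in \<open>auto simp: D_def\<close>)
qed

lemma A_span: "A = bispan A' D UNIV"
proof
  obtain p0 where "F p0 = A" using F_low by blast
  then show "A \<subseteq> bispan A' D UNIV" using F_span[of p0] bispan_mono[of "{(a, b). a \<ge> p0}" UNIV] by auto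
  show "bispan A' D UNIV \<subseteq> A"
    using subA A'W WA FA by (intro bispan_least) (auto simp: D_def)
qed

text \<open>Controls the error in the conjugation property. On \<open>Gr (k - m)\<close> only types
  with \<open>a \<ge> q - m + 1\<close> and \<open>b \<ge> p - m + 1\<close> occur; since
  \<open>a + b = k - m\<close> and \<open>k = p + q\<close>, this forces \<open>a < q\<close> and
  \<open>b < p\<close>.\<close>

lemma Qf_both:
  assumes "x \<in> Qf p k m" "vconj x \<in> Qf q k m" and k: "k = p + q"
  shows "x \<in> bispan A' D {(r, s). r < q \<and> s < p}"
proof -
  obtain k0 where k0: "\<And>k. k \<le> k0 \<Longrightarrow> W k = A'" using W_low by blast
  show ?thesis using assms(1,2)
  proof (induction "nat (k - m - k0)" arbitrary: m x)
    case 0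
    then have "x \<in> A'" using k0[of "k - m"] Qf_W by auto
    then show ?case by (rule bispan_bottom)
  next
    case (Suc n)
    obtain y where y: "y \<in> Fb (p - m + 1) \<inter> W (k - m)" "x - y \<in> W (k - m - 1)"
      using Qf_Gr[OF Suc.prems(1)] by blast
    obtain y' where y': "y' \<in> Fb (q - m + 1) \<inter> W (k - m)" "vconj x - y' \<in> W (k - m - 1)"
      using Qf_Gr[OF Suc.prems(2)] by blast
    have f: "vconj y' \<in> F (q - m + 1) \<inter> W (k - m)" using y' by (simp add: mem_Fb vconj_W)
    have xf: "x - vconj y' \<in> W (k - m - 1)"
      using y'(2) vconj_W[of "vconj x - y'"] by (simp add: vconj_diff)
    obtain d where d: "d \<in> bispan A' D {(a, b). a \<ge> q - m + 1 \<and> b \<ge> p - m + 1 \<and> a + b = k - m}"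
      "x - d \<in> W (k - m - 1)" using D_Gr_span[OF f y(1) xf y(2)] by blast
    have 1: "bispan A' D {(a, b). a \<ge> q - m + 1 \<and> b \<ge> p - m + 1 \<and> a + b = k - m} \<subseteq> Qf p k m"
    proof (rule bispan_least[OF subQf A'Qf])
      fix a b assume ab: "(a, b) \<in> {(a, b). a \<ge> q - m + 1 \<and> b \<ge> p - m + 1 \<and> a + b = k - m}"
      have "Fb b \<subseteq> Fb (p - m + 1)" using ab by (intro antiFb) auto
      moreover have "Lq b (k - m) \<subseteq> Lq (p - m + 1) (k - m + 1)" using ab by (intro Lq_mono) auto
      ultimately have "Kq b (k - m) \<subseteq> Qf p k m"
        unfolding Kq_def Qf_def by (intro subspace_sum_mono) auto
      then show "D a b \<subseteq> Qf p k m" using ab unfolding D_def by auto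
    qed
    have 2: "bispan A' D {(a, b). a \<ge> q - m + 1 \<and> b \<ge> p - m + 1 \<and> a + b = k - m} \<subseteq> vconj ` Qf q k m"
    proof (rule bispan_least[OF subspace_vconj[OF subQf]])
      show "A' \<subseteq> vconj ` Qf q k m" using A'Qf conjA' by (metis image_mono)
      fix a b assume ab: "(a, b) \<in> {(a, b). a \<ge> q - m + 1 \<and> b \<ge> p - m + 1 \<and> a + b = k - m}"
      show "D a b \<subseteq> vconj ` Qf q k m"
      proof
        fix z assume z: "z \<in> D a b"
        then have "vconj z \<in> Fb (q - m + 1) \<inter> W (k - m)"
          using ab antiF[of "q - m + 1" a] unfolding D_def by (auto simp: mem_Fb vconj_W)
        then show "z \<in> vconj ` Qf q k m"
          unfolding mem_vconj_image Qf_def using subspace_sum_upper1[OF subLq] by blast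
      qed
    qed
    have dd: "d \<in> Qf p k m" "vconj d \<in> Qf q k m"
      using d(1) 1 2 by (auto simp: mem_vconj_image[symmetric])
    have "x - d \<in> Qf p k (m + 1)"
      using dd Suc.prems d subspace_diff[OF subQf] by (intro Qf_next) auto
    moreover have "vconj (x - d) \<in> Qf q k (m + 1)"
      using dd Suc.prems d subspace_diff[OF subQf] by (intro Qf_next) (simp_all add: vconj_diff flip: vconj_W[of "x - d"])
    ultimately have "x - d \<in> bispan A' D {(r, s). r < q \<and> s < p}"
      using Suc.hyps by (intro Suc.hyps(1)) auto
    moreover have "d \<in> bispan A' D {(r, s). r < q \<and> s < p}"
      using d(1) by (rule subsetD[OF bispan_mono, rotated]) (use k in auto)
    ultimately have "x - d + d \<in> bispan A' D {(r, s). r < q \<and> s < p}"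
      by (rule subspace_add[OF subspace_bispan])
    then show ?case by simp
  qed
qed

text \<open>The conjugate of \<open>x\<close> and a lift \<open>d\<close> in \<open>D q p\<close> of
  its class agree in the top weight. Their difference lies in \<open>Kq p\<close>, its conjugate in
  \<open>Kq q\<close>, and \<open>Qf_both\<close> then bounds the types that occur.\<close>

lemma D_conj:
  assumes x: "x \<in> D p q"
  obtains y where "y \<in> D q p" "vconj x - y \<in> bispan A' D {(r, s). r < q \<and> s < p}"
proof -
  let ?k = "p + q"
  obtain y0 z0 where yz: "y0 \<in> Fb q \<inter> W ?k" "z0 \<in> Lq q ?k" "x = y0 + z0"
    using x unfolding D_def Kq_def by (auto elim!: subspace_sumE)
  have f: "vconj y0 \<in> F q \<inter> W (q + p)" using yz by (simp add: mem_Fb vconj_W add.commute)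
  have b: "vconj x \<in> Fb p \<inter> W (q + p)" using x unfolding D_def by (simp add: mem_Fb vconj_W add.commute)
  have "z0 \<in> W (?k - 1)" using yz Lq_W monoW[of "?k - 2" "?k - 1"] by auto
  then have 1: "vconj x - vconj y0 \<in> W (q + p - 1)"
    using yz by (simp add: vconj_add vconj_W add.commute)
  have 2: "vconj x - vconj x \<in> W (q + p - 1)" using subspace_0[OF subW] by simp
  obtain d where d: "d \<in> D q p" "vconj x - d \<in> W (q + p - 1)" using D_surj[OF f b 1 2] by blast
  have "vconj x - d \<in> Kq p ?k"
    using b d by (intro subspace_diff[OF subKq]) (auto simp: D_def add.commute intro: Kq_base1)
  then have A: "vconj x - d \<in> Qf p ?k 1" using d by (intro Qf_start) (auto simp: add.commute)
  have "vconj d \<in> Kq q ?k"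
    using d by (intro Kq_base1) (auto simp: D_def mem_Fb vconj_W add.commute)
  then have "x - vconj d \<in> Kq q ?k"
    using x by (intro subspace_diff[OF subKq]) (auto simp: D_def)
  moreover have "x - vconj d \<in> W (?k - 1)"
    using d(2) vconj_W[of "vconj x - d" "?k - 1"] by (simp add: vconj_diff add.commute)
  ultimately have "x - vconj d \<in> Qf q ?k 1" by (intro Qf_start)
  then have B: "vconj (vconj x - d) \<in> Qf q ?k 1" by (simp add: vconj_diff)
  show thesis using that[OF d(1) Qf_both[OF A B refl]] .
qed

text \<open>The summand of smallest \<open>p\<close> lies in \<open>Fb (k - p)\<close> modulo lower
  weight, whereas all others lie in \<open>F (p + 1)\<close>; opposedness separates them.\<close>

lemma D_indep_Gr:
  assumes "finite S" "\<And>p. p \<in> S \<Longrightarrow> u p \<in> D p (k - p)" "(\<Sum>p\<in>S. u p) \<in> W (k - 1)"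
  shows "\<forall>p\<in>S. u p \<in> A'"
  using assms
proof (induction S rule: finite_linorder_min_induct)
  case (insert p0 S)
  have S: "p0 \<notin> S" using insert.hyps by auto
  let ?s = "\<Sum>p\<in>S. u p"
  have u: "u p0 \<in> D p0 (k - p0)" using insert by auto
  obtain y z where yz: "y \<in> Fb (k - p0) \<inter> W k" "z \<in> Lq (k - p0) k" "u p0 = y + z"
    using u unfolding D_def Kq_def by (auto elim!: subspace_sumE)
  have zW: "z \<in> W (k - 1)" using yz Lq_W monoW[of "k - 2" "k - 1"] by auto
  have s: "?s \<in> F (p0 + 1) \<inter> W k"
  proof (rule module.subspace_sum[OF module_axioms subFW])
    fix p assume "p \<in> S"
    then show "u p \<in> F (p0 + 1) \<inter> W k"
      using insert.prems(1)[of p] insert.hyps(2) antiF[of "p0 + 1" p] unfolding D_def by force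
  qed
  have tot: "u p0 + ?s \<in> W (k - 1)" using insert S by simp
  have "?s - (- y) = (u p0 + ?s) - z" using yz by simp
  then have "?s - (- y) \<in> W (k - 1)" using tot zW subspace_diff[OF subW] by metis
  then have "?s \<in> W (k - 1)"
    using yz subspace_neg[OF subFbW] by (intro opposed_zero[OF s, of "- y" "k - p0"]) auto
  then have "u p0 \<in> W (k - 1)" using tot subspace_diff[OF subW, of "u p0 + ?s" "k - 1" ?s] by simp
  then have "u p0 \<in> A'" using u by (intro D_inj) auto
  moreover have "\<forall>p\<in>S. u p \<in> A'"
    using insert.IH insert.prems \<open>?s \<in> W (k - 1)\<close> by auto
  ultimately show ?case by auto
qed auto

lemma D_indep:
  assumes P: "finite P" and u: "\<And>i. i \<in> P \<Longrightarrow> u i \<in> D (fst i) (snd i)" and s: "(\<Sum>i\<in>P. u i) \<in> A'"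
  shows "\<forall>i\<in>P. u i \<in> A'"
proof -
  define wt :: "int \<times> int \<Rightarrow> int" where "wt i = fst i + snd i" for i
  define s where "s k = (\<Sum>i\<in>{i\<in>P. wt i = k}. u i)" for k
  have sW: "s k \<in> W k" for k
    unfolding s_def using u by (intro module.subspace_sum[OF module_axioms subW]) (auto simp: wt_def D_def)
  have sA: "(\<forall>i\<in>{i\<in>P. wt i = k}. u i \<in> A')" if "s k \<in> W (k - 1)" for k
  proof -
    let ?S = "fst ` {i\<in>P. wt i = k}"
    have inj: "inj_on fst {i\<in>P. wt i = k}" by (auto simp: inj_on_def wt_def)
    have "s k = (\<Sum>p\<in>?S. u (p, k - p))"
      unfolding s_def sum.reindex[OF inj] by (rule sum.cong) (auto simp: wt_def)
    moreover have "u (p, k - p) \<in> D p (k - p)" if "p \<in> ?S" for p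
      using that u unfolding wt_def by force
    ultimately have "\<forall>p\<in>?S. u (p, k - p) \<in> A'"
      using that P by (intro D_indep_Gr) auto
    show ?thesis
    proof
      fix i assume i: "i \<in> {i \<in> P. wt i = k}"
      then have "fst i \<in> ?S" by (rule imageI)
      then have "u (fst i, k - fst i) \<in> A'" using \<open>\<forall>p\<in>?S. u (p, k - p) \<in> A'\<close> by (rule bspec[rotated])
      moreover have "(fst i, k - fst i) = i" using i by (auto simp: wt_def prod_eq_iff)
      ultimately show "u i \<in> A'" by simp
    qed
  qed
  have "\<forall>k\<in>T. s k \<in> W (k - 1)" if "finite T" "(\<Sum>k\<in>T. s k) \<in> A'" for T
    using that
  proof (induction T rule: finite_linorder_max_induct)
    case (insert k T)
    have T: "k \<notin> T" using insert.hyps by auto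
    have "(\<Sum>k\<in>T. s k) \<in> W (k - 1)"
    proof (rule module.subspace_sum[OF module_axioms subW])
      fix l assume "l \<in> T"
      then have "l \<le> k - 1" using insert.hyps(2) by force
      then show "s l \<in> W (k - 1)" using sW[of l] monoW by blast
    qed
    moreover have "s k + (\<Sum>k\<in>T. s k) \<in> A'" using insert T by simp
    ultimately have sk: "s k \<in> W (k - 1)"
      using subspace_diff[OF subW, of "s k + (\<Sum>k\<in>T. s k)" "k - 1" "\<Sum>k\<in>T. s k"] A'W by auto
    have "s k \<in> A'"
      unfolding s_def using sA[OF sk] by (intro module.subspace_sum[OF module_axioms subA']) auto
    then have "(\<Sum>k\<in>T. s k) \<in> A'"
      using \<open>s k + (\<Sum>k\<in>T. s k) \<in> A'\<close> subspace_diff[OF subA', of "s k + (\<Sum>k\<in>T. s k)" "s k"] by simp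
    then show ?case using insert.IH sk by auto
  qed auto
  moreover have "(\<Sum>i\<in>P. u i) = (\<Sum>k\<in>wt ` P. s k)"
    unfolding s_def by (rule sum.image_gen[OF P])
  ultimately have "\<forall>k\<in>wt ` P. s k \<in> W (k - 1)" using P s by auto
  then show ?thesis using sA by blast
qed

lemma bigrading_D: "is_deligne_bigrading A' A F W D"
  unfolding is_deligne_bigrading_def
proof (intro conjI allI impI)
  show "subspace (D p q)" "A' \<subseteq> D p q" "D p q \<subseteq> A" for p q
    by (rule subD, rule A'D) (use FA in \<open>auto simp: D_def\<close>)
  show "bispan A' D UNIV = A" using A_span by simp
  show "F p = bispan A' D {(a, b). p \<le> a}" for p by (rule F_span)
  show "W k = bispan A' D {(a, b). a + b \<le> k}" for k by (rule W_span)
  fix P and u :: "int \<Rightarrow> int \<Rightarrow> 'v"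
  assume P: "finite P" "\<forall>(p, q)\<in>P. u p q \<in> D p q" "(\<Sum>(p, q)\<in>P. u p q) \<in> A'"
  have "\<forall>i\<in>P. (case i of (p, q) \<Rightarrow> u p q) \<in> A'"
    using P by (intro D_indep) auto
  then show "\<forall>(p, q)\<in>P. u p q \<in> A'" by auto
next
  fix p q
  let ?L = "\<lambda>q p. bispan A' D {(r, s). r < q \<and> s < p}"
  have 1: "vconj ` D p q \<subseteq> subspace_sum (D q p) (?L q p)" for p q
  proof
    fix x assume "x \<in> vconj ` D p q"
    then have "vconj x \<in> D p q" by (simp add: mem_vconj_image)
    then obtain y where "y \<in> D q p" "x - y \<in> ?L q p" using D_conj by (metis vconj_vconj)
    then show "x \<in> subspace_sum (D q p) (?L q p)"
      unfolding subspace_sum_alt[OF subD subspace_bispan] by blast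
  qed
  have L: "vconj ` ?L p q \<subseteq> ?L q p" for p q
  proof -
    have "vconj ` ?L p q = bispan A' (\<lambda>a b. vconj ` D b a) (prod.swap ` {(r, s). r < p \<and> s < q})"
      by (rule vconj_bispan[OF conjA'])
    also have "\<dots> \<subseteq> ?L q p"
    proof (rule bispan_least[OF subspace_bispan])
      show "A' \<subseteq> ?L q p" by (auto intro: bispan_bottom)
      fix a b assume "(a, b) \<in> prod.swap ` {(r, s). r < p \<and> s < q}"
      then have ab: "a < q" "b < p" by auto
      have "subspace_sum (D a b) (?L a b) \<subseteq> ?L q p"
      proof (rule subspace_sum_least[OF subspace_bispan])
        show "D a b \<subseteq> ?L q p" using ab by (auto intro: bispan_base[of a b])
        show "?L a b \<subseteq> ?L q p" using ab by (intro bispan_mono) auto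
      qed
      then show "vconj ` D b a \<subseteq> ?L q p" using 1 by blast
    qed
    finally show ?thesis .
  qed
  have 2: "D q p \<subseteq> subspace_sum (vconj ` D p q) (?L q p)"
  proof
    fix x assume "x \<in> D q p"
    then obtain y where y: "y \<in> D p q" "vconj x - y \<in> ?L p q" using D_conj by metis
    then have "vconj (vconj x - y) \<in> ?L q p" using L by blast
    then have "x - vconj y \<in> ?L q p" by (simp add: vconj_diff)
    then show "x \<in> subspace_sum (vconj ` D p q) (?L q p)"
      unfolding subspace_sum_alt[OF subspace_vconj[OF subD] subspace_bispan] using y by blast
  qed
  show "subspace_sum (vconj ` D p q) (?L q p) = subspace_sum (D q p) (?L q p)"
  proof
    show "subspace_sum (vconj ` D p q) (?L q p) \<subseteq> subspace_sum (D q p) (?L q p)"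
      by (intro subspace_sum_least 1 subspace_sum_upper2 subspace_subspace_sum subD subspace_bispan)
    show "subspace_sum (D q p) (?L q p) \<subseteq> subspace_sum (vconj ` D p q) (?L q p)"
      by (intro subspace_sum_least 2 subspace_sum_upper2 subspace_subspace_sum subD subspace_bispan
          subspace_vconj)
  qed
qed

text \<open>Summands of smaller first index and no larger weight satisfy the conjugate condition of
  \<open>D (k - q) q\<close>: a term whose conjugate index \<open>s - i\<close> is below
  \<open>q\<close> reappears as correction term number \<open>q - s + i\<close>.\<close>

lemma Kq_incl:
  assumes "r < k - q" "r + s \<le> k"
  shows "Kq s (r + s) \<subseteq> Kq q k"
  unfolding Kq_def[of s]
proof (rule subspace_sum_least[OF subKq])
  have *: "x \<in> Kq q k" if x: "x \<in> Fb (s - i)" "x \<in> W m" and m: "m \<le> k" "m \<le> k - q + s - i - 1" for x i m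
  proof (cases "s - i \<ge> q")
    case True
    then show ?thesis using x antiFb[OF True] monoW[OF m(1)] by (intro Kq_base1) auto
  next
    case False
    then show ?thesis using x monoW[of m "k - (q - s + i) - 1"] m
      by (intro Kq_base2 Lq_base[of "q - s + i"]) auto
  qed
  show "Fb s \<inter> W (r + s) \<subseteq> Kq q k" using *[of _ 0 "r + s"] assms by auto
  show "Lq s (r + s) \<subseteq> Kq q k"
    unfolding Lq_def
  proof (rule span_minimal[OF _ subKq], safe)
    fix x and i :: int assume "1 \<le> i" "x \<in> Fb (s - i)" "x \<in> W (r + s - i - 1)"
    then show "x \<in> Kq q k" using assms by (intro *[of _ i "r + s - i - 1"]) auto
  qed
qed

text \<open>The conjugation axiom puts \<open>I p q\<close> into the conjugate of
  \<open>I q p\<close> plus summands of smaller indices, so induction on the weight and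
  \<open>Kq_incl\<close> give \<open>I p q \<subseteq> D p q\<close>. Equality follows because the
  \<open>I p q\<close> span and the \<open>D p q\<close> are independent.\<close>

lemma bigrading_unique:
  assumes I: "is_deligne_bigrading A' A F W I"
  shows "I = D"
proof -
  note I' = I[unfolded is_deligne_bigrading_def]
  have subI: "subspace (I p q)" and A'I: "A' \<subseteq> I p q" and IA: "I p q \<subseteq> A" for p q
    using I' by auto
  have FI: "F p = bispan A' I {(a, b). a \<ge> p}" for p using I' by blast
  have WI: "W k = bispan A' I {(a, b). a + b \<le> k}" for k using I' by blast
  have conjI: "subspace_sum (vconj ` I p q) (bispan A' I {(r, s). r < q \<and> s < p}) =
            subspace_sum (I q p) (bispan A' I {(r, s). r < q \<and> s < p})" for p q using I' by blast
  have IF: "I p q \<subseteq> F p" for p q unfolding FI by (auto intro: bispan_base)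
  have IW: "I p q \<subseteq> W (p + q)" for p q unfolding WI by (auto intro: bispan_base)
  obtain k0 where k0: "\<And>k. k \<le> k0 \<Longrightarrow> W k = A'" using W_low by blast
  have IK: "I p q \<subseteq> Kq q (p + q)" if "p + q \<le> k0 + int n" for p q n
    using that
  proof (induction n arbitrary: p q)
    case 0
    then show ?case using IW[of p q] k0[of "p + q"] A'Kq by auto
  next
    case (Suc n)
    let ?L = "bispan A' I {(r, s). r < p \<and> s < q}"
    have L: "?L \<subseteq> Kq q (p + q)"
    proof (rule bispan_least[OF subKq A'Kq])
      fix r s assume rs: "(r, s) \<in> {(r, s). r < p \<and> s < q}"
      then have "I r s \<subseteq> Kq s (r + s)" using Suc by auto
      also have "\<dots> \<subseteq> Kq q (p + q)" using rs by (intro Kq_incl) auto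
      finally show "I r s \<subseteq> Kq q (p + q)" .
    qed
    show ?case
    proof
      fix x assume "x \<in> I p q"
      then have "x \<in> subspace_sum (I p q) ?L" using subspace_sum_upper1[OF subspace_bispan] by blast
      then obtain y l where y: "y \<in> I q p" "l \<in> ?L" "x = vconj y + l"
        unfolding conjI[of q p, symmetric] mem_subspace_sum by blast
      have "vconj y \<in> Kq q (p + q)"
        using y(1) IF[of q p] IW[of q p] by (intro Kq_base1) (auto simp: mem_Fb vconj_W add.commute)
      then show "x \<in> Kq q (p + q)" using y L subspace_add[OF subKq] by blast
    qed
  qed
  have ID: "I p q \<subseteq> D p q" for p q
  proof -
    have "I p q \<subseteq> Kq q (p + q)" by (rule IK[of p q "nat (p + q - k0)"]) linarith
    then show ?thesis using IF[of p q] IW[of p q] unfolding D_def by blast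
  qed
  have "D p q \<subseteq> I p q" for p q
  proof
    fix x assume x: "x \<in> D p q"
    then have "x \<in> span (A' \<union> (\<Union>i\<in>UNIV. I (fst i) (snd i)))"
    proof -
      have "x \<in> A" using x FA unfolding D_def by blast
      moreover have "bispan A' I UNIV = A" using I' by (elim conjE)
      ultimately show ?thesis unfolding bispan_alt by (elim ssubst)
    qed
    from span_family[OF subA' subI this] obtain P u where P: "finite P"
      "\<forall>i\<in>P. u i \<in> I (fst i) (snd i)" "\<forall>i. i \<notin> P \<longrightarrow> u i = 0" "x - (\<Sum>i\<in>P. u i) \<in> A'" by blast
    let ?P = "insert (p, q) P"
    let ?v = "\<lambda>i. if i = (p, q) then x - u i else - u i"
    have uI: "u i \<in> I (fst i) (snd i)" for i using P subspace_0[OF subI] by metis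
    have "(\<Sum>i\<in>?P. u i) = (\<Sum>i\<in>P. u i)" using P by (intro sum.mono_neutral_right) auto
    moreover have "(\<Sum>i\<in>?P. ?v i) = (\<Sum>i\<in>?P. (if i = (p, q) then x else 0) - u i)"
      by (rule sum.cong) auto
    ultimately have "(\<Sum>i\<in>?P. ?v i) = x - (\<Sum>i\<in>P. u i)"
      using P by (simp only: sum_subtractf) simp
    then have "(\<Sum>i\<in>?P. ?v i) \<in> A'" using P by simp
    moreover have "?v i \<in> D (fst i) (snd i)" for i
    proof -
      have "u i \<in> D (fst i) (snd i)" using uI ID by blast
      then show ?thesis using x subspace_diff[OF subD] subspace_neg[OF subD] by auto
    qed
    ultimately have "\<forall>i\<in>?P. ?v i \<in> A'" using P(1) by (intro D_indep) auto
    then have "x - u (p, q) \<in> A'" by auto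
    then have "x - u (p, q) + u (p, q) \<in> I p q"
      using A'I uI[of "(p, q)"] by (intro subspace_add[OF subI]) auto
    then show "x \<in> I p q" by simp
  qed
  with ID show ?thesis by (intro ext subset_antisym)
qed

text \<open>Substitute for invariance of the conjugate filtration: the conjugate of
  \<open>D a b\<close> is \<open>D b a\<close> only modulo smaller summands, on which
  \<open>Y\<close> acts by other scalars, and \<open>Kq_incl\<close> places these in
  \<open>Kq q k\<close>.\<close>

lemma conj_D_Kq:
  assumes A': "A' = {0}" and Y: "endomorphism Y"
    and YD: "\<And>p q v. v \<in> D p q \<Longrightarrow> Y v = of_int (p + q) *\<^sub>C v"
    and v: "v \<in> Fb q \<inter> W k"
  shows "Y v \<in> Kq q k"
proof -
  have "vconj v \<in> bispan A' D {(a, b). a \<ge> q \<and> a + b \<le> k}"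
    unfolding FW_span[symmetric] using v by (simp add: mem_Fb vconj_W)
  then have "v \<in> vconj ` bispan A' D {(a, b). a \<ge> q \<and> a + b \<le> k}"
    by (simp add: mem_vconj_image)
  then have v': "v \<in> span (A' \<union> (\<Union>(a, b)\<in>prod.swap ` {(a, b). a \<ge> q \<and> a + b \<le> k}. vconj ` D b a))"
    unfolding vconj_bispan[OF conjA'] unfolding bispan_def .
  show ?thesis
  proof (rule endo_span_subset[OF Y subKq _ v'])
    fix w assume "w \<in> A' \<union> (\<Union>(a, b)\<in>prod.swap ` {(a, b). a \<ge> q \<and> a + b \<le> k}. vconj ` D b a)"
    then consider "w \<in> A'" | a b where "a \<ge> q" "a + b \<le> k" "w \<in> vconj ` D a b" by auto
    then show "Y w \<in> Kq q k"
    proof cases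
      case 1
      then show ?thesis using A' endo_zero[OF Y] subspace_0[OF subKq] by simp
    next
      case 2
      then have wD: "vconj w \<in> D a b" by (simp add: mem_vconj_image)
      then obtain y where y: "y \<in> D b a" "w - y \<in> bispan A' D {(r, s). r < b \<and> s < a}"
        using D_conj by (metis vconj_vconj)
      let ?c = "of_int (a + b) :: complex"
      have l: "Y u - ?c *\<^sub>C u \<in> Kq q k" if "u \<in> bispan A' D {(r, s). r < b \<and> s < a}" for u
      proof (rule endo_span_subset[OF endo_minus[OF Y endo_scaled[OF endo_id]] subKq _ that[unfolded bispan_def]])
        fix u assume "u \<in> A' \<union> (\<Union>(r, s)\<in>{(r, s). r < b \<and> s < a}. D r s)"
        then consider "u \<in> A'" | r s where "r < b" "s < a" "u \<in> D r s" by auto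
        then show "Y u - ?c *\<^sub>C u \<in> Kq q k"
        proof cases
          case 1
          then show ?thesis using A' endo_zero[OF Y] subspace_0[OF subKq] by simp
        next
          case rs: 2
          have "u \<in> Kq s (r + s)" using rs unfolding D_def by blast
          also have "\<dots> \<subseteq> Kq q k" using rs 2 by (intro Kq_incl) auto
          finally have "u \<in> Kq q k" .
          then show ?thesis
            unfolding YD[OF rs(3)] by (intro subspace_diff[OF subKq] subspace_scale[OF subKq])
        qed
      qed
      have "w \<in> Fb q \<inter> W k"
        using wD 2 antiF[of q a] monoW[of "a + b" k] unfolding D_def by (auto simp: mem_Fb vconj_W)
      then have "?c *\<^sub>C w \<in> Kq q k" by (intro subspace_scale[OF subKq] Kq_base1) auto
      moreover have "Y w = ?c *\<^sub>C w + (Y (w - y) - ?c *\<^sub>C (w - y))"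
        using YD[OF y(1)] by (simp add: endo_diff[OF Y] scale_right_diff_distrib add.commute)
      ultimately show ?thesis using l[OF y(2)] subspace_add[OF subKq] by simp
    qed
  qed
qed

lemma deligne_eq_D: "deligne_bigrading A' A F W = D"
  unfolding deligne_bigrading_def
proof (rule the_equality)
  show "is_deligne_bigrading A' A F W D" by (rule bigrading_D)
qed (rule bigrading_unique)

end


section \<open>Finite families of complementary projections and the Hodge grading\<close>

locale projections = rational_structure scale B
  for scale :: "complex \<Rightarrow> 'v::ab_group_add \<Rightarrow> 'v" (infixr "*\<^sub>C" 75) and B :: "'v set" +
  fixes K :: "'i set" and \<pi> :: "'i \<Rightarrow> 'v \<Rightarrow> 'v"
  assumes finK: "finite K"
    and endo_pi: "endomorphism (\<pi> i)"
    and pi_outside: "i \<notin> K \<Longrightarrow> \<pi> i v = 0"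
    and pi_pi: "\<pi> i (\<pi> j v) = (if i = j then \<pi> j v else 0)"
    and pi_total: "(\<Sum>i\<in>K. \<pi> i v) = v"
begin

lemma pi_add: "\<pi> i (u + v) = \<pi> i u + \<pi> i v" by (rule endo_add[OF endo_pi])
lemma pi_diff: "\<pi> i (u - v) = \<pi> i u - \<pi> i v" by (rule endo_diff[OF endo_pi])
lemma pi_scale: "\<pi> i (c *\<^sub>C v) = c *\<^sub>C \<pi> i v" by (rule endo_scale[OF endo_pi])
lemma pi_zero [simp]: "\<pi> i 0 = 0" by (rule endo_zero[OF endo_pi])
lemma pi_sum: "\<pi> i (sum f S) = (\<Sum>j\<in>S. \<pi> i (f j))" by (rule endo_sum[OF endo_pi])

lemma pi_eqI:
  assumes "\<And>i. \<pi> i u = \<pi> i v"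
  shows "u = v"
proof -
  have "(\<Sum>i\<in>K. \<pi> i u) = (\<Sum>i\<in>K. \<pi> i v)" by (rule sum.cong[OF refl assms])
  then show ?thesis unfolding pi_total .
qed

lemma endo_eqI:
  assumes "endomorphism X" "endomorphism Y" "\<And>i v. X (\<pi> i v) = Y (\<pi> i v)"
  shows "X v = Y v"
proof -
  have "X v = (\<Sum>i\<in>K. X (\<pi> i v))" "Y v = (\<Sum>i\<in>K. Y (\<pi> i v))"
    using endo_sum[OF assms(1)] endo_sum[OF assms(2)] pi_total by metis+
  then show ?thesis using assms(3) by simp
qed

end

context rational_structure
begin

text \<open>The index type may be infinite. The finite set \<open>K\<close> is the union of the
  supports of the finitely many basis vectors.\<close>

lemma direct_family_projections:
  fixes I :: "'i \<Rightarrow> 'v set"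
  assumes I: "\<And>i. subspace (I i)" and sp: "span (\<Union>i. I i) = UNIV"
    and ind: "\<And>P u. finite P \<Longrightarrow> (\<And>i. i \<in> P \<Longrightarrow> u i \<in> I i) \<Longrightarrow> (\<Sum>i\<in>P. u i) = 0 \<Longrightarrow>
      \<forall>i\<in>P. u i = 0"
  obtains K \<pi> where "projections scale B K \<pi>" "\<And>i v. \<pi> i v \<in> I i" "\<And>i v. v \<in> I i \<Longrightarrow> \<pi> i v = v"
proof -
  define dec where "dec v P u \<longleftrightarrow> finite P \<and> (\<forall>i. u i \<in> I i) \<and> (\<forall>i. i \<notin> P \<longrightarrow> u i = 0) \<and>
    v = (\<Sum>i\<in>P. u i)" for v P u
  have ex: "\<exists>P u. dec v P u" for v
  proof -
    have "v \<in> span ({0} \<union> (\<Union>i\<in>UNIV. I i))" using sp span_mono[of "\<Union>i. I i" "{0} \<union> (\<Union>i. I i)"] by auto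
    from span_family[OF subspace_single_0 I this] obtain P u where
      "finite P" "\<forall>i\<in>P. u i \<in> I i" "\<forall>i. i \<notin> P \<longrightarrow> u i = 0" "v - (\<Sum>i\<in>P. u i) \<in> {0}" by blast
    then have "dec v P u" unfolding dec_def using subspace_0[OF I] by (metis eq_iff_diff_eq_0 singletonD)
    then show ?thesis by blast
  qed
  have bigger: "dec v Q u" if "dec v P u" "finite Q" "P \<subseteq> Q" for v P Q u
    using that unfolding dec_def by (auto intro!: sum.mono_neutral_left)
  have uniq: "u = w" if u: "dec v P u" and w: "dec v Q w" for v P Q u w
  proof
    fix i
    let ?R = "insert i (P \<union> Q)"
    have fin: "finite ?R" using u w by (simp add: dec_def)
    have "dec v ?R u" "dec v ?R w"
      using bigger[OF u fin] bigger[OF w fin] by auto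
    then have "(\<Sum>i\<in>?R. u i - w i) = 0" unfolding sum_subtractf dec_def by auto
    then have "\<forall>i\<in>?R. u i - w i = 0"
      using u w fin subspace_diff[OF I] by (intro ind) (auto simp: dec_def)
    then show "u i = w i" by auto
  qed
  obtain S c where c: "dec v (S v) (c v)" for v using ex by metis
  define \<pi> where "\<pi> i v = c v i" for i v
  have piI: "\<pi> i v \<in> I i" for i v using c[of v] by (simp add: dec_def \<pi>_def)
  have pi_single: "\<pi> j v = (if j = i then v else 0)" if "v \<in> I i" for i j v
  proof -
    have "dec v {i} (\<lambda>j. if j = i then v else 0)"
      using that subspace_0[OF I] by (auto simp: dec_def)
    from uniq[OF c this] show ?thesis unfolding \<pi>_def by simp
  qed
  have endo: "endomorphism (\<pi> i)" for i
  proof (rule endomorphismI)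
    fix x y k
    let ?R = "S x \<union> S y"
    have fin: "finite ?R" using c by (simp add: dec_def)
    have "dec x ?R (c x)" "dec y ?R (c y)" using bigger[OF c fin] by auto
    then have "dec (x + y) ?R (\<lambda>i. c x i + c y i)"
      unfolding dec_def using subspace_add[OF I] by (auto simp: sum.distrib)
    from uniq[OF c this] show "\<pi> i (x + y) = \<pi> i x + \<pi> i y" unfolding \<pi>_def by simp
    have "dec (k *\<^sub>C x) (S x) (\<lambda>i. k *\<^sub>C c x i)"
      using c[of x] subspace_scale[OF I] scale_sum_right[of k "c x" "S x"] unfolding dec_def by simp
    from uniq[OF c this] show "\<pi> i (k *\<^sub>C x) = k *\<^sub>C \<pi> i x" unfolding \<pi>_def by simp
  qed
  define K where "K = (\<Union>b\<in>B. S b)"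
  have finK: "finite K" unfolding K_def using c finite_Basis by (auto simp: dec_def)
  have vB: "v \<in> span B" for v using span_Basis by simp
  have out: "\<pi> i v = 0" if "i \<notin> K" for i v
    using endo_eq_on_span[OF endo endo_const_zero _ vB] that c unfolding K_def \<pi>_def dec_def
    by (metis UN_I)
  have tot: "(\<Sum>i\<in>K. \<pi> i v) = v" for v
  proof (rule endo_eq_on_span[OF endo_sum_fun[OF endo] endo_id _ vB])
    fix b assume "b \<in> B"
    then have "dec b K (c b)" using bigger[OF c finK] unfolding K_def by blast
    then show "(\<Sum>i\<in>K. \<pi> i b) = b" unfolding dec_def \<pi>_def by simp
  qed
  have "projections scale B K \<pi>"
    by (unfold_locales) (use finK endo out tot pi_single[OF piI] in auto)
  then show thesis using that piI pi_single by metis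
qed

text \<open>All that the orbit argument takes from Deligne's grading. The last fact is weaker than
  invariance of the conjugate filtration: it carries the correction terms.\<close>

lemma hodge_grading:
  assumes "mixed_hodge_structure {0} UNIV F W"
  defines "Y \<equiv> hodge_grading F W"
  shows endo_hodge_grading: "endomorphism Y"
    and hodge_grading_W: "v \<in> W k \<Longrightarrow> Y v - of_int k *\<^sub>C v \<in> W (k - 1)"
    and hodge_grading_F: "v \<in> F p \<Longrightarrow> Y v \<in> F p"
    and hodge_grading_conj: "v \<in> vconj ` F q \<Longrightarrow> v \<in> W k \<Longrightarrow>
      Y v \<in> span (vconj ` F q \<inter> W k \<union> (\<Union>i\<in>{1..}. vconj ` F (q - i) \<inter> W (k - i - 1)))"
proof -
  interpret mhs scale B "{0}" UNIV F W by unfold_locales fact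
  have "span (\<Union>i. D (fst i) (snd i)) = UNIV"
    using A_span unfolding bispan_alt by (metis Un_insert_left span_insert_0 sup_bot_left)
  moreover have "\<forall>i\<in>P. u i = 0" if "finite P" "\<And>i. i \<in> P \<Longrightarrow> u i \<in> D (fst i) (snd i)"
    "(\<Sum>i\<in>P. u i) = 0" for P and u :: "int \<times> int \<Rightarrow> 'v" using D_indep[OF that(1,2)] that(3) by auto
  ultimately obtain K \<pi> where P: "projections scale B K \<pi>" "\<And>i v. \<pi> i v \<in> D (fst i) (snd i)"
    "\<And>i v. v \<in> D (fst i) (snd i) \<Longrightarrow> \<pi> i v = v"
    by (rule direct_family_projections[of "\<lambda>i. D (fst i) (snd i)", OF subD]) blast+
  interpret P: projections scale B K \<pi> by (rule P(1))
  define Z where "Z v = (\<Sum>i\<in>K. of_int (fst i + snd i) *\<^sub>C \<pi> i v)" for v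
  have Z: "endomorphism Z"
    unfolding Z_def[abs_def] by (intro endo_sum_fun endo_scaled P.endo_pi)
  have ZD: "Z v = of_int (p + q) *\<^sub>C v" if v: "v \<in> D p q" for p q v
  proof -
    have "\<pi> (p, q) v = v" using P(3)[of v "(p, q)"] v by simp
    then have pv: "\<pi> i v = (if i = (p, q) then v else 0)" for i
      using P.pi_pi[of i "(p, q)" v] by auto
    have "Z v = (\<Sum>i\<in>K. if i = (p, q) then of_int (p + q) *\<^sub>C v else 0)"
      unfolding Z_def by (rule sum.cong) (auto simp: pv)
    also have "\<dots> = of_int (p + q) *\<^sub>C v"
      using P.finK P.pi_outside[of "(p, q)" v] pv[of "(p, q)"] by (auto simp: sum.delta)
    finally show ?thesis .
  qed
  have uniq: "X = Z" if X: "endomorphism X" "\<And>p q v. v \<in> D p q \<Longrightarrow> X v = of_int (p + q) *\<^sub>C v" for X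
  proof
    fix v
    have "v \<in> bispan {0} D UNIV" using A_span by simp
    then show "X v = Z v"
      unfolding bispan_def
      by (rule endo_eq_on_span[OF X(1) Z, rotated]) (use X(2) ZD endo_zero[OF X(1)] endo_zero[OF Z] in auto)
  qed
  have Y: "Y = Z"
    unfolding Y_def hodge_grading_def deligne_eq_D
  proof (rule the_equality)
    show "endomorphism Z \<and> (\<forall>p q. \<forall>v\<in>D p q. Z v = of_int (p + q) *\<^sub>C v)"
      using Z ZD by blast
  qed (rule uniq, blast+)
  show "endomorphism Y" using Y Z by simp
  show "Y v - of_int k *\<^sub>C v \<in> W (k - 1)" if v: "v \<in> W k" for v k
  proof -
    have v': "v \<in> span ({0} \<union> (\<Union>(a, b)\<in>{(a, b). a + b \<le> k}. D a b))"
      using v W_span[of k] unfolding bispan_def by (elim subst)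
    show ?thesis
      unfolding Y
    proof (rule endo_span_subset[OF endo_minus[OF Z endo_scaled[OF endo_id]] subW _ v'])
      fix w assume "w \<in> {0} \<union> (\<Union>(a, b)\<in>{(a, b). a + b \<le> k}. D a b)"
      then consider "w = 0" | a b where "a + b \<le> k" "w \<in> D a b" by auto
      then show "Z w - of_int k *\<^sub>C w \<in> W (k - 1)"
      proof cases
        case 1
        then show ?thesis using endo_zero[OF Z] subspace_0[OF subW] by simp
      next
        case 2
        have eq: "Z w - of_int k *\<^sub>C w = of_int (a + b - k) *\<^sub>C w"
          unfolding ZD[OF 2(2)] by (simp add: scale_left_diff_distrib)
        show ?thesis
        proof (cases "a + b = k")
          case True
          then show ?thesis using eq subspace_0[OF subW] by simp
        next
          case False
          then have "w \<in> W (k - 1)" using 2 monoW[of "a + b" "k - 1"] unfolding D_def by auto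
          then show ?thesis unfolding eq by (rule subspace_scale[OF subW])
        qed
      qed
    qed
  qed
  show "Y v \<in> F p" if v: "v \<in> F p" for v p
  proof -
    have v': "v \<in> span ({0} \<union> (\<Union>(a, b)\<in>{(a, b). a \<ge> p}. D a b))"
      using v F_span[of p] unfolding bispan_def by (elim subst)
    show ?thesis
      unfolding Y
    proof (rule endo_span_subset[OF Z subF _ v'])
      fix w assume "w \<in> {0} \<union> (\<Union>(a, b)\<in>{(a, b). a \<ge> p}. D a b)"
      then consider "w = 0" | a b where "a \<ge> p" "w \<in> D a b" by auto
      then show "Z w \<in> F p"
      proof cases
        case 1
        then show ?thesis using endo_zero[OF Z] subspace_0[OF subF] by simp
      next
        case 2
        have "w \<in> F p" using 2 antiF[of p a] unfolding D_def by auto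
        then show ?thesis unfolding ZD[OF 2(2)] by (rule subspace_scale[OF subF])
      qed
    qed
  qed
  show "Y v \<in> span (vconj ` F q \<inter> W k \<union> (\<Union>i\<in>{1..}. vconj ` F (q - i) \<inter> W (k - i - 1)))"
    (is "_ \<in> ?S") if v: "v \<in> vconj ` F q" "v \<in> W k" for v q k
  proof -
    have "Z v \<in> Kq q k"
      using v by (intro conj_D_Kq[OF refl Z ZD]) (auto simp: Fb_def)
    moreover have "Kq q k \<subseteq> ?S"
      unfolding Kq_def Lq_def Fb_def
      by (intro subspace_sum_least subspace_span span_mono) (auto intro: span_base)
    ultimately show ?thesis using Y by auto
  qed
qed

text \<open>Closure under real multiples is all that is assumed of \<open>S\<close>, so that
  \<open>V_R\<close> is covered as well as complex subspaces. The value at \<open>2 * t\<close>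
  minus \<open>2 ^ m\<close> times the value at \<open>t\<close> has no term of degree
  \<open>m\<close>, which drives the induction.\<close>

lemma subspace_poly_coeff:
  fixes S :: "'v set"
  assumes add: "\<And>x y. x \<in> S \<Longrightarrow> y \<in> S \<Longrightarrow> x + y \<in> S"
    and sc: "\<And>r x. x \<in> S \<Longrightarrow> complex_of_real r *\<^sub>C x \<in> S"
    and p: "\<And>t::real. (\<Sum>n<m. complex_of_real t ^ n *\<^sub>C v n) \<in> S"
    and n: "n < m"
  shows "v n \<in> S"
  using p n
proof (induction m arbitrary: v n)
  case (Suc m)
  have low: "v n \<in> S" if "n < m" for n
  proof -
    let ?w = "\<lambda>n. complex_of_real (2 ^ n - 2 ^ m) *\<^sub>C v n"
    have "(\<Sum>n<m. complex_of_real t ^ n *\<^sub>C ?w n) \<in> S" for t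
    proof -
      have "(\<Sum>n<m. complex_of_real t ^ n *\<^sub>C ?w n) = (\<Sum>n<Suc m. complex_of_real t ^ n *\<^sub>C ?w n)"
        by simp
      also have "\<dots> = (\<Sum>n<Suc m. complex_of_real (2 * t) ^ n *\<^sub>C v n - complex_of_real (2 ^ m) *\<^sub>C (complex_of_real t ^ n *\<^sub>C v n))"
        by (rule sum.cong) (auto simp: scale_left_diff_distrib power_mult_distrib algebra_simps simp flip: scale_left_diff_distrib)
      also have "\<dots> = (\<Sum>n<Suc m. complex_of_real (2 * t) ^ n *\<^sub>C v n)
          + complex_of_real (- (2 ^ m)) *\<^sub>C (\<Sum>n<Suc m. complex_of_real t ^ n *\<^sub>C v n)"
        unfolding sum_subtractf scale_sum_right by (simp add: sum_negf)
      also have "\<dots> \<in> S" using Suc.prems(1) by (intro add sc)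
      finally show ?thesis .
    qed
    from Suc.IH[OF this that] have "complex_of_real (1 / (2 ^ n - 2 ^ m)) *\<^sub>C ?w n \<in> S" by (rule sc)
    moreover have "complex_of_real (1 / x) *\<^sub>C complex_of_real x *\<^sub>C u = u" if "x \<noteq> 0" for x :: real and u
      using that by simp
    moreover have "(2::real) ^ n - 2 ^ m \<noteq> 0" using that by simp
    ultimately show ?thesis by metis
  qed
  show ?case
  proof (cases "n < m")
    case False
    then have n: "n = m" using Suc.prems by simp
    have s: "(\<Sum>n<m. v n) \<in> S \<or> m = 0"
    proof -
      have "finite T \<Longrightarrow> T \<noteq> {} \<Longrightarrow> T \<subseteq> {..<m} \<Longrightarrow> (\<Sum>n\<in>T. v n) \<in> S" for T
        by (induction T rule: finite_ne_induct) (auto intro: low add)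
      from this[of "{..<m}"] show ?thesis by auto
    qed
    have tot: "(\<Sum>n<Suc m. v n) \<in> S" using Suc.prems(1)[of 1] by simp
    show ?thesis
    proof (cases "m = 0")
      case False
      then have "complex_of_real (- 1) *\<^sub>C (\<Sum>n<m. v n) \<in> S" using s by (intro sc) auto
      from add[OF tot this] show ?thesis using n by simp
    qed (use tot n in simp)
  qed (rule low)
qed simp

text \<open>A subspace is closed because it is the kernel of a linear map: \<open>g\<close> kills
  \<open>S\<close> and fixes the vectors that complete a basis of \<open>S\<close>.\<close>

lemma subspace_limit:
  assumes S: "subspace S" and \<F>: "\<F> \<noteq> bot"
    and lim: "\<And>b. b \<in> B \<Longrightarrow> ((\<lambda>z. representation B (x z) b) \<longlongrightarrow> representation B l b) \<F>"
    and ev: "eventually (\<lambda>z. x z \<in> S) \<F>"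
  shows "l \<in> S"
proof -
  obtain b where b: "b \<subseteq> S" "independent b" "S \<subseteq> span b" using maximal_independent_subset[of S] by blast
  interpret vp: vector_space_pair scale scale ..
  have bs: "span b = S" using b S span_minimal by blast
  define C where "C = extend_basis b"
  have C: "independent C" "b \<subseteq> C" "span C = UNIV"
    unfolding C_def using independent_extend_basis[OF b(2)] extend_basis_superset[OF b(2)]
      span_extend_basis[OF b(2)] by auto
  obtain g where g: "Vector_Spaces.linear scale scale g" "\<forall>x\<in>C. g x = (if x \<in> b then 0 else x)"
    using vp.linear_independent_extend[OF C(1), of "\<lambda>x. if x \<in> b then 0 else x"] by blast
  have eg: "endomorphism g" using g(1) unfolding endomorphism_def .
  have g0: "g v = 0" if "v \<in> S" for v
  proof -
    have "g v \<in> {0}" by (rule endo_span_subset[OF eg _ _ that[folded bs]]) (use g(2) C in auto)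
    then show ?thesis by simp
  qed
  have gS: "v - g v \<in> S" for v
  proof -
    have "v \<in> span C" using C by simp
    then show ?thesis
      by (rule endo_span_subset[OF endo_minus[OF endo_id eg] S, rotated])
        (use g(2) b S in \<open>auto simp: subspace_0\<close>)
  qed
  have "g l = 0"
  proof (rule rep_eqI)
    fix b' assume b': "b' \<in> B"
    have rep: "representation B (g v) b' = (\<Sum>b\<in>B. representation B v b * representation B (g b) b')" for v
      by (subst rep_sum[of v]) (simp add: endo_sum[OF eg] endo_scale[OF eg] rep_sum_fun rep_scale)
    have "((\<lambda>z. \<Sum>b\<in>B. representation B (x z) b * representation B (g b) b') \<longlongrightarrow>
        (\<Sum>b\<in>B. representation B l b * representation B (g b) b')) \<F>"
      by (intro tendsto_intros lim)
    then have "((\<lambda>z. representation B (g (x z)) b') \<longlongrightarrow> representation B (g l) b') \<F>"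
      by (subst (asm) (1 2) rep[symmetric])
    moreover have "eventually (\<lambda>z. representation B (g (x z)) b' = 0) \<F>"
      using ev by eventually_elim (simp add: g0 rep_zero)
    ultimately have "((\<lambda>z. 0::complex) \<longlongrightarrow> representation B (g l) b') \<F>"
      by (rule Lim_transform_eventually)
    then have "representation B (g l) b' = 0"
      by (rule tendsto_unique[OF \<F> _ tendsto_const])
    then show "representation B (g l) b' = representation B 0 b'" by (simp add: rep_zero)
  qed
  then show ?thesis using gS[of l] by simp
qed

end

text \<open>Dividing by the highest power with nonzero coefficient isolates that coefficient, which
  contradicts the limit if the power is nonnegative. Coefficients of negative powers may
  survive.\<close>

lemma laurent_coeff_zero:
  fixes c :: "int \<Rightarrow> complex"
  assumes fin: "finite C"
    and lim: "((\<lambda>y. \<Sum>m\<in>C. complex_of_real y powi m * c m) \<longlongrightarrow> 0) at_top"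
    and m: "m \<in> C" "m \<ge> 0"
  shows "c m = 0"
proof (rule ccontr)
  assume "c m \<noteq> 0"
  let ?s = "\<lambda>y. complex_of_real y"
  define T where "T = {m\<in>C. c m \<noteq> 0}"
  have T: "finite T" "m \<in> T" using fin m \<open>c m \<noteq> 0\<close> by (auto simp: T_def)
  define M where "M = Max T"
  have "T \<noteq> {}" using T(2) by blast
  from Max_in[OF T(1) this] have M: "M \<in> T" unfolding M_def .
  have M0: "M \<ge> 0" using m(2) Max_ge[OF T] unfolding M_def by simp
  have sinf: "filterlim ?s at_infinity at_top"
    by (intro filterlim_compose[OF filterlim_of_real_at_infinity] filterlim_at_top_imp_at_infinity filterlim_ident)
  then have inv: "((\<lambda>y. inverse (?s y)) \<longlongrightarrow> 0) at_top"
    by (rule filterlim_compose[OF tendsto_inverse_0])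
  have eq: "eventually (\<lambda>y. (\<Sum>m\<in>T. inverse (?s y) ^ nat (M - m) * c m)
      = inverse (?s y) ^ nat M * (\<Sum>m\<in>C. ?s y powi m * c m)) at_top"
    using eventually_gt_at_top[of 0]
  proof eventually_elim
    case (elim y)
    have 1: "(\<Sum>m\<in>C. ?s y powi m * c m) = (\<Sum>m\<in>T. ?s y powi m * c m)"
      using fin by (intro sum.mono_neutral_right) (auto simp: T_def)
    have 2: "inverse (?s y) ^ nat M * (?s y powi m * c m) = inverse (?s y) ^ nat (M - m) * c m"
      if "m \<in> T" for m
    proof -
      have "m \<le> M" using that T Max_ge unfolding M_def by blast
      then have "inverse (?s y) ^ nat (M - m) = ?s y powi (m - M)"
        by (cases "m = M") (auto simp: power_int_def)
      moreover have "inverse (?s y) ^ nat M = ?s y powi (- M)"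
        using M0 by (cases "M = 0") (auto simp: power_int_def)
      moreover have "?s y powi (m - M) = ?s y powi (- M) * ?s y powi m"
        using elim by (subst power_int_add[symmetric]) auto
      ultimately show ?thesis by simp
    qed
    show ?case
      unfolding 1 sum_distrib_left by (rule sum.cong[OF refl]) (rule 2[symmetric])
  qed
  have "((\<lambda>y. inverse (?s y) ^ nat M * (\<Sum>m\<in>C. ?s y powi m * c m)) \<longlongrightarrow> 0 ^ nat M * 0) at_top"
    by (intro tendsto_mult tendsto_power inv lim)
  then have "((\<lambda>y. \<Sum>m\<in>T. inverse (?s y) ^ nat (M - m) * c m) \<longlongrightarrow> 0) at_top"
    using Lim_transform_eventually eq by (force simp: eq_commute)
  moreover have "((\<lambda>y. \<Sum>m\<in>T. inverse (?s y) ^ nat (M - m) * c m) \<longlongrightarrow> (\<Sum>m\<in>T. 0 ^ nat (M - m) * c m)) at_top"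
    by (intro tendsto_intros inv)
  ultimately have "(\<Sum>m\<in>T. 0 ^ nat (M - m) * c m) = 0"
    using tendsto_unique trivial_limit_at_top_linorder by blast
  moreover have "(\<Sum>m\<in>T. 0 ^ nat (M - m) * c m) = (\<Sum>m\<in>T. if m = M then c m else 0)"
  proof (rule sum.cong[OF refl])
    fix m assume "m \<in> T"
    then have "m \<le> M" using Max_ge[OF T(1)] unfolding M_def by blast
    then show "0 ^ nat (M - m) * c m = (if m = M then c m else 0)" by (simp add: power_0_left)
  qed
  ultimately have "c M = 0" using T M by simp
  then show False using M by (simp add: T_def)
qed


section \<open>Comparison of weight filtrations\<close>

context rational_structure
begin

lemma funpow_lower:
  assumes "\<And>k. N ` M k \<subseteq> M (k - 2 :: int)" and "x \<in> M k"
  shows "(N ^^ n) x \<in> M (k - 2 * int n)"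
proof (induction n)
  case (Suc n)
  then have "N ((N ^^ n) x) \<in> M (k - 2 * int n - 2)" using assms(1) by blast
  then show ?case by (simp add: algebra_simps)
qed (use assms in simp)

lemma funpow_stable: "N ` A \<subseteq> A \<Longrightarrow> x \<in> A \<Longrightarrow> (N ^^ n) x \<in> A"
  by (induction n) auto

text \<open>Common core of two uniqueness proofs. The inclusion holds up to a large shift
  \<open>r0\<close>, and the shift is reduced one by one. \<open>h3\<close> is surjectivity of
  powers of \<open>N\<close> for \<open>M\<close>, \<open>h4\<close> injectivity for
  \<open>M'\<close>, and \<open>Z\<close>, \<open>Zw\<close> are the spaces in which errors are
  allowed.\<close>

lemma filtration_compare:
  fixes M M' :: "int \<Rightarrow> 'v set"
  assumes N: "endomorphism N"
    and M: "\<And>k. subspace (M k)" "\<And>k l. k \<le> l \<Longrightarrow> M k \<subseteq> M l" "\<And>k. N ` M k \<subseteq> M (k - 2)"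
    and M': "\<And>k. subspace (M' k)" "\<And>k l. k \<le> l \<Longrightarrow> M' k \<subseteq> M' l" "\<And>k. N ` M' k \<subseteq> M' (k - 2)"
    and bound: "\<And>k. M k \<subseteq> M' (k + int r0)"
    and top: "\<And>k l. k \<ge> k1 \<Longrightarrow> M l \<subseteq> M' k"
    and h1: "\<And>k x. x \<in> M k \<Longrightarrow> \<exists>x'\<in>M' k. x - x' \<in> Z"
    and h2: "\<And>k. M k \<inter> Zw \<subseteq> M' k"
    and h3: "\<And>l x. x \<in> M (i - int l) \<Longrightarrow> \<exists>y\<in>M (i + int l). \<exists>y'\<in>M (i - int l - 1). x - (N ^^ l) y - y' \<in> Zw"
    and h4: "\<And>k m x. x \<in> Z \<Longrightarrow> x \<in> M' k \<Longrightarrow> (N ^^ m) x \<in> M' (k - 2 * int m - 1) \<Longrightarrow> k \<ge> i + int m \<Longrightarrow>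
      x \<in> M' (k - 1)"
  shows "M k \<subseteq> M' k"
proof -
  note Nn = endo_funpow[OF N]
  have step: "\<forall>k. M k \<subseteq> M' (k + int r)" if C: "\<And>k. M k \<subseteq> M' (k + int (Suc r))" for r
  proof -
    \<comment> \<open>Indices above the centre \<open>i\<close> are treated from the top downwards:
      the argument at \<open>i + int l\<close> uses the one at
      \<open>i + int (l + 2)\<close>.\<close>
    have up: "M (i + int l) \<subseteq> M' (i + int l + int r)" for l
    proof (induction "nat (k1 - int l - i)" arbitrary: l rule: less_induct)
      case less
      show ?case
      proof (cases "i + int l \<ge> k1")
        case True
        then show ?thesis by (intro top) auto
      next
        case False
        have IH: "M (i + int (l + 2)) \<subseteq> M' (i + int (l + 2) + int r)"
          using False by (intro less) auto
        show ?thesis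
        proof
          fix x assume x: "x \<in> M (i + int l)"
          have Nx: "(N ^^ (l + 1)) x \<in> M (i - int (l + 2))"
            using funpow_lower[of N M, OF M(3) x, of "l + 1"] by (simp add: algebra_simps)
          obtain y y' where y: "y \<in> M (i + int (l + 2))" "y' \<in> M (i - int (l + 2) - 1)"
            "(N ^^ (l + 1)) x - (N ^^ (l + 2)) y - y' \<in> Zw" using h3[OF Nx] by blast
          let ?w = "(N ^^ (l + 1)) x - (N ^^ (l + 2)) y - y'"
          have "(N ^^ (l + 2)) y \<in> M (i - int (l + 2))"
            using funpow_lower[of N M, OF M(3) y(1), of "l + 2"] by (simp add: algebra_simps)
          moreover have "y' \<in> M (i - int (l + 2))"
            using y(2) M(2)[of "i - int (l + 2) - 1" "i - int (l + 2)"] by auto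
          ultimately have "?w \<in> M (i - int (l + 2))"
            using Nx subspace_diff[OF M(1)] by blast
          then have w: "?w \<in> M' (i - int (l + 2))" using y(3) h2 by blast
          \<comment> \<open>Subtracting \<open>N y\<close> leaves a vector that
            \<open>N ^^ (l + 1)\<close> sends into the index \<open>i - int (l + 2) - 1\<close> up
            to an error in \<open>Zw\<close>; \<open>N y\<close> itself is controlled by the
            induction hypothesis for \<open>y\<close>.\<close>
          have Ny: "N y \<in> M (i + int l)" using M(3) y(1) by force
          have x1: "x - N y \<in> M (i + int l)" using x Ny by (rule subspace_diff[OF M(1)])
          obtain x' where x': "x' \<in> M' (i + int l)" "x - N y - x' \<in> Z" using h1[OF x1] by blast
          let ?\<delta> = "x - N y - x'"
          have lift: "x' \<in> M' (i + int l + int (Suc r))"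
            using x'(1) M'(2)[of "i + int l" "i + int l + int (Suc r)"] by auto
          have d: "?\<delta> \<in> M' (i + int l + int (Suc r))"
            using C x1 lift subspace_diff[OF M'(1)] by blast
          have "(N ^^ (l + 1)) ?\<delta> = ?w + y' - (N ^^ (l + 1)) x'"
            by (simp only: endo_diff[OF Nn]) (simp add: funpow_swap1)
          moreover have "?w + y' - (N ^^ (l + 1)) x' \<in> M' (i + int l + int (Suc r) - 2 * int (l + 1) - 1)"
            (is "_ \<in> M' ?k")
          proof -
            have "?w \<in> M' ?k" using w M'(2)[of "i - int (l + 2)" ?k] by auto
            moreover have "y' \<in> M' ?k"
            proof -
              have "y' \<in> M' (i - int (l + 2) - 1 + int (Suc r))" using y(2) C by blast
              also have "i - int (l + 2) - 1 + int (Suc r) = ?k" by simp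
              finally show ?thesis .
            qed
            moreover have "(N ^^ (l + 1)) x' \<in> M' ?k"
              using funpow_lower[of N M', OF M'(3) x'(1), of "l + 1"]
                M'(2)[of "i + int l - 2 * int (l + 1)" ?k] by auto
            ultimately show ?thesis by (rule subspace_diff[OF M'(1) subspace_add[OF M'(1)]])
          qed
          ultimately have "?\<delta> \<in> M' (i + int l + int (Suc r) - 1)"
            by (intro h4[OF x'(2) d, of "l + 1"]) (auto elim: ssubst)
          then have "?\<delta> \<in> M' (i + int l + int r)" by (simp add: algebra_simps)
          moreover have "x' \<in> M' (i + int l + int r)"
            using x'(1) M'(2)[of "i + int l" "i + int l + int r"] by auto
          moreover have "N y \<in> M' (i + int l + int r)"
          proof -
            have "N y \<in> M' (i + int (l + 2) + int r - 2)" using y(1) IH M'(3) by blast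
            then show ?thesis by (simp add: algebra_simps)
          qed
          ultimately have "?\<delta> + x' + N y \<in> M' (i + int l + int r)"
            by (intro subspace_add[OF M'(1)])
          then show "x \<in> M' (i + int l + int r)" by simp
        qed
      qed
    qed
    show ?thesis
    proof (intro allI subsetI)
      fix k x assume x: "x \<in> M k"
      show "x \<in> M' (k + int r)"
      proof (cases "k \<ge> i")
        case True
        then show ?thesis using up[of "nat (k - i)"] x by auto
      next
        case False
        \<comment> \<open>Below the centre, \<open>N ^^ l\<close> from index
          \<open>i + int l\<close> is onto up to lower terms and errors, so the case above is
          transported downwards.\<close>
        define l where "l = nat (i - k)"
        have l: "k = i - int l" using False by (simp add: l_def)
        obtain y y' where y: "y \<in> M (i + int l)" "y' \<in> M (i - int l - 1)"
          "x - (N ^^ l) y - y' \<in> Zw" using h3 x l by blast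
        let ?w = "x - (N ^^ l) y - y'"
        have "(N ^^ l) y \<in> M k"
        proof -
          have "i + int l - 2 * int l = k" using l by simp
          with funpow_lower[of N M, OF M(3) y(1), of l] show ?thesis by metis
        qed
        moreover have "y' \<in> M k" using y(2) M(2)[of "i - int l - 1" k] l by auto
        ultimately have "?w \<in> M k" using x by (intro subspace_diff[OF M(1)])
        then have "?w \<in> M' k" using y(3) h2 by blast
        then have "?w \<in> M' (k + int r)" using M'(2)[of k "k + int r"] by auto
        moreover have "(N ^^ l) y \<in> M' (k + int r)"
        proof -
          have "y \<in> M' (i + int l + int r)" using y(1) up by blast
          moreover have "i + int l + int r - 2 * int l = k + int r" using l by simp
          ultimately show ?thesis using funpow_lower[of N M', OF M'(3), of y _ l] by metis
        qed
        moreover have "y' \<in> M' (k + int r)"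
        proof -
          have "y' \<in> M' (i - int l - 1 + int (Suc r))" using y(2) C by blast
          moreover have "i - int l - 1 + int (Suc r) = k + int r" using l by simp
          ultimately show ?thesis by metis
        qed
        ultimately have "?w + (N ^^ l) y + y' \<in> M' (k + int r)" by (intro subspace_add[OF M'(1)])
        then show ?thesis by simp
      qed
    qed
  qed
  have "\<forall>k. M k \<subseteq> M' (k + int (r0 - n))" for n
  proof (induction n)
    case (Suc n)
    show ?case
    proof (cases "r0 - n")
      case 0
      then show ?thesis using Suc by simp
    next
      case (Suc r)
      then have "\<forall>k. M k \<subseteq> M' (k + int r)" using Suc.IH by (intro step) auto
      moreover have "r0 - Suc n = r" using Suc by simp
      ultimately show ?thesis by simp
    qed
  qed (use bound in simp)
  from this[of r0] show ?thesis by simp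
qed

subsection \<open>The monodromy weight filtration\<close>

context
  fixes A' A N M
  assumes M: "is_monodromy_weight_filtration A' A N M"
begin

lemma mono_sub: "subspace (M k)" "A' \<subseteq> M k" "M k \<subseteq> A" "k \<le> l \<Longrightarrow> M k \<subseteq> M l"
  and mono_N: "N ` M k \<subseteq> M (k - 2)"
  and mono_inj: "v \<in> M (int n) \<Longrightarrow> (N ^^ n) v \<in> M (- int n - 1) \<Longrightarrow> v \<in> M (int n - 1)"
  and mono_surj: "subspace_sum ((N ^^ n) ` M (int n)) (M (- int n - 1)) = M (- int n)"
  using M unfolding is_monodromy_weight_filtration_def increasing_filtration_def
  by (auto dest: monoD)

lemma mono_low: "\<exists>k0. \<forall>k\<le>k0. M k = A'"
proof -
  obtain k0 where "M k0 = A'"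
    using M unfolding is_monodromy_weight_filtration_def increasing_filtration_def by auto
  then show ?thesis using mono_sub(2,4) by (intro exI[of _ k0]) blast
qed

lemma mono_high: "\<exists>k0. \<forall>k\<ge>k0. M k = A"
proof -
  obtain k0 where "M k0 = A"
    using M unfolding is_monodromy_weight_filtration_def increasing_filtration_def by auto
  then show ?thesis using mono_sub(3,4) by (intro exI[of _ k0]) blast
qed

lemma mono_subA': "subspace A'"
  using mono_low mono_sub(1) by (metis order_refl)

lemma mono_inj':
  assumes "v \<in> M k" "(N ^^ m) v \<in> M (k - 2 * int m - 1)" "k \<ge> int m"
  shows "v \<in> M (k - 1)"
proof -
  define n where "n = nat k"
  have k: "k = int n" and mn: "m \<le> n" using assms(3) by (auto simp: n_def)
  have "(N ^^ (n - m)) ((N ^^ m) v) \<in> M (k - 2 * int m - 1 - 2 * int (n - m))"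
    by (rule funpow_lower[of N M, OF mono_N assms(2)])
  also have "(N ^^ (n - m)) ((N ^^ m) v) = (N ^^ n) v"
    using mn by (metis comp_apply funpow_add le_add_diff_inverse2)
  also have "k - 2 * int m - 1 - 2 * int (n - m) = - int n - 1" using k mn by (simp add: of_nat_diff)
  finally show ?thesis using mono_inj[of v n] assms(1) k by simp
qed

end

text \<open>Centre \<open>0\<close>, with errors allowed in all of \<open>A\<close> for
  \<open>h1\<close> and in \<open>A'\<close> for \<open>h3\<close>, so that \<open>h1\<close> and
  \<open>h2\<close> become trivial and \<open>h3\<close>, \<open>h4\<close> are the defining
  properties.\<close>

lemma monodromy_le:
  assumes N: "endomorphism N" and M: "is_monodromy_weight_filtration A' A N M"
    and M': "is_monodromy_weight_filtration A' A N M'"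
  shows "M k \<subseteq> M' k"
proof -
  obtain a where a: "\<And>k. k \<le> a \<Longrightarrow> M k = A'" using mono_low[OF M] by blast
  obtain b where b: "\<And>k. k \<ge> b \<Longrightarrow> M' k = A" using mono_high[OF M'] by blast
  show ?thesis
  proof (rule filtration_compare[where i = 0 and Z = A and Zw = A' and ?r0.0 = "nat (b - a)" and N = N and ?k1.0 = b])
    show "M k \<subseteq> M' (k + int (nat (b - a)))" for k
    proof (cases "k \<le> a")
      case True
      then show ?thesis using a mono_sub(2)[OF M'] by simp
    next
      case False
      then show ?thesis using b[of "k + int (nat (b - a))"] mono_sub(3)[OF M] by simp
    qed
    show "M l \<subseteq> M' k" if "k \<ge> b" for k l using b[OF that] mono_sub(3)[OF M] by simp
    show "\<exists>x'\<in>M' k. x - x' \<in> A" if "x \<in> M k" for k x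
      using that mono_sub(3)[OF M] subspace_0[OF mono_sub(1)[OF M']] by (intro bexI[of _ 0]) auto
    show "M k \<inter> A' \<subseteq> M' k" for k using mono_sub(2)[OF M'] by blast
    show "\<exists>y\<in>M (0 + int l). \<exists>y'\<in>M (0 - int l - 1). x - (N ^^ l) y - y' \<in> A'" if "x \<in> M (0 - int l)" for l x
    proof -
      have "x \<in> subspace_sum ((N ^^ l) ` M (int l)) (M (- int l - 1))"
        using that mono_surj[OF M, of l] by simp
      then obtain y y' where "y \<in> M (int l)" "y' \<in> M (- int l - 1)" "x = (N ^^ l) y + y'"
        by (auto elim!: subspace_sumE)
      then show ?thesis using subspace_0[OF mono_subA'[OF M]] by (intro bexI[of _ y] bexI[of _ y']) auto
    qed
    show "x \<in> M' (k - 1)" if "x \<in> M' k" "(N ^^ m) x \<in> M' (k - 2 * int m - 1)" "0 + int m \<le> k" for k m x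
      using mono_inj'[OF M' that(1,2)] that(3) by simp
  qed (use N mono_sub[OF M] mono_sub[OF M'] mono_N[OF M] mono_N[OF M'] in auto)
qed

lemma monodromy_unique:
  assumes "endomorphism N" and "is_monodromy_weight_filtration A' A N M"
    and "is_monodromy_weight_filtration A' A N M'"
  shows "M = M'"
  using monodromy_le assms by (intro ext subset_antisym) blast+

lemma subspace_sum_absorb: "U \<subseteq> T \<Longrightarrow> 0 \<in> U \<Longrightarrow> subspace T \<Longrightarrow> subspace_sum U T = T"
  using subspace_sumI[of 0 U _ T] by (intro subset_antisym subspace_sum_least) auto

text \<open>Induction on the nilpotency index on \<open>A / A'\<close>. The kernel \<open>A1\<close>
  and the image \<open>A1'\<close> of \<open>N ^^ d\<close> become the steps of index
  \<open>d - 1\<close> and \<open>-d\<close>; between them one inserts the filtration of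
  \<open>A1 / A1'\<close>, on which \<open>N ^^ d\<close> is zero.\<close>

lemma monodromy_exists:
  assumes N: "endomorphism N"
  shows "subspace A' \<Longrightarrow> subspace A \<Longrightarrow> A' \<subseteq> A \<Longrightarrow> N ` A' \<subseteq> A' \<Longrightarrow> N ` A \<subseteq> A \<Longrightarrow> (N ^^ d) ` A \<subseteq> A' \<Longrightarrow>
    \<exists>M. is_monodromy_weight_filtration A' A N M"
proof (induction d arbitrary: A' A)
  case 0
  then have A: "A = A'" by auto
  have "subspace_sum ((N ^^ l) ` A') A' = A'" for l
    using 0 funpow_stable[of N A'] by (intro subspace_sum_absorb)
      (auto intro!: image_eqI[of _ _ 0] simp: endo_zero[OF endo_funpow[OF N]] subspace_0)
  then have "is_monodromy_weight_filtration A' A N (\<lambda>_. A')"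
    using 0 A unfolding is_monodromy_weight_filtration_def increasing_filtration_def by (auto simp: mono_def)
  then show ?case by blast
next
  case (Suc d)
  have im0: "0 \<in> (N ^^ l) ` T" if "subspace T" for l T
    using that by (auto intro!: image_eqI[of _ _ 0] simp: endo_zero[OF endo_funpow[OF N]] subspace_0)
  have NA: "(N ^^ l) x \<in> A" if "x \<in> A" for l x using funpow_stable[OF Suc.prems(5) that] .
  have NA': "(N ^^ l) x \<in> A'" if "x \<in> A'" for l x using funpow_stable[OF Suc.prems(4) that] .
  have kill: "(N ^^ l) x \<in> A'" if "x \<in> A" "l \<ge> Suc d" for l x
  proof -
    have "(N ^^ l) x = (N ^^ (l - Suc d)) ((N ^^ Suc d) x)"
      using that(2) by (metis comp_apply funpow_add le_add_diff_inverse2)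
    also have "\<dots> \<in> A'" by (rule NA') (use Suc.prems(6) that in blast)
    finally show ?thesis .
  qed
  show ?case
  proof (cases "d = 0")
    case True
    \<comment> \<open>For \<open>d = 0\<close> the map \<open>N ^^ d\<close> is the identity, whose
      kernel is smaller than its image, so the nested construction below would be the wrong way
      round.\<close>
    define M where "M l = (if l \<ge> 0 then A else A')" for l :: int
    have NAA: "N x \<in> A'" if "x \<in> A" for x using kill[of x 1] that True by simp
    have surj: "subspace_sum ((N ^^ l) ` M (int l)) (M (- int l - 1)) = M (- int l)" for l
    proof (cases "l = 0")
      case True
      then show ?thesis using Suc.prems(1-3) subspace_sum_upper1[of A' A] subspace_sum_least[of A A A']
        by (auto simp: M_def)
    next
      case False
      then have "(N ^^ l) ` A \<subseteq> A'" using kill True by auto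
      from subspace_sum_absorb[OF this im0[OF Suc.prems(2)] Suc.prems(1)] show ?thesis
        using False by (simp add: M_def)
    qed
    have "is_monodromy_weight_filtration A' A N M"
      unfolding is_monodromy_weight_filtration_def increasing_filtration_def
    proof (intro conjI allI impI ballI)
      show "\<exists>k. M k = A'" "\<exists>k. M k = A"
        by (rule exI[of _ "-1"], simp add: M_def) (rule exI[of _ 0], simp add: M_def)
      show "N ` M l \<subseteq> M (l - 2)" for l using Suc.prems NAA by (auto simp: M_def)
    qed (use Suc.prems surj in \<open>auto simp: M_def mono_def split: if_splits\<close>)
    then show ?thesis by blast
  next
    case False
    define A1 where "A1 = {v\<in>A. (N ^^ d) v \<in> A'}"
    define A1' where "A1' = subspace_sum ((N ^^ d) ` A) A'"
    note Nd = endo_funpow[OF N, of d]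
    have sub1: "subspace A1"
    proof -
      have "A1 = A \<inter> {v. (N ^^ d) v \<in> A'}" by (auto simp: A1_def)
      then show ?thesis using subspace_inter[OF Suc.prems(2) endo_subspace_vimage[OF Nd Suc.prems(1)]] by simp
    qed
    have sub1': "subspace A1'"
      unfolding A1'_def by (intro subspace_subspace_sum endo_subspace_image[OF Nd] Suc.prems)
    have A'1: "A' \<subseteq> A1'" unfolding A1'_def by (intro subspace_sum_upper2 endo_subspace_image[OF Nd] Suc.prems)
    have NdA: "(N ^^ d) x \<in> A1'" if "x \<in> A" for x
      unfolding A1'_def using subspace_sum_upper1[OF Suc.prems(1)] that by blast
    have le1: "A1' \<subseteq> A1"
      unfolding A1'_def
    proof (rule subspace_sum_least[OF sub1])
      show "A' \<subseteq> A1" using Suc.prems NA' by (auto simp: A1_def)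
      show "(N ^^ d) ` A \<subseteq> A1"
      proof
        fix y assume "y \<in> (N ^^ d) ` A"
        then obtain x where x: "x \<in> A" "y = (N ^^ d) x" by blast
        have "(N ^^ d) y = (N ^^ (d + d)) x" using x by (simp add: funpow_add)
        then show "y \<in> A1" using x NA kill[of x "d + d"] False by (auto simp: A1_def)
      qed
    qed
    have N1: "N ` A1 \<subseteq> A1" using Suc.prems by (auto simp: A1_def funpow_swap1[symmetric])
    have NA1': "N x \<in> A'" if x: "x \<in> A1'" for x
    proof -
      obtain a b where ab: "a \<in> A" "b \<in> A'" "x = (N ^^ d) a + b"
        using x unfolding A1'_def by (elim subspace_sumE) blast
      then have "N x = (N ^^ Suc d) a + N b" using endo_add[OF N] by simp
      then show ?thesis using ab kill[of a "Suc d"] Suc.prems subspace_add[OF Suc.prems(1)] by auto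
    qed
    have "\<exists>M. is_monodromy_weight_filtration A1' A1 N M"
      using sub1 sub1' le1 N1 NA1' A'1 by (intro Suc.IH) (auto simp: A1_def)
    then obtain M1 where M1: "is_monodromy_weight_filtration A1' A1 N M1" by blast
    have kill1: "(N ^^ l) x \<in> A1'" if "x \<in> A1" "l \<ge> d" for l x
    proof -
      have "(N ^^ l) x = (N ^^ (l - d)) ((N ^^ d) x)"
        using that(2) by (metis comp_apply funpow_add le_add_diff_inverse2)
      also have "\<dots> \<in> A'" by (rule NA') (use that in \<open>auto simp: A1_def\<close>)
      finally show ?thesis using A'1 by blast
    qed
    \<comment> \<open>As \<open>N ^^ d\<close> is zero on \<open>A1 / A1'\<close>, injectivity of
      its higher powers above and surjectivity below confine the jumps of \<open>M1\<close> to the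
      indices from \<open>1 - d\<close> to \<open>d - 1\<close>.\<close>
    have M1_top: "M1 k = A1" if "k \<ge> int d - 1" for k
    proof -
      have *: "M1 (int d - 1 + int n) \<subseteq> M1 (int d - 1)" for n
      proof (induction n)
        case (Suc n)
        have "M1 (int d - 1 + int (Suc n)) \<subseteq> M1 (int d - 1 + int n)"
        proof
          fix v assume v: "v \<in> M1 (int d - 1 + int (Suc n))"
          then have "(N ^^ (d + n)) v \<in> A1'" using mono_sub(3)[OF M1] by (intro kill1) auto
          then have "(N ^^ (d + n)) v \<in> M1 (- int (d + n) - 1)" using mono_sub(2)[OF M1] by blast
          then have "v \<in> M1 (int (d + n) - 1)" using v by (intro mono_inj[OF M1]) auto
          then show "v \<in> M1 (int d - 1 + int n)" by (simp add: algebra_simps)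
        qed
        then show ?case using Suc by blast
      qed simp
      obtain k0 where k0: "\<And>k. k \<ge> k0 \<Longrightarrow> M1 k = A1" using mono_high[OF M1] by blast
      have "A1 \<subseteq> M1 (int d - 1)" using *[of "nat (k0 - int d + 1)"] k0[of "int d - 1 + int (nat (k0 - int d + 1))"] by auto
      then show ?thesis using mono_sub(3)[OF M1, of k] mono_sub(4)[OF M1 that] by blast
    qed
    have M1_bot: "M1 k = A1'" if "k \<le> - int d" for k
    proof -
      have *: "M1 (- int d) \<subseteq> M1 (- int d - int n)" for n
      proof (induction n)
        case (Suc n)
        have "M1 (- int d - int n) \<subseteq> M1 (- int d - int (Suc n))"
        proof -
          have "M1 (- int (d + n)) = subspace_sum ((N ^^ (d + n)) ` M1 (int (d + n))) (M1 (- int (d + n) - 1))"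
            by (rule mono_surj[OF M1, symmetric])
          also have "\<dots> \<subseteq> M1 (- int (d + n) - 1)"
          proof (rule subspace_sum_least[OF mono_sub(1)[OF M1] _ order_refl])
            show "(N ^^ (d + n)) ` M1 (int (d + n)) \<subseteq> M1 (- int (d + n) - 1)"
              using kill1[of _ "d + n"] mono_sub(2,3)[OF M1] by fastforce
          qed
          finally show ?thesis by (simp add: algebra_simps)
        qed
        then show ?case using Suc by blast
      qed simp
      obtain k0 where k0: "\<And>k. k \<le> k0 \<Longrightarrow> M1 k = A1'" using mono_low[OF M1] by blast
      have "M1 (- int d) \<subseteq> A1'" using *[of "nat (- int d - k0)"] k0[of "- int d - int (nat (- int d - k0))"] by auto
      then show ?thesis using mono_sub(2)[OF M1, of k] mono_sub(4)[OF M1 that] by blast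
    qed
    define M where "M l = (if l \<ge> int d then A else if l < - int d then A' else M1 l)" for l
    have M_mid: "M l = M1 l" if "l < int d" "l \<ge> - int d" for l using that by (simp add: M_def)
    have M_hi: "M l = A" if "l \<ge> int d" for l using that by (simp add: M_def)
    have M_lo: "M l = A'" if "l < - int d" for l using that by (simp add: M_def)
    have A1A: "A1 \<subseteq> A" by (auto simp: A1_def)
    have subM: "subspace (M k)" "A' \<subseteq> M k" "M k \<subseteq> A" for k
    proof -
      show "subspace (M k)" using Suc.prems mono_sub(1)[OF M1] by (simp add: M_def)
      show "A' \<subseteq> M k" using Suc.prems(3) A'1 mono_sub(2)[OF M1, of k] by (auto simp: M_def)
      show "M k \<subseteq> A" using Suc.prems(3) A1A mono_sub(3)[OF M1, of k] by (auto simp: M_def)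
    qed
    have monoM: "M k \<subseteq> M l" if "k \<le> l" for k l
    proof (cases "l \<ge> int d \<or> k < - int d")
      case True
      then show ?thesis
        using subM(3)[of k] subM(2)[of l] M_hi[of l] M_lo[of k] by (elim disjE) simp_all
    next
      case False
      then show ?thesis using mono_sub(4)[OF M1 that] that by (auto simp: M_def)
    qed
    have NM: "N ` M l \<subseteq> M (l - 2)" for l
    proof -
      consider "l \<ge> int d + 2" | "l = int d + 1 \<or> l = int d" | "l < int d" "l - 2 \<ge> - int d"
        | "l \<ge> - int d" "l - 2 < - int d" "l < int d" | "l < - int d" by linarith
      then show ?thesis
      proof cases
        case 1
        then show ?thesis using Suc.prems(5) by (simp add: M_def)
      next
        case 2
        \<comment> \<open>\<open>N v\<close> lies in \<open>A1\<close>, which is \<open>M1\<close>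
          at index \<open>d - 1\<close>, and \<open>N ^^ (d - 1)\<close> maps it into
          \<open>A1'\<close>; injectivity of that power gains the missing step.\<close>
        have "N v \<in> M1 (int d - 2)" if v: "v \<in> A" for v
        proof -
          define e where "e = d - 1"
          have e: "d = Suc e" using False by (simp add: e_def)
          have "N v \<in> M1 (int e)"
            using v Suc.prems(5) kill[of v "Suc d"] M1_top[of "int e"] e
            by (auto simp: A1_def funpow_swap1[symmetric])
          moreover have "(N ^^ e) (N v) \<in> M1 (- int e - 1)"
            using NdA[OF v] mono_sub(2)[OF M1, of "- int e - 1"] e by (auto simp: funpow_swap1)
          ultimately have "N v \<in> M1 (int e - 1)" by (rule mono_inj[OF M1])
          then show ?thesis using e by simp
        qed
        then have "N ` A \<subseteq> M (int d - 2)"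
          using False M_mid[of "int d - 2"] by auto
        also have "M (int d - 2) \<subseteq> M (l - 2)" using 2 by (intro monoM) auto
        finally show ?thesis using 2 M_hi[of l] by auto
      next
        case 3
        then show ?thesis using mono_N[OF M1, of l] by (simp add: M_def)
      next
        case 4
        have "N x \<in> A'" if x: "x \<in> M1 (- int d + 1)" for x
        proof -
          define e where "e = d - 1"
          have e: "d = Suc e" using False by (simp add: e_def)
          have "M1 (- int e) = subspace_sum ((N ^^ e) ` M1 (int e)) (M1 (- int e - 1))"
            using mono_surj[OF M1] by simp
          then have "x \<in> subspace_sum ((N ^^ e) ` A1) A1'"
            using x e M1_top[of "int e"] M1_bot[of "- int e - 1"] by simp
          then obtain a b where ab: "a \<in> A1" "b \<in> A1'" "x = (N ^^ e) a + b"
            by (elim subspace_sumE) blast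
          then have "N x = (N ^^ d) a + N b" using endo_add[OF N] e by simp
          then show ?thesis using ab NA1' subspace_add[OF Suc.prems(1)] by (auto simp: A1_def)
        qed
        moreover have "M l \<subseteq> M1 (- int d + 1)"
          using 4 M_mid[of l] mono_sub(4)[OF M1, of l "- int d + 1"] by auto
        ultimately show ?thesis using 4 M_lo[of "l - 2"] by auto
      next
        case 5
        then show ?thesis using Suc.prems(4) by (simp add: M_def)
      qed
    qed
    have inj: "v \<in> M (int l - 1)" if v: "v \<in> M (int l)" "(N ^^ l) v \<in> M (- int l - 1)" for l v
    proof -
      consider "l < d" | "l = d" | "l > d" by linarith
      then show ?thesis
      proof cases
        case 1
        then show ?thesis using v mono_inj[OF M1, of v l] by (simp add: M_def)
      next
        case 2
        then have "v \<in> A1" using v by (simp add: M_def A1_def)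
        then show ?thesis using 2 M_mid[of "int l - 1"] M1_top[of "int d - 1"] False by auto
      next
        case 3
        then show ?thesis using v by (simp add: M_def)
      qed
    qed
    have surj: "subspace_sum ((N ^^ l) ` M (int l)) (M (- int l - 1)) = M (- int l)" for l
    proof -
      consider "l < d" | "l = d" | "l > d" by linarith
      then show ?thesis
      proof cases
        case 1
        then show ?thesis using mono_surj[OF M1, of l] by (simp add: M_def)
      next
        case 2
        then show ?thesis using M_mid[of "- int d"] M1_bot[of "- int d"] False by (simp add: M_def A1'_def)
      next
        case 3
        then have "(N ^^ l) ` A \<subseteq> A'" using kill by auto
        from subspace_sum_absorb[OF this im0[OF Suc.prems(2)] Suc.prems(1)] show ?thesis
          using 3 by (simp add: M_def)
      qed
    qed
    have ends: "\<exists>k. M k = A'" "\<exists>k. M k = A"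
      using M_lo[of "- int d - 1"] M_hi[of "int d"] by auto
    have "is_monodromy_weight_filtration A' A N M"
      unfolding is_monodromy_weight_filtration_def increasing_filtration_def
      using subM monoM NM inj surj ends by (auto simp: mono_def)
    then show ?thesis by blast
  qed
qed

lemma monodromy_weight_filtration:
  assumes "nilpotent N" "subspace A'" "subspace A" "A' \<subseteq> A" "N ` A' \<subseteq> A'" "N ` A \<subseteq> A"
  shows "is_monodromy_weight_filtration A' A N (monodromy_weight_filtration A' A N)"
proof -
  have N: "endomorphism N" using assms(1) by (simp add: nilpotent_def)
  obtain d where "\<forall>v. (N ^^ d) v = 0" using assms(1) unfolding nilpotent_def by blast
  then have "(N ^^ d) ` A \<subseteq> A'" using subspace_0[OF assms(2)] by auto
  then obtain M where M: "is_monodromy_weight_filtration A' A N M"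
    using monodromy_exists[OF N assms(2-6)] by blast
  then show ?thesis
    unfolding monodromy_weight_filtration_def
    by (rule theI[where P = "is_monodromy_weight_filtration A' A N"]) (rule monodromy_unique[OF N _ M])
qed

subsection \<open>The relative weight filtration\<close>

context
  fixes W N
  assumes W: "increasing_filtration {0} UNIV W" and nil: "nilpotent N" and NW: "\<And>k. N ` W k \<subseteq> W k"
begin

lemma W_filt: "subspace (W k)" "k \<le> l \<Longrightarrow> W k \<subseteq> W l"
  using W unfolding increasing_filtration_def by (auto dest: monoD)

lemma Gr_monodromy:
  "is_monodromy_weight_filtration (W (k - 1)) (W k) N (monodromy_weight_filtration (W (k - 1)) (W k) N)"
  using nil NW W_filt by (intro monodromy_weight_filtration) auto

lemma Gr_limit_alt:
  "Gr_limit_weight_filtration N W k l = monodromy_weight_filtration (W (k - 1)) (W k) N (l - k)"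
  unfolding Gr_limit_weight_filtration_def shift_def by simp

lemma Gr_limit_N: "N ` Gr_limit_weight_filtration N W k l \<subseteq> Gr_limit_weight_filtration N W k (l - 2)"
  using mono_N[OF Gr_monodromy[of k], of "l - k"] unfolding Gr_limit_alt by (simp add: algebra_simps)

context
  fixes M
  assumes M: "is_relative_weight_filtration N W M"
begin

lemma rel_sub: "subspace (M k)" "k \<le> l \<Longrightarrow> M k \<subseteq> M l" and rel_N: "N ` M k \<subseteq> M (k - 2)"
  using M unfolding is_relative_weight_filtration_def increasing_filtration_def by (auto dest: monoD)

lemma rel_Gr: "subspace_sum (M l \<inter> W k) (W (k - 1)) = Gr_limit_weight_filtration N W k l"
  using M unfolding is_relative_weight_filtration_def Gr_filtration_def induced_filtration_def
  by (metis (no_types, lifting))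

text \<open>On each graded piece \<open>M\<close> induces the monodromy filtration centred at the
  weight, where injectivity is known. It is lifted to \<open>M\<close> by descending in
  \<open>W\<close>; the bound on \<open>k\<close> only becomes easier as \<open>c\<close>
  decreases.\<close>

lemma rel_inj:
  assumes "x \<in> W c" "x \<in> M k" "(N ^^ m) x \<in> M (k - 2 * int m - 1)" "k \<ge> c + int m"
  shows "x \<in> M (k - 1)"
proof -
  obtain c0 where c0: "W c0 = {0}" using W unfolding increasing_filtration_def by auto
  show ?thesis using assms
  proof (induction "nat (c - c0)" arbitrary: c x)
    case 0
    then have "W c \<subseteq> {0}" using W_filt(2)[of c c0] c0 by simp
    then show ?case using 0 subspace_0[OF rel_sub(1)] by auto
  next
    case (Suc n)
    let ?L = "monodromy_weight_filtration (W (c - 1)) (W c) N"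
    have L: "?L (l - c) = subspace_sum (M l \<inter> W c) (W (c - 1))" for l
      unfolding rel_Gr Gr_limit_alt ..
    have in_L: "y \<in> ?L (l - c)" if "y \<in> M l" "y \<in> W c" for y l
      unfolding L using subspace_sum_upper1[OF W_filt(1)] that by blast
    have Nx: "(N ^^ m) x \<in> W c" using funpow_stable[OF NW Suc.prems(1)] .
    have "k - 2 * int m - 1 - c = k - c - 2 * int m - 1" by simp
    with in_L[OF Suc.prems(3) Nx] have "(N ^^ m) x \<in> ?L (k - c - 2 * int m - 1)" by metis
    then have "x \<in> ?L (k - c - 1)"
      using Suc.prems(4) by (intro mono_inj'[OF Gr_monodromy in_L[OF Suc.prems(2,1)]]) auto
    then have "x \<in> subspace_sum (M (k - 1) \<inter> W c) (W (c - 1))"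
      unfolding L[symmetric] by (simp add: algebra_simps)
    then obtain y w where yw: "y \<in> M (k - 1)" "w \<in> W (c - 1)" "x = y + w"
      by (auto elim!: subspace_sumE)
    have yM: "y \<in> M k" using yw(1) rel_sub(2)[of "k - 1" k] by auto
    have "w = x - y" using yw by simp
    then have "w \<in> M k" using Suc.prems(2) yM subspace_diff[OF rel_sub(1)] by simp
    moreover have "(N ^^ m) w \<in> M (k - 2 * int m - 1)"
    proof -
      have N: "endomorphism N" using nil by (simp add: nilpotent_def)
      have "(N ^^ m) y \<in> M (k - 1 - 2 * int m)" using funpow_lower[of N M, OF rel_N yw(1)] .
      then have "(N ^^ m) x - (N ^^ m) y \<in> M (k - 2 * int m - 1)"
        using Suc.prems(3) by (intro subspace_diff[OF rel_sub(1)]) (auto simp: algebra_simps)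
      then show ?thesis using \<open>w = x - y\<close> endo_diff[OF endo_funpow[OF N]] by simp
    qed
    ultimately have "w \<in> M (k - 1)"
      using Suc.hyps yw Suc.prems(4) by (intro Suc.hyps(1)[of "c - 1"]) auto
    then show ?case using yw subspace_add[OF rel_sub(1)] by simp
  qed
qed

end

text \<open>One step of an induction along \<open>W\<close>. Both filtrations induce the same one on
  \<open>Gr i\<close>, so all errors lie in \<open>W (i - 1)\<close>, where the inclusion is already
  known.\<close>

lemma relative_le:
  assumes M: "is_relative_weight_filtration N W M" and M': "is_relative_weight_filtration N W M'"
    and IH: "\<And>l. M l \<inter> W (i - 1) \<subseteq> M' l"
  shows "M k \<inter> W i \<subseteq> M' k"
proof -
  have N: "endomorphism N" using nil by (simp add: nilpotent_def)
  obtain a where a0: "M a = {0}"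
    using M unfolding is_relative_weight_filtration_def increasing_filtration_def by auto
  obtain b where b0: "M' b = UNIV"
    using M' unfolding is_relative_weight_filtration_def increasing_filtration_def by auto
  have a: "M k = {0}" if "k \<le> a" for k
    using rel_sub(2)[OF M that] a0 subspace_0[OF rel_sub(1)[OF M]] by auto
  have b: "M' k = UNIV" if "k \<ge> b" for k using rel_sub(2)[OF M' that] b0 by auto
  let ?L = "monodromy_weight_filtration (W (i - 1)) (W i) N"
  have L: "?L (l - i) = subspace_sum (M l \<inter> W i) (W (i - 1))" for l
    unfolding rel_Gr[OF M] Gr_limit_alt ..
  have L': "?L (l - i) = subspace_sum (M' l \<inter> W i) (W (i - 1))" for l
    unfolding rel_Gr[OF M'] Gr_limit_alt ..
  have subMW: "subspace (M k \<inter> W i)" "subspace (M' k \<inter> W i)" for k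
    using rel_sub(1)[OF M] rel_sub(1)[OF M'] W_filt(1) subspace_inter by blast+
  have "M k \<inter> W i \<subseteq> M' k \<inter> W i"
  proof (rule filtration_compare[where M = "\<lambda>k. M k \<inter> W i" and M' = "\<lambda>k. M' k \<inter> W i" and
        i = i and Z = "W (i - 1)" and Zw = "W (i - 1)" and ?r0.0 = "nat (b - a)" and N = N and ?k1.0 = b])
    show "M k \<inter> W i \<subseteq> M' (k + int (nat (b - a))) \<inter> W i" for k
    proof (cases "k \<le> a")
      case True
      then show ?thesis using a subspace_0[OF rel_sub(1)[OF M']] by auto
    next
      case False
      then show ?thesis using b[of "k + int (nat (b - a))"] by auto
    qed
    show "M l \<inter> W i \<subseteq> M' k \<inter> W i" if "k \<ge> b" for k l using b[OF that] by simp
    show "\<exists>x'\<in>M' k \<inter> W i. x - x' \<in> W (i - 1)" if "x \<in> M k \<inter> W i" for k x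
    proof -
      have "x \<in> subspace_sum (M' k \<inter> W i) (W (i - 1))"
        using that L L' subspace_sum_upper1[OF W_filt(1)] by blast
      then show ?thesis unfolding subspace_sum_alt[OF subMW(2) W_filt(1)] .
    qed
    show "M k \<inter> W i \<inter> W (i - 1) \<subseteq> M' k \<inter> W i" for k using IH by blast
    show "\<exists>y\<in>M (i + int l) \<inter> W i. \<exists>y'\<in>M (i - int l - 1) \<inter> W i. x - (N ^^ l) y - y' \<in> W (i - 1)"
      if x: "x \<in> M (i - int l) \<inter> W i" for l x
    proof -
      have "x \<in> ?L (i - int l - i)" unfolding L using x subspace_sum_upper1[OF W_filt(1)] by blast
      then have "x \<in> subspace_sum ((N ^^ l) ` ?L (int l)) (?L (- int l - 1))"
        using mono_surj[OF Gr_monodromy[of i], of l] by simp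
      then obtain u u' where u: "u \<in> ?L (int l)" "u' \<in> ?L (- int l - 1)" "x = (N ^^ l) u + u'"
        by (auto elim!: subspace_sumE)
      have "int l = i + int l - i" "- int l - 1 = i - int l - 1 - i" by simp_all
      then have "u \<in> ?L (i + int l - i)" "u' \<in> ?L (i - int l - 1 - i)" using u by metis+
      then obtain y w y' w' where y: "y \<in> M (i + int l) \<inter> W i" "w \<in> W (i - 1)" "u = y + w"
        "y' \<in> M (i - int l - 1) \<inter> W i" "w' \<in> W (i - 1)" "u' = y' + w'"
        unfolding L by (elim subspace_sumE) blast
      have "x - (N ^^ l) y - y' = (N ^^ l) w + w'"
        using u y endo_add[OF endo_funpow[OF N]] by simp
      also have "\<dots> \<in> W (i - 1)"
        using y funpow_stable[OF NW] by (intro subspace_add[OF W_filt(1)]) auto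
      finally show ?thesis using y by blast
    qed
    show "x \<in> M' (k - 1) \<inter> W i" if "x \<in> W (i - 1)" "x \<in> M' k \<inter> W i"
      "(N ^^ m) x \<in> M' (k - 2 * int m - 1) \<inter> W i" "i + int m \<le> k" for k m x
      using rel_inj[OF M', of x "i - 1" k m] that by auto
    show "N ` (M k \<inter> W i) \<subseteq> M (k - 2) \<inter> W i" for k using rel_N[OF M] NW by blast
    show "N ` (M' k \<inter> W i) \<subseteq> M' (k - 2) \<inter> W i" for k using rel_N[OF M'] NW by blast
    show "M k \<inter> W i \<subseteq> M l \<inter> W i" "M' k \<inter> W i \<subseteq> M' l \<inter> W i" if "k \<le> l" for k l
      using rel_sub(2)[OF M that] rel_sub(2)[OF M' that] by blast+
  qed (use N subMW in auto)
  then show ?thesis by blast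
qed

lemma relative_unique:
  assumes M: "is_relative_weight_filtration N W M" and M': "is_relative_weight_filtration N W M'"
  shows "M = M'"
proof -
  obtain c0 where c0: "W c0 = {0}" using W unfolding increasing_filtration_def by auto
  obtain c1 where c1: "W c1 = UNIV" using W unfolding increasing_filtration_def by auto
  have *: "\<forall>l. M l \<inter> W (c0 + int n) = M' l \<inter> W (c0 + int n)" for n
  proof (induction n)
    case 0
    then show ?case using c0 subspace_0[OF rel_sub(1)[OF M]] subspace_0[OF rel_sub(1)[OF M']] by auto
  next
    case (Suc n)
    have "c0 + int (Suc n) - 1 = c0 + int n" by simp
    then have "M l \<inter> W (c0 + int (Suc n)) \<subseteq> M' l" "M' l \<inter> W (c0 + int (Suc n)) \<subseteq> M l" for l
    proof -
      have IH: "M l \<inter> W (c0 + int (Suc n) - 1) \<subseteq> M' l" "M' l \<inter> W (c0 + int (Suc n) - 1) \<subseteq> M l" for l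
        using Suc by auto
      show "M l \<inter> W (c0 + int (Suc n)) \<subseteq> M' l" by (rule relative_le[OF M M' IH(1)])
      show "M' l \<inter> W (c0 + int (Suc n)) \<subseteq> M l" by (rule relative_le[OF M' M IH(2)])
    qed
    then show ?case by blast
  qed
  have "W c1 \<subseteq> W (c0 + int (nat (c1 - c0)))" by (rule W_filt(2)) simp
  then have "W (c0 + int (nat (c1 - c0))) = UNIV" using c1 by blast
  then show ?thesis using *[of "nat (c1 - c0)"] by (intro ext) auto
qed

lemma relative_weight_filtration_eq:
  "is_relative_weight_filtration N W M \<Longrightarrow> relative_weight_filtration N W = M"
  unfolding relative_weight_filtration_def using relative_unique by (intro the_equality) blast+

end

end


subsection \<open>Degrees of endomorphisms\<close>

locale graded = projections scale B K \<pi>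
  for scale :: "complex \<Rightarrow> 'v::ab_group_add \<Rightarrow> 'v" (infixr "*\<^sub>C" 75) and B :: "'v set"
    and K :: "'i::ab_group_add set" and \<pi> :: "'i \<Rightarrow> 'v \<Rightarrow> 'v"
begin

text \<open>Conditions on an endomorphism in terms of filtrations become bounds on the set of
  degrees in which it may have nonzero entries.\<close>

definition supp :: "'i set \<Rightarrow> ('v \<Rightarrow> 'v) \<Rightarrow> bool" where
  "supp \<Gamma> X \<longleftrightarrow> endomorphism X \<and> (\<forall>i j v. \<pi> j (X (\<pi> i v)) \<noteq> 0 \<longrightarrow> j - i \<in> \<Gamma>)"

definition cmp :: "'i \<Rightarrow> ('v \<Rightarrow> 'v) \<Rightarrow> 'v \<Rightarrow> 'v" where
  "cmp \<delta> X v = (\<Sum>i\<in>K. \<pi> (i + \<delta>) (X (\<pi> i v)))"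

text \<open>The finitely many degrees that a nonzero entry can have; this keeps sums over all
  components finite even though the index group is infinite.\<close>

definition degs :: "'i set" where "degs = (\<lambda>(j, i). j - i) ` (K \<times> K)"

lemma fin_degs: "finite degs" unfolding degs_def using finK by simp

lemma supp_endo: "supp \<Gamma> X \<Longrightarrow> endomorphism X" by (simp add: supp_def)

lemma suppD: "supp \<Gamma> X \<Longrightarrow> j - i \<notin> \<Gamma> \<Longrightarrow> \<pi> j (X (\<pi> i v)) = 0" unfolding supp_def by blast

lemma suppI: "endomorphism X \<Longrightarrow> (\<And>i j v. j - i \<notin> \<Gamma> \<Longrightarrow> \<pi> j (X (\<pi> i v)) = 0) \<Longrightarrow> supp \<Gamma> X"
  unfolding supp_def by blast

lemma supp_mono: "supp \<Gamma> X \<Longrightarrow> \<Gamma> \<subseteq> \<Gamma>' \<Longrightarrow> supp \<Gamma>' X" unfolding supp_def by blast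

lemma supp_zero: "supp \<Gamma> (\<lambda>v. 0)" by (simp add: supp_def endo_const_zero)

lemma supp_add: "supp \<Gamma> X \<Longrightarrow> supp \<Gamma> Y \<Longrightarrow> supp \<Gamma> (\<lambda>v. X v + Y v)"
  by (intro suppI endo_plus) (auto simp: pi_add suppD dest: supp_endo)

lemma supp_diff: "supp \<Gamma> X \<Longrightarrow> supp \<Gamma> Y \<Longrightarrow> supp \<Gamma> (\<lambda>v. X v - Y v)"
  by (intro suppI endo_minus) (auto simp: pi_diff suppD dest: supp_endo)

lemma supp_scale: "supp \<Gamma> X \<Longrightarrow> supp \<Gamma> (\<lambda>v. c *\<^sub>C X v)"
  by (intro suppI endo_scaled) (auto simp: pi_scale suppD dest: supp_endo)

lemma supp_sum: "(\<And>i. i \<in> S \<Longrightarrow> supp \<Gamma> (X i)) \<Longrightarrow> supp \<Gamma> (\<lambda>v. \<Sum>i\<in>S. X i v)"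
  by (induction S rule: infinite_finite_induct) (simp_all add: supp_zero supp_add)

lemma supp_comp:
  assumes X: "supp \<Gamma> X" and Y: "supp \<Gamma>' Y" and G: "\<And>a b. a \<in> \<Gamma> \<Longrightarrow> b \<in> \<Gamma>' \<Longrightarrow> a + b \<in> \<Gamma>''"
  shows "supp \<Gamma>'' (\<lambda>v. X (Y v))"
proof (rule suppI)
  fix i j v assume ij: "j - i \<notin> \<Gamma>''"
  have "\<pi> j (X (Y (\<pi> i v))) = (\<Sum>l\<in>K. \<pi> j (X (\<pi> l (Y (\<pi> i v)))))"
  proof -
    have "X (Y (\<pi> i v)) = X (\<Sum>l\<in>K. \<pi> l (Y (\<pi> i v)))" unfolding pi_total ..
    also have "\<pi> j \<dots> = (\<Sum>l\<in>K. \<pi> j (X (\<pi> l (Y (\<pi> i v)))))"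
      unfolding endo_sum[OF supp_endo[OF X]] pi_sum ..
    finally show ?thesis .
  qed
  also have "\<dots> = 0"
  proof (rule sum.neutral, rule ballI)
    fix l assume "l \<in> K"
    show "\<pi> j (X (\<pi> l (Y (\<pi> i v)))) = 0"
    proof (cases "l - i \<in> \<Gamma>'")
      case True
      then have "j - l \<notin> \<Gamma>" using G[of "j - l" "l - i"] ij by auto
      then show ?thesis by (rule suppD[OF X])
    next
      case False
      then show ?thesis using suppD[OF Y False] endo_zero[OF supp_endo[OF X]] by simp
    qed
  qed
  finally show "\<pi> j (X (Y (\<pi> i v))) = 0" .
qed (rule endo_comp[OF supp_endo[OF X] supp_endo[OF Y]])

lemma endo_cmp: "endomorphism X \<Longrightarrow> endomorphism (cmp \<delta> X)"
  unfolding cmp_def[abs_def] by (rule endo_sum_fun) (rule endo_comp[OF endo_pi endo_comp[OF _ endo_pi]])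

lemma pi_cmp:
  assumes X: "endomorphism X"
  shows "\<pi> j (cmp \<delta> X v) = \<pi> j (X (\<pi> (j - \<delta>) v))"
proof -
  have "\<pi> j (cmp \<delta> X v) = (\<Sum>i\<in>K. if i = j - \<delta> then \<pi> j (X (\<pi> i v)) else 0)"
    unfolding cmp_def pi_sum by (rule sum.cong) (auto simp: pi_pi)
  then show ?thesis using finK pi_outside endo_zero[OF X] by (cases "j - \<delta> \<in> K") auto
qed

lemma cmp_pi: "endomorphism X \<Longrightarrow> cmp \<delta> X (\<pi> i v) = \<pi> (i + \<delta>) (X (\<pi> i v))"
  by (rule pi_eqI) (auto simp: pi_cmp pi_pi endo_zero algebra_simps)

lemma supp_cmp: "endomorphism X \<Longrightarrow> supp {\<delta>} (cmp \<delta> X)"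
  by (rule suppI) (auto simp: endo_cmp pi_cmp pi_pi endo_zero)

lemma cmp_zero_of_supp: "supp \<Gamma> X \<Longrightarrow> \<delta> \<notin> \<Gamma> \<Longrightarrow> cmp \<delta> X v = 0"
  unfolding cmp_def by (intro sum.neutral ballI suppD) auto

lemma supp_iff_cmp:
  assumes X: "endomorphism X"
  shows "supp \<Gamma> X \<longleftrightarrow> (\<forall>\<delta>. \<delta> \<notin> \<Gamma> \<longrightarrow> cmp \<delta> X = (\<lambda>v. 0))"
proof
  assume *: "\<forall>\<delta>. \<delta> \<notin> \<Gamma> \<longrightarrow> cmp \<delta> X = (\<lambda>v. 0)"
  show "supp \<Gamma> X"
  proof (rule suppI[OF X])
    fix i j v assume "j - i \<notin> \<Gamma>"
    then have "cmp (j - i) X (\<pi> i v) = 0" using * by simp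
    then show "\<pi> j (X (\<pi> i v)) = 0" by (simp add: cmp_pi[OF X])
  qed
qed (auto simp: cmp_zero_of_supp)

lemma cmp_outside: "endomorphism X \<Longrightarrow> \<delta> \<notin> degs \<Longrightarrow> cmp \<delta> X v = 0"
  unfolding cmp_def
proof (intro sum.neutral ballI)
  fix i assume d: "\<delta> \<notin> degs" "i \<in> K"
  have "i + \<delta> \<notin> K"
  proof
    assume "i + \<delta> \<in> K"
    then have "i + \<delta> - i \<in> degs" unfolding degs_def using d(2) by (intro image_eqI[of _ _ "(i + \<delta>, i)"]) auto
    then show False using d(1) by simp
  qed
  then show "\<pi> (i + \<delta>) (X (\<pi> i v)) = 0" by (rule pi_outside)
qed

lemma cmp_eq_hom:
  assumes X: "supp {\<epsilon>} X"
  shows "cmp \<delta> X = (if \<delta> = \<epsilon> then X else (\<lambda>v. 0))"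
proof (cases "\<delta> = \<epsilon>")
  case True
  note e = supp_endo[OF X]
  have "cmp \<epsilon> X v = X v" for v
  proof (rule endo_eqI[OF endo_cmp[OF e] e])
    fix i v
    show "cmp \<epsilon> X (\<pi> i v) = X (\<pi> i v)"
    proof (rule pi_eqI)
      fix j
      show "\<pi> j (cmp \<epsilon> X (\<pi> i v)) = \<pi> j (X (\<pi> i v))"
        using suppD[OF X, of j i v] by (cases "j - i = \<epsilon>") (auto simp: cmp_pi[OF e] pi_pi)
    qed
  qed
  then show ?thesis using True by auto
next
  case False
  then show ?thesis using cmp_zero_of_supp[OF X] by auto
qed

lemma cmp_add: "endomorphism X \<Longrightarrow> endomorphism Y \<Longrightarrow> cmp \<delta> (\<lambda>v. X v + Y v) v = cmp \<delta> X v + cmp \<delta> Y v"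
  by (simp add: cmp_def pi_add sum.distrib)

lemma cmp_diff: "cmp \<delta> (\<lambda>v. X v - Y v) v = cmp \<delta> X v - cmp \<delta> Y v"
  by (simp add: cmp_def pi_diff sum_subtractf)

lemma cmp_scale: "cmp \<delta> (\<lambda>v. c *\<^sub>C X v) v = c *\<^sub>C cmp \<delta> X v"
  by (simp add: cmp_def pi_scale scale_sum_right)

lemma cmp_sum: "cmp \<delta> (\<lambda>v. \<Sum>i\<in>S. X i v) v = (\<Sum>i\<in>S. cmp \<delta> (X i) v)"
  unfolding cmp_def pi_sum by (rule sum.swap)

definition restr :: "'i set \<Rightarrow> ('v \<Rightarrow> 'v) \<Rightarrow> 'v \<Rightarrow> 'v" where
  "restr \<Gamma> X v = (\<Sum>\<delta>\<in>degs \<inter> \<Gamma>. cmp \<delta> X v)"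

lemma supp_restr: "endomorphism X \<Longrightarrow> supp \<Gamma> (restr \<Gamma> X)"
  unfolding restr_def[abs_def] by (intro supp_sum) (auto intro: supp_mono[OF supp_cmp])

lemma cmp_restr:
  assumes X: "endomorphism X"
  shows "cmp \<delta> (restr \<Gamma> X) v = (if \<delta> \<in> \<Gamma> then cmp \<delta> X v else 0)"
proof -
  have "cmp \<delta> (restr \<Gamma> X) v = (\<Sum>\<epsilon>\<in>degs \<inter> \<Gamma>. cmp \<delta> (cmp \<epsilon> X) v)"
    unfolding restr_def[abs_def] by (rule cmp_sum)
  also have "\<dots> = (\<Sum>\<epsilon>\<in>degs \<inter> \<Gamma>. if \<epsilon> = \<delta> then cmp \<delta> X v else 0)"
    by (rule sum.cong) (auto simp: cmp_eq_hom[OF supp_cmp[OF X]])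
  finally show ?thesis using fin_degs cmp_outside[OF X] by auto
qed

lemma endo_restr: "endomorphism X \<Longrightarrow> endomorphism (restr \<Gamma> X)"
  using supp_restr supp_endo by blast

lemma cmp_eqI:
  assumes X: "endomorphism X" and Y: "endomorphism Y" and eq: "\<And>\<delta> v. cmp \<delta> X v = cmp \<delta> Y v"
  shows "X v = Y v"
proof (rule endo_eqI[OF X Y], rule pi_eqI)
  fix i j v
  show "\<pi> j (X (\<pi> i v)) = \<pi> j (Y (\<pi> i v))"
    using eq[of "j - i" "\<pi> i v"] by (simp add: cmp_pi[OF X] cmp_pi[OF Y])
qed

lemma cmp_comp_left:
  assumes N: "supp {\<epsilon>} N" and X: "endomorphism X"
  shows "cmp \<delta> (\<lambda>v. N (X v)) v = N (cmp (\<delta> - \<epsilon>) X v)"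
proof (rule endo_eqI[OF endo_cmp[OF endo_comp[OF supp_endo[OF N] X]] endo_comp[OF supp_endo[OF N] endo_cmp[OF X]]])
  fix i v
  note eN = supp_endo[OF N]
  have piN: "\<pi> j (N u) = N (\<pi> (j - \<epsilon>) u)" for j u
  proof -
    have "\<pi> j (N u) = \<pi> j (cmp \<epsilon> N u)" using cmp_eq_hom[OF N, of \<epsilon>] by simp
    also have "\<dots> = \<pi> j (N (\<pi> (j - \<epsilon>) u))" by (rule pi_cmp[OF eN])
    also have "\<dots> = cmp \<epsilon> N (\<pi> (j - \<epsilon>) u)" by (simp add: cmp_pi[OF eN])
    finally show ?thesis using cmp_eq_hom[OF N, of \<epsilon>] by simp
  qed
  show "cmp \<delta> (\<lambda>v. N (X v)) (\<pi> i v) = N (cmp (\<delta> - \<epsilon>) X (\<pi> i v))"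
    by (simp add: cmp_pi[OF endo_comp[OF eN X]] cmp_pi[OF X] piN algebra_simps)
qed

lemma cmp_comp_right:
  assumes N: "supp {\<epsilon>} N" and X: "endomorphism X"
  shows "cmp \<delta> (\<lambda>v. X (N v)) v = cmp (\<delta> - \<epsilon>) X (N v)"
proof (rule endo_eqI[OF endo_cmp[OF endo_comp[OF X supp_endo[OF N]]] endo_comp[OF endo_cmp[OF X] supp_endo[OF N]]])
  fix i v
  note eN = supp_endo[OF N]
  have Np: "N (\<pi> i v) = \<pi> (i + \<epsilon>) (N (\<pi> i v))"
    using cmp_eq_hom[OF N, of \<epsilon>] cmp_pi[OF eN, of \<epsilon> i v] by simp
  have "cmp (\<delta> - \<epsilon>) X (N (\<pi> i v)) = cmp (\<delta> - \<epsilon>) X (\<pi> (i + \<epsilon>) (N (\<pi> i v)))"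
    using Np by simp
  also have "\<dots> = \<pi> (i + \<delta>) (X (N (\<pi> i v)))"
    unfolding cmp_pi[OF X] unfolding Np[symmetric] by (simp add: algebra_simps)
  finally show "cmp \<delta> (\<lambda>v. X (N v)) (\<pi> i v) = cmp (\<delta> - \<epsilon>) X (N (\<pi> i v))"
    by (simp add: cmp_pi[OF endo_comp[OF X eN]])
qed

end

section \<open>Commutators and conjugation by exponentials\<close>

context rational_structure
begin

definition br :: "('v \<Rightarrow> 'v) \<Rightarrow> ('v \<Rightarrow> 'v) \<Rightarrow> 'v \<Rightarrow> 'v" where
  "br N X v = N (X v) - X (N v)"

lemma endo_br: "endomorphism N \<Longrightarrow> endomorphism X \<Longrightarrow> endomorphism (br N X)"
  unfolding br_def[abs_def] by (rule endo_minus[OF endo_comp endo_comp])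

lemma endo_br_pow: "endomorphism N \<Longrightarrow> endomorphism X \<Longrightarrow> endomorphism ((br N ^^ n) X)"
  by (induction n) (auto intro: endo_br)

lemma br_add: "endomorphism N \<Longrightarrow> br N (\<lambda>v. X v + Y v) = (\<lambda>v. br N X v + br N Y v)"
  by (auto simp: br_def endo_add)

lemma br_scale: "endomorphism N \<Longrightarrow> br N (\<lambda>v. c *\<^sub>C X v) = (\<lambda>v. c *\<^sub>C br N X v)"
  by (auto simp: br_def endo_scale scale_right_diff_distrib)

lemma br_zero: "endomorphism N \<Longrightarrow> br N (\<lambda>v. 0) = (\<lambda>v. 0)"
  by (auto simp: br_def endo_zero)

lemma br_pow_zero: "endomorphism N \<Longrightarrow> (br N ^^ n) (\<lambda>v. 0) = (\<lambda>v. 0)"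
  by (induction n) (auto simp: br_zero)

lemma br_pow_add:
  assumes N: "endomorphism N"
  shows "(br N ^^ n) (\<lambda>v. X v + Y v) = (\<lambda>v. (br N ^^ n) X v + (br N ^^ n) Y v)"
proof (induction n)
  case (Suc n)
  then show ?case by (simp add: br_add[OF N, symmetric])
qed simp

lemma br_pow_scale:
  assumes N: "endomorphism N"
  shows "(br N ^^ n) (\<lambda>v. c *\<^sub>C X v) = (\<lambda>v. c *\<^sub>C (br N ^^ n) X v)"
proof (induction n)
  case (Suc n)
  then show ?case by (simp add: br_scale[OF N, symmetric])
qed simp

lemma br_pow_sum:
  assumes N: "endomorphism N"
  shows "(br N ^^ n) (\<lambda>v. \<Sum>i\<in>S. X i v) = (\<lambda>v. \<Sum>i\<in>S. (br N ^^ n) (X i) v)"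
  by (induction S rule: infinite_finite_induct) (simp_all add: br_pow_zero[OF N] br_pow_add[OF N])

lemma br_jacobi:
  assumes "endomorphism N" "endomorphism X" "endomorphism Y"
  shows "br N (br X Y) = (\<lambda>v. br (br N X) Y v + br X (br N Y) v)"
  by (auto simp: br_def endo_diff[OF assms(1)] endo_diff[OF assms(2)] endo_diff[OF assms(3)] algebra_simps)

lemma nilpotent_scaled:
  assumes N: "endomorphism N"
  shows "((\<lambda>v. c *\<^sub>C N v) ^^ n) v = c ^ n *\<^sub>C (N ^^ n) v"
  by (induction n arbitrary: v) (simp_all add: endo_scale[OF N])

text \<open>The identity \<open>Ad(exp(s N)) = exp(s ad(N))\<close> for nilpotent \<open>N\<close>;
  the \<open>n\<close>-th twist with \<open>T = -X\<close> is the \<open>n\<close>-th iterated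
  bracket.\<close>

lemma nexp_conj_br:
  assumes N: "endomorphism N" and nil: "\<And>v. (N ^^ m) v = 0" and X: "endomorphism X"
  shows "nexp m (\<lambda>v. s *\<^sub>C N v) (X (nexp m (\<lambda>v. (- s) *\<^sub>C N v) v))
    = (\<Sum>n<2 * m. (s ^ n / fact n) *\<^sub>C (br N ^^ n) X v)"
proof -
  have tw: "twist (\<lambda>v. s *\<^sub>C N v) (\<lambda>v. (- s) *\<^sub>C N v) X n = (\<lambda>v. s ^ n *\<^sub>C (br N ^^ n) X v)" for n
  proof (induction n)
    case (Suc n)
    note e = endo_br_pow[OF N X, of n]
    show ?case
    proof
      fix v
      let ?A = "(br N ^^ n) X"
      have "s ^ n *\<^sub>C ?A ((- s) *\<^sub>C N v) = - ((s * s ^ n) *\<^sub>C ?A (N v))"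
        unfolding endo_scale[OF e] by (simp add: mult.commute)
      then show "twist (\<lambda>v. s *\<^sub>C N v) (\<lambda>v. (- s) *\<^sub>C N v) X (Suc n) v = s ^ Suc n *\<^sub>C (br N ^^ Suc n) X v"
        by (simp only: twist.simps Suc) (simp add: br_def endo_scale[OF N] scale_right_diff_distrib)
    qed
  qed simp
  have nils: "((\<lambda>v. c *\<^sub>C N v) ^^ m) v = 0" for c v
    by (simp add: nilpotent_scaled[OF N] nil)
  show ?thesis
    unfolding nexp_conj[OF endo_scaled[OF N] X endo_scaled[OF N] nils nils] tw by simp
qed

lemma nexp_add:
  assumes N: "endomorphism N" and nil: "\<And>v. (N ^^ m) v = 0"
  shows "nexp m (\<lambda>v. s *\<^sub>C N v) (nexp m (\<lambda>v. t *\<^sub>C N v) v) = nexp m (\<lambda>v. (s + t) *\<^sub>C N v) v"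
proof -
  have nils: "((\<lambda>v. c *\<^sub>C N v) ^^ m) v = 0" for c v
    by (simp add: nilpotent_scaled[OF N] nil)
  have tw: "twist (\<lambda>v. s *\<^sub>C N v) (\<lambda>v. t *\<^sub>C N v) (\<lambda>v. v) n = (\<lambda>v. (s + t) ^ n *\<^sub>C (N ^^ n) v)" for n
  proof (induction n)
    case (Suc n)
    show ?case
    proof
      fix v
      have "twist (\<lambda>v. s *\<^sub>C N v) (\<lambda>v. t *\<^sub>C N v) (\<lambda>v. v) (Suc n) v
          = (s * (s + t) ^ n) *\<^sub>C N ((N ^^ n) v) + ((s + t) ^ n * t) *\<^sub>C (N ^^ n) (N v)"
        by (simp only: twist.simps Suc endo_scale[OF N] endo_scale[OF endo_funpow[OF N]] scale_scale)
      also have "(N ^^ n) (N v) = N ((N ^^ n) v)" by (simp add: funpow_swap1)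
      also have "(s * (s + t) ^ n) *\<^sub>C N ((N ^^ n) v) + ((s + t) ^ n * t) *\<^sub>C N ((N ^^ n) v)
          = (s * (s + t) ^ n + (s + t) ^ n * t) *\<^sub>C N ((N ^^ n) v)"
        by (rule scale_left_distrib[symmetric])
      also have "s * (s + t) ^ n + (s + t) ^ n * t = (s + t) ^ Suc n" by (simp add: algebra_simps)
      finally show "twist (\<lambda>v. s *\<^sub>C N v) (\<lambda>v. t *\<^sub>C N v) (\<lambda>v. v) (Suc n) v
          = (s + t) ^ Suc n *\<^sub>C (N ^^ Suc n) v" by simp
    qed
  qed simp
  have "nexp m (\<lambda>v. s *\<^sub>C N v) (nexp m (\<lambda>v. t *\<^sub>C N v) v)
      = (\<Sum>n<2 * m. (1 / fact n) *\<^sub>C (s + t) ^ n *\<^sub>C (N ^^ n) v)"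
    using nexp_conj[OF endo_scaled[OF N] endo_id endo_scaled[OF N] nils nils] by (simp add: tw)
  also have "\<dots> = nexp m (\<lambda>v. (s + t) *\<^sub>C N v) v"
    unfolding nexp_def nilpotent_scaled[OF N]
    by (rule sum.mono_neutral_right) (auto simp: funpow_zero_ge[OF N nil])
  finally show ?thesis .
qed

lemma nexp_zero: "m > 0 \<Longrightarrow> nexp m (\<lambda>v. 0 *\<^sub>C N v) v = v"
proof -
  assume "m > 0"
  have "(1 / fact n) *\<^sub>C ((\<lambda>v. 0 *\<^sub>C N v) ^^ n) v = (if n = 0 then v else 0)" for n by (cases n) auto
  then have "nexp m (\<lambda>v. 0 *\<^sub>C N v) v = (\<Sum>n<m. if n = 0 then v else 0)"
    unfolding nexp_def by (intro sum.cong) auto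
  then show ?thesis using \<open>m > 0\<close> by simp
qed

lemma nexp_subspace:
  assumes "subspace S" "N ` S \<subseteq> S" "v \<in> S"
  shows "nexp m (\<lambda>v. s *\<^sub>C N v) v \<in> S"
proof -
  have "((\<lambda>v. s *\<^sub>C N v) ^^ n) v \<in> S" for n
    by (induction n) (use assms subspace_scale[OF assms(1)] in auto)
  then show ?thesis unfolding nexp_def
    using assms(1) by (intro module.subspace_sum[OF module_axioms] subspace_scale) auto
qed

end

subsection \<open>Opposed filtrations and nilpotent operators\<close>

text \<open>
  \<open>U a\<close> is the part of degree \<open>a\<close> of a graded space on which \<open>n\<close> has degree \<open>-1\<close>; sequences \<open>u\<close>
  with \<open>u a \<in> U a\<close> stand for elements of the direct sum, and \<open>ex u\<close> for \<open>exp(n) u\<close>.  The axiom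
  \<open>opp\<close> says that the decreasing filtration by degree and its image under \<open>exp(-n)\<close> intersect
  trivially in complementary degrees.
\<close>

locale lefschetz = vector_space scale
  for scale :: "complex \<Rightarrow> 'u::ab_group_add \<Rightarrow> 'u" +
  fixes n :: "'u \<Rightarrow> 'u" and U :: "int \<Rightarrow> 'u set" and w :: int and m :: nat
  assumes n_add: "n (x + y) = n x + n y" and n_scale: "n (scale c x) = scale c (n x)"
    and subU: "subspace (U a)" and nU: "x \<in> U a \<Longrightarrow> n x \<in> U (a - 1)"
    and nil: "x \<in> U a \<Longrightarrow> (n ^^ m) x = 0"
    and opp: "(\<And>a. u a \<in> U a) \<Longrightarrow> (\<And>a. a < p \<Longrightarrow> u a = 0) \<Longrightarrow>
      (\<And>\<alpha>. \<alpha> \<le> w - p \<Longrightarrow> (\<Sum>k<m. scale (1 / fact k) ((n ^^ k) (u (\<alpha> + int k)))) = 0) \<Longrightarrow> u a = 0"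
begin

definition ex :: "(int \<Rightarrow> 'u) \<Rightarrow> int \<Rightarrow> 'u" where
  "ex u \<alpha> = (\<Sum>k<m. scale (1 / fact k) ((n ^^ k) (u (\<alpha> + int k))))"

lemma nk_add: "(n ^^ k) (x + y) = (n ^^ k) x + (n ^^ k) y"
  by (induction k) (auto simp: n_add)

lemma nk_scale: "(n ^^ k) (scale c x) = scale c ((n ^^ k) x)"
  by (induction k) (auto simp: n_scale)

lemma nk_zero [simp]: "(n ^^ k) 0 = 0"
  using nk_scale[of k 0 0] by simp

lemma nk_sum: "(n ^^ k) (sum f S) = (\<Sum>i\<in>S. (n ^^ k) (f i))"
  by (induction S rule: infinite_finite_induct) (auto simp: nk_add)

lemma nkU: "x \<in> U a \<Longrightarrow> (n ^^ k) x \<in> U (a - int k)"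
proof (induction k)
  case (Suc k)
  then have "n ((n ^^ k) x) \<in> U (a - int k - 1)" by (intro nU)
  then show ?case by (simp add: algebra_simps)
qed simp

lemma nk_ge: "x \<in> U a \<Longrightarrow> k \<ge> m \<Longrightarrow> (n ^^ k) x = 0"
  using nil[of x a] by (metis comp_apply funpow_add le_add_diff_inverse2 nk_zero)

lemma ex_add: "ex (\<lambda>a. u a + v a) \<alpha> = ex u \<alpha> + ex v \<alpha>"
  by (simp add: ex_def nk_add scale_right_distrib sum.distrib)

lemma ex_scale: "ex (\<lambda>a. scale c (u a)) \<alpha> = scale c (ex u \<alpha>)"
  by (simp add: ex_def nk_scale scale_sum_right)

lemma ex_single:
  assumes "x \<in> U c"
  shows "ex (\<lambda>a. if a = c then x else 0) \<alpha>
    = (if \<alpha> \<le> c then scale (1 / fact (nat (c - \<alpha>))) ((n ^^ nat (c - \<alpha>)) x) else 0)"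
proof (cases "\<alpha> \<le> c")
  case True
  have "ex (\<lambda>a. if a = c then x else 0) \<alpha>
      = (\<Sum>k<m. if k = nat (c - \<alpha>) then scale (1 / fact k) ((n ^^ k) x) else 0)"
    unfolding ex_def by (rule sum.cong) (use True in auto)
  then show ?thesis using True nk_ge[OF assms] by (auto simp: not_less)
next
  case False
  then show ?thesis unfolding ex_def by (auto intro!: sum.neutral)
qed

lemma opp0:
  assumes "\<And>a. u a \<in> U a" "\<And>a. a < p \<Longrightarrow> u a = 0" "\<And>\<alpha>. \<alpha> \<le> w - p \<Longrightarrow> ex u \<alpha> = 0"
  shows "u a = 0"
  using assms unfolding ex_def by (rule opp)

text \<open>Half of a hard Lefschetz property with centre \<open>w / 2\<close>. An element of degree
  \<open>c\<close> lies in the filtration from degree \<open>c\<close> on; under the hypothesis its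
  exponential has no part in degrees up to \<open>w - c\<close>, so \<open>opp\<close> kills
  it.\<close>

lemma injective:
  assumes x: "x \<in> U c" and c: "2 * c \<ge> w" and z: "(n ^^ nat (2 * c - w)) x = 0"
  shows "x = 0"
proof -
  let ?u = "\<lambda>a. if a = c then x else 0"
  have "?u c = 0"
  proof (rule opp0[of ?u c])
    fix \<alpha> assume "\<alpha> \<le> w - c"
    then have "nat (2 * c - w) \<le> nat (c - \<alpha>)" by simp
    then have "(n ^^ nat (c - \<alpha>)) x = 0"
      using z by (metis comp_apply funpow_add le_add_diff_inverse2 nk_zero)
    then show "ex ?u \<alpha> = 0" by (simp add: ex_single[OF x])
  qed (use x subspace_0[OF subU] in auto)
  then show ?thesis by simp
qed

text \<open>Once \<open>X = n T\<close>, the inhomogeneous term is the exponential of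
  \<open>j T\<close> in degree \<open>c + 1\<close>, so uniqueness forces \<open>G = - j T\<close>
  there, where \<open>G\<close> is zero. The vector \<open>T\<close> comes from the equation at
  \<open>\<alpha> = w - c\<close> together with \<open>injective\<close>.\<close>

lemma solution_high_zero:
  assumes c: "c \<ge> 0" "c \<ge> w" and X: "X \<in> U c" and j: "j \<noteq> 0"
    and G: "\<And>a. G a \<in> U a" "\<And>a. a \<le> c + 1 \<Longrightarrow> G a = 0"
    and eq: "\<And>\<alpha>. \<alpha> \<le> w \<Longrightarrow> ex G \<alpha> + scale (j / fact (nat (c - \<alpha>) + 1)) ((n ^^ nat (c - \<alpha>)) X) = 0"
  shows "X = 0"
proof -
  define h where "h = nat (2 * c - w)"
  have h: "int h = 2 * c - w" using c by (simp add: h_def)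
  \<comment> \<open>At \<open>\<alpha> = w - c\<close> the terms with \<open>k < h + 2\<close>
    involve \<open>G\<close> in degrees up to \<open>c + 1\<close> and vanish, so
    \<open>n ^^ (h + 2)\<close> can be factored out of the sum.\<close>
  define R where "R = (\<Sum>k\<in>{h+2..<m}. scale (1 / fact k) ((n ^^ (k - h - 2)) (G (w - c + int k))))"
  have RU: "R \<in> U (c + 2)"
    unfolding R_def
  proof (intro module.subspace_sum[OF module_axioms subU] subspace_scale[OF subU])
    fix k assume k: "k \<in> {h+2..<m}"
    have "w - c + int k - int (k - h - 2) = c + 2" using k h by (simp add: of_nat_diff)
    then show "(n ^^ (k - h - 2)) (G (w - c + int k)) \<in> U (c + 2)" using nkU[OF G(1)] by metis
  qed
  have "ex G (w - c) = (\<Sum>k\<in>{h+2..<m}. scale (1 / fact k) ((n ^^ k) (G (w - c + int k))))"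
    unfolding ex_def by (rule sum.mono_neutral_right) (use h G(2) in auto)
  also have "\<dots> = (n ^^ h) ((n ^^ 2) R)"
    unfolding R_def nk_sum nk_scale
  proof (rule sum.cong[OF refl])
    fix k assume k: "k \<in> {h+2..<m}"
    then have "k \<ge> h + 2" by simp
    then have "k = h + (2 + (k - h - 2))" by arith
    then show "scale (1 / fact k) ((n ^^ k) (G (w - c + int k))) =
        scale (1 / fact k) ((n ^^ h) ((n ^^ 2) ((n ^^ (k - h - 2)) (G (w - c + int k)))))"
      by (metis comp_apply funpow_add)
  qed
  finally have "(n ^^ h) ((n ^^ 2) R) + scale (j / fact (h + 1)) ((n ^^ h) X) = 0"
  proof -
    assume a: "ex G (w - c) = (n ^^ h) ((n ^^ 2) R)"
    have "nat (c - (w - c)) = h" by (simp add: h_def)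
    then show ?thesis using eq[of "w - c"] c(1) unfolding a by simp
  qed
  then have "(n ^^ h) ((n ^^ 2) R + scale (j / fact (h + 1)) X) = 0"
    by (simp add: nk_add nk_scale)
  moreover have "(n ^^ 2) R + scale (j / fact (h + 1)) X \<in> U c"
    using subspace_add[OF subU nkU[OF RU, of 2, simplified] subspace_scale[OF subU X]]
    by simp
  ultimately have "(n ^^ 2) R + scale (j / fact (h + 1)) X = 0"
    using injective[of _ c] c unfolding h_def by simp
  then have e1: "scale (j / fact (h + 1)) X = - (n ^^ 2) R" by (simp add: add_eq_0_iff)
  define T where "T = scale (- (fact (h + 1) / j)) (n R)"
  have "X = scale (fact (h + 1) / j) (scale (j / fact (h + 1)) X)"
    using j by (simp del: fact_Suc)
  also have "\<dots> = n T" unfolding e1 T_def n_scale by (simp add: numeral_2_eq_2 del: fact_Suc)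
  finally have XT: "X = n T" .
  have TU: "T \<in> U (c + 1)"
    using nU[OF RU] unfolding T_def by (intro subspace_scale[OF subU]) (simp add: algebra_simps)
  let ?u = "\<lambda>a. G a + scale j (if a = c + 1 then T else 0)"
  have "?u (c + 1) = 0"
  proof (rule opp0[of ?u 0])
    show "?u a \<in> U a" for a
      using G(1) TU subspace_0[OF subU] by (intro subspace_add[OF subU] subspace_scale[OF subU]) auto
    show "?u a = 0" if "a < 0" for a using that c G(2) by simp
    fix \<alpha> assume a: "\<alpha> \<le> w - 0"
    have "nat (c + 1 - \<alpha>) = Suc (nat (c - \<alpha>))" using a c by simp
    then have "(n ^^ nat (c + 1 - \<alpha>)) T = (n ^^ nat (c - \<alpha>)) X"
      by (simp add: XT funpow_swap1)
    moreover have "nat (c + 1 - \<alpha>) = nat (c - \<alpha>) + 1" "\<alpha> \<le> c + 1" using a c by auto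
    ultimately have "ex ?u \<alpha> = ex G \<alpha> + scale (j / fact (nat (c - \<alpha>) + 1)) ((n ^^ nat (c - \<alpha>)) X)"
      unfolding ex_add ex_scale ex_single[OF TU] by simp
    then show "ex ?u \<alpha> = 0" using eq a by simp
  qed
  then have "T = 0" using G(2)[of "c + 1"] j by simp
  then show ?thesis using XT n_scale[of 0 0] by simp
qed

text \<open>The same mechanism with \<open>X\<close> in degree \<open>-1\<close>: the solution is
  \<open>- j T\<close> concentrated in degree \<open>0\<close>. The relation between
  \<open>X\<close> and \<open>T\<close> is obtained only after \<open>n ^^ (j - 1)\<close>, a power
  beyond the range of \<open>injective\<close> in degree \<open>-1\<close>.\<close>

lemma solution_low:
  assumes w: "w = - int j" "j \<ge> 1" and X: "X \<in> U (- 1)"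
    and g: "\<And>a. g a \<in> U a" "\<And>a. a < 0 \<Longrightarrow> g a = 0"
    and eq: "\<And>\<alpha>. \<alpha> \<le> w \<Longrightarrow>
      ex g \<alpha> + scale (of_nat j / fact (nat (- 1 - \<alpha>) + 1)) ((n ^^ nat (- 1 - \<alpha>)) X) = 0"
  obtains T where "T \<in> U 0" "g 0 = scale (- of_nat j) T" "\<And>a. a \<noteq> 0 \<Longrightarrow> g a = 0"
    "(n ^^ (j - 1)) X = (n ^^ j) T"
proof -
  define R where "R = (\<Sum>k\<in>{j..<m}. scale (1 / fact k) ((n ^^ (k - j)) (g (w + int k))))"
  have RU: "R \<in> U 0"
    unfolding R_def
  proof (intro module.subspace_sum[OF module_axioms subU] subspace_scale[OF subU])
    fix k assume k: "k \<in> {j..<m}"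
    have "w + int k - int (k - j) = 0" using k w by (simp add: of_nat_diff)
    then show "(n ^^ (k - j)) (g (w + int k)) \<in> U 0" using nkU[OF g(1)] by metis
  qed
  have "ex g w = (\<Sum>k\<in>{j..<m}. scale (1 / fact k) ((n ^^ k) (g (w + int k))))"
    unfolding ex_def by (rule sum.mono_neutral_right) (use w g(2) in auto)
  also have "\<dots> = (n ^^ j) R"
    unfolding R_def nk_sum nk_scale
  proof (rule sum.cong[OF refl])
    fix k assume k: "k \<in> {j..<m}"
    then have "k = j + (k - j)" by simp
    then show "scale (1 / fact k) ((n ^^ k) (g (w + int k))) =
        scale (1 / fact k) ((n ^^ j) ((n ^^ (k - j)) (g (w + int k))))"
      by (metis comp_apply funpow_add)
  qed
  finally have e: "(n ^^ j) R + scale (of_nat j / fact j) ((n ^^ (j - 1)) X) = 0"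
  proof -
    assume a: "ex g w = (n ^^ j) R"
    have "nat (- 1 - w) = j - 1" "nat (- 1 - w) + 1 = j" using w by auto
    then show ?thesis using eq[of w] a by simp
  qed
  define T where "T = scale (- (fact j / of_nat j)) R"
  have TU: "T \<in> U 0" unfolding T_def using RU by (rule subspace_scale[OF subU])
  have e': "scale (of_nat j / fact j) ((n ^^ (j - 1)) X) = - (n ^^ j) R" using e by (simp add: add_eq_0_iff)
  have "(n ^^ (j - 1)) X = scale (fact j / of_nat j) (scale (of_nat j / fact j) ((n ^^ (j - 1)) X))"
    using w by simp
  also have "\<dots> = (n ^^ j) T" unfolding e' T_def nk_scale by simp
  finally have XT: "(n ^^ (j - 1)) X = (n ^^ j) T" .
  let ?u = "\<lambda>a. g a + scale (of_nat j) (if a = 0 then T else 0)"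
  have u: "?u a = 0" for a
  proof (rule opp0[of ?u 0])
    show "?u a \<in> U a" for a
      using g(1) TU subspace_0[OF subU] by (intro subspace_add[OF subU] subspace_scale[OF subU]) auto
    show "?u a = 0" if "a < 0" for a using that g(2) by simp
    fix \<alpha> assume a: "\<alpha> \<le> w - 0"
    define l where "l = nat (- \<alpha>) - j"
    have l: "nat (- \<alpha>) = l + j" "nat (- 1 - \<alpha>) = l + (j - 1)" "nat (- 1 - \<alpha>) + 1 = nat (- \<alpha>)"
      using a w by (auto simp: l_def)
    have "(n ^^ nat (- \<alpha>)) T = (n ^^ nat (- 1 - \<alpha>)) X"
      unfolding l(1,2) funpow_add comp_apply XT ..
    then have "ex ?u \<alpha> = ex g \<alpha> + scale (of_nat j / fact (nat (- 1 - \<alpha>) + 1)) ((n ^^ nat (- 1 - \<alpha>)) X)"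
      unfolding ex_add ex_scale ex_single[OF TU] l(3) using a w by simp
    then show "ex ?u \<alpha> = 0" using eq a by simp
  qed
  show thesis
  proof (rule that[OF TU _ _ XT])
    show "g 0 = scale (- of_nat j) T" using u[of 0] by (simp add: add_eq_0_iff)
    show "g a = 0" if "a \<noteq> 0" for a using u[of a] that by simp
  qed
qed

end


subsection \<open>Nilpotent orbits in a trigraded space\<close>

text \<open>
  The index \<open>(k, p, q)\<close> stands for the weight \<open>k\<close> with respect to a grading of \<open>W\<close> and the Hodge
  type \<open>(p, q)\<close> of the limit; \<open>N0\<close> is the part of \<open>N\<close> of weight \<open>0\<close>.
\<close>

locale frame = graded scale B K \<pi>
  for scale :: "complex \<Rightarrow> 'v::ab_group_add \<Rightarrow> 'v" (infixr "*\<^sub>C" 75) and B :: "'v set"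
    and K :: "(int \<times> int \<times> int) set" and \<pi> :: "int \<times> int \<times> int \<Rightarrow> 'v \<Rightarrow> 'v" +
  fixes W F :: "int \<Rightarrow> 'v set" and N :: "'v \<Rightarrow> 'v" and m :: nat
  assumes W_iff: "v \<in> W k \<longleftrightarrow> (\<forall>i. fst i > k \<longrightarrow> \<pi> i v = 0)"
    and F_iff: "v \<in> F p \<longleftrightarrow> (\<forall>i. fst (snd i) < p \<longrightarrow> \<pi> i v = 0)"
    and Fb_iff: "v \<in> vconj ` F q \<longleftrightarrow> (\<forall>i. snd (snd i) < q \<longrightarrow> \<pi> i v = 0)"
    and nilN: "(N ^^ m) v = 0"
    and suppN: "supp (insert (0, - 1, - 1) {(l, a, b). l \<le> - 1 \<and> a \<ge> - 1 \<and> b \<ge> - 1}) N"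
    and big: "i \<in> K \<Longrightarrow> j \<in> K \<Longrightarrow> \<bar>fst (snd i) - fst (snd j)\<bar> < int m"
begin

definition N0 :: "'v \<Rightarrow> 'v" where "N0 = cmp (0, - 1, - 1) N"

definition Y :: "'v \<Rightarrow> 'v" where "Y v = (\<Sum>i\<in>K. of_int (fst i) *\<^sub>C \<pi> i v)"

definition E :: "int \<Rightarrow> 'v set" where "E k = {v. \<forall>i. fst i \<noteq> k \<longrightarrow> \<pi> i v = 0}"

definition pr :: "int \<Rightarrow> 'v \<Rightarrow> 'v" where "pr k v = (\<Sum>i\<in>{i\<in>K. fst i = k}. \<pi> i v)"

definition ex0 :: "complex \<Rightarrow> 'v \<Rightarrow> 'v" where "ex0 s = nexp m (\<lambda>v. s *\<^sub>C N0 v)"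

definition exN :: "complex \<Rightarrow> 'v \<Rightarrow> 'v" where "exN s = nexp m (\<lambda>v. s *\<^sub>C N v)"

definition Fb :: "int \<Rightarrow> 'v set" where "Fb q = vconj ` F q"

lemma Fb_iff': "v \<in> Fb q \<longleftrightarrow> (\<forall>i. snd (snd i) < q \<longrightarrow> \<pi> i v = 0)"
  unfolding Fb_def by (rule Fb_iff)

lemma endoN: "endomorphism N" using suppN by (rule supp_endo)

lemma supp0: "supp {(0, - 1, - 1)} N0" unfolding N0_def by (rule supp_cmp[OF endoN])

lemma endo0: "endomorphism N0" using supp0 by (rule supp_endo)

lemma sub_pi: "subspace {v. \<forall>i. P i \<longrightarrow> \<pi> i v = 0}"
  by (auto simp: subspace_def pi_add pi_scale)

lemma subW: "subspace (W k)" and subF: "subspace (F p)" and subFb: "subspace (Fb q)"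
  and subE: "subspace (E k)"
proof -
  have "W k = {v. \<forall>i. fst i > k \<longrightarrow> \<pi> i v = 0}" "F p = {v. \<forall>i. fst (snd i) < p \<longrightarrow> \<pi> i v = 0}"
    "Fb q = {v. \<forall>i. snd (snd i) < q \<longrightarrow> \<pi> i v = 0}" using W_iff F_iff Fb_iff' by auto
  then show "subspace (W k)" "subspace (F p)" "subspace (Fb q)" "subspace (E k)"
    unfolding E_def by (simp_all only: sub_pi)
qed

lemma monoW: "k \<le> l \<Longrightarrow> W k \<subseteq> W l" and antiF: "p \<le> q \<Longrightarrow> F q \<subseteq> F p" and antiFb: "p \<le> q \<Longrightarrow> Fb q \<subseteq> Fb p"
  by (auto simp: W_iff F_iff Fb_iff')

lemma E_W: "E k \<subseteq> W k" by (auto simp: E_def W_iff)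

lemma pi_E: "\<pi> i v \<in> E (fst i)" and pi_F: "\<pi> i v \<in> F (fst (snd i))" and pi_Fb: "\<pi> i v \<in> Fb (snd (snd i))"
  by (auto simp: E_def F_iff Fb_iff' pi_pi)

lemma E_W_zero: "v \<in> E k \<Longrightarrow> v \<in> W (k - 1) \<Longrightarrow> v = 0"
  by (rule pi_eqI) (auto simp: E_def W_iff, metis zle_diff1_eq not_less less_irrefl linorder_neqE)

lemma pi_pr: "\<pi> i (pr k v) = (if fst i = k then \<pi> i v else 0)"
proof -
  have "\<pi> i (pr k v) = (\<Sum>j\<in>{j\<in>K. fst j = k}. if j = i then \<pi> i v else 0)"
    unfolding pr_def pi_sum by (rule sum.cong) (auto simp: pi_pi)
  then show ?thesis using finK pi_outside[of i v] by auto
qed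

lemma endo_pr: "endomorphism (pr k)"
  unfolding pr_def[abs_def] by (intro endo_sum_fun endo_pi)

lemma pr_E: "pr k v \<in> E k" by (auto simp: E_def pi_pr)

lemma pr_of_E: "v \<in> E l \<Longrightarrow> pr k v = (if k = l then v else 0)"
  by (rule pi_eqI) (auto simp: pi_pr E_def)

lemma pr_F: "v \<in> F p \<Longrightarrow> pr k v \<in> F p" and pr_Fb: "v \<in> Fb q \<Longrightarrow> pr k v \<in> Fb q"
  by (auto simp: F_iff Fb_iff' pi_pr)

lemma pr_W: "v \<in> W (k - 1) \<Longrightarrow> pr k v = 0"
  by (rule pi_eqI) (auto simp: pi_pr W_iff)

lemma pr_total: "(\<Sum>k\<in>fst ` K. pr k v) = v"
proof (rule pi_eqI)
  fix i
  have "\<pi> i (\<Sum>k\<in>fst ` K. pr k v) = (\<Sum>k\<in>fst ` K. if k = fst i then \<pi> i v else 0)"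
    unfolding pi_sum pi_pr by (rule sum.cong) auto
  then show "\<pi> i (\<Sum>k\<in>fst ` K. pr k v) = \<pi> i v"
    using finK pi_outside[of i v] by auto
qed

lemma E_total: "v \<in> E k \<Longrightarrow> v = (\<Sum>i\<in>{i\<in>K. fst i = k}. \<pi> i v)"
  using pr_of_E[of v k k] unfolding pr_def by simp

lemma N_W: "N ` W k \<subseteq> W k" and N0_E: "N0 ` E k \<subseteq> E k" and N0_W: "N0 ` W k \<subseteq> W k"
  and N_N0: "v \<in> W k \<Longrightarrow> N v - N0 v \<in> W (k - 1)"
proof -
  have sum_form: "\<pi> j (X v) = (\<Sum>i\<in>K. \<pi> j (X (\<pi> i v)))" if X: "endomorphism X" for X j v
  proof -
    have "X v = X (\<Sum>i\<in>K. \<pi> i v)" unfolding pi_total ..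
    then show ?thesis unfolding endo_sum[OF X] by (simp only: pi_sum)
  qed
  have *: "X v \<in> W (k + d)" if X: "supp \<Gamma> X" and G: "\<And>\<delta>. \<delta> \<in> \<Gamma> \<Longrightarrow> fst \<delta> \<le> d" and v: "v \<in> W k" for X \<Gamma> d v k
    unfolding W_iff
  proof (intro allI impI)
    fix j :: "int \<times> int \<times> int" assume j: "fst j > k + d"
    show "\<pi> j (X v) = 0"
    proof (subst sum_form[OF supp_endo[OF X]], rule sum.neutral, rule ballI)
      fix i assume "i \<in> K"
      show "\<pi> j (X (\<pi> i v)) = 0"
      proof (cases "fst i > k")
        case True
        then have "\<pi> i v = 0" using v W_iff by blast
        then show ?thesis using endo_zero[OF supp_endo[OF X]] by simp
      next
        case False
        then have "j - i \<notin> \<Gamma>" using G[of "j - i"] j by auto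
        then show ?thesis by (rule suppD[OF X])
      qed
    qed
  qed
  have "N v \<in> W (k + 0)" if "v \<in> W k" for v k by (rule *[OF suppN _ that]) auto
  then show "N ` W k \<subseteq> W k" for k by auto
  have "N0 v \<in> W (k + 0)" if "v \<in> W k" for v k by (rule *[OF supp0 _ that]) auto
  then show "N0 ` W k \<subseteq> W k" for k by auto
  show "N0 ` E k \<subseteq> E k"
  proof
    fix y assume "y \<in> N0 ` E k"
    then obtain v where v: "v \<in> E k" "y = N0 v" by blast
    have "\<pi> j (N0 v) = 0" if "fst j \<noteq> k" for j
    proof (subst sum_form[OF endo0], rule sum.neutral, rule ballI)
      fix i assume "i \<in> K"
      show "\<pi> j (N0 (\<pi> i v)) = 0"
      proof (cases "fst i = k")
        case True
        then have "j - i \<notin> {(0, - 1, - 1)}" using that by (auto simp: prod_eq_iff)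
        then show ?thesis by (rule suppD[OF supp0])
      next
        case False
        then have "\<pi> i v = 0" using v unfolding E_def by blast
        then show ?thesis using endo_zero[OF endo0] by simp
      qed
    qed
    then show "y \<in> E k" using v by (auto simp: E_def)
  qed
  have "supp {\<delta>. fst \<delta> \<le> - 1} (\<lambda>v. N v - N0 v)"
    unfolding supp_iff_cmp[OF endo_minus[OF endoN endo0]]
  proof (intro allI impI ext)
    fix \<delta> :: "int \<times> int \<times> int" and v assume d: "\<delta> \<notin> {\<delta>. fst \<delta> \<le> - 1}"
    show "cmp \<delta> (\<lambda>v. N v - N0 v) v = 0"
    proof (cases "\<delta> = (0, - 1, - 1)")
      case False
      then have "\<delta> \<notin> insert (0, - 1, - 1) {(l, a, b). l \<le> - 1 \<and> a \<ge> - 1 \<and> b \<ge> - 1}"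
        using d by (cases \<delta>) auto
      from cmp_zero_of_supp[OF suppN this] False show ?thesis
        unfolding cmp_diff cmp_eq_hom[OF supp0] by simp
    next
      case True
      then show ?thesis unfolding cmp_diff cmp_eq_hom[OF supp0] by (simp add: N0_def)
    qed
  qed
  note s = this
  have "N v - N0 v \<in> W (k + - 1)" if "v \<in> W k" for v k by (rule *[OF s _ that]) auto
  then show "v \<in> W k \<Longrightarrow> N v - N0 v \<in> W (k - 1)" by simp
qed

text \<open>Each factor \<open>N0\<close> lowers the first Hodge index by one, and by
  \<open>big\<close> two such indices differ by less than \<open>m\<close>.\<close>

lemma nil0: "(N0 ^^ m) v = 0"
proof -
  have s: "supp {(0, - int n, - int n)} (N0 ^^ n)" for n
  proof (induction n)
    case 0
    then show ?case by (auto simp: supp_def endo_id pi_pi zero_prod_def)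
  next
    case (Suc n)
    have "supp {(0, - int (Suc n), - int (Suc n))} (\<lambda>v. N0 ((N0 ^^ n) v))"
      by (rule supp_comp[OF supp0 Suc]) auto
    then show ?case by (simp add: comp_def)
  qed
  have "cmp (0, - int m, - int m) (N0 ^^ m) v = 0"
  proof (rule cmp_outside[OF endo_funpow[OF endo0]])
    show "(0, - int m, - int m) \<notin> degs"
    proof
      assume "(0, - int m, - int m) \<in> degs"
      then obtain i j where "i \<in> K" "j \<in> K" "fst (snd i) - fst (snd j) = - int m"
        unfolding degs_def by (auto simp: prod_eq_iff)
      then show False using big[of i j] by simp
    qed
  qed
  then show ?thesis using cmp_eq_hom[OF s[of m], of "(0, - int m, - int m)"] by simp
qed

lemma ex0_add: "ex0 s (ex0 t v) = ex0 (s + t) v" unfolding ex0_def by (rule nexp_add[OF endo0 nil0])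

lemma m_pos: "K \<noteq> {} \<Longrightarrow> m > 0" using big by fastforce

lemma v_zero: "K = {} \<Longrightarrow> (v::'v) = 0"
  using pi_total[of v] by simp

lemma ex0_inverse: "ex0 s (ex0 (- s) v) = v" and ex0_inverse': "ex0 (- s) (ex0 s v) = v"
proof -
  have "nexp m (\<lambda>v. 0 *\<^sub>C X v) v = v" for X v
    using nexp_zero[of m X] m_pos v_zero by (cases "K = {}") metis+
  then have "ex0 0 v = v" for v unfolding ex0_def by blast
  then show "ex0 s (ex0 (- s) v) = v" "ex0 (- s) (ex0 s v) = v" unfolding ex0_add by auto
qed

lemma endo_ex0: "endomorphism (ex0 s)" and endo_exN: "endomorphism (exN s)"
  unfolding ex0_def exN_def by (intro endo_nexp endo_scaled endo0 endoN)+

lemma ex0_E: "v \<in> E k \<Longrightarrow> ex0 s v \<in> E k"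
  unfolding ex0_def using nexp_subspace[OF subE N0_E] by blast

text \<open>\<open>N\<close> and \<open>N0\<close> agree on \<open>Gr k\<close>, hence so do their
  exponentials. This allows opposedness to be restated inside the eigenspaces \<open>E k\<close>, on
  which \<open>ex0\<close> acts.\<close>

lemma exN_ex0: "v \<in> W k \<Longrightarrow> exN s v - ex0 s v \<in> W (k - 1)"
proof -
  assume v: "v \<in> W k"
  have "((\<lambda>v. s *\<^sub>C N v) ^^ n) v - ((\<lambda>v. s *\<^sub>C N0 v) ^^ n) v \<in> W (k - 1)" for n
    unfolding nilpotent_scaled[OF endoN] nilpotent_scaled[OF endo0] scale_right_diff_distrib[symmetric]
  proof (intro subspace_scale[OF subW])
    show "(N ^^ n) v - (N0 ^^ n) v \<in> W (k - 1)"
    proof (induction n)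
      case (Suc n)
      have "(N0 ^^ n) v \<in> W k" using v N0_W by (induction n) auto
      then have "N ((N ^^ n) v - (N0 ^^ n) v) + (N ((N0 ^^ n) v) - N0 ((N0 ^^ n) v)) \<in> W (k - 1)"
        using Suc N_W N_N0 by (intro subspace_add[OF subW]) auto
      then show ?case by (simp add: endo_diff[OF endoN])
    qed (simp add: subspace_0[OF subW])
  qed
  then have "(\<Sum>n<m. (1 / fact n) *\<^sub>C (((\<lambda>v. s *\<^sub>C N v) ^^ n) v - ((\<lambda>v. s *\<^sub>C N0 v) ^^ n) v)) \<in> W (k - 1)"
    by (intro module.subspace_sum[OF module_axioms subW] subspace_scale[OF subW])
  then show ?thesis by (simp add: ex0_def exN_def nexp_def scale_right_diff_distrib sum_subtractf)
qed

lemma pr_ex0: "pr k (ex0 s v) = ex0 s (pr k v)"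
proof -
  have "pr k (ex0 s u) = ex0 s (pr k u)" if "u \<in> E l" for u l
    using pr_of_E[OF that] pr_of_E[OF ex0_E[OF that]] endo_zero[OF endo_ex0] by simp
  from this[OF pi_E] show ?thesis
    by (rule endo_eqI[OF endo_comp[OF endo_pr endo_ex0] endo_comp[OF endo_ex0 endo_pr]])
qed

text \<open>\<open>opposed s\<close>: the filtrations \<open>F\<close> and \<open>exp(-s N) vconj F\<close> are opposed on each \<open>Gr\<^sup>W\<^sub>k\<close>.\<close>

definition opposed :: "complex \<Rightarrow> bool" where
  "opposed s \<longleftrightarrow>
    (\<forall>k p q x y. p + q = k + 1 \<longrightarrow> x \<in> F p \<longrightarrow> x \<in> W k \<longrightarrow> y \<in> Fb q \<longrightarrow> y \<in> W k \<longrightarrow>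
      x - exN (- s) y \<in> W (k - 1) \<longrightarrow> x \<in> W (k - 1)) \<and>
    (\<forall>k p q v. p + q = k + 1 \<longrightarrow> v \<in> W k \<longrightarrow>
      (\<exists>x y. x \<in> F p \<and> x \<in> W k \<and> y \<in> Fb q \<and> y \<in> W k \<and> v - x - exN (- s) y \<in> W (k - 1)))"

context
  fixes s assumes s: "opposed s"
begin

lemma opposed_E_zero:
  assumes v: "v \<in> E k" "v \<in> F p" "ex0 s v \<in> Fb q" and pq: "p + q \<ge> k + 1"
  shows "v = 0"
proof -
  let ?y = "ex0 s v"
  have y: "?y \<in> W k" using ex0_E[OF v(1)] E_W by blast
  have "v - exN (- s) ?y = - (exN (- s) ?y - ex0 (- s) ?y)" unfolding ex0_inverse' by simp
  then have d: "v - exN (- s) ?y \<in> W (k - 1)"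
    by (elim ssubst) (rule subspace_neg[OF subW exN_ex0[OF y]])
  have q: "?y \<in> Fb (k + 1 - p)" using v(3) antiFb[of "k + 1 - p" q] pq by auto
  have "v \<in> W (k - 1)"
    using s[unfolded opposed_def, THEN conjunct1, rule_format, of p "k + 1 - p" k v ?y] v q d y E_W by auto
  then show ?thesis using v(1) E_W_zero by blast
qed

lemma opposed_E_sum:
  assumes v: "v \<in> E k" and pq: "p + q = k + 1"
  obtains a b where "a \<in> E k" "a \<in> F p" "b \<in> E k" "ex0 s b \<in> Fb q" "v = a + b"
proof -
  obtain x y where xy: "x \<in> F p" "y \<in> Fb q" "y \<in> W k" "v - x - exN (- s) y \<in> W (k - 1)"
    using s pq v E_W unfolding opposed_def by blast
  have "pr k (exN (- s) y - ex0 (- s) y) = 0" using exN_ex0[OF xy(3)] by (rule pr_W)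
  then have 1: "pr k (exN (- s) y) = ex0 (- s) (pr k y)"
    by (simp add: endo_diff[OF endo_pr] pr_ex0)
  have "pr k (v - x - exN (- s) y) = 0" using xy(4) by (rule pr_W)
  then have "pr k v - pr k x - pr k (exN (- s) y) = 0" unfolding endo_diff[OF endo_pr] .
  then have "v - (pr k x + ex0 (- s) (pr k y)) = 0"
    using pr_of_E[OF v, of k] unfolding 1 by (simp add: diff_diff_eq)
  then have "v = pr k x + ex0 (- s) (pr k y)" by (rule eq_iff_diff_eq_0[THEN iffD2])
  moreover have "ex0 s (ex0 (- s) (pr k y)) \<in> Fb q" unfolding ex0_inverse using pr_Fb xy by blast
  ultimately show thesis using that pr_E ex0_E pr_F xy by blast
qed

text \<open>The part of type \<open>(p, k - p)\<close> of the Hodge structure that the orbit induces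
  on \<open>Gr k\<close>, represented in \<open>E k\<close> and transported so that its Hodge
  filtration is \<open>F\<close>.\<close>

definition H :: "int \<times> int \<Rightarrow> 'v set" where
  "H i = {v \<in> E (fst i). v \<in> F (snd i) \<and> ex0 s v \<in> Fb (fst i - snd i)}"

lemma subH: "subspace (H i)"
proof -
  have "H i = E (fst i) \<inter> F (snd i) \<inter> {v. ex0 s v \<in> Fb (fst i - snd i)}" by (auto simp: H_def)
  then show ?thesis
    using subspace_inter[OF subspace_inter[OF subE subF] endo_subspace_vimage[OF endo_ex0 subFb]] by simp
qed

lemma F_low: "\<exists>p0. F p0 = UNIV" and F_high: "\<exists>p0. F p0 = {0}" and Fb_high: "\<exists>q0. Fb q0 = {0}"
proof -
  define a where "a = Min (insert 0 ((fst \<circ> snd) ` K))"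
  define b where "b = Max (insert 0 ((fst \<circ> snd) ` K))"
  define c where "c = Max (insert 0 ((snd \<circ> snd) ` K))"
  have abc: "a \<le> fst (snd i)" "fst (snd i) \<le> b" "snd (snd i) \<le> c" if "i \<in> K" for i
    using finK that unfolding a_def b_def c_def by (auto intro!: Min_le Max_ge)
  have *: "fst (snd i) < a \<Longrightarrow> \<pi> i v = 0" "\<not> fst (snd i) < b + 1 \<Longrightarrow> \<pi> i v = 0"
    "\<not> snd (snd i) < c + 1 \<Longrightarrow> \<pi> i v = 0" for i v
    by (atomize (full), cases "i \<in> K") (use abc[of i] pi_outside[of i v] in auto)
  show "\<exists>p0. F p0 = UNIV" using * F_iff[of _ a] by (intro exI[of _ a]) auto
  have "v = 0" if "v \<in> F (b + 1)" for v
  proof (rule pi_eqI)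
    fix i show "\<pi> i v = \<pi> i 0" using that *(2)[of i v] unfolding F_iff pi_zero by blast
  qed
  then show "\<exists>p0. F p0 = {0}" using subspace_0[OF subF] by blast
  have "v = 0" if "v \<in> Fb (c + 1)" for v
  proof (rule pi_eqI)
    fix i show "\<pi> i v = \<pi> i 0" using that *(3)[of i v] unfolding Fb_iff' pi_zero by blast
  qed
  then show "\<exists>q0. Fb q0 = {0}" using subspace_0[OF subFb] by blast
qed

lemma F_E_span: "v \<in> E k \<Longrightarrow> v \<in> F p \<Longrightarrow> v \<in> span (\<Union>p'\<in>{p..}. H (k, p'))"
proof -
  obtain p0 where p0: "F p0 = {0}" using F_high by blast
  show "v \<in> E k \<Longrightarrow> v \<in> F p \<Longrightarrow> v \<in> span (\<Union>p'\<in>{p..}. H (k, p'))"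
  proof (induction "nat (p0 - p)" arbitrary: p v)
    case 0
    then have "v = 0" using antiF[of p0 p] p0 by auto
    then show ?case by (simp add: span_zero)
  next
    case (Suc n)
    obtain a b where ab: "a \<in> E k" "a \<in> F (p + 1)" "b \<in> E k" "ex0 s b \<in> Fb (k - p)" "v = a + b"
      by (rule opposed_E_sum[OF Suc.prems(1), of "p + 1" "k - p"]) auto
    have "a \<in> F p" using ab(2) antiF[of p "p + 1"] by auto
    then have "v - a \<in> F p" by (rule subspace_diff[OF subF Suc.prems(2)])
    then have "b \<in> F p" unfolding ab(5) by simp
    then have "b \<in> H (k, p)" using ab by (simp add: H_def)
    then have "b \<in> span (\<Union>p'\<in>{p..}. H (k, p'))" by (auto intro: span_base)
    moreover have "a \<in> span (\<Union>p'\<in>{p+1..}. H (k, p'))" using Suc.hyps ab by auto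
    then have "a \<in> span (\<Union>p'\<in>{p..}. H (k, p'))"
      by (rule subsetD[OF span_mono, rotated]) (intro UN_mono, auto)
    ultimately show ?case unfolding ab(5) by (intro span_add)
  qed
qed

lemma Fb_E_span: "v \<in> E k \<Longrightarrow> ex0 s v \<in> Fb q \<Longrightarrow> v \<in> span (\<Union>p'\<in>{..k-q}. H (k, p'))"
proof -
  obtain q0 where q0: "Fb q0 = {0}" using Fb_high by blast
  show "v \<in> E k \<Longrightarrow> ex0 s v \<in> Fb q \<Longrightarrow> v \<in> span (\<Union>p'\<in>{..k-q}. H (k, p'))"
  proof (induction "nat (q0 - q)" arbitrary: q v)
    case 0
    then have "ex0 s v = 0" using antiFb[of q0 q] q0 by auto
    then have "v = 0" using ex0_inverse'[of s v] endo_zero[OF endo_ex0] by simp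
    then show ?case by (simp add: span_zero)
  next
    case (Suc n)
    obtain a b where ab: "a \<in> E k" "a \<in> F (k - q)" "b \<in> E k" "ex0 s b \<in> Fb (q + 1)" "v = a + b"
      by (rule opposed_E_sum[OF Suc.prems(1), of "k - q" "q + 1"]) auto
    have "ex0 s a = ex0 s v - ex0 s b" using ab endo_add[OF endo_ex0] by simp
    then have "ex0 s a \<in> Fb q" using Suc.prems ab antiFb[of q "q + 1"] subspace_diff[OF subFb] by auto
    then have "a \<in> H (k, k - q)" using ab by (simp add: H_def)
    then have "a \<in> span (\<Union>p'\<in>{..k-q}. H (k, p'))" by (auto intro: span_base)
    moreover have "b \<in> span (\<Union>p'\<in>{..k-(q+1)}. H (k, p'))" using Suc.hyps ab by auto
    then have "b \<in> span (\<Union>p'\<in>{..k-q}. H (k, p'))"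
      by (rule subsetD[OF span_mono, rotated]) (intro UN_mono, auto)
    ultimately show ?case unfolding ab(5) by (intro span_add)
  qed
qed

lemma H_span: "span (\<Union>i. H i) = UNIV"
proof -
  obtain p0 where p0: "F p0 = UNIV" using F_low by blast
  have "pr k v \<in> span (\<Union>i. H i)" for k v
    using F_E_span[OF pr_E, of k v p0] p0 by (auto intro: subsetD[OF span_mono, rotated])
  then have "(\<Sum>k\<in>fst ` K. pr k v) \<in> span (\<Union>i. H i)" for v by (rule span_sum)
  then show ?thesis unfolding pr_total by auto
qed

lemma H_indep:
  assumes P: "finite P" and u: "\<And>i. i \<in> P \<Longrightarrow> u i \<in> H i" and z: "(\<Sum>i\<in>P. u i) = 0"
  shows "\<forall>i\<in>P. u i = 0"
proof
  fix i0 :: "int \<times> int" assume i0: "i0 \<in> P"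
  define k where "k = fst i0"
  have one: "\<forall>p\<in>T. w p = 0" if "finite T" "\<And>p. p \<in> T \<Longrightarrow> w p \<in> H (k, p)" "(\<Sum>p\<in>T. w p) = 0" for T w
    using that
  proof (induction T rule: finite_linorder_min_induct)
    case (insert p T)
    have T: "p \<notin> T" using insert.hyps by auto
    have w: "w p \<in> H (k, p)" using insert.prems by auto
    have "w p + (\<Sum>p\<in>T. w p) = 0" using insert T by simp
    then have eq: "w p = - (\<Sum>p\<in>T. w p)" by (simp add: eq_neg_iff_add_eq_0)
    have "(\<Sum>p\<in>T. w p) \<in> F (p + 1)"
    proof (rule module.subspace_sum[OF module_axioms subF])
      fix p' assume p': "p' \<in> T"
      then have "p + 1 \<le> p'" using insert.hyps(2) by force
      then show "w p' \<in> F (p + 1)" using insert.prems(1)[of p'] p' antiF[of "p + 1" p'] by (auto simp: H_def)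
    qed
    then have "w p \<in> F (p + 1)" unfolding eq by (rule subspace_neg[OF subF])
    then have "w p = 0" using w by (intro opposed_E_zero[of _ k "p + 1" "k - p"]) (auto simp: H_def)
    moreover from this have "(\<Sum>p\<in>T. w p) = 0" using eq by simp
    then have "\<forall>p\<in>T. w p = 0" using insert.IH insert.prems(1) by blast
    ultimately show ?case by simp
  qed simp
  define T where "T = snd ` {i\<in>P. fst i = k}"
  have inj: "inj_on snd {i\<in>P. fst i = k}" by (auto simp: inj_on_def prod_eq_iff)
  have "(\<Sum>p\<in>T. u (k, p)) = (\<Sum>i\<in>{i\<in>P. fst i = k}. u i)"
    unfolding T_def sum.reindex[OF inj] by (rule sum.cong) auto
  also have "\<dots> = (\<Sum>i\<in>P. if fst i = k then u i else 0)"
    by (rule sum.inter_filter[OF P])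
  also have "\<dots> = (\<Sum>i\<in>P. pr k (u i))"
  proof (rule sum.cong[OF refl])
    fix i assume "i \<in> P"
    then have "u i \<in> E (fst i)" using u by (auto simp: H_def)
    from pr_of_E[OF this, of k] show "(if fst i = k then u i else 0) = pr k (u i)" by auto
  qed
  also have "\<dots> = 0" using z endo_sum[OF endo_pr, of k u P] endo_zero[OF endo_pr] by simp
  finally have "\<forall>p\<in>T. u (k, p) = 0" using P u by (intro one) (auto simp: T_def)
  moreover have "snd i0 \<in> T" using i0 by (auto simp: T_def k_def)
  ultimately show "u i0 = 0" by (auto simp: k_def)
qed

text \<open>Endomorphisms of weight \<open>-j\<close> inherit a Hodge structure of weight
  \<open>-j\<close>, and \<open>p + (1 - j - p)\<close> is one more than that. Concretely,
  \<open>A\<close> maps each summand \<open>H (k, r)\<close> into an intersection that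
  \<open>opposed_E_zero\<close> shows to be zero.\<close>

lemma opposed_End_zero:
  assumes A: "supp {\<delta>. fst \<delta> = - j \<and> fst (snd \<delta>) \<ge> p} A"
    and C: "supp {\<delta>. snd (snd \<delta>) \<ge> 1 - j - p} (\<lambda>v. ex0 s (A (ex0 (- s) v)))"
  shows "A v = 0"
proof -
  note eA = supp_endo[OF A]
  have AE: "A v \<in> E (k - j)" "v \<in> F r \<Longrightarrow> A v \<in> F (r + p)" if v: "v \<in> E k" for v k r
  proof -
    have vs: "A v = (\<Sum>i\<in>{i\<in>K. fst i = k}. A (\<pi> i v))"
      using arg_cong[OF E_total[OF v], of A] unfolding endo_sum[OF eA] .
    show "A v \<in> E (k - j)" unfolding vs
    proof (rule module.subspace_sum[OF module_axioms subE])
      fix i assume i: "i \<in> {i\<in>K. fst i = k}"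
      show "A (\<pi> i v) \<in> E (k - j)" unfolding E_def using i by (auto intro!: suppD[OF A])
    qed
    show "A v \<in> F (r + p)" if vF: "v \<in> F r" unfolding vs
    proof (rule module.subspace_sum[OF module_axioms subF])
      fix i assume i: "i \<in> {i\<in>K. fst i = k}"
      show "A (\<pi> i v) \<in> F (r + p)"
      proof (cases "fst (snd i) < r")
        case True
        then have "\<pi> i v = 0" using vF F_iff by blast
        then show ?thesis using endo_zero[OF eA] subspace_0[OF subF] by simp
      next
        case False
        then show ?thesis unfolding F_iff by (auto intro!: suppD[OF A])
      qed
    qed
  qed
  let ?C = "\<lambda>v. ex0 s (A (ex0 (- s) v))"
  have CF: "?C v \<in> Fb (q + (1 - j - p))" if v: "v \<in> Fb q" for v q
  proof -
    have vs: "?C v = (\<Sum>i\<in>K. ?C (\<pi> i v))"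
      using arg_cong[OF pi_total[of v], of ?C] unfolding endo_sum[OF supp_endo[OF C]] by simp
    show ?thesis unfolding vs
    proof (rule module.subspace_sum[OF module_axioms subFb])
      fix i assume i: "i \<in> K"
      show "?C (\<pi> i v) \<in> Fb (q + (1 - j - p))"
      proof (cases "snd (snd i) < q")
        case True
        then have "\<pi> i v = 0" using v Fb_iff' by blast
        then show ?thesis using endo_zero[OF supp_endo[OF C]] subspace_0[OF subFb] by simp
      next
        case False
        then show ?thesis unfolding Fb_iff' by (auto intro!: suppD[OF C])
      qed
    qed
  qed
  have "A v = 0" if "v \<in> H i" for v i
  proof -
    obtain k r where i: "i = (k, r)" by (cases i)
    have v: "v \<in> E k" "v \<in> F r" "ex0 s v \<in> Fb (k - r)" using that i by (auto simp: H_def)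
    have "ex0 s (A v) = ?C (ex0 s v)" by (simp add: ex0_inverse')
    then have "ex0 s (A v) \<in> Fb (k - r + (1 - j - p))" using CF[OF v(3)] by simp
    then show ?thesis using AE[OF v(1)] v(2) by (intro opposed_E_zero[of _ "k - j" "r + p"]) auto
  qed
  then have z: "A v = 0" if "v \<in> (\<Union>i. H i)" for v using that by blast
  show ?thesis
    by (rule endo_eq_on_span[OF eA endo_const_zero, of "\<Union>i. H i", OF z]) (simp_all only: H_span UNIV_I)
qed

text \<open>The other half of opposedness for endomorphisms, with the indices \<open>0\<close> and
  \<open>1 - j\<close>. For \<open>A\<close>, the transport of \<open>C\<close>, the part
  \<open>G\<close> consists of the entries between summands \<open>H\<close> that do not lower
  \<open>p\<close>.\<close>

lemma opposed_End_sum: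
  assumes C: "supp {\<delta>. fst \<delta> = - j} C"
  obtains G where "supp {\<delta>. fst \<delta> = - j \<and> fst (snd \<delta>) \<ge> 0} G"
    "supp {\<delta>. snd (snd \<delta>) \<ge> 1 - j} (\<lambda>v. ex0 s (G (ex0 (- s) v)) - C v)"
proof -
  obtain K' \<eta> where P: "projections scale B K' \<eta>" "\<And>i v. \<eta> i v \<in> H i" "\<And>i v. v \<in> H i \<Longrightarrow> \<eta> i v = v"
  proof (rule direct_family_projections[of H, OF subH H_span])
    show "\<forall>i\<in>P. u i = 0" if "finite P" "\<And>i. i \<in> P \<Longrightarrow> u i \<in> H i" "(\<Sum>i\<in>P. u i) = 0" for P u
      using H_indep that by blast
  qed blast
  interpret P: projections scale B K' \<eta> by (rule P(1))
  note eC = supp_endo[OF C]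
  define A where "A v = ex0 (- s) (C (ex0 s v))" for v
  have eA: "endomorphism A"
    unfolding A_def[abs_def] by (rule endo_comp[OF endo_ex0 endo_comp[OF eC endo_ex0]])
  have AE: "A v \<in> E (k - j)" if v: "v \<in> E k" for v k
  proof -
    let ?v = "ex0 s v"
    have vs: "C ?v = (\<Sum>i\<in>{i\<in>K. fst i = k}. C (\<pi> i ?v))"
      using arg_cong[OF E_total[OF ex0_E[OF v]], of C] unfolding endo_sum[OF eC] .
    have "C ?v \<in> E (k - j)" unfolding vs
    proof (rule module.subspace_sum[OF module_axioms subE])
      fix i assume i: "i \<in> {i\<in>K. fst i = k}"
      show "C (\<pi> i ?v) \<in> E (k - j)" unfolding E_def using i by (auto intro!: suppD[OF C])
    qed
    then show ?thesis unfolding A_def by (rule ex0_E)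
  qed
  have eta_E: "\<eta> i v = 0" if v: "v \<in> E k" "fst i \<noteq> k" for i k v
  proof -
    obtain p0 where p0: "F p0 = UNIV" using F_low by blast
    have "v \<in> span (\<Union>p'\<in>{p0..}. H (k, p'))" using F_E_span[OF v(1), of p0] p0 by simp
    then have "\<eta> i v \<in> {0}"
    proof (rule endo_span_subset[OF P.endo_pi subspace_single_0, rotated])
      fix u assume "u \<in> (\<Union>p'\<in>{p0..}. H (k, p'))"
      then obtain p' where "u \<in> H (k, p')" by blast
      then have "\<eta> (k, p') u = u" by (rule P(3))
      then show "\<eta> i u \<in> {0}" using P.pi_pi[of i "(k, p')" u] v(2) by auto
    qed
    then show ?thesis by simp
  qed
  define G where "G v = (\<Sum>i\<in>K'. \<Sum>i'\<in>{i'\<in>K'. snd i' \<ge> snd i}. \<eta> i' (A (\<eta> i v)))" for v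
  have eG: "endomorphism G"
    unfolding G_def[abs_def]
    by (rule endo_sum_fun, rule endo_sum_fun) (rule endo_comp[OF P.endo_pi endo_comp[OF eA P.endo_pi]])
  have GH: "G u = (\<Sum>i'\<in>{i'\<in>K'. snd i' \<ge> r}. \<eta> i' (A u))" if u: "u \<in> H (k, r)" for u k r
  proof -
    have eu: "\<eta> i u = (if i = (k, r) then u else 0)" for i
      using P(3)[OF u] P.pi_pi[of i "(k, r)" u] by auto
    have "G u = (\<Sum>i\<in>K'. if i = (k, r) then (\<Sum>i'\<in>{i'\<in>K'. snd i' \<ge> r}. \<eta> i' (A u)) else 0)"
      unfolding G_def by (rule sum.cong) (auto simp: eu endo_zero[OF eA])
    also have "\<dots> = (\<Sum>i'\<in>{i'\<in>K'. snd i' \<ge> r}. \<eta> i' (A u))"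
      using P.finK P.pi_outside[of "(k, r)" u] eu[of "(k, r)"] endo_zero[OF eA] by auto
    finally show ?thesis .
  qed
  have HE: "u \<in> E k" if "u \<in> H (k, r)" for u k r using that by (simp add: H_def)
  have GE: "G u \<in> E (k - j)" "G u \<in> F r" if u: "u \<in> H (k, r)" for u k r
  proof -
    note AuE = AE[OF HE[OF u]]
    have "\<eta> i' (A u) \<in> E (k - j)" "snd i' \<ge> r \<Longrightarrow> \<eta> i' (A u) \<in> F r" for i'
    proof -
      show "\<eta> i' (A u) \<in> E (k - j)"
        using P(2)[of i' "A u"] eta_E[OF AuE, of i'] subspace_0[OF subE] by (cases "fst i' = k - j") (auto simp: H_def)
      show "snd i' \<ge> r \<Longrightarrow> \<eta> i' (A u) \<in> F r"
        using P(2)[of i' "A u"] antiF[of r "snd i'"] by (auto simp: H_def)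
    qed
    then show "G u \<in> E (k - j)" "G u \<in> F r"
      unfolding GH[OF u] by (auto intro!: module.subspace_sum[OF module_axioms subE] module.subspace_sum[OF module_axioms subF])
  qed
  have G_supp: "supp {\<delta>. fst \<delta> = - j \<and> fst (snd \<delta>) \<ge> 0} G"
  proof (rule suppI[OF eG])
    fix i i' :: "int \<times> int \<times> int" and v assume d: "i' - i \<notin> {\<delta>. fst \<delta> = - j \<and> fst (snd \<delta>) \<ge> 0}"
    have sp: "\<pi> i v \<in> span (\<Union>p'\<in>{fst (snd i)..}. H (fst i, p'))"
      by (rule F_E_span[OF pi_E pi_F])
    have "G (\<pi> i v) \<in> E (fst i - j) \<inter> F (fst (snd i))"
    proof (rule endo_span_subset[OF eG subspace_inter[OF subE subF] _ sp])
      fix u assume "u \<in> (\<Union>p'\<in>{fst (snd i)..}. H (fst i, p'))"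
      then obtain p' where p': "p' \<ge> fst (snd i)" "u \<in> H (fst i, p')" by auto
      then show "G u \<in> E (fst i - j) \<inter> F (fst (snd i))" using GE[OF p'(2)] antiF[OF p'(1)] by blast
    qed
    then have "fst i' \<noteq> fst i - j \<longrightarrow> \<pi> i' (G (\<pi> i v)) = 0" "fst (snd i') < fst (snd i) \<longrightarrow> \<pi> i' (G (\<pi> i v)) = 0"
      unfolding Int_iff E_def F_iff by blast+
    moreover have "fst i' \<noteq> fst i - j \<or> fst (snd i') < fst (snd i)" using d by auto
    ultimately show "\<pi> i' (G (\<pi> i v)) = 0" by blast
  qed
  have AGH: "ex0 s (A u - G u) \<in> Fb (k - r + 1 - j)" if u: "u \<in> H (k, r)" for u k r
  proof -
    note AuE = AE[OF HE[OF u]]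
    have "A u = (\<Sum>i'\<in>K'. \<eta> i' (A u))" by (rule P.pi_total[symmetric])
    also have "\<dots> = (\<Sum>i'\<in>{i'\<in>K'. snd i' \<ge> r}. \<eta> i' (A u)) + (\<Sum>i'\<in>{i'\<in>K'. \<not> snd i' \<ge> r}. \<eta> i' (A u))"
      using P.finK by (subst sum.union_disjoint[symmetric]) (auto intro!: sum.cong)
    finally have "A u - G u = (\<Sum>i'\<in>{i'\<in>K'. \<not> snd i' \<ge> r}. \<eta> i' (A u))"
      unfolding GH[OF u] by (simp add: algebra_simps)
    moreover have "ex0 s (\<Sum>i'\<in>{i'\<in>K'. \<not> snd i' \<ge> r}. \<eta> i' (A u)) \<in> Fb (k - r + 1 - j)"
      unfolding endo_sum[OF endo_ex0]
    proof (rule module.subspace_sum[OF module_axioms subFb])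
      fix i' assume i': "i' \<in> {i'\<in>K'. \<not> snd i' \<ge> r}"
      show "ex0 s (\<eta> i' (A u)) \<in> Fb (k - r + 1 - j)"
      proof (cases "fst i' = k - j")
        case True
        then show ?thesis
          using P(2)[of i' "A u"] antiFb[of "k - r + 1 - j" "fst i' - snd i'"] i' by (auto simp: H_def)
      next
        case False
        then show ?thesis using eta_E[OF AuE] endo_zero[OF endo_ex0] subspace_0[OF subFb] by simp
      qed
    qed
    ultimately show ?thesis by simp
  qed
  have "supp {\<delta>. snd (snd \<delta>) \<ge> 1 - j} (\<lambda>v. ex0 s (G (ex0 (- s) v)) - C v)"
  proof (rule suppI[OF endo_minus[OF endo_comp[OF endo_ex0 endo_comp[OF eG endo_ex0]] eC]])
    fix i i' :: "int \<times> int \<times> int" and v assume d: "i' - i \<notin> {\<delta>. snd (snd \<delta>) \<ge> 1 - j}"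
    let ?u = "ex0 (- s) (\<pi> i v)"
    have "?u \<in> span (\<Union>p'\<in>{..fst i - snd (snd i)}. H (fst i, p'))"
      by (rule Fb_E_span[OF ex0_E[OF pi_E]]) (simp add: ex0_inverse pi_Fb)
    then have "ex0 s (A ?u - G ?u) \<in> Fb (snd (snd i) + 1 - j)"
    proof (rule endo_span_subset[OF endo_comp[OF endo_ex0 endo_minus[OF eA eG]] subFb, rotated])
      fix u assume "u \<in> (\<Union>p'\<in>{..fst i - snd (snd i)}. H (fst i, p'))"
      then obtain p' where p': "p' \<le> fst i - snd (snd i)" "u \<in> H (fst i, p')" by auto
      then show "ex0 s (A u - G u) \<in> Fb (snd (snd i) + 1 - j)"
        using AGH[OF p'(2)] antiFb[of "snd (snd i) + 1 - j" "fst i - p' + 1 - j"] by auto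
    qed
    moreover have "ex0 s (A ?u - G ?u) = - (ex0 s (G ?u) - C (\<pi> i v))"
      by (simp add: endo_diff[OF endo_ex0] A_def ex0_inverse)
    ultimately have "ex0 s (G ?u) - C (\<pi> i v) \<in> Fb (snd (snd i) + 1 - j)"
      using subspace_neg[OF subFb] by (metis minus_minus)
    moreover have "snd (snd i') < snd (snd i) + 1 - j" using d by auto
    ultimately show "\<pi> i' (ex0 s (G ?u) - C (\<pi> i v)) = 0" unfolding Fb_iff' by blast
  qed
  then show thesis using that G_supp by blast
qed

end

end


section \<open>Brackets with \<open>N0\<close> and the equations in each weight\<close>

lemma fun_sum_apply: "(\<Sum>i\<in>S. f i) v = (\<Sum>i\<in>S. f i v)" for f :: "'i \<Rightarrow> 'a \<Rightarrow> 'b::ab_group_add"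
  by (induction S rule: infinite_finite_induct) auto

context rational_structure
begin

text \<open>Spaces of homogeneous endomorphisms are subspaces of this function space; in this form
  they serve as the \<open>U a\<close> of the locale \<open>lefschetz\<close>.\<close>

lemma vector_space_fun: "vector_space (\<lambda>c (X :: 'v \<Rightarrow> 'v) v. c *\<^sub>C X v)"
  by unfold_locales (auto simp: fun_eq_iff scale_right_distrib scale_left_distrib)

lemma br_left_add: "endomorphism X \<Longrightarrow> br (\<lambda>v. A v + C v) X v = br A X v + br C X v"
  by (simp add: br_def endo_add)

end

context graded
begin

lemma supp_br:
  assumes "supp \<Gamma> X" "supp \<Gamma>' Z" "\<And>a b. a \<in> \<Gamma> \<Longrightarrow> b \<in> \<Gamma>' \<Longrightarrow> a + b \<in> \<Gamma>''"
  shows "supp \<Gamma>'' (br X Z)"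
  unfolding br_def[abs_def]
  by (rule supp_diff[OF supp_comp[OF assms(1,2)] supp_comp[OF assms(2,1)]]) (metis assms(3) add.commute)+

lemma cmp_br:
  assumes N: "supp {\<epsilon>} N" and X: "endomorphism X"
  shows "cmp \<delta> (br N X) = br N (cmp (\<delta> - \<epsilon>) X)"
  by (rule ext) (simp add: br_def[abs_def] cmp_diff cmp_comp_left[OF N X] cmp_comp_right[OF N X])

end

context frame
begin

lemma supp_Y: "supp {0} Y" and Y_pi: "Y (\<pi> i v) = of_int (fst i) *\<^sub>C \<pi> i v"
proof -
  show Yp: "Y (\<pi> i v) = of_int (fst i) *\<^sub>C \<pi> i v" for i v
  proof -
    have "Y (\<pi> i v) = (\<Sum>j\<in>K. if j = i then of_int (fst i) *\<^sub>C \<pi> i v else 0)"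
      unfolding Y_def by (rule sum.cong) (auto simp: pi_pi)
    then show ?thesis using finK pi_outside[of i v] by auto
  qed
  have "endomorphism Y"
    unfolding Y_def[abs_def] by (intro endo_sum_fun endo_scaled endo_pi)
  then show "supp {0} Y" by (rule suppI) (auto simp: Yp pi_scale pi_pi)
qed

lemma endo_Y: "endomorphism Y" using supp_Y by (rule supp_endo)

text \<open>The bracket with \<open>Y\<close> reads off the weight. In weight \<open>-j\<close> it
  produces the factor \<open>j\<close> of the inhomogeneous term.\<close>

lemma br_Y:
  assumes X: "supp {\<delta>. fst \<delta> = l} X"
  shows "br X Y v = of_int (- l) *\<^sub>C X v"
proof (rule endo_eqI[OF endo_br[OF supp_endo[OF X] endo_Y] endo_scaled[OF supp_endo[OF X]]])
  fix i v
  note eX = supp_endo[OF X]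
  show "br X Y (\<pi> i v) = of_int (- l) *\<^sub>C X (\<pi> i v)"
  proof (rule pi_eqI)
    fix j
    have piY: "\<pi> j (Y u) = of_int (fst j) *\<^sub>C \<pi> j u" for u
    proof -
      have "\<pi> j (Y u) = \<pi> j (cmp 0 Y u)" using cmp_eq_hom[OF supp_Y, of 0] by simp
      then show ?thesis by (simp add: pi_cmp[OF endo_Y] Y_pi pi_scale pi_pi)
    qed
    have e: "\<pi> j (br X Y (\<pi> i v)) = (of_int (fst i) - of_int (fst j)) *\<^sub>C \<pi> j (X (\<pi> i v))"
      unfolding br_def Y_pi endo_scale[OF eX] pi_diff pi_scale piY by (simp add: scale_left_diff_distrib)
    show "\<pi> j (br X Y (\<pi> i v)) = \<pi> j (of_int (- l) *\<^sub>C X (\<pi> i v))"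
    proof (cases "fst j - fst i = l")
      case True
      then have "(of_int (fst i) - of_int (fst j) :: complex) = of_int (- l)" by auto
      then show ?thesis unfolding e pi_scale by simp
    next
      case False
      then have "\<pi> j (X (\<pi> i v)) = 0" by (intro suppD[OF X]) auto
      then show ?thesis unfolding e pi_scale by simp
    qed
  qed
qed

abbreviation br0 :: "('v \<Rightarrow> 'v) \<Rightarrow> 'v \<Rightarrow> 'v" where "br0 \<equiv> br N0"

lemma supp_br0_pow: "supp {(l, a, b)} X \<Longrightarrow> supp {(l, a - int n, b - int n)} ((br0 ^^ n) X)"
proof (induction n)
  case (Suc n)
  have "supp {(l, a - int (Suc n), b - int (Suc n))} (br0 ((br0 ^^ n) X))"
    by (rule supp_br[OF supp0 Suc.IH[OF Suc.prems]]) auto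
  then show ?case by simp
qed simp

lemma cmp_br0_pow:
  "endomorphism X \<Longrightarrow> cmp (l, a, b) ((br0 ^^ n) X) = (br0 ^^ n) (cmp (l, a + int n, b + int n) X)"
proof (induction n arbitrary: a b)
  case (Suc n)
  have "cmp (l, a, b) (br0 ((br0 ^^ n) X)) = br0 (cmp ((l, a, b) - (0, - 1, - 1)) ((br0 ^^ n) X))"
    by (rule cmp_br[OF supp0 endo_br_pow[OF endo0 Suc.prems]])
  then show ?case using Suc.IH[OF Suc.prems, of "a + 1" "b + 1"] by (simp add: algebra_simps)
qed simp

lemma degs_bound: "(l, a, b) \<in> degs \<Longrightarrow> \<bar>a\<bar> < int m"
  unfolding degs_def using big by (auto simp: prod_eq_iff)

text \<open>A nonzero result needs both \<open>a\<close> and \<open>a - int n\<close> strictly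
  between \<open>- int m\<close> and \<open>int m\<close>, which allows at most
  \<open>2 * m - 2\<close> brackets.\<close>

lemma br0_pow_nil:
  assumes X: "supp {(l, a, b)} X" and n: "n \<ge> 2 * m - 1"
  shows "(br0 ^^ n) X v = 0"
proof (cases "\<bar>a\<bar> < int m")
  case True
  note s = supp_br0_pow[OF X, of n]
  have "(l, a - int n, b - int n) \<notin> degs"
    using degs_bound[of l "a - int n" "b - int n"] True n by auto
  from cmp_outside[OF supp_endo[OF s] this] show ?thesis
    using cmp_eq_hom[OF s, of "(l, a - int n, b - int n)"] by simp
next
  case False
  then have "(l, a, b) \<notin> degs" using degs_bound by blast
  from cmp_outside[OF supp_endo[OF X] this] have "X = (\<lambda>v. 0)"
    using cmp_eq_hom[OF X, of "(l, a, b)"] by auto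
  then show ?thesis by (simp add: br_pow_zero[OF endo0])
qed

text \<open>\<open>lowers X\<close>: all iterated brackets of \<open>X\<close> with \<open>N0\<close> lower the weight \<open>k\<close> and raise \<open>q - k\<close>.\<close>

definition lowers :: "('v \<Rightarrow> 'v) \<Rightarrow> bool" where
  "lowers X \<longleftrightarrow> (\<forall>n. supp {\<delta>. fst \<delta> \<le> - 1 \<and> snd (snd \<delta>) \<ge> 1 + fst \<delta>} ((br0 ^^ n) X))"

lemma lowers_supp: "lowers X \<Longrightarrow> supp {\<delta>. fst \<delta> \<le> - 1 \<and> snd (snd \<delta>) \<ge> 1 + fst \<delta>} X"
  unfolding lowers_def by (drule spec[of _ 0]) simp

lemma lowers_endo: "lowers X \<Longrightarrow> endomorphism X" using lowers_supp supp_endo by blast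

lemma lowers_zero: "lowers (\<lambda>v. 0)" unfolding lowers_def by (simp add: br_pow_zero[OF endo0] supp_zero)

lemma lowers_add: "lowers X \<Longrightarrow> lowers Z \<Longrightarrow> lowers (\<lambda>v. X v + Z v)"
  unfolding lowers_def br_pow_add[OF endo0] by (blast intro: supp_add)

lemma lowers_scale: "lowers X \<Longrightarrow> lowers (\<lambda>v. c *\<^sub>C X v)"
  unfolding lowers_def br_pow_scale[OF endo0] by (blast intro: supp_scale)

lemma lowers_sum: "(\<And>i. i \<in> S \<Longrightarrow> lowers (X i)) \<Longrightarrow> lowers (\<lambda>v. \<Sum>i\<in>S. X i v)"
  by (induction S rule: infinite_finite_induct) (simp_all add: lowers_zero lowers_add)

lemma lowers_br0: "lowers X \<Longrightarrow> lowers (br0 X)"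
  unfolding lowers_def
proof
  fix n
  assume "\<forall>n. supp {\<delta>. fst \<delta> \<le> - 1 \<and> snd (snd \<delta>) \<ge> 1 + fst \<delta>} ((br0 ^^ n) X)"
  from spec[OF this, of "Suc n"]
  show "supp {\<delta>. fst \<delta> \<le> - 1 \<and> snd (snd \<delta>) \<ge> 1 + fst \<delta>} ((br0 ^^ n) (br0 X))"
    by (simp add: funpow_swap1)
qed

text \<open>By the Jacobi identity powers of \<open>br0\<close> distribute over the two factors, and
  the bounds for the two factors add up with one to spare.\<close>

lemma lowers_br: "lowers X \<Longrightarrow> lowers Z \<Longrightarrow> lowers (br X Z)"
proof -
  have "supp {\<delta>. fst \<delta> \<le> - 1 \<and> snd (snd \<delta>) \<ge> 1 + fst \<delta>} ((br0 ^^ n) (br X Z))"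
    if "lowers X" "lowers Z" for n X Z using that
  proof (induction n arbitrary: X Z)
    case 0
    have "supp {\<delta>. fst \<delta> \<le> - 1 \<and> snd (snd \<delta>) \<ge> 1 + fst \<delta>} (br X Z)"
      by (rule supp_br[OF lowers_supp[OF 0(1)] lowers_supp[OF 0(2)]]) auto
    then show ?case by simp
  next
    case (Suc n)
    have "(br0 ^^ Suc n) (br X Z) = (br0 ^^ n) (br0 (br X Z))" by (simp add: funpow_swap1)
    also have "\<dots> = (\<lambda>v. (br0 ^^ n) (br (br0 X) Z) v + (br0 ^^ n) (br X (br0 Z)) v)"
      unfolding br_jacobi[OF endo0 lowers_endo[OF Suc.prems(1)] lowers_endo[OF Suc.prems(2)]]
        br_pow_add[OF endo0] ..
    finally show ?case
      using Suc.IH[OF lowers_br0[OF Suc.prems(1)] Suc.prems(2)] Suc.IH[OF Suc.prems(1) lowers_br0[OF Suc.prems(2)]]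
      by (simp add: supp_add)
  qed
  then show "lowers X \<Longrightarrow> lowers Z \<Longrightarrow> lowers (br X Z)" unfolding lowers_def[of "br X Z"] by blast
qed

text \<open>\<open>good i\<close>: the part of \<open>N\<close> of weight \<open>-i\<close> has type \<open>(-1, -1)\<close> and is of highest weight.\<close>

definition good :: "int \<Rightarrow> bool" where
  "good i \<longleftrightarrow> (\<forall>a b. (a, b) \<noteq> (- 1, - 1) \<longrightarrow> cmp (- i, a, b) N = (\<lambda>v. 0)) \<and>
    (br0 ^^ nat (i - 1)) (cmp (- i, - 1, - 1) N) = (\<lambda>v. 0)"

text \<open>After \<open>n\<close> brackets the second Hodge degree is \<open>-1 - n\<close>, which
  respects the bound \<open>1 - i\<close> as long as \<open>n \<le> i - 2\<close>; from
  \<open>n = i - 1\<close> on the bracket is zero.\<close>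

lemma good_lowers:
  assumes i: "i \<ge> 1" and g: "good i"
  shows "lowers (cmp (- i, a, b) N)"
proof (cases "(a, b) = (- 1, - 1)")
  case True
  show ?thesis
    unfolding lowers_def
  proof
    fix n
    note s = supp_br0_pow[OF supp_cmp[OF endoN, of "(- i, - 1, - 1)"], of n]
    show "supp {\<delta>. fst \<delta> \<le> - 1 \<and> snd (snd \<delta>) \<ge> 1 + fst \<delta>} ((br0 ^^ n) (cmp (- i, a, b) N))"
    proof (cases "n \<ge> nat (i - 1)")
      case True
      have "(br0 ^^ n) X = (br0 ^^ (n - nat (i - 1))) ((br0 ^^ nat (i - 1)) X)" for X
        using True by (metis comp_apply funpow_add le_add_diff_inverse2)
      then show ?thesis using g \<open>(a, b) = (- 1, - 1)\<close>
        by (simp add: good_def br_pow_zero[OF endo0] supp_zero)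
    next
      case False
      then show ?thesis using s i \<open>(a, b) = (- 1, - 1)\<close> by (auto intro: supp_mono)
    qed
  qed
next
  case False
  then show ?thesis using g lowers_zero by (simp add: good_def)
qed

context
  fixes s :: complex and f h :: "'v \<Rightarrow> 'v"
  assumes f: "endomorphism f" and h: "\<And>v. h v = exN s (f (exN (- s) v))"
    and fY: "supp {\<delta>. fst \<delta> \<le> - 1 \<and> fst (snd \<delta>) \<ge> 0} (\<lambda>v. f v - Y v)"
    and hY: "supp {\<delta>. fst \<delta> \<le> - 1 \<and> snd (snd \<delta>) \<ge> 1 + fst \<delta>} (\<lambda>v. h v - Y v)"
begin

text \<open>For \<open>b \<le> - j\<close> the component of \<open>h\<close> in degree
  \<open>(- j, a, b)\<close> is zero. In the bracket series for \<open>h\<close>, everything that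
  involves the good parts of \<open>N\<close> satisfies the bound of \<open>lowers\<close> and
  misses this degree, so only the terms linear in \<open>f - Y\<close> or in the weight
  \<open>- j\<close> part of \<open>N\<close> survive.\<close>

lemma level_eq:
  assumes j: "j \<ge> 1" and lower_good: "\<And>i. 1 \<le> i \<Longrightarrow> i < j \<Longrightarrow> good i"
    and lower_zero: "\<And>\<delta> v. fst \<delta> > - j \<Longrightarrow> cmp \<delta> (\<lambda>v. f v - Y v) v = 0"
    and b: "b \<le> - j"
  shows "(\<Sum>n<2*m. (s ^ n / fact n) *\<^sub>C
      ((br0 ^^ n) (cmp (- j, a + int n, b + int n) (\<lambda>v. f v - Y v)) v +
       (if n = 0 then 0 else of_int j *\<^sub>C (br0 ^^ (n - 1)) (cmp (- j, a + int n - 1, b + int n - 1) N) v))) = 0"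
proof -
  define g where "g v = f v - Y v" for v
  note eg = endo_minus[OF f endo_Y, folded g_def]
  let ?low = "{\<delta> :: int \<times> int \<times> int. fst \<delta> \<le> - j - 1}"
  \<comment> \<open>\<open>N1\<close> is the part already known to be good, \<open>Nj\<close> the
    part under study, and brackets with \<open>N2\<close> matter only below weight
    \<open>- j\<close>.\<close>
  define N1 where "N1 = restr {\<delta>. - j < fst \<delta> \<and> fst \<delta> \<le> - 1} N"
  define Nj where "Nj = restr {\<delta>. fst \<delta> = - j} N"
  define N2 where "N2 = restr ?low N"
  note eN1 = endo_restr[OF endoN, of "{\<delta>. - j < fst \<delta> \<and> fst \<delta> \<le> - 1}", folded N1_def]
  note sNj = supp_restr[OF endoN, of "{\<delta>. fst \<delta> = - j}", folded Nj_def]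
  note sN2 = supp_restr[OF endoN, of ?low, folded N2_def]
  have N_split: "N v = N0 v + (N1 v + (Nj v + N2 v))" for v
  proof (rule cmp_eqI[OF endoN endo_plus[OF endo0 endo_plus[OF eN1 endo_plus[OF supp_endo[OF sNj] supp_endo[OF sN2]]]]])
    fix \<delta> :: "int \<times> int \<times> int" and v
    have z: "fst \<delta> \<ge> 0 \<Longrightarrow> \<delta> \<noteq> (0, - 1, - 1) \<Longrightarrow> cmp \<delta> N v = 0"
      by (rule cmp_zero_of_supp[OF suppN]) auto
    have "cmp \<delta> (\<lambda>v. N0 v + (N1 v + (Nj v + N2 v))) v = cmp \<delta> N0 v + (cmp \<delta> N1 v + (cmp \<delta> Nj v + cmp \<delta> N2 v))"
      by (simp add: cmp_def pi_add sum.distrib)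
    also have "\<dots> = cmp \<delta> N v"
      unfolding N1_def Nj_def N2_def cmp_restr[OF endoN] cmp_eq_hom[OF supp0]
      using z j by (auto simp: N0_def)
    finally show "cmp \<delta> N v = cmp \<delta> (\<lambda>v. N0 v + (N1 v + (Nj v + N2 v))) v" ..
  qed
  have N1_low: "lowers N1"
    unfolding N1_def restr_def[abs_def]
  proof (rule lowers_sum)
    fix \<delta> assume d: "\<delta> \<in> degs \<inter> {\<delta>. - j < fst \<delta> \<and> fst \<delta> \<le> - 1}"
    obtain i a b where "\<delta> = (- i, a, b)" by (cases \<delta>) (metis minus_minus)
    then show "lowers (cmp \<delta> N)" using d good_lowers[OF _ lower_good, of i a b] by auto
  qed
  have N1Y: "lowers (br N1 Y)"
  proof -
    have "br N1 Y = (\<lambda>v. \<Sum>\<delta>\<in>degs \<inter> {\<delta>. - j < fst \<delta> \<and> fst \<delta> \<le> - 1}. of_int (- fst \<delta>) *\<^sub>C cmp \<delta> N v)"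
    proof
      fix v
      have "br N1 Y v = (\<Sum>\<delta>\<in>degs \<inter> {\<delta>. - j < fst \<delta> \<and> fst \<delta> \<le> - 1}. br (cmp \<delta> N) Y v)"
        by (simp add: br_def N1_def restr_def endo_sum[OF endo_Y] sum_subtractf)
      also have "\<dots> = (\<Sum>\<delta>\<in>degs \<inter> {\<delta>. - j < fst \<delta> \<and> fst \<delta> \<le> - 1}. of_int (- fst \<delta>) *\<^sub>C cmp \<delta> N v)"
        by (rule sum.cong[OF refl], rule br_Y, rule supp_mono[OF supp_cmp[OF endoN]]) auto
      finally show "br N1 Y v = \<dots>" .
    qed
    moreover have "lowers (\<lambda>v. \<Sum>\<delta>\<in>degs \<inter> {\<delta>. - j < fst \<delta> \<and> fst \<delta> \<le> - 1}. of_int (- fst \<delta>) *\<^sub>C cmp \<delta> N v)"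
    proof (rule lowers_sum, rule lowers_scale)
      fix \<delta> assume d: "\<delta> \<in> degs \<inter> {\<delta>. - j < fst \<delta> \<and> fst \<delta> \<le> - 1}"
      obtain i a b where "\<delta> = (- i, a, b)" by (cases \<delta>) (metis minus_minus)
      then show "lowers (cmp \<delta> N)" using d good_lowers[OF _ lower_good, of i a b] by auto
    qed
    ultimately show ?thesis by simp
  qed
  have N0Y: "br0 Y v = 0" for v
    using br_Y[of 0 N0 v] supp_mono[OF supp0] by auto
  have NjY: "br Nj Y v = of_int j *\<^sub>C Nj v" for v
    using br_Y[OF sNj, of v] by simp
  define gj where "gj = restr {\<delta>. fst \<delta> = - j} g"
  note sgj = supp_restr[OF eg, of "{\<delta>. fst \<delta> = - j}", folded gj_def]
  \<comment> \<open>The contribution in weight \<open>- j\<close>: either all brackets with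
    \<open>N0\<close> act on the component of \<open>f - Y\<close>, or the first bracket is
    \<open>[Nj, Y] = j Nj\<close> and the remaining ones are with \<open>N0\<close>.\<close>
  define A where "A n = (\<lambda>v. (br0 ^^ n) gj v + (if n = 0 then 0 else of_int j *\<^sub>C (br0 ^^ (n - 1)) Nj v))" for n
  have br0j: "supp {\<delta>. fst \<delta> = - j} ((br0 ^^ n) X)" if "supp {\<delta>. fst \<delta> = - j} X" for n X
  proof (induction n)
    case (Suc n)
    have "supp {\<delta>. fst \<delta> = - j} (br0 ((br0 ^^ n) X))" by (rule supp_br[OF supp0 Suc]) auto
    then show ?case by simp
  qed (use that in simp)
  have sA: "supp {\<delta>. fst \<delta> = - j} (A n)" for n
  proof (cases "n = 0")
    case True
    then show ?thesis using sgj by (simp add: A_def)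
  next
    case False
    then show ?thesis using supp_add[OF br0j[OF sgj] supp_scale[OF br0j[OF sNj]]] by (simp add: A_def)
  qed
  have A_Suc: "A (Suc n) v = br0 (A n) v + (if n = 0 then of_int j *\<^sub>C Nj v else 0)" for n v
  proof (cases n)
    case 0
    then show ?thesis by (simp add: A_def)
  next
    case (Suc k)
    then show ?thesis by (simp add: A_def br_add[OF endo0] br_scale[OF endo0])
  qed
  \<comment> \<open>For \<open>n = 0\<close> the remainder is \<open>Y\<close>, which has weight
    zero and does not satisfy \<open>lowers\<close>; after one bracket \<open>Y\<close> enters only
    through \<open>[N1, Y]\<close>, and then \<open>lowers\<close> is stable.\<close>
  have main: "\<exists>R. (if n = 0 then R = Y else lowers R) \<and> endomorphism R \<and>
      supp ?low (\<lambda>v. (br N ^^ n) f v - (R v + A n v))" for n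
  proof (induction n)
    case 0
    have "supp ?low (\<lambda>v. f v - (Y v + A 0 v))"
      unfolding supp_iff_cmp[OF endo_minus[OF f endo_plus[OF endo_Y supp_endo[OF sA]]]]
    proof (intro allI impI ext)
      fix \<delta> :: "int \<times> int \<times> int" and v assume d: "\<delta> \<notin> ?low"
      have "cmp \<delta> (\<lambda>v. f v - (Y v + A 0 v)) v = cmp \<delta> g v - cmp \<delta> gj v"
        by (simp add: cmp_def pi_diff pi_add sum_subtractf sum.distrib g_def A_def)
      also have "\<dots> = 0"
        using d lower_zero[of \<delta> v, folded g_def] unfolding gj_def cmp_restr[OF eg]
        by (cases "fst \<delta> = - j") auto
      finally show "cmp \<delta> (\<lambda>v. f v - (Y v + A 0 v)) v = 0" .
    qed
    then show ?case using endo_Y by auto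
  next
    case (Suc n)
    then obtain R where R: "if n = 0 then R = Y else lowers R" "endomorphism R"
      "supp ?low (\<lambda>v. (br N ^^ n) f v - (R v + A n v))" by blast
    define w where "w v = (br N ^^ n) f v - (R v + A n v)" for v
    note sw = R(3)[folded w_def]
    have X: "(br N ^^ n) f = (\<lambda>v. R v + (A n v + w v))" by (rule ext) (simp add: w_def)
    have brX: "br N ((br N ^^ n) f) v = br N R v + (br N (A n) v + br N w v)" for v
      unfolding X by (simp add: br_add[OF endoN])
    have split: "br N Z v = br0 Z v + (br N1 Z v + (br Nj Z v + br N2 Z v))" if "endomorphism Z" for Z v
    proof -
      have "br N Z = br (\<lambda>v. N0 v + (N1 v + (Nj v + N2 v))) Z"
        using N_split by (simp add: br_def fun_eq_iff)
      then show ?thesis by (simp add: br_left_add[OF that])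
    qed
    have s1: "supp ?low (br N1 (A n))"
      by (rule supp_br[OF lowers_supp[OF N1_low] sA]) auto
    have s2: "supp ?low (br Nj (A n))" by (rule supp_br[OF sNj sA]) (use j in auto)
    have s3: "supp ?low (br N2 (A n))" by (rule supp_br[OF sN2 sA]) (use j in auto)
    have s4: "supp ?low (br N w)" by (rule supp_br[OF suppN sw]) auto
    show ?case
    proof (cases "n = 0")
      case True
      have s5: "supp ?low (br N2 Y)" by (rule supp_br[OF sN2 supp_Y]) auto
      have "(br N ^^ Suc n) f v - (br N1 Y v + A (Suc n) v)
          = br N2 Y v + (br N1 (A n) v + (br Nj (A n) v + (br N2 (A n) v + br N w v)))" for v
        using True R brX[of v] by (simp add: split[OF endo_Y] split[OF supp_endo[OF sA]] A_Suc N0Y NjY)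
      then have "supp ?low (\<lambda>v. (br N ^^ Suc n) f v - (br N1 Y v + A (Suc n) v))"
        using supp_add[OF s5 supp_add[OF s1 supp_add[OF s2 supp_add[OF s3 s4]]]] by presburger
      then show ?thesis using N1Y lowers_endo by (intro exI[of _ "br N1 Y"]) auto
    next
      case False
      then have RL: "lowers R" using R by simp
      have s5: "supp ?low (br Nj R)" by (rule supp_br[OF sNj lowers_supp[OF RL]]) auto
      have s6: "supp ?low (br N2 R)" by (rule supp_br[OF sN2 lowers_supp[OF RL]]) auto
      have "(br N ^^ Suc n) f v - ((br0 R v + br N1 R v) + A (Suc n) v)
          = br Nj R v + (br N2 R v + (br N1 (A n) v + (br Nj (A n) v + (br N2 (A n) v + br N w v))))" for v
        using False brX[of v] by (simp add: split[OF R(2)] split[OF supp_endo[OF sA]] A_Suc)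
      then have "supp ?low (\<lambda>v. (br N ^^ Suc n) f v - ((br0 R v + br N1 R v) + A (Suc n) v))"
        using supp_add[OF s5 supp_add[OF s6 supp_add[OF s1 supp_add[OF s2 supp_add[OF s3 s4]]]]] by presburger
      then show ?thesis
        using lowers_add[OF lowers_br0[OF RL] lowers_br[OF N1_low RL]] lowers_endo
        by (intro exI[of _ "\<lambda>v. br0 R v + br N1 R v"]) auto
    qed
  qed
  let ?\<delta> = "(- j, a, b)"
  have cX: "cmp ?\<delta> ((br N ^^ n) f) v = cmp ?\<delta> (A n) v" for n v
  proof -
    obtain R where R: "if n = 0 then R = Y else lowers R" "endomorphism R"
      "supp ?low (\<lambda>v. (br N ^^ n) f v - (R v + A n v))" using main by blast
    have "cmp ?\<delta> R v = 0"
    proof (cases "n = 0")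
      case True
      then show ?thesis using cmp_zero_of_supp[OF supp_Y, of ?\<delta>] R j by (simp add: zero_prod_def)
    next
      case False
      then show ?thesis using R j b by (intro cmp_zero_of_supp[OF lowers_supp]) auto
    qed
    moreover have "cmp ?\<delta> (\<lambda>v. (br N ^^ n) f v - (R v + A n v)) v = 0"
      by (rule cmp_zero_of_supp[OF R(3)]) auto
    ultimately show ?thesis by (simp add: cmp_diff cmp_add[OF R(2) supp_endo[OF sA]])
  qed
  show ?thesis
  proof -
    have hs: "h = (\<lambda>v. \<Sum>n<2 * m. (s ^ n / fact n) *\<^sub>C (br N ^^ n) f v)"
      unfolding h[abs_def] exN_def by (rule ext) (rule nexp_conj_br[OF endoN nilN f])
    have eh: "endomorphism h" unfolding h[abs_def] by (rule endo_comp[OF endo_exN endo_comp[OF f endo_exN]])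
    have "cmp ?\<delta> (\<lambda>v. h v - Y v) v = 0"
      by (rule cmp_zero_of_supp[OF hY]) (use b in auto)
    moreover have "cmp ?\<delta> Y v = 0"
      using j by (intro cmp_zero_of_supp[OF supp_Y]) (auto simp: zero_prod_def)
    ultimately have "cmp ?\<delta> h v = 0" by (simp add: cmp_diff)
    moreover have "cmp ?\<delta> h v = (\<Sum>n<2 * m. (s ^ n / fact n) *\<^sub>C cmp ?\<delta> (A n) v)"
      unfolding hs by (simp only: cmp_sum cmp_scale cX)
    moreover have "cmp ?\<delta> (A n) v = (br0 ^^ n) (cmp (- j, a + int n, b + int n) g) v +
       (if n = 0 then 0 else of_int j *\<^sub>C (br0 ^^ (n - 1)) (cmp (- j, a + int n - 1, b + int n - 1) N) v)" for n
    proof -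
      have 1: "cmp ?\<delta> ((br0 ^^ n) gj) v = (br0 ^^ n) (cmp (- j, a + int n, b + int n) g) v"
      proof -
        have "cmp (- j, a + int n, b + int n) gj = cmp (- j, a + int n, b + int n) g"
          unfolding gj_def by (rule ext) (simp add: cmp_restr[OF eg])
        then show ?thesis by (simp add: cmp_br0_pow[OF supp_endo[OF sgj]])
      qed
      have 2: "cmp ?\<delta> ((br0 ^^ (n - 1)) Nj) v = (br0 ^^ (n - 1)) (cmp (- j, a + int n - 1, b + int n - 1) N) v"
        if "n \<noteq> 0"
      proof -
        have "cmp (- j, a + int (n - 1), b + int (n - 1)) Nj = cmp (- j, a + int n - 1, b + int n - 1) N"
          unfolding Nj_def using that by (intro ext) (simp add: cmp_restr[OF endoN] of_nat_diff algebra_simps)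
        then show ?thesis by (simp add: cmp_br0_pow[OF supp_endo[OF sNj]])
      qed
      show ?thesis
        using 1 2 unfolding A_def
        by (cases "n = 0") (auto simp: cmp_add[OF supp_endo[OF br0j[OF sgj]] endo_scaled[OF supp_endo[OF br0j[OF sNj]]]] cmp_scale)
    qed
    ultimately show ?thesis by (simp add: g_def[abs_def])
  qed
qed

end

end


section \<open>Solving the equations in each weight\<close>

context frame
begin

text \<open>With the factor \<open>s\<close> absorbed into the operator, \<open>ex\<close> of the
  locale \<open>lefschetz\<close> becomes conjugation by \<open>ex0 s\<close>.\<close>

abbreviation nn :: "complex \<Rightarrow> ('v \<Rightarrow> 'v) \<Rightarrow> 'v \<Rightarrow> 'v" where "nn s \<equiv> \<lambda>X v. s *\<^sub>C br0 X v"

lemma nn_pow: "(nn s ^^ k) X = (\<lambda>v. s ^ k *\<^sub>C (br0 ^^ k) X v)"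
  by (induction k) (simp_all add: br_scale[OF endo0])

text \<open>\<open>br0\<close> lowers both Hodge degrees by one and so acts on each diagonal
  \<open>a - b = d\<close> of weight \<open>- j\<close>. There the condition
  \<open>b \<le> - j - p\<close> reads \<open>a \<le> d - j - p\<close>, whence
  \<open>w = d - j\<close>; the axiom \<open>opp\<close> is \<open>opposed_End_zero\<close>.\<close>

lemma lefschetz_frame:
  assumes s: "opposed s"
  shows "lefschetz (\<lambda>c X v. c *\<^sub>C X v) (nn s) (\<lambda>a. {X. supp {(- j, a, a - d)} X}) (d - j) (2 * m)"
proof -
  interpret V: vector_space "\<lambda>c (X :: 'v \<Rightarrow> 'v) v. c *\<^sub>C X v" by (rule vector_space_fun)
  show ?thesis
  proof unfold_locales
    fix X Z :: "'v \<Rightarrow> 'v" and a c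
    have "br0 (X + Z) = (\<lambda>v. br0 X v + br0 Z v)"
      using br_add[OF endo0, of X Z] by (simp add: plus_fun_def)
    then show "nn s (X + Z) = nn s X + nn s Z" by (simp add: fun_eq_iff scale_right_distrib)
    show "nn s (\<lambda>v. c *\<^sub>C X v) = (\<lambda>v. c *\<^sub>C nn s X v)"
      by (simp add: br_scale[OF endo0] mult.commute)
    show "V.subspace {X. supp {(- j, a, a - d)} X}"
      by (rule V.subspaceI) (auto simp: plus_fun_def zero_fun_def intro: supp_zero supp_add supp_scale)
    show "nn s X \<in> {X. supp {(- j, a - 1, a - 1 - d)} X}" if "X \<in> {X. supp {(- j, a, a - d)} X}"
    proof -
      have "supp {(- j, a - 1, a - 1 - d)} (br0 X)"
        by (rule supp_br[OF supp0]) (use that in auto)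
      then show ?thesis by (auto intro: supp_scale)
    qed
    show "(nn s ^^ (2 * m)) X = 0" if "X \<in> {X. supp {(- j, a, a - d)} X}"
      using br0_pow_nil[of "- j" a "a - d" X "2 * m"] that by (auto simp: nn_pow zero_fun_def)
  next
    fix u :: "int \<Rightarrow> 'v \<Rightarrow> 'v" and p a0
    assume u: "\<And>a. u a \<in> {X. supp {(- j, a, a - d)} X}" and low: "\<And>a. a < p \<Longrightarrow> u a = 0"
      and eq: "\<And>\<alpha>. \<alpha> \<le> d - j - p \<Longrightarrow>
        (\<Sum>k<2*m. (\<lambda>v. (1 / fact k) *\<^sub>C (nn s ^^ k) (u (\<alpha> + int k)) v)) = 0"
    have su: "supp {(- j, a, a - d)} (u a)" for a using u by simp
    note eu = supp_endo[OF su]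
    \<comment> \<open>A sequence along the diagonal is summed to a single endomorphism; terms
      outside this range of degrees are zero by \<open>big\<close>.\<close>
    define A where "A v = (\<Sum>a\<in>{- int m..int m}. u a v)" for v
    have sA: "supp {\<delta>. fst \<delta> = - j \<and> fst (snd \<delta>) \<ge> p} A"
      unfolding A_def[abs_def]
    proof (rule supp_sum)
      fix a
      show "supp {\<delta>. fst \<delta> = - j \<and> fst (snd \<delta>) \<ge> p} (u a)"
      proof (cases "a < p")
        case True
        then show ?thesis using low supp_zero by (simp add: zero_fun_def)
      next
        case False
        then show ?thesis by (intro supp_mono[OF su]) auto
      qed
    qed
    note eA = supp_endo[OF sA]
    have cA: "cmp (l, a, b) A = (if l = - j \<and> b = a - d then u a else (\<lambda>v. 0))" for l a b
    proof
      fix v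
      have "cmp (l, a, b) A v = (\<Sum>a'\<in>{- int m..int m}. if a' = a then (if l = - j \<and> b = a - d then u a v else 0) else 0)"
        unfolding A_def[abs_def] cmp_sum
        by (rule sum.cong) (auto simp: cmp_eq_hom[OF su])
      moreover have "u a v = 0" if "a \<notin> {- int m..int m}"
      proof -
        have "(- j, a, a - d) \<notin> degs" using degs_bound[of "- j" a "a - d"] that by auto
        from cmp_outside[OF eu[of a] this, of v] show ?thesis
          using cmp_eq_hom[OF su[of a], of "(- j, a, a - d)"] by simp
      qed
      ultimately show "cmp (l, a, b) A v = (if l = - j \<and> b = a - d then u a else (\<lambda>v. 0)) v" by auto
    qed
    have C: "ex0 s (A (ex0 (- s) v)) = (\<Sum>k<2*m. (s ^ k / fact k) *\<^sub>C (br0 ^^ k) A v)" for v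
      unfolding ex0_def by (rule nexp_conj_br[OF endo0 nil0 eA])
    have eC: "endomorphism (\<lambda>v. ex0 s (A (ex0 (- s) v)))"
      by (rule endo_comp[OF endo_ex0 endo_comp[OF eA endo_ex0]])
    have "supp {\<delta>. snd (snd \<delta>) \<ge> 1 - j - p} (\<lambda>v. ex0 s (A (ex0 (- s) v)))"
      unfolding supp_iff_cmp[OF eC]
    proof (intro allI impI ext)
      fix \<delta> :: "int \<times> int \<times> int" and v assume d: "\<delta> \<notin> {\<delta>. snd (snd \<delta>) \<ge> 1 - j - p}"
      obtain l a b where \<delta>: "\<delta> = (l, a, b)" by (cases \<delta>)
      have e: "cmp \<delta> (\<lambda>v. ex0 s (A (ex0 (- s) v))) v
          = (\<Sum>k<2*m. (s ^ k / fact k) *\<^sub>C (br0 ^^ k) (cmp (l, a + int k, b + int k) A) v)"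
        unfolding C \<delta> cmp_sum cmp_scale cmp_br0_pow[OF eA] ..
      show "cmp \<delta> (\<lambda>v. ex0 s (A (ex0 (- s) v))) v = 0"
      proof (cases "l = - j \<and> b = a - d")
        case True
        have "(\<Sum>k<2*m. (\<lambda>v. (1 / fact k) *\<^sub>C (nn s ^^ k) (u (a + int k)) v)) v = 0"
          using eq[of a] True d \<delta> by simp
        then show ?thesis unfolding e cA fun_sum_apply nn_pow using True by simp
      next
        case False
        then show ?thesis unfolding e cA by (auto simp: br_pow_zero[OF endo0])
      qed
    qed
    from opposed_End_zero[OF s sA this] have "A = (\<lambda>v. 0)" by auto
    then have "cmp (- j, a0, a0 - d) A = (\<lambda>v. 0)" by (auto simp: cmp_def)
    then show "u a0 = 0" using cA[of "- j" a0 "a0 - d"] by (simp add: zero_fun_def)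
  qed
qed

text \<open>In degree \<open>0\<close> with \<open>w = - j\<close> the critical power for
  injectivity is exactly \<open>j\<close>.\<close>

lemma highest_unique:
  assumes s: "opposed s" "s \<noteq> 0" and j: "j \<ge> 1" and T: "supp {(- j, 0, 0)} T"
    and z: "(br0 ^^ nat j) T = (\<lambda>v. 0)"
  shows "T = (\<lambda>v. 0)"
proof -
  interpret L: lefschetz "\<lambda>c X v. c *\<^sub>C X v" "nn s" "\<lambda>a. {X. supp {(- j, a, a - 0)} X}" "0 - j" "2 * m"
    by (rule lefschetz_frame[OF s(1)])
  have "T = 0"
    by (rule L.injective[of T 0]) (use T j z in \<open>auto simp: nn_pow zero_fun_def\<close>)
  then show ?thesis by (simp add: zero_fun_def)
qed

context
  fixes s :: complex and f h :: "'v \<Rightarrow> 'v"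
  assumes f: "endomorphism f" and h: "\<And>v. h v = exN s (f (exN (- s) v))"
    and fY: "supp {\<delta>. fst \<delta> \<le> - 1 \<and> fst (snd \<delta>) \<ge> 0} (\<lambda>v. f v - Y v)"
    and hY: "supp {\<delta>. fst \<delta> \<le> - 1 \<and> snd (snd \<delta>) \<ge> 1 + fst \<delta>} (\<lambda>v. h v - Y v)"
begin

context
  fixes j :: int
  assumes j: "j \<ge> 1" and lower_good: "\<And>i. 1 \<le> i \<Longrightarrow> i < j \<Longrightarrow> good i"
    and lower_zero: "\<And>\<delta> v. fst \<delta> > - j \<Longrightarrow> cmp \<delta> (\<lambda>v. f v - Y v) v = 0"
begin

text \<open>Brings the equation into the form treated in \<open>lefschetz\<close>. The part of
  \<open>N\<close> of first Hodge degree \<open>c\<close> occurs with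
  \<open>c - \<alpha> + 1\<close> brackets in all, one of which is spent on \<open>Y\<close>; this
  explains the factorial.\<close>

lemma level_eq_fun:
  assumes \<alpha>: "\<alpha> \<le> d - j"
  shows "(\<Sum>k<2*m. (\<lambda>v. (1 / fact k) *\<^sub>C (nn s ^^ k) (cmp (- j, \<alpha> + int k, \<alpha> + int k - d) (\<lambda>v. f v - Y v)) v)) +
    (\<Sum>c\<in>{- int m..int m}. (\<lambda>v. (of_int j / fact (nat (c - \<alpha>) + 1)) *\<^sub>C
      (nn s ^^ nat (c - \<alpha>)) (\<lambda>v. s *\<^sub>C cmp (- j, c, c - d) N v) v)) = 0"
proof
  fix v
  define T where "T c = (of_int j * s ^ (nat (c - \<alpha>) + 1) / fact (nat (c - \<alpha>) + 1)) *\<^sub>C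
      (br0 ^^ nat (c - \<alpha>)) (cmp (- j, c, c - d) N) v" for c
  \<comment> \<open>Terms with \<open>c\<close> out of range, below \<open>\<alpha>\<close> or too
    far above it vanish, so the sum can run over a set of \<open>c\<close> that does not depend on
    \<open>\<alpha>\<close>.\<close>
  have T_out: "T c = 0" if "c \<notin> {- int m..int m}" for c
  proof -
    have "(- j, c, c - d) \<notin> degs" using degs_bound[of "- j" c "c - d"] that by auto
    then have "cmp (- j, c, c - d) N = (\<lambda>v. 0)" using cmp_outside[OF endoN] by blast
    then show ?thesis by (simp add: T_def br_pow_zero[OF endo0])
  qed
  have T_low: "T c = 0" if "c < \<alpha>" for c
  proof -
    have "cmp (- j, c, c - d) N = (\<lambda>v. 0)"
      using that \<alpha> j by (intro ext cmp_zero_of_supp[OF suppN]) auto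
    then show ?thesis by (simp add: T_def br_pow_zero[OF endo0])
  qed
  have T_high: "T c = 0" if "c \<ge> \<alpha> + 2 * int m - 1" for c
    using br0_pow_nil[OF supp_cmp[OF endoN], of "nat (c - \<alpha>)"] that by (simp add: T_def)
  have inj: "inj_on (\<lambda>n. \<alpha> + int n - 1) {1..<2*m}" by (auto simp: inj_on_def)
  have "(\<Sum>n<2*m. (s ^ n / fact n) *\<^sub>C (if n = 0 then 0 else
      of_int j *\<^sub>C (br0 ^^ (n - 1)) (cmp (- j, \<alpha> + int n - 1, (\<alpha> - d) + int n - 1) N) v))
      = (\<Sum>n\<in>{1..<2*m}. T (\<alpha> + int n - 1))"
  proof (rule sum.mono_neutral_cong_right)
    fix n assume n: "n \<in> {1..<2*m}"
    have e: "nat (\<alpha> + int n - 1 - \<alpha>) = n - 1" "(n - 1) + 1 = n" "\<alpha> - d + int n - 1 = \<alpha> + int n - 1 - d" using n by auto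
    show "(s ^ n / fact n) *\<^sub>C (if n = 0 then 0 else
      of_int j *\<^sub>C (br0 ^^ (n - 1)) (cmp (- j, \<alpha> + int n - 1, (\<alpha> - d) + int n - 1) N) v) = T (\<alpha> + int n - 1)"
      unfolding T_def e using n by (simp add: mult.commute)
  qed auto
  also have "\<dots> = (\<Sum>c\<in>(\<lambda>n. \<alpha> + int n - 1) ` {1..<2*m}. T c)"
    unfolding sum.reindex[OF inj] by simp
  also have "\<dots> = (\<Sum>c\<in>{- int m..int m}. T c)"
  proof (rule sum.mono_neutral_cong)
    show "T c = 0" if "c \<in> {- int m..int m} - (\<lambda>n. \<alpha> + int n - 1) ` {1..<2*m}" for c
    proof (cases "c < \<alpha> \<or> c \<ge> \<alpha> + 2 * int m - 1")
      case False
      then have "c = \<alpha> + int (nat (c - \<alpha> + 1)) - 1" "nat (c - \<alpha> + 1) \<in> {1..<2*m}" by auto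
      then show ?thesis using that by blast
    qed (use T_low T_high in blast)
  qed (use T_out in auto)
  finally have 2: "(\<Sum>n<2*m. (s ^ n / fact n) *\<^sub>C (if n = 0 then 0 else
      of_int j *\<^sub>C (br0 ^^ (n - 1)) (cmp (- j, \<alpha> + int n - 1, (\<alpha> - d) + int n - 1) N) v))
      = (\<Sum>c\<in>{- int m..int m}. T c)" .
  have e: "(\<alpha> - d) + int n = \<alpha> + int n - d" for n by simp
  have "(\<Sum>k<2*m. (s ^ k / fact k) *\<^sub>C (br0 ^^ k) (cmp (- j, \<alpha> + int k, \<alpha> + int k - d) (\<lambda>v. f v - Y v)) v) +
     (\<Sum>c\<in>{- int m..int m}. T c) = 0"
    using level_eq[OF f h fY hY j lower_good lower_zero, of "\<alpha> - d" \<alpha> v] \<alpha> 2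
    unfolding scale_right_distrib sum.distrib e by simp
  then show "((\<Sum>k<2*m. (\<lambda>v. (1 / fact k) *\<^sub>C (nn s ^^ k) (cmp (- j, \<alpha> + int k, \<alpha> + int k - d) (\<lambda>v. f v - Y v)) v)) +
    (\<Sum>c\<in>{- int m..int m}. (\<lambda>v. (of_int j / fact (nat (c - \<alpha>) + 1)) *\<^sub>C
      (nn s ^^ nat (c - \<alpha>)) (\<lambda>v. s *\<^sub>C cmp (- j, c, c - d) N v) v))) v = 0 v"
    by (simp add: fun_sum_apply nn_pow br_pow_scale[OF endo0] T_def mult_ac)
qed

lemma cmp_diff_low: "a < 0 \<Longrightarrow> cmp (- j, a, b) (\<lambda>v. f v - Y v) = (\<lambda>v. 0)"
  using cmp_zero_of_supp[OF fY, of "(- j, a, b)"] by auto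

lemma endo_fY: "endomorphism (\<lambda>v. f v - Y v)" using fY by (rule supp_endo)

text \<open>A part of \<open>N\<close> of type \<open>(-1, -1)\<close> is seen only by the diagonal
  \<open>a = b\<close>. On the others the equation is homogeneous and \<open>opp\<close> leaves the
  zero solution; on this one \<open>solution_low\<close> applies.\<close>

lemma level_step:
  assumes s: "opposed s" "s \<noteq> 0"
    and type: "\<And>a b. (a, b) \<noteq> (- 1, - 1) \<Longrightarrow> cmp (- j, a, b) N = (\<lambda>v. 0)"
  obtains T where "supp {(- j, 0, 0)} T"
    "cmp (- j, 0, 0) (\<lambda>v. f v - Y v) = (\<lambda>v. (- of_int j) *\<^sub>C T v)"
    "(br0 ^^ nat (j - 1)) (cmp (- j, - 1, - 1) N) = (br0 ^^ nat j) T"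
    "\<And>a b. (a, b) \<noteq> (0, 0) \<Longrightarrow> cmp (- j, a, b) (\<lambda>v. f v - Y v) = (\<lambda>v. 0)"
proof -
  let ?g = "\<lambda>v. f v - Y v"
  have m: "m \<ge> 1 \<or> K = {}" using m_pos by fastforce
  have off: "cmp (- j, a, a - d) ?g = (\<lambda>v. 0)" if d: "d \<noteq> 0" for a d
  proof -
    interpret L: lefschetz "\<lambda>c X v. c *\<^sub>C X v" "nn s" "\<lambda>a. {X. supp {(- j, a, a - d)} X}" "d - j" "2 * m"
      by (rule lefschetz_frame[OF s(1)])
    have "cmp (- j, a, a - d) ?g = 0"
    proof (rule L.opp[of "\<lambda>a. cmp (- j, a, a - d) ?g" 0])
      show "cmp (- j, a, a - d) ?g \<in> {X. supp {(- j, a, a - d)} X}" for a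
        using supp_cmp[OF endo_fY] by simp
      show "cmp (- j, a, a - d) ?g = 0" if "a < 0" for a using cmp_diff_low[OF that] by (simp add: zero_fun_def)
      fix \<alpha> assume a: "\<alpha> \<le> d - j - 0"
      have "(\<Sum>c\<in>{- int m..int m}. (\<lambda>v. (of_int j / fact (nat (c - \<alpha>) + 1)) *\<^sub>C
        (nn s ^^ nat (c - \<alpha>)) (\<lambda>v. s *\<^sub>C cmp (- j, c, c - d) N v) v)) = 0"
        using type d by (intro sum.neutral) (auto simp: nn_pow br_pow_scale[OF endo0] br_pow_zero[OF endo0] zero_fun_def)
      then show "(\<Sum>k<2*m. (\<lambda>v. (1 / fact k) *\<^sub>C (nn s ^^ k) (cmp (- j, \<alpha> + int k, \<alpha> + int k - d) ?g) v)) = 0"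
        using level_eq_fun[of \<alpha> d] a by simp
    qed
    then show ?thesis by (simp add: zero_fun_def)
  qed
  interpret L: lefschetz "\<lambda>c X v. c *\<^sub>C X v" "nn s" "\<lambda>a. {X. supp {(- j, a, a - 0)} X}" "0 - j" "2 * m"
    by (rule lefschetz_frame[OF s(1)])
  let ?X = "\<lambda>v. s *\<^sub>C cmp (- j, - 1, - 1) N v"
  have j': "int (nat j) = j" using j by simp
  obtain T where T: "T \<in> {X. supp {(- j, 0, 0 - 0)} X}" "cmp (- j, 0, 0 - 0) ?g = (\<lambda>v. (- of_nat (nat j)) *\<^sub>C T v)"
    "\<And>a. a \<noteq> 0 \<Longrightarrow> cmp (- j, a, a - 0) ?g = 0" "(nn s ^^ (nat j - 1)) ?X = (nn s ^^ nat j) T"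
  proof (rule L.solution_low[of "nat j" ?X "\<lambda>a. cmp (- j, a, a - 0) ?g"])
    show "0 - j = - int (nat j)" "1 \<le> nat j" using j by auto
    show "?X \<in> {X. supp {(- j, - 1, - 1 - 0)} X}" using supp_scale[OF supp_cmp[OF endoN]] by simp
    show "cmp (- j, a, a - 0) ?g \<in> {X. supp {(- j, a, a - 0)} X}" for a
      using supp_cmp[OF endo_fY] by simp
    show "cmp (- j, a, a - 0) ?g = 0" if "a < 0" for a using cmp_diff_low[OF that] by (simp add: zero_fun_def)
    fix \<alpha> assume a: "\<alpha> \<le> 0 - j"
    have *: "(\<Sum>c\<in>{- int m..int m}. (\<lambda>v. (of_int j / fact (nat (c - \<alpha>) + 1)) *\<^sub>C
        (nn s ^^ nat (c - \<alpha>)) (\<lambda>v. s *\<^sub>C cmp (- j, c, c - 0) N v) v)) =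
      (\<lambda>v. (of_nat (nat j) / fact (nat (- 1 - \<alpha>) + 1)) *\<^sub>C (nn s ^^ nat (- 1 - \<alpha>)) ?X v)"
    proof (cases "m \<ge> 1")
      case True
      have "(\<Sum>c\<in>{- int m..int m}. (\<lambda>v. (of_int j / fact (nat (c - \<alpha>) + 1)) *\<^sub>C
        (nn s ^^ nat (c - \<alpha>)) (\<lambda>v. s *\<^sub>C cmp (- j, c, c - 0) N v) v)) =
        (\<Sum>c\<in>{- 1}. (\<lambda>v. (of_int j / fact (nat (c - \<alpha>) + 1)) *\<^sub>C
        (nn s ^^ nat (c - \<alpha>)) (\<lambda>v. s *\<^sub>C cmp (- j, c, c - 0) N v) v))"
        using True type by (intro sum.mono_neutral_right)
          (auto simp: nn_pow br_pow_scale[OF endo0] br_pow_zero[OF endo0] zero_fun_def)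
      moreover have "(of_nat (nat j) :: complex) = of_int j" using j by simp
      ultimately show ?thesis by simp
    next
      case False
      then have "K = {}" using m by simp
      from v_zero[OF this] show ?thesis by (intro ext) metis
    qed
    show "L.ex (\<lambda>a. cmp (- j, a, a - 0) ?g) \<alpha> +
        (\<lambda>v. (of_nat (nat j) / fact (nat (- 1 - \<alpha>) + 1)) *\<^sub>C (nn s ^^ nat (- 1 - \<alpha>)) ?X v) = 0"
      using level_eq_fun[OF a] unfolding L.ex_def * .
  qed blast
  have "s ^ nat j *\<^sub>C (br0 ^^ (nat j - 1)) (cmp (- j, - 1, - 1) N) v = s ^ nat j *\<^sub>C (br0 ^^ nat j) T v" for v
  proof -
    have "s ^ nat j = s ^ (nat j - 1) * s" using j by (simp flip: power_Suc2)
    then show ?thesis using fun_cong[OF T(4), of v] by (simp add: nn_pow br_pow_scale[OF endo0])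
  qed
  then have "(br0 ^^ (nat j - 1)) (cmp (- j, - 1, - 1) N) = (br0 ^^ nat j) T"
    using s(2) by (intro ext) simp
  moreover have "nat (j - 1) = nat j - 1" by simp
  moreover have "cmp (- j, a, b) ?g = (\<lambda>v. 0)" if "(a, b) \<noteq> (0, 0)" for a b
  proof (cases "a = b")
    case True
    then show ?thesis using T(3)[of a] that by (simp add: zero_fun_def)
  next
    case False
    then show ?thesis using off[of "a - b" a] by simp
  qed
  ultimately show thesis
    using T(1,2) j by (intro that[of T]) auto
qed

end

text \<open>In each weight the solution is \<open>- j T\<close>, where goodness makes the
  \<open>j\<close>-fold bracket of \<open>T\<close> with \<open>N0\<close> vanish;
  \<open>highest_unique\<close> then gives \<open>T = 0\<close>.\<close>

lemma good_zero:
  assumes s: "opposed s" "s \<noteq> 0" and g: "\<And>i. i \<ge> 1 \<Longrightarrow> good i"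
  shows "f v = Y v"
proof -
  have *: "\<forall>\<delta> v. fst \<delta> > - 1 - int n \<longrightarrow> cmp \<delta> (\<lambda>v. f v - Y v) v = 0" for n
  proof (induction n)
    case 0
    then show ?case using cmp_zero_of_supp[OF fY] by auto
  next
    case (Suc n)
    define j where "j = 1 + int n"
    have j: "j \<ge> 1" by (simp add: j_def)
    have low: "cmp \<delta> (\<lambda>v. f v - Y v) v = 0" if "fst \<delta> > - j" for \<delta> v
    proof -
      have "fst \<delta> > - 1 - int n" using that by (simp add: j_def)
      then show ?thesis using Suc by blast
    qed
    have type: "cmp (- j, a, b) N = (\<lambda>v. 0)" if "(a, b) \<noteq> (- 1, - 1)" for a b
      using g[OF j] that by (auto simp: good_def)
    obtain T where T: "supp {(- j, 0, 0)} T"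
      "cmp (- j, 0, 0) (\<lambda>v. f v - Y v) = (\<lambda>v. (- of_int j) *\<^sub>C T v)"
      "(br0 ^^ nat (j - 1)) (cmp (- j, - 1, - 1) N) = (br0 ^^ nat j) T"
      "\<And>a b. (a, b) \<noteq> (0, 0) \<Longrightarrow> cmp (- j, a, b) (\<lambda>v. f v - Y v) = (\<lambda>v. 0)"
      using level_step[OF j g low s type] by blast
    have "T = (\<lambda>v. 0)"
      using g[OF j] T(3) by (intro highest_unique[OF s j T(1)]) (simp add: good_def)
    then have z: "cmp (- j, a, b) (\<lambda>v. f v - Y v) v = 0" for a b v
      using T(2,4) by (cases "(a, b) = (0, 0)") auto
    show ?case
    proof (intro allI impI)
      fix \<delta> :: "int \<times> int \<times> int" and v assume d: "fst \<delta> > - 1 - int (Suc n)"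
      obtain l a b where \<delta>: "\<delta> = (l, a, b)" by (cases \<delta>)
      show "cmp \<delta> (\<lambda>v. f v - Y v) v = 0"
        using low[of \<delta> v] z[of a b v] d unfolding \<delta> j_def by (cases "l = - 1 - int n") auto
    qed
  qed
  have "cmp \<delta> (\<lambda>v. f v - Y v) v = 0" for \<delta> v
  proof -
    have "fst \<delta> > - 1 - int (nat (- fst \<delta>))" by simp
    then show ?thesis using * by blast
  qed
  then have "cmp \<delta> f v = cmp \<delta> Y v" for \<delta> v by (simp add: cmp_diff)
  then show ?thesis by (rule cmp_eqI[OF f endo_Y])
qed

text \<open>If \<open>N\<close> has type \<open>(-1, -1)\<close> and \<open>f\<close> has the same component of type \<open>(0, 0)\<close> as \<open>Y\<close>, then
  \<open>Y\<close> is Deligne's grading.\<close>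

lemma all_good:
  assumes s: "opposed s" "s \<noteq> 0"
    and type: "\<And>j a b. j \<ge> 1 \<Longrightarrow> (a, b) \<noteq> (- 1, - 1) \<Longrightarrow> cmp (- j, a, b) N = (\<lambda>v. 0)"
    and zero: "\<And>j v. j \<ge> 1 \<Longrightarrow> cmp (- j, 0, 0) (\<lambda>v. f v - Y v) v = 0"
    and i: "i \<ge> 1"
  shows "good i"
proof -
  have *: "(\<forall>\<delta> v. fst \<delta> > - 1 - int n \<longrightarrow> cmp \<delta> (\<lambda>v. f v - Y v) v = 0) \<and> (\<forall>i. 1 \<le> i \<and> i < 1 + int n \<longrightarrow> good i)" for n
  proof (induction n)
    case 0
    then show ?case using cmp_zero_of_supp[OF fY] by auto
  next
    case (Suc n)
    define j where "j = 1 + int n"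
    have j: "j \<ge> 1" by (simp add: j_def)
    have low: "cmp \<delta> (\<lambda>v. f v - Y v) v = 0" if "fst \<delta> > - j" for \<delta> v
    proof -
      have "fst \<delta> > - 1 - int n" using that by (simp add: j_def)
      then show ?thesis using Suc by blast
    qed
    have g: "good i" if "1 \<le> i" "i < j" for i using Suc that by (auto simp: j_def)
    obtain T where T: "supp {(- j, 0, 0)} T"
      "cmp (- j, 0, 0) (\<lambda>v. f v - Y v) = (\<lambda>v. (- of_int j) *\<^sub>C T v)"
      "(br0 ^^ nat (j - 1)) (cmp (- j, - 1, - 1) N) = (br0 ^^ nat j) T"
      "\<And>a b. (a, b) \<noteq> (0, 0) \<Longrightarrow> cmp (- j, a, b) (\<lambda>v. f v - Y v) = (\<lambda>v. 0)"
      using level_step[OF j g low s type[OF j]] by blast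
    have "(- of_int j) *\<^sub>C T v = 0" for v using zero[OF j, of v] fun_cong[OF T(2), of v] by simp
    then have T0: "T = (\<lambda>v. 0)" using j by auto
    have gj: "good j"
      using T(3) type[OF j] unfolding good_def T0 by (simp add: br_pow_zero[OF endo0])
    have z: "cmp (- j, a, b) (\<lambda>v. f v - Y v) v = 0" for a b v
      using T(2,4) T0 by (cases "(a, b) = (0, 0)") auto
    show ?case
    proof (intro conjI allI impI)
      fix \<delta> :: "int \<times> int \<times> int" and v assume d: "fst \<delta> > - 1 - int (Suc n)"
      obtain l a b where \<delta>: "\<delta> = (l, a, b)" by (cases \<delta>)
      show "cmp \<delta> (\<lambda>v. f v - Y v) v = 0"
        using low[of \<delta> v] z[of a b v] d unfolding \<delta> j_def by (cases "l = - 1 - int n") auto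
    next
      fix i assume "1 \<le> i \<and> i < 1 + int (Suc n)"
      then show "good i" using g gj by (cases "i = j") (auto simp: j_def)
    qed
  qed
  show ?thesis using *[of "nat i"] i by auto
qed

end

end


section \<open>Consequences of a real limit for the type of \<open>N\<close>\<close>

context rational_structure
begin

lemma tendsto_endo:
  assumes X: "endomorphism X"
    and lim: "\<And>b. b \<in> B \<Longrightarrow> ((\<lambda>z. representation B (x z) b) \<longlongrightarrow> representation B l b) \<F>"
  shows "((\<lambda>z. representation B (X (x z)) b) \<longlongrightarrow> representation B (X l) b) \<F>"
proof -
  have rep: "representation B (X v) b = (\<Sum>b'\<in>B. representation B v b' * representation B (X b') b)" for v
    by (subst rep_sum[of v]) (simp add: endo_sum[OF X] endo_scale[OF X] rep_sum_fun rep_scale)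
  show ?thesis
    by (subst (1 2) rep) (intro tendsto_intros lim)
qed

end

text \<open>Models the imaginary axis: \<open>f y\<close> is the transported grading at the point
  \<open>\<i> * y\<close>, and \<open>h y\<close> is its conjugate by the exponential of
  \<open>2 * \<i> * y * N\<close>. The symmetry of the projections under \<open>vconj\<close>
  expresses reality of the limit \<open>Y\<close>.\<close>

locale real_frame = frame scale B K \<pi> W F N m
  for scale :: "complex \<Rightarrow> 'v::ab_group_add \<Rightarrow> 'v" (infixr "*\<^sub>C" 75) and B :: "'v set"
    and K and \<pi> :: "int \<times> int \<times> int \<Rightarrow> 'v \<Rightarrow> 'v" and W F N m +
  assumes realN: "N (vconj v) = vconj (N v)"
    and conj_pi: "vconj (\<pi> (k, p, q) v) = \<pi> (k, q, p) (vconj v)"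
  fixes f h :: "real \<Rightarrow> 'v \<Rightarrow> 'v" and y1 :: real
  assumes y1: "y1 > 0"
    and opp: "y \<ge> y1 \<Longrightarrow> opposed (2 * \<i> * complex_of_real y)"
    and f: "y \<ge> y1 \<Longrightarrow> endomorphism (f y)"
    and h: "y \<ge> y1 \<Longrightarrow> h y v = exN (2 * \<i> * complex_of_real y) (f y (exN (- (2 * \<i> * complex_of_real y)) v))"
    and fY: "y \<ge> y1 \<Longrightarrow> supp {\<delta>. fst \<delta> \<le> - 1 \<and> fst (snd \<delta>) \<ge> 0} (\<lambda>v. f y v - Y v)"
    and hY: "y \<ge> y1 \<Longrightarrow> supp {\<delta>. fst \<delta> \<le> - 1 \<and> snd (snd \<delta>) \<ge> 1 + fst \<delta>} (\<lambda>v. h y v - Y v)"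
    and lim: "b \<in> B \<Longrightarrow> ((\<lambda>y. representation B (f y v) b) \<longlongrightarrow> representation B (Y v) b) at_top"
begin

abbreviation S :: "real \<Rightarrow> complex" where "S y \<equiv> 2 * \<i> * complex_of_real y"

lemma S_nonzero: "y \<ge> y1 \<Longrightarrow> S y \<noteq> 0" using y1 by auto

lemma endo_g: "y \<ge> y1 \<Longrightarrow> endomorphism (\<lambda>v. f y v - Y v)"
  using fY supp_endo by blast

lemma lim_cmp:
  assumes b: "b \<in> B"
  shows "((\<lambda>y. representation B (cmp \<delta> (\<lambda>v. f y v - Y v) v) b) \<longlongrightarrow> 0) at_top"
proof -
  have "((\<lambda>y. representation B (\<pi> (i + \<delta>) (f y (\<pi> i v) - Y (\<pi> i v))) b) \<longlongrightarrow> representation B (\<pi> (i + \<delta>) 0) b) at_top" for i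
  proof (rule tendsto_endo[OF endo_pi])
    fix b assume b: "b \<in> B"
    have "((\<lambda>y. representation B (f y (\<pi> i v)) b - representation B (Y (\<pi> i v)) b) \<longlongrightarrow>
      representation B (Y (\<pi> i v)) b - representation B (Y (\<pi> i v)) b) at_top"
      by (intro tendsto_intros lim b)
    then show "((\<lambda>y. representation B (f y (\<pi> i v) - Y (\<pi> i v)) b) \<longlongrightarrow> representation B 0 b) at_top"
      by (simp add: rep_diff rep_zero)
  qed
  then have "((\<lambda>y. \<Sum>i\<in>K. representation B (\<pi> (i + \<delta>) (f y (\<pi> i v) - Y (\<pi> i v))) b) \<longlongrightarrow>
      (\<Sum>i\<in>K. representation B (\<pi> (i + \<delta>) 0) b)) at_top"
    by (rule tendsto_sum)
  then show ?thesis unfolding cmp_def rep_sum_fun by (simp add: rep_zero)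
qed

context
  fixes j :: int
  assumes j: "j \<ge> 1" and lower_good: "\<And>i. 1 \<le> i \<Longrightarrow> i < j \<Longrightarrow> good i"
    and lower_zero: "\<And>y \<delta> v. y \<ge> y1 \<Longrightarrow> fst \<delta> > - j \<Longrightarrow> cmp \<delta> (\<lambda>v. f y v - Y v) v = 0"
begin

text \<open>Existence at the base point for a single component of \<open>N\<close>: decompose minus
  the inhomogeneous term by \<open>opposed_End_sum\<close>. The bound on \<open>c\<close> ensures
  \<open>\<alpha> \<le> c\<close> in every equation, so the number of brackets is never
  negative.\<close>

lemma level_solution:
  assumes c: "c \<ge> d - 1"
  obtains G where "\<And>a. supp {(- j, a, a - d)} (G a)" "\<And>a. a < 0 \<Longrightarrow> G a = (\<lambda>v. 0)"
    "\<And>\<alpha> v. \<alpha> \<le> d - j \<Longrightarrow> (\<Sum>k<2*m. (1 / fact k) *\<^sub>C (nn (S y1) ^^ k) (G (\<alpha> + int k)) v) +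
      (of_int j / fact (nat (c - \<alpha>) + 1)) *\<^sub>C (nn (S y1) ^^ nat (c - \<alpha>)) (\<lambda>v. S y1 *\<^sub>C cmp (- j, c, c - d) N v) v = 0"
proof -
  let ?X = "\<lambda>v. S y1 *\<^sub>C cmp (- j, c, c - d) N v"
  have sX: "supp {(- j, c, c - d)} ?X" by (rule supp_scale[OF supp_cmp[OF endoN]])
  have sXk: "supp {(- j, c - int k, c - d - int k)} ((nn (S y1) ^^ k) ?X)" for k
    unfolding nn_pow by (rule supp_scale[OF supp_br0_pow[OF sX]])
  define C where "C v = - (\<Sum>k<2*m. (of_int j / fact (k + 1)) *\<^sub>C (nn (S y1) ^^ k) ?X v)" for v
  have sC: "supp {\<delta>. fst \<delta> = - j} C"
  proof -
    have "supp {\<delta>. fst \<delta> = - j} (\<lambda>v. (- 1) *\<^sub>C (\<Sum>k<2*m. (of_int j / fact (k + 1)) *\<^sub>C (nn (S y1) ^^ k) ?X v))"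
      by (intro supp_scale supp_sum) (rule supp_mono[OF sXk], auto)
    then show ?thesis unfolding C_def[abs_def] by simp
  qed
  obtain A where A: "supp {\<delta>. fst \<delta> = - j \<and> fst (snd \<delta>) \<ge> 0} A"
    "supp {\<delta>. snd (snd \<delta>) \<ge> 1 - j} (\<lambda>v. ex0 (S y1) (A (ex0 (- S y1) v)) - C v)"
    by (rule opposed_End_sum[OF opp[OF order_refl] sC]) blast
  note eA = supp_endo[OF A(1)]
  show thesis
  proof (rule that[of "\<lambda>a. cmp (- j, a, a - d) A"])
    show "supp {(- j, a, a - d)} (cmp (- j, a, a - d) A)" for a by (rule supp_cmp[OF eA])
    show "cmp (- j, a, a - d) A = (\<lambda>v. 0)" if "a < 0" for a
      using that by (intro ext cmp_zero_of_supp[OF A(1)]) auto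
    fix \<alpha> v assume a: "\<alpha> \<le> d - j"
    have ca: "\<alpha> \<le> c" using a c j by simp
    have "cmp (- j, \<alpha>, \<alpha> - d) (\<lambda>v. ex0 (S y1) (A (ex0 (- S y1) v)) - C v) v = 0"
      using a by (intro cmp_zero_of_supp[OF A(2)]) auto
    moreover have "cmp (- j, \<alpha>, \<alpha> - d) (\<lambda>v. ex0 (S y1) (A (ex0 (- S y1) v))) v
        = (\<Sum>k<2*m. (1 / fact k) *\<^sub>C (nn (S y1) ^^ k) (cmp (- j, \<alpha> + int k, \<alpha> + int k - d) A) v)"
    proof -
      have "(\<lambda>v. ex0 (S y1) (A (ex0 (- S y1) v))) = (\<lambda>v. \<Sum>k<2*m. (S y1 ^ k / fact k) *\<^sub>C (br0 ^^ k) A v)"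
        unfolding ex0_def by (rule ext) (rule nexp_conj_br[OF endo0 nil0 eA])
      moreover have "\<alpha> - d + int k = \<alpha> + int k - d" for k by simp
      ultimately show ?thesis by (simp only: cmp_sum cmp_scale cmp_br0_pow[OF eA] nn_pow) simp
    qed
    moreover have "cmp (- j, \<alpha>, \<alpha> - d) C v
        = - ((of_int j / fact (nat (c - \<alpha>) + 1)) *\<^sub>C (nn (S y1) ^^ nat (c - \<alpha>)) ?X v)"
    proof -
      have "cmp (- j, \<alpha>, \<alpha> - d) C v = - (\<Sum>k<2*m. (of_int j / fact (k + 1)) *\<^sub>C cmp (- j, \<alpha>, \<alpha> - d) ((nn (S y1) ^^ k) ?X) v)"
      proof -
        have "cmp \<delta> (\<lambda>v. - Z v) v = - cmp \<delta> Z v" for \<delta> Z v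
          by (simp add: cmp_def endo_neg[OF endo_pi] sum_negf)
        then show ?thesis unfolding C_def[abs_def] by (simp only: cmp_sum cmp_scale)
      qed
      also have "(\<Sum>k<2*m. (of_int j / fact (k + 1)) *\<^sub>C cmp (- j, \<alpha>, \<alpha> - d) ((nn (S y1) ^^ k) ?X) v)
          = (\<Sum>k<2*m. if k = nat (c - \<alpha>) then (of_int j / fact (nat (c - \<alpha>) + 1)) *\<^sub>C (nn (S y1) ^^ nat (c - \<alpha>)) ?X v else 0)"
        by (rule sum.cong) (use ca in \<open>auto simp: cmp_eq_hom[OF sXk]\<close>)
      also have "\<dots> = (of_int j / fact (nat (c - \<alpha>) + 1)) *\<^sub>C (nn (S y1) ^^ nat (c - \<alpha>)) ?X v"
        using br0_pow_nil[OF sX, of "nat (c - \<alpha>)" v] by (auto simp: nn_pow)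
      finally show ?thesis .
    qed
    ultimately show "(\<Sum>k<2*m. (1 / fact k) *\<^sub>C (nn (S y1) ^^ k) (cmp (- j, \<alpha> + int k, \<alpha> + int k - d) A) v) +
      (of_int j / fact (nat (c - \<alpha>) + 1)) *\<^sub>C (nn (S y1) ^^ nat (c - \<alpha>)) ?X v = 0"
      by (simp add: cmp_diff)
  qed
qed

text \<open>The solution \<open>f y - Y\<close> is a Laurent polynomial in \<open>y\<close> whose coefficients are the solutions
  for the single components of \<open>N\<close>; convergence to zero kills the nonnegative powers.\<close>

lemma type_zero:
  assumes c0: "c0 \<ge> 0"
  shows "cmp (- j, c0, c0 - d) N = (\<lambda>v. 0)"
proof (cases "c0 \<ge> d - 1 \<and> c0 \<le> int m")
  case False
  then consider "c0 < d - 1" | "c0 > int m" by linarith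
  then show ?thesis
  proof cases
    case 1
    then show ?thesis using j by (intro ext cmp_zero_of_supp[OF suppN]) auto
  next
    case 2
    then have "(- j, c0, c0 - d) \<notin> degs" using degs_bound[of "- j" c0 "c0 - d"] c0 by auto
    then show ?thesis using cmp_outside[OF endoN] by blast
  qed
next
  case True
  \<comment> \<open>The first Hodge degrees in which \<open>N\<close> can have a component on this
    diagonal; its second Hodge degree \<open>c - d\<close> is at least \<open>-1\<close>.\<close>
  define C where "C = {max (- int m) (d - 1)..int m}"
  define P where "P c G \<longleftrightarrow> (\<forall>a. supp {(- j, a, a - d)} (G a)) \<and> (\<forall>a<0. G a = (\<lambda>v. 0)) \<and>
    (\<forall>\<alpha>\<le>d - j. \<forall>v. (\<Sum>k<2*m. (1 / fact k) *\<^sub>C (nn (S y1) ^^ k) (G (\<alpha> + int k)) v) +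
      (of_int j / fact (nat (c - \<alpha>) + 1)) *\<^sub>C (nn (S y1) ^^ nat (c - \<alpha>)) (\<lambda>v. S y1 *\<^sub>C cmp (- j, c, c - d) N v) v = 0)"
    for c G
  define G where "G c = (SOME G. P c G)" for c
  have PG: "P c (G c)" if "c \<in> C" for c
  proof -
    have "c \<ge> d - 1" using that by (simp add: C_def)
    then have "\<exists>G. P c G" unfolding P_def by (rule level_solution) blast
    then show ?thesis unfolding G_def by (rule someI_ex)
  qed
  have G: "\<And>c a. c \<in> C \<Longrightarrow> supp {(- j, a, a - d)} (G c a)"
    "\<And>c a. c \<in> C \<Longrightarrow> a < 0 \<Longrightarrow> G c a = (\<lambda>v. 0)"
    "\<And>c \<alpha> v. c \<in> C \<Longrightarrow> \<alpha> \<le> d - j \<Longrightarrow> (\<Sum>k<2*m. (1 / fact k) *\<^sub>C (nn (S y1) ^^ k) (G c (\<alpha> + int k)) v) +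
      (of_int j / fact (nat (c - \<alpha>) + 1)) *\<^sub>C (nn (S y1) ^^ nat (c - \<alpha>)) (\<lambda>v. S y1 *\<^sub>C cmp (- j, c, c - d) N v) v = 0"
    using PG unfolding P_def by blast+
  \<comment> \<open>Passing from \<open>y1\<close> to \<open>y1 * t\<close> multiplies the operator
    by \<open>t\<close>. The powers \<open>1 + c - a\<close> compensate for this exactly, and
    \<open>opp\<close> makes the solution unique.\<close>
  have sol: "cmp (- j, a, a - d) (\<lambda>v. f (y1 * t) v - Y v) v = (\<Sum>c\<in>C. complex_of_real t powi (1 + c - a) *\<^sub>C G c a v)"
    if t: "t \<ge> 1" for t a v
  proof -
    let ?y = "y1 * t" and ?t = "complex_of_real t"
    have y: "?y \<ge> y1" using t y1 by simp
    have t0: "?t \<noteq> 0" using t by auto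
    have Sy: "S ?y = ?t * S y1" by simp
    let ?g = "\<lambda>v. f ?y v - Y v"
    interpret L: lefschetz "\<lambda>c X v. c *\<^sub>C X v" "nn (S ?y)" "\<lambda>a. {X. supp {(- j, a, a - d)} X}" "d - j" "2 * m"
      by (rule lefschetz_frame[OF opp[OF y]])
    let ?u = "\<lambda>a v. cmp (- j, a, a - d) ?g v - (\<Sum>c\<in>C. ?t powi (1 + c - a) *\<^sub>C G c a v)"
    have "?u a = 0"
    proof (rule L.opp[of ?u 0])
      show "?u a \<in> {X. supp {(- j, a, a - d)} X}" for a
        by (simp, intro supp_diff supp_cmp[OF endo_g[OF y]] supp_sum supp_scale G(1))
      show "?u a = 0" if "a < 0" for a
        using cmp_zero_of_supp[OF fY[OF y], of "(- j, a, a - d)"] G(2) that by (auto simp: zero_fun_def intro!: sum.neutral)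
      fix \<alpha> assume a: "\<alpha> \<le> d - j - 0"
      show "(\<Sum>k<2*m. (\<lambda>v. (1 / fact k) *\<^sub>C (nn (S ?y) ^^ k) (?u (\<alpha> + int k)) v)) = 0"
      proof
        fix v
        let ?E = "\<lambda>u. \<Sum>k<2*m. (1 / fact k) *\<^sub>C (nn (S ?y) ^^ k) (u (\<alpha> + int k)) v"
        let ?X = "\<lambda>c. (of_int j / fact (nat (c - \<alpha>) + 1)) *\<^sub>C
          (nn (S ?y) ^^ nat (c - \<alpha>)) (\<lambda>v. S ?y *\<^sub>C cmp (- j, c, c - d) N v) v"
        have br_diff: "(br0 ^^ k) (\<lambda>v. P v - Q v) = (\<lambda>v. (br0 ^^ k) P v - (br0 ^^ k) Q v)" for k P Q
          using br_pow_add[OF endo0, of k P "\<lambda>v. (- 1) *\<^sub>C Q v", unfolded br_pow_scale[OF endo0]] by simp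
        have 1: "?E (\<lambda>a. cmp (- j, a, a - d) ?g) + (\<Sum>c\<in>{- int m..int m}. ?X c) = 0"
          using fun_cong[OF level_eq_fun[OF f[OF y] h[OF y] fY[OF y] hY[OF y] j lower_good lower_zero[OF y], of \<alpha> d], of v] a
          by (simp add: fun_sum_apply)
        have 2: "(\<Sum>c\<in>{- int m..int m}. ?X c) = (\<Sum>c\<in>C. ?X c)"
        proof (rule sum.mono_neutral_right)
          show "\<forall>c\<in>{- int m..int m} - C. ?X c = 0"
          proof
            fix c assume "c \<in> {- int m..int m} - C"
            then have "c < d - 1" by (auto simp: C_def)
            then have "cmp (- j, c, c - d) N = (\<lambda>v. 0)"
              using j by (intro ext cmp_zero_of_supp[OF suppN]) auto
            then show "?X c = 0" by (simp add: nn_pow br_pow_scale[OF endo0] br_pow_zero[OF endo0])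
          qed
        qed (auto simp: C_def)
        have 3: "?E (\<lambda>a v. ?t powi (1 + c - a) *\<^sub>C G c a v) = - ?X c" if c: "c \<in> C" for c
        proof -
          have ca: "c \<ge> \<alpha>" using c a j by (auto simp: C_def)
          have "(1 / fact k) *\<^sub>C (nn (S ?y) ^^ k) (\<lambda>v. ?t powi (1 + c - (\<alpha> + int k)) *\<^sub>C G c (\<alpha> + int k) v) v
              = ?t powi (1 + c - \<alpha>) *\<^sub>C (1 / fact k) *\<^sub>C (nn (S y1) ^^ k) (G c (\<alpha> + int k)) v" for k
          proof -
            have "?t powi (1 + c - (\<alpha> + int k)) * ?t ^ k = ?t powi (1 + c - \<alpha>)"
            proof -
              have e: "1 + c - \<alpha> = (1 + c - (\<alpha> + int k)) + int k" by simp
              show ?thesis by (subst e) (simp only: power_int_add[OF disjI1[OF t0]] power_int_of_nat)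
            qed
            then have "S ?y ^ k * ?t powi (1 + c - (\<alpha> + int k)) = ?t powi (1 + c - \<alpha>) * S y1 ^ k"
              unfolding Sy power_mult_distrib by (simp add: mult_ac)
            then show ?thesis
              by (simp add: nn_pow br_pow_scale[OF endo0] mult_ac del: of_real_mult)
          qed
          then have "?E (\<lambda>a v. ?t powi (1 + c - a) *\<^sub>C G c a v)
              = ?t powi (1 + c - \<alpha>) *\<^sub>C (\<Sum>k<2*m. (1 / fact k) *\<^sub>C (nn (S y1) ^^ k) (G c (\<alpha> + int k)) v)"
            by (simp add: scale_sum_right)
          also have "(\<Sum>k<2*m. (1 / fact k) *\<^sub>C (nn (S y1) ^^ k) (G c (\<alpha> + int k)) v)
            = - ((of_int j / fact (nat (c - \<alpha>) + 1)) *\<^sub>C (nn (S y1) ^^ nat (c - \<alpha>)) (\<lambda>v. S y1 *\<^sub>C cmp (- j, c, c - d) N v) v)"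
            using G(3)[OF c, of \<alpha> v] a by (simp add: eq_neg_iff_add_eq_0)
          also have "?t powi (1 + c - \<alpha>) *\<^sub>C - ((of_int j / fact (nat (c - \<alpha>) + 1)) *\<^sub>C (nn (S y1) ^^ nat (c - \<alpha>)) (\<lambda>v. S y1 *\<^sub>C cmp (- j, c, c - d) N v) v) = - ?X c"
          proof -
            have "?t powi (1 + c - \<alpha>) = ?t ^ (nat (c - \<alpha>) + 1)"
            proof -
              have "1 + c - \<alpha> = int (nat (c - \<alpha>) + 1)" using ca by simp
              then show ?thesis by (simp only: power_int_of_nat)
            qed
            then have "?t powi (1 + c - \<alpha>) * S y1 ^ (nat (c - \<alpha>) + 1) = S ?y ^ (nat (c - \<alpha>) + 1)"
              unfolding Sy power_mult_distrib by simp
            then have "?t powi (1 + c - \<alpha>) * (S y1 * S y1 ^ nat (c - \<alpha>)) = S ?y * S ?y ^ nat (c - \<alpha>)"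
              by simp
            then show ?thesis
              by (simp add: nn_pow br_pow_scale[OF endo0] mult_ac del: of_real_mult)
          qed
          finally show ?thesis .
        qed
        have "(\<Sum>k<2*m. (\<lambda>v. (1 / fact k) *\<^sub>C (nn (S ?y) ^^ k) (?u (\<alpha> + int k)) v)) v
            = ?E (\<lambda>a. cmp (- j, a, a - d) ?g) - (\<Sum>c\<in>C. ?E (\<lambda>a v. ?t powi (1 + c - a) *\<^sub>C G c a v))"
          unfolding fun_sum_apply nn_pow br_diff br_pow_sum[OF endo0] scale_right_diff_distrib sum_subtractf
            scale_sum_right
          by (subst (2) sum.swap) simp
        also have "\<dots> = ?E (\<lambda>a. cmp (- j, a, a - d) ?g) + (\<Sum>c\<in>C. ?X c)"
        proof -
          have 4: "(\<Sum>c\<in>C. ?E (\<lambda>a v. ?t powi (1 + c - a) *\<^sub>C G c a v)) = - (\<Sum>c\<in>C. ?X c)"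
            unfolding sum_negf[symmetric] by (rule sum.cong[OF refl 3])
          show ?thesis unfolding 4 by (rule diff_minus_eq_add)
        qed
        also have "\<dots> = 0" using 1 2 by simp
        finally show "(\<Sum>k<2*m. (\<lambda>v. (1 / fact k) *\<^sub>C (nn (S ?y) ^^ k) (?u (\<alpha> + int k)) v)) v = 0 v" by simp
      qed
    qed
    from fun_cong[OF this, of v] show ?thesis by simp
  qed
  \<comment> \<open>For \<open>a \<le> c + 1\<close> the exponent \<open>1 + c - a\<close> is
    nonnegative, and for fixed \<open>a\<close> distinct \<open>c\<close> have distinct exponents,
    so the limit zero reaches each \<open>G c a\<close> separately.\<close>
  have G0: "G c a = (\<lambda>v. 0)" if c: "c \<in> C" and ac: "a \<le> c + 1" for c a
  proof
    fix v
    show "G c a v = 0"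
    proof (rule rep_eqI)
      fix b assume b: "b \<in> B"
      have "((\<lambda>t. representation B (cmp (- j, a, a - d) (\<lambda>v. f (y1 * t) v - Y v) v) b) \<longlongrightarrow> 0) at_top"
        by (rule filterlim_compose[OF lim_cmp[OF b]])
          (rule filterlim_tendsto_pos_mult_at_top[OF tendsto_const y1 filterlim_ident])
      then have "((\<lambda>t. \<Sum>c\<in>C. complex_of_real t powi (1 + c - a) * representation B (G c a v) b) \<longlongrightarrow> 0) at_top"
        by (rule Lim_transform_eventually)
          (use eventually_ge_at_top[of 1] in \<open>eventually_elim, simp add: sol rep_sum_fun rep_scale\<close>)
      moreover have "(\<Sum>c\<in>C. complex_of_real t powi (1 + c - a) * representation B (G c a v) b)
          = (\<Sum>i\<in>(\<lambda>c. 1 + c - a) ` C. complex_of_real t powi i * representation B (G (i - 1 + a) a v) b)" for t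
        by (subst sum.reindex) (auto simp: inj_on_def)
      ultimately have "((\<lambda>t. \<Sum>i\<in>(\<lambda>c. 1 + c - a) ` C. complex_of_real t powi i * representation B (G (i - 1 + a) a v) b) \<longlongrightarrow> 0) at_top"
        by simp
      then have "representation B (G ((1 + c - a) - 1 + a) a v) b = 0"
        by (rule laurent_coeff_zero[rotated]) (use c ac in \<open>auto simp: C_def\<close>)
      then show "representation B (G c a v) b = representation B 0 b" by (simp add: rep_zero)
    qed
  qed
  have c0C: "c0 \<in> C" using True c0 by (auto simp: C_def)
  interpret L: lefschetz "\<lambda>c X v. c *\<^sub>C X v" "nn (S y1)" "\<lambda>a. {X. supp {(- j, a, a - d)} X}" "d - j" "2 * m"
    by (rule lefschetz_frame[OF opp[OF order_refl]])
  have "(\<lambda>v. S y1 *\<^sub>C cmp (- j, c0, c0 - d) N v) = 0"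
  proof (rule L.solution_high_zero[OF c0, where j = "of_int j" and G = "G c0"])
    show "d - j \<le> c0" using True j by simp
    show "(\<lambda>v. S y1 *\<^sub>C cmp (- j, c0, c0 - d) N v) \<in> {X. supp {(- j, c0, c0 - d)} X}"
      using supp_scale[OF supp_cmp[OF endoN]] by simp
    show "complex_of_int j \<noteq> 0" using j by simp
    show "G c0 a \<in> {X. supp {(- j, a, a - d)} X}" for a using G(1)[OF c0C] by simp
    show "G c0 a = 0" if "a \<le> c0 + 1" for a using G0[OF c0C that] by (simp add: zero_fun_def)
    show "L.ex (G c0) \<alpha> + (\<lambda>v. (of_int j / fact (nat (c0 - \<alpha>) + 1)) *\<^sub>C
      (nn (S y1) ^^ nat (c0 - \<alpha>)) (\<lambda>v. S y1 *\<^sub>C cmp (- j, c0, c0 - d) N v) v) = 0" if "\<alpha> \<le> d - j" for \<alpha>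
      using G(3)[OF c0C that] by (auto simp: L.ex_def fun_eq_iff fun_sum_apply)
  qed
  then show ?thesis using S_nonzero[OF order_refl] by (auto simp: fun_eq_iff)
qed

text \<open>Reality of \<open>N\<close> and of the frame exchanges the two Hodge degrees, so that
  vanishing for \<open>a \<ge> 0\<close> also yields vanishing for \<open>b \<ge> 0\<close>.\<close>

lemma cmp_conj: "cmp (- j, a, b) N v = vconj (cmp (- j, b, a) N (vconj v))"
proof -
  have "cmp (- j, a, b) N v = vconj (cmp (- j, b, a) N (vconj v))"
  proof (rule endo_eqI[OF endo_cmp[OF endoN] endo_vconj[OF endo_cmp[OF endoN]]])
    fix i :: "int \<times> int \<times> int" and v
    obtain k p q where i: "i = (k, p, q)" by (cases i)
    have "vconj (\<pi> i v) = \<pi> (k, q, p) (vconj v)" unfolding i by (rule conj_pi)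
    then have "vconj (cmp (- j, b, a) N (vconj (\<pi> i v))) = vconj (\<pi> ((k, q, p) + (- j, b, a)) (N (\<pi> (k, q, p) (vconj v))))"
      by (simp add: cmp_pi[OF endoN])
    also have "\<dots> = \<pi> (i + (- j, a, b)) (vconj (N (\<pi> (k, q, p) (vconj v))))"
      unfolding i by (simp add: conj_pi)
    also have "vconj (N (\<pi> (k, q, p) (vconj v))) = N (\<pi> i v)"
      unfolding i realN[symmetric] conj_pi by simp
    finally show "cmp (- j, a, b) N (\<pi> i v) = vconj (cmp (- j, b, a) N (vconj (\<pi> i v)))"
      by (simp add: cmp_pi[OF endoN])
  qed
  then show ?thesis .
qed

lemma type_all:
  assumes "(a, b) \<noteq> (- 1, - 1)"
  shows "cmp (- j, a, b) N = (\<lambda>v. 0)"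
proof -
  have 1: "cmp (- j, a, b) N = (\<lambda>v. 0)" if "a \<ge> 0" for a b
    using type_zero[OF that, of "a - b"] by simp
  consider "a \<ge> 0" | "b \<ge> 0" | "a < - 1 \<or> b < - 1" using assms by fastforce
  then show ?thesis
  proof cases
    case 2
    then show ?thesis using 1[of b a] by (intro ext) (simp add: cmp_conj[of a b])
  next
    case 3
    then show ?thesis using j by (intro ext cmp_zero_of_supp[OF suppN]) auto
  qed (rule 1)
qed

text \<open>The \<open>j\<close>-fold bracket of \<open>T y\<close> with \<open>N0\<close> does not
  depend on \<open>y\<close>, so by \<open>highest_unique\<close> neither does \<open>T y\<close>;
  since \<open>f y - Y\<close> tends to zero, so does this constant.\<close>

lemma level_good: "good j \<and> (\<forall>y\<ge>y1. \<forall>a b v. cmp (- j, a, b) (\<lambda>v. f y v - Y v) v = 0)"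
proof -
  define P where "P y T \<longleftrightarrow> supp {(- j, 0, 0)} T \<and>
    cmp (- j, 0, 0) (\<lambda>v. f y v - Y v) = (\<lambda>v. (- of_int j) *\<^sub>C T v) \<and>
    (br0 ^^ nat (j - 1)) (cmp (- j, - 1, - 1) N) = (br0 ^^ nat j) T \<and>
    (\<forall>a b. (a, b) \<noteq> (0, 0) \<longrightarrow> cmp (- j, a, b) (\<lambda>v. f y v - Y v) = (\<lambda>v. 0))" for y T
  have exT: "\<exists>T. P y T" if y: "y \<ge> y1" for y
    unfolding P_def
    by (rule level_step[OF f[OF y] h[OF y] fY[OF y] hY[OF y] j lower_good lower_zero[OF y] opp[OF y] S_nonzero[OF y] type_all])
      blast+
  define T where "T y = (SOME T. P y T)" for y
  have PT: "P y (T y)" if "y \<ge> y1" for y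
    unfolding T_def by (rule someI_ex[OF exT[OF that]])
  have T: "\<And>y. y \<ge> y1 \<Longrightarrow> supp {(- j, 0, 0)} (T y)"
    "\<And>y. y \<ge> y1 \<Longrightarrow> cmp (- j, 0, 0) (\<lambda>v. f y v - Y v) = (\<lambda>v. (- of_int j) *\<^sub>C T y v)"
    "\<And>y. y \<ge> y1 \<Longrightarrow> (br0 ^^ nat (j - 1)) (cmp (- j, - 1, - 1) N) = (br0 ^^ nat j) (T y)"
    "\<And>y a b. y \<ge> y1 \<Longrightarrow> (a, b) \<noteq> (0, 0) \<Longrightarrow> cmp (- j, a, b) (\<lambda>v. f y v - Y v) = (\<lambda>v. 0)"
    using PT unfolding P_def by blast+
  have const: "T y = T y1" if y: "y \<ge> y1" for y
  proof -
    have "(br0 ^^ nat j) (\<lambda>v. T y v + (- 1) *\<^sub>C T y1 v) = (\<lambda>v. 0)"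
      using T(3)[OF y] T(3)[OF order_refl]
      unfolding br_pow_add[OF endo0] br_pow_scale[OF endo0] by simp
    then have "(\<lambda>v. T y v + (- 1) *\<^sub>C T y1 v) = (\<lambda>v. 0)"
      by (rule highest_unique[OF opp[OF order_refl] S_nonzero[OF order_refl] j
            supp_add[OF T(1)[OF y] supp_scale[OF T(1)[OF order_refl]]]])
    then show ?thesis by (auto simp: fun_eq_iff)
  qed
  have T0: "T y1 = (\<lambda>v. 0)"
  proof
    fix v
    have "(- of_int j) *\<^sub>C T y1 v = 0"
    proof (rule rep_eqI)
      fix b assume b: "b \<in> B"
      have "((\<lambda>y::real. representation B ((- of_int j) *\<^sub>C T y1 v) b) \<longlongrightarrow> 0) at_top"
        by (rule Lim_transform_eventually[OF lim_cmp[OF b, of "(- j, 0, 0)" v]])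
          (rule eventually_mono[OF eventually_ge_at_top[of y1]], simp only: T(2) const[symmetric])
      then have "0 = representation B ((- of_int j) *\<^sub>C T y1 v) b"
        by (simp add: tendsto_const_iff)
      then show "representation B ((- of_int j) *\<^sub>C T y1 v) b = representation B 0 b"
        by (simp add: rep_zero)
    qed
    then show "T y1 v = 0" using j by auto
  qed
  have "good j"
    using T(3)[OF order_refl] type_all unfolding good_def T0 by (simp add: br_pow_zero[OF endo0])
  moreover have "cmp (- j, a, b) (\<lambda>v. f y v - Y v) v = 0" if "y \<ge> y1" for y a b v
    using T(2,4)[OF that] const[OF that] T0 by (cases "(a, b) = (0, 0)") auto
  ultimately show ?thesis by blast
qed

end

lemma N_type:
  assumes j: "j \<ge> 1" and ab: "(a, b) \<noteq> (- 1, - 1)"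
  shows "cmp (- j, a, b) N = (\<lambda>v. 0)"
proof -
  have *: "(\<forall>y \<delta> v. y \<ge> y1 \<longrightarrow> fst \<delta> > - 1 - int n \<longrightarrow> cmp \<delta> (\<lambda>v. f y v - Y v) v = 0) \<and>
    (\<forall>i. 1 \<le> i \<and> i < 1 + int n \<longrightarrow> good i)" for n
  proof (induction n)
    case 0
    have "cmp \<delta> (\<lambda>v. f y v - Y v) v = 0" if "y \<ge> y1" "fst \<delta> > - 1" for y \<delta> v
      by (rule cmp_zero_of_supp[OF fY[OF that(1)]]) (use that in auto)
    then show ?case by auto
  next
    case (Suc n)
    define i where "i = 1 + int n"
    have i: "i \<ge> 1" by (simp add: i_def)
    have low: "cmp \<delta> (\<lambda>v. f y v - Y v) v = 0" if "y \<ge> y1" "fst \<delta> > - i" for y \<delta> v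
    proof -
      have "fst \<delta> > - 1 - int n" using that by (simp add: i_def)
      then show ?thesis using Suc that by blast
    qed
    have g: "good i'" if "1 \<le> i'" "i' < i" for i' using Suc that by (auto simp: i_def)
    note lev = level_good[OF i g low]
    show ?case
    proof (intro conjI allI impI)
      fix y v and \<delta> :: "int \<times> int \<times> int" assume y: "y \<ge> y1" and d: "fst \<delta> > - 1 - int (Suc n)"
      obtain l a b where \<delta>: "\<delta> = (l, a, b)" by (cases \<delta>)
      have z: "cmp (- i, a, b) (\<lambda>v. f y v - Y v) v = 0" using lev y by blast
      show "cmp \<delta> (\<lambda>v. f y v - Y v) v = 0"
        using low[OF y, of \<delta> v] z d unfolding \<delta> i_def by (cases "l = - 1 - int n") auto
    next
      fix i' assume "1 \<le> i' \<and> i' < 1 + int (Suc n)"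
      then show "good i'" using g lev by (cases "i' = i") (auto simp: i_def)
    qed
  qed
  have "good j" using *[of "nat j"] j by auto
  then show ?thesis using ab by (simp add: good_def)
qed

end


section \<open>The weight filtration by total Hodge degree\<close>

context frame
begin

text \<open>The candidate for the relative weight filtration. The index \<open>k\<close> of the
  grading of \<open>W\<close> is deliberately ignored.\<close>

definition M :: "int \<Rightarrow> 'v set" where
  "M l = {v. \<forall>i. fst (snd i) + snd (snd i) > l \<longrightarrow> \<pi> i v = 0}"

lemma subM: "subspace (M l)" unfolding M_def by (rule sub_pi)

lemma M_iff: "v \<in> M l \<longleftrightarrow> (\<forall>i. fst (snd i) + snd (snd i) > l \<longrightarrow> \<pi> i v = 0)"
  by (simp only: M_def mem_Collect_eq)

lemma M_bounds: "\<exists>l. M l = {0}" "\<exists>l. M l = UNIV"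
proof -
  let ?w = "\<lambda>i :: int \<times> int \<times> int. fst (snd i) + snd (snd i)"
  have *: "Min (insert 0 (?w ` K)) \<le> ?w i" "?w i \<le> Max (insert 0 (?w ` K))" if "i \<in> K" for i
    using finK that by (auto intro!: Min_le Max_ge)
  have "v = 0" if "v \<in> M (Min (insert 0 (?w ` K)) - 1)" for v
  proof (rule pi_eqI)
    fix i show "\<pi> i v = \<pi> i 0"
    proof (cases "i \<in> K")
      case True
      from *(1)[OF this] have "?w i > Min (insert 0 (?w ` K)) - 1" by linarith
      then show ?thesis using that unfolding M_iff pi_zero by blast
    qed (simp add: pi_outside)
  qed
  then show "\<exists>l. M l = {0}" using subspace_0[OF subM] by blast
  have "v \<in> M (Max (insert 0 (?w ` K)))" for v
    unfolding M_iff using *(2) pi_outside by (meson not_less)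
  then show "\<exists>l. M l = UNIV" by blast
qed

lemma M_increasing: "increasing_filtration {0} UNIV M"
  unfolding increasing_filtration_def mono_def
  using subM subspace_0[OF subM] M_bounds by (auto simp: M_def)

definition I :: "int \<Rightarrow> int \<Rightarrow> 'v set" where
  "I p q = {v. \<forall>i. snd i \<noteq> (p, q) \<longrightarrow> \<pi> i v = 0}"

lemma subI: "subspace (I p q)" unfolding I_def by (rule sub_pi)

lemma bispan_I: "bispan {0} I P = {v. \<forall>i. snd i \<notin> P \<longrightarrow> \<pi> i v = 0}" (is "_ = ?R")
proof
  show "bispan {0} I P \<subseteq> ?R"
  proof (rule bispan_least)
    show "subspace ?R" by (rule sub_pi)
    show "{0} \<subseteq> ?R" by simp
    show "I a b \<subseteq> ?R" if "(a, b) \<in> P" for a b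
          proof
      fix x assume x: "x \<in> I a b"
      have "\<pi> i x = 0" if "snd i \<notin> P" for i
      proof -
        have "snd i \<noteq> (a, b)" using that \<open>(a, b) \<in> P\<close> by metis
        then show ?thesis using x unfolding I_def by blast
      qed
      then show "x \<in> ?R" by blast
    qed
  qed
  show "?R \<subseteq> bispan {0} I P"
  proof
    fix v assume v: "v \<in> ?R"
    have "(\<Sum>i\<in>K. \<pi> i v) \<in> bispan {0} I P"
    proof (rule module.subspace_sum[OF module_axioms subspace_bispan])
      fix i
      show "\<pi> i v \<in> bispan {0} I P"
      proof (cases "snd i \<in> P")
        case True
        then have "(fst (snd i), snd (snd i)) \<in> P" by simp
        then show ?thesis by (rule bispan_base) (auto simp: I_def pi_pi)
      next
        case False
        then have "\<pi> i v = 0" using v by blast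
        then show ?thesis using subspace_0[OF subspace_bispan] by simp
      qed
    qed
    then show "v \<in> bispan {0} I P" unfolding pi_total .
  qed
qed

context
  assumes conj_pi: "\<And>k p q v. vconj (\<pi> (k, p, q) v) = \<pi> (k, q, p) (vconj v)"
    and decF: "decreasing_filtration {0} UNIV F"
begin

lemma pi_vconj: "\<pi> i (vconj v) = 0 \<longleftrightarrow> \<pi> (fst i, snd (snd i), fst (snd i)) v = 0"
proof -
  have "\<pi> i (vconj v) = vconj (\<pi> (fst i, snd (snd i), fst (snd i)) v)" by (simp add: conj_pi)
  then show ?thesis by (metis vconj_vconj vconj_zero)
qed

lemma conj_I: "vconj ` I p q = I q p"
proof -
  have "v \<in> vconj ` I p q \<longleftrightarrow> v \<in> I q p" for v
  proof -
    have "v \<in> vconj ` I p q \<longleftrightarrow> (\<forall>i. snd i \<noteq> (p, q) \<longrightarrow> \<pi> (fst i, snd (snd i), fst (snd i)) v = 0)"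
      by (simp only: mem_vconj_image I_def mem_Collect_eq pi_vconj)
    also have "\<dots> \<longleftrightarrow> v \<in> I q p" by (auto simp: I_def)
    finally show ?thesis .
  qed
  then show ?thesis by blast
qed

lemma conj_M: "vconj ` M l = M l"
proof -
  have "v \<in> vconj ` M l \<longleftrightarrow> v \<in> M l" for v
  proof -
    have "v \<in> vconj ` M l \<longleftrightarrow> (\<forall>i. fst (snd i) + snd (snd i) > l \<longrightarrow> \<pi> (fst i, snd (snd i), fst (snd i)) v = 0)"
      by (simp only: mem_vconj_image M_def mem_Collect_eq pi_vconj)
    also have "\<dots> \<longleftrightarrow> v \<in> M l" by (auto simp: M_def add.commute)
    finally show ?thesis .
  qed
  then show ?thesis by blast
qed

lemma mono_M: "k \<le> l \<Longrightarrow> M k \<subseteq> M l" by (auto simp: M_def)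

lemma Gr_M: "Gr_filtration F M l p = subspace_sum (F p \<inter> M l) (M (l - 1))"
  unfolding Gr_filtration_def induced_filtration_def ..

lemma conj_Gr_M: "vconj ` Gr_filtration F M l q = subspace_sum (Fb q \<inter> M l) (M (l - 1))"
proof -
  have "vconj ` (F q \<inter> M l) = Fb q \<inter> M l"
  proof -
    have "inj vconj" by (simp add: inj_def)
    then show ?thesis by (simp add: image_Int Fb_def conj_M)
  qed
  then show ?thesis unfolding Gr_M vconj_subspace_sum conj_M by simp
qed

text \<open>\<open>F\<close>, its conjugate and \<open>M\<close> are all cut out by the same
  projections, so opposedness reduces to inequalities between \<open>p\<close>, \<open>q\<close> and
  \<open>l\<close>.\<close>

lemma pure_M: "pure_hodge_structure (M (l - 1)) (M l) l (Gr_filtration F M l)"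
proof -
  have sG: "subspace (Gr_filtration F M l p)" for p
    unfolding Gr_M by (intro subspace_subspace_sum subspace_inter subF subM)
  have le: "M (l - 1) \<subseteq> M l" by (rule mono_M) simp
  obtain p0 where p0: "F p0 = {0}" using decF unfolding decreasing_filtration_def by blast
  obtain p1 where p1: "F p1 = UNIV" using decF unfolding decreasing_filtration_def by blast
  have hi: "Gr_filtration F M l p0 = M (l - 1)"
    unfolding Gr_M p0 using subspace_0[OF subM] subspace_0[OF subM]
    by (intro subspace_sum_absorb subM) auto
  have lo: "Gr_filtration F M l p1 = M l"
    unfolding Gr_M p1 using subspace_sum_upper1[OF subM, of "M l" "l - 1"] subspace_sum_least[OF subM order_refl le] by auto
  have dec: "decreasing_filtration (M (l - 1)) (M l) (Gr_filtration F M l)"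
    unfolding decreasing_filtration_def
  proof (intro conjI allI)
    show "M (l - 1) \<subseteq> Gr_filtration F M l p" for p
      unfolding Gr_M by (rule subspace_sum_upper2[OF subspace_inter[OF subF subM]])
    show "Gr_filtration F M l p \<subseteq> M l" for p
      unfolding Gr_M by (rule subspace_sum_least[OF subM _ le]) blast
    show "antimono (Gr_filtration F M l)"
      unfolding antimono_def Gr_M using antiF by (intro allI impI subspace_sum_mono) auto
  qed (use sG hi lo in blast)+
  have "Gr_filtration F M l p \<inter> vconj ` Gr_filtration F M l (l - p + 1) = M (l - 1)" for p
  proof
    show "M (l - 1) \<subseteq> Gr_filtration F M l p \<inter> vconj ` Gr_filtration F M l (l - p + 1)"
      unfolding conj_Gr_M unfolding Gr_M
      using subspace_sum_upper2[OF subspace_inter[OF subF subM]] subspace_sum_upper2[OF subspace_inter[OF subFb subM]] by blast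
    show "Gr_filtration F M l p \<inter> vconj ` Gr_filtration F M l (l - p + 1) \<subseteq> M (l - 1)"
    proof
      fix x assume x: "x \<in> Gr_filtration F M l p \<inter> vconj ` Gr_filtration F M l (l - p + 1)"
      then obtain f w where fw: "f \<in> F p" "f \<in> M l" "w \<in> M (l - 1)" "x = f + w"
        unfolding Gr_M by (auto elim!: subspace_sumE)
      obtain f' w' where fw': "f' \<in> Fb (l - p + 1)" "f' \<in> M l" "w' \<in> M (l - 1)" "x = f' + w'"
        using x unfolding conj_Gr_M by (auto elim!: subspace_sumE)
      have "\<pi> i x = 0" if i: "fst (snd i) + snd (snd i) > l - 1" for i
      proof -
        have w0: "\<pi> i w = 0" "\<pi> i w' = 0" using fw(3) fw'(3) i unfolding M_iff by blast+
        consider "fst (snd i) + snd (snd i) > l" | "fst (snd i) < p" | "snd (snd i) < l - p + 1"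
          using i by linarith
        then show ?thesis
        proof cases
          case 1
          then have "\<pi> i f = 0" using fw(2) unfolding M_iff by blast
          then show ?thesis using fw(4) w0 by (simp add: pi_add)
        next
          case 2
          then have "\<pi> i f = 0" using fw(1) unfolding F_iff by blast
          then show ?thesis using fw(4) w0 by (simp add: pi_add)
        next
          case 3
          then have "\<pi> i f' = 0" using fw'(1) unfolding Fb_iff' by blast
          then show ?thesis using fw'(4) w0 by (simp add: pi_add)
        qed
      qed
      then show "x \<in> M (l - 1)" unfolding M_iff by blast
    qed
  qed
  moreover have "subspace_sum (Gr_filtration F M l p) (vconj ` Gr_filtration F M l (l - p + 1)) = M l" for p
  proof
    show "subspace_sum (Gr_filtration F M l p) (vconj ` Gr_filtration F M l (l - p + 1)) \<subseteq> M l"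
      unfolding conj_Gr_M unfolding Gr_M
      by (intro subspace_sum_least subM le) auto
    show "M l \<subseteq> subspace_sum (Gr_filtration F M l p) (vconj ` Gr_filtration F M l (l - p + 1))"
    proof
      fix v assume v: "v \<in> M l"
      let ?S = "subspace_sum (Gr_filtration F M l p) (vconj ` Gr_filtration F M l (l - p + 1))"
      have sS: "subspace ?S" by (intro subspace_subspace_sum sG subspace_vconj)
      have 1: "F p \<inter> M l \<subseteq> ?S"
        using subspace_sum_upper1[OF subM] subspace_sum_upper1[OF subspace_vconj[OF sG]] unfolding Gr_M by blast
      have 2: "Fb (l - p + 1) \<inter> M l \<subseteq> ?S"
        using subspace_sum_upper1[OF subM, of "Fb (l - p + 1) \<inter> M l" "l - 1"]
          subspace_sum_upper2[OF sG, of "vconj ` Gr_filtration F M l (l - p + 1)" p]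
        unfolding conj_Gr_M by blast
      have 3: "M (l - 1) \<subseteq> ?S"
        using subspace_sum_upper2[OF subspace_inter[OF subF subM]] subspace_sum_upper1[OF subspace_vconj[OF sG]]
        unfolding Gr_M by blast
      have "(\<Sum>i\<in>K. \<pi> i v) \<in> ?S"
      proof (rule module.subspace_sum[OF module_axioms sS])
        fix i
        have piM: "\<pi> i v \<in> M (fst (snd i) + snd (snd i))" by (auto simp: M_def pi_pi)
        consider "fst (snd i) + snd (snd i) > l" | "fst (snd i) + snd (snd i) \<le> l" "fst (snd i) \<ge> p"
          | "fst (snd i) + snd (snd i) \<le> l" "snd (snd i) \<ge> l - p + 1" | "fst (snd i) + snd (snd i) \<le> l - 1"
          by linarith
        then show "\<pi> i v \<in> ?S"
        proof cases
          case 1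
          then have "\<pi> i v = 0" using v unfolding M_iff by blast
          then show ?thesis using subspace_0[OF sS] by simp
        next
          case c: 2
          then have "\<pi> i v \<in> F p \<inter> M l" using piM pi_F antiF mono_M by blast
          then show ?thesis using 1 by blast
        next
          case c: 3
          then have "\<pi> i v \<in> Fb (l - p + 1) \<inter> M l" using piM pi_Fb antiFb mono_M by blast
          then show ?thesis using 2 by blast
        next
          case 4
          then have "\<pi> i v \<in> M (l - 1)" using piM mono_M by blast
          then show ?thesis using 3 by blast
        qed
      qed
      then show "v \<in> ?S" unfolding pi_total .
    qed
  qed
  ultimately show ?thesis unfolding pure_hodge_structure_def using dec by blast
qed

lemma mhs_M: "mixed_hodge_structure {0} UNIV F M"
  unfolding mixed_hodge_structure_def using decF M_increasing conj_M pure_M by blast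

lemma bigrading_I: "is_deligne_bigrading {0} UNIV F M I"
  unfolding is_deligne_bigrading_def
proof (intro conjI allI impI)
  show "bispan {0} I UNIV = UNIV" unfolding bispan_I by simp
  show "F p = bispan {0} I {(a, b). p \<le> a}" for p
    unfolding bispan_I using F_iff[of _ p] by (auto simp: case_prod_beta)
  show "M k = bispan {0} I {(a, b). a + b \<le> k}" for k
    unfolding bispan_I using M_iff[of _ k] by (auto simp: case_prod_beta)
  show "subspace_sum (vconj ` I p q) (bispan {0} I {(r, s). r < q \<and> s < p}) =
            subspace_sum (I q p) (bispan {0} I {(r, s). r < q \<and> s < p})" for p q
    unfolding conj_I ..
  fix P and u :: "int \<Rightarrow> int \<Rightarrow> 'v"
  assume P: "finite P" "\<forall>(p, q)\<in>P. u p q \<in> I p q" "(\<Sum>(p, q)\<in>P. u p q) \<in> {0}"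
  have "u p q = 0" if pq: "(p, q) \<in> P" for p q
  proof (rule pi_eqI)
    fix i
    show "\<pi> i (u p q) = \<pi> i 0"
    proof (cases "snd i = (p, q)")
      case True
      have "\<pi> i (\<Sum>(p, q)\<in>P. u p q) = (\<Sum>x\<in>P. \<pi> i (case x of (p, q) \<Rightarrow> u p q))" by (rule pi_sum)
      also have "\<dots> = (\<Sum>x\<in>P. if x = (p, q) then \<pi> i (u p q) else 0)"
      proof (rule sum.cong[OF refl])
        fix x assume "x \<in> P"
        then have "(case x of (p, q) \<Rightarrow> u p q) \<in> I (fst x) (snd x)" using P(2) by auto
        then show "\<pi> i (case x of (p, q) \<Rightarrow> u p q) = (if x = (p, q) then \<pi> i (u p q) else 0)"
          using True by (cases "x = (p, q)") (auto simp: I_def simp del: split_paired_All)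
      qed
      also have "\<dots> = \<pi> i (u p q)" using P(1) pq by simp
      finally show ?thesis using P(3) by simp
    next
      case False
      have "u p q \<in> I p q" using P(2) pq by blast
      then have "\<pi> i (u p q) = 0" using False unfolding I_def by blast
      then show ?thesis by simp
    qed
  qed
  then show "\<forall>(p, q)\<in>P. u p q \<in> {0}" by auto
qed (use subI subspace_0[OF subI] in auto)

text \<open>Uniqueness identifies Deligne's bigrading of \<open>(F, M)\<close> with
  \<open>I\<close>, whose summands are swapped by conjugation exactly and not only modulo lower
  terms.\<close>

lemma split_M: "split_over_R {0} UNIV F M"
proof -
  interpret m: mhs scale B "{0}" UNIV F M by unfold_locales (rule mhs_M)
  have "deligne_bigrading {0} UNIV F M = I"
    using m.deligne_eq_D m.bigrading_unique[OF bigrading_I] by simp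
  then show ?thesis unfolding split_over_R_def using mhs_M conj_I by simp
qed

end

end

section \<open>The transported grading of a nilpotent orbit\<close>

locale orbit = rational_structure scale B
  for scale :: "complex \<Rightarrow> 'v::ab_group_add \<Rightarrow> 'v" (infixr "*\<^sub>C" 75) and B :: "'v set" +
  fixes W F :: "int \<Rightarrow> 'v set" and N :: "'v \<Rightarrow> 'v" and \<alpha> :: real
  assumes incW: "increasing_filtration {0} UNIV W" and decF: "decreasing_filtration {0} UNIV F"
    and nil: "nilpotent N" and NW: "N ` W k \<subseteq> W k" and realN: "N (vconj v) = vconj (N v)"
    and NF: "N ` F p \<subseteq> F (p - 1)"
    and mhs_orbit: "Im z > \<alpha> \<Longrightarrow> mixed_hodge_structure {0} UNIV (act (exp_mult z N) F) W"
    and Gr_split: "Gr_split_orbit W F N k"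
begin

lemma endoN: "endomorphism N" using nil by (simp add: nilpotent_def)

abbreviation ex :: "complex \<Rightarrow> 'v \<Rightarrow> 'v" where "ex z \<equiv> exp_mult z N"

lemma ex_eq: "(\<And>v. (N ^^ m) v = 0) \<Longrightarrow> ex z = nexp m (\<lambda>v. z *\<^sub>C N v)"
  unfolding exp_mult_def
  by (rule exp_end_eq_nexp[OF endo_scaled[OF endoN]]) (simp add: nilpotent_scaled[OF endoN])

lemma obtain_nil:
  obtains m where "\<And>v. (N ^^ m) v = 0" "m > 0"
proof -
  obtain n where n: "\<forall>v. (N ^^ n) v = 0" using nil unfolding nilpotent_def by blast
  have "(N ^^ Suc n) v = 0" for v using n endo_zero[OF endoN] by simp
  then show thesis using that by blast
qed

lemma endo_ex: "endomorphism (ex z)"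
proof -
  obtain m where m: "\<And>v. (N ^^ m) v = 0" using obtain_nil by blast
  show ?thesis unfolding ex_eq[OF m] by (rule endo_nexp[OF endo_scaled[OF endoN]])
qed

lemma ex_add: "ex s (ex t v) = ex (s + t) v"
proof -
  obtain m where m: "\<And>v. (N ^^ m) v = 0" using obtain_nil by blast
  show ?thesis unfolding ex_eq[OF m] by (rule nexp_add[OF endoN m])
qed

lemma ex_0 [simp]: "ex 0 v = v"
proof -
  obtain m where m: "\<And>v. (N ^^ m) v = 0" "m > 0" using obtain_nil by blast
  show ?thesis unfolding ex_eq[OF m(1)] by (rule nexp_zero[OF m(2)])
qed

lemma ex_W: "v \<in> W k \<Longrightarrow> ex z v \<in> W k"
proof -
  obtain m where m: "\<And>v. (N ^^ m) v = 0" using obtain_nil by blast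
  show "v \<in> W k \<Longrightarrow> ex z v \<in> W k"
    unfolding ex_eq[OF m] using nexp_subspace[OF W_filt(1)[OF incW nil NW] NW] .
qed

lemma ex_conj: "vconj (ex z v) = ex (cnj z) (vconj v)"
proof -
  obtain m where m: "\<And>v. (N ^^ m) v = 0" using obtain_nil by blast
  have "(N ^^ n) (vconj v) = vconj ((N ^^ n) v)" for n by (induction n) (simp_all add: realN)
  then show ?thesis
    unfolding ex_eq[OF m] nexp_def nilpotent_scaled[OF endoN] by (simp add: vconj_sum vconj_scale)
qed

lemma conjW: "vconj ` W k = W k"
  using mhs_orbit[of "\<i> * complex_of_real (\<alpha> + 1)"] unfolding mixed_hodge_structure_def by simp

lemma subF: "subspace (F p)" and antiF: "p \<le> q \<Longrightarrow> F q \<subseteq> F p"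
  using decF unfolding decreasing_filtration_def by (auto dest: antimonoD)

lemma W_sub: "subspace (W k)" and W_mono: "k \<le> l \<Longrightarrow> W k \<subseteq> W l"
  using W_filt[OF incW nil NW] by blast+

text \<open>Pulling the grading at the point \<open>z\<close> back by \<open>ex (- z)\<close> makes
  it preserve the fixed filtration \<open>F\<close>.\<close>

definition psi :: "complex \<Rightarrow> 'v \<Rightarrow> 'v" where
  "psi z = Ad (ex (- z)) (hodge_grading (act (ex z) F) W)"

lemma psi_alt: "psi z v = ex (- z) (hodge_grading (act (ex z) F) W (ex z v))"
proof -
  have "inv (ex (- z)) = ex z" by (rule inv_unique_comp) (auto simp: fun_eq_iff ex_add)
  then show ?thesis by (simp add: psi_def Ad_def)
qed

context
  fixes z :: complex assumes z: "Im z > \<alpha>"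
begin

private abbreviation (input) "Yz \<equiv> hodge_grading (act (ex z) F) W"

lemma endo_psi: "endomorphism (psi z)"
  unfolding psi_alt[abs_def]
  by (rule endo_comp[OF endo_ex endo_comp[OF endo_hodge_grading[OF mhs_orbit[OF z]] endo_ex]])

lemma psi_W: "v \<in> W k \<Longrightarrow> psi z v - of_int k *\<^sub>C v \<in> W (k - 1)"
proof -
  assume v: "v \<in> W k"
  have "ex (- z) (Yz (ex z v) - of_int k *\<^sub>C ex z v) \<in> W (k - 1)"
    by (intro ex_W hodge_grading_W[OF mhs_orbit[OF z]] v)
  then show ?thesis
    unfolding psi_alt by (simp add: endo_diff[OF endo_ex] endo_scale[OF endo_ex] ex_add)
qed

lemma psi_F: "v \<in> F p \<Longrightarrow> psi z v \<in> F p"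
proof -
  assume v: "v \<in> F p"
  then have "ex z v \<in> act (ex z) F p" unfolding act_def by blast
  then have "Yz (ex z v) \<in> act (ex z) F p" by (rule hodge_grading_F[OF mhs_orbit[OF z]])
  then obtain f where "f \<in> F p" "Yz (ex z v) = ex z f" unfolding act_def by blast
  then show ?thesis unfolding psi_alt by (simp add: ex_add)
qed

text \<open>As \<open>N\<close> is real, the conjugate of \<open>ex z F\<close> is
  \<open>ex (cnj z)\<close> applied to the conjugate of \<open>F\<close>. This is why
  \<open>z - cnj z\<close> governs the relation between \<open>psi z\<close> and the conjugate
  filtration.\<close>

lemma ex_Fb: "ex (cnj z) v \<in> vconj ` act (ex z) F q \<longleftrightarrow> v \<in> vconj ` F q"
proof -
  have "ex (cnj z) v \<in> vconj ` act (ex z) F q \<longleftrightarrow> ex z (vconj v) \<in> ex z ` F q"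
    unfolding mem_vconj_image act_def by (simp add: ex_conj)
  also have "\<dots> \<longleftrightarrow> vconj v \<in> F q"
  proof
    assume "ex z (vconj v) \<in> ex z ` F q"
    then obtain f where f: "f \<in> F q" "ex z (vconj v) = ex z f" by blast
    from arg_cong[OF f(2), of "ex (- z)"] show "vconj v \<in> F q" using f(1) by (simp add: ex_add)
  qed blast
  finally show ?thesis by (simp add: mem_vconj_image)
qed

lemma psi_conj:
  assumes v: "v \<in> vconj ` F q" "v \<in> W k"
  shows "ex (z - cnj z) (psi z (ex (- (z - cnj z)) v)) \<in>
    span (vconj ` F q \<inter> W k \<union> (\<Union>i\<in>{1..}. vconj ` F (q - i) \<inter> W (k - i - 1)))" (is "_ \<in> span ?S")
proof -
  let ?S' = "vconj ` act (ex z) F q \<inter> W k \<union> (\<Union>i\<in>{1..}. vconj ` act (ex z) F (q - i) \<inter> W (k - i - 1))"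
  have "ex (z - cnj z) (psi z (ex (- (z - cnj z)) v)) = ex (- cnj z) (Yz (ex (cnj z) v))"
    unfolding psi_alt by (simp add: ex_add)
  also have "\<dots> \<in> span ?S"
  proof (rule endo_span_subset[OF endo_ex subspace_span])
    show "Yz (ex (cnj z) v) \<in> span ?S'"
    proof (rule hodge_grading_conj[OF mhs_orbit[OF z]])
      show "ex (cnj z) v \<in> vconj ` act (ex z) F q" using v(1) unfolding ex_Fb .
      show "ex (cnj z) v \<in> W k" using v(2) by (rule ex_W)
    qed
    fix u assume u: "u \<in> ?S'"
    have bk: "ex (- cnj z) u \<in> vconj ` F r" if "u \<in> vconj ` act (ex z) F r" for r
      using that ex_Fb[of "ex (- cnj z) u" r] by (simp add: ex_add)
    have uW: "ex (- cnj z) u \<in> W l" if "u \<in> W l" for l using that by (rule ex_W)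
    have "ex (- cnj z) u \<in> ?S" using u
    proof
      assume "u \<in> vconj ` act (ex z) F q \<inter> W k"
      then show ?thesis using bk[of q] uW[of k] by blast
    next
      assume "u \<in> (\<Union>i\<in>{1..}. vconj ` act (ex z) F (q - i) \<inter> W (k - i - 1))"
      then obtain i where "i \<ge> 1" "u \<in> vconj ` act (ex z) F (q - i)" "u \<in> W (k - i - 1)" by blast
      then show ?thesis using bk[of "q - i"] uW[of "k - i - 1"] by auto
    qed
    then show "ex (- cnj z) u \<in> span ?S" by (rule span_base)
  qed
  finally show ?thesis .
qed

lemma orbit_opposed_zero:
  assumes "p + q = k + 1" "x \<in> F p" "x \<in> W k" "y \<in> vconj ` F q" "y \<in> W k"
    "x - ex (- (z - cnj z)) y \<in> W (k - 1)"
  shows "x \<in> W (k - 1)"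
proof -
  interpret m: mhs scale B "{0}" UNIV "act (ex z) F" W by unfold_locales (rule mhs_orbit[OF z])
  have "ex z (x - ex (- (z - cnj z)) y) \<in> W (k - 1)" by (rule ex_W) fact
  then have "ex z x - ex (cnj z) y \<in> W (k - 1)" by (simp add: endo_diff[OF endo_ex] ex_add)
  then have "ex z x \<in> W (k - 1)"
  proof (rule m.opposed_zero[rotated 3])
    show "ex z x \<in> act (ex z) F p \<inter> W k" using assms ex_W by (simp add: act_def)
    show "ex (cnj z) y \<in> m.Fb q \<inter> W k" unfolding m.Fb_def using assms ex_W ex_Fb[of y q] by blast
    show "k + 1 \<le> p + q" using assms(1) by simp
  qed
  then have "ex (- z) (ex z x) \<in> W (k - 1)" by (rule ex_W)
  then show ?thesis by (simp add: ex_add)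
qed

lemma orbit_opposed_sum:
  assumes "p + q = k + 1" "v \<in> W k"
  shows "\<exists>x y. x \<in> F p \<and> x \<in> W k \<and> y \<in> vconj ` F q \<and> y \<in> W k \<and> v - x - ex (- (z - cnj z)) y \<in> W (k - 1)"
proof -
  interpret m: mhs scale B "{0}" UNIV "act (ex z) F" W by unfold_locales (rule mhs_orbit[OF z])
  obtain f y w where f: "f \<in> act (ex z) F p \<inter> W k" "y \<in> m.Fb q \<inter> W k" "w \<in> W (k - 1)" "ex z v = f + y + w"
    using m.opposed_sum[OF ex_W[OF assms(2), of z], of p q] assms(1) by (metis order_refl)
  obtain x where x: "x \<in> F p" "f = ex z x" using f(1) by (auto simp: act_def)
  let ?y = "ex (- cnj z) y"
  have "ex (- z) f = x" using x by (simp add: ex_add)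
  then have xW: "x \<in> W k" using ex_W[of f k "- z"] f(1) by simp
  have y: "?y \<in> vconj ` F q" using f(2) ex_Fb[of ?y q] by (simp add: ex_add m.Fb_def)
  have "v = ex (- z) (ex z v)" by (simp add: ex_add)
  also have "\<dots> = x + ex (- z) y + ex (- z) w"
    unfolding f(4) using \<open>ex (- z) f = x\<close> by (simp add: endo_add[OF endo_ex])
  also have "ex (- z) y = ex (- (z - cnj z)) ?y" by (simp add: ex_add)
  finally have "v - x - ex (- (z - cnj z)) ?y = ex (- z) w" by (simp add: algebra_simps)
  then show ?thesis using x(1) xW y ex_W f by (metis IntE)
qed

end

context
  fixes K and \<pi> :: "int \<times> int \<times> int \<Rightarrow> 'v \<Rightarrow> 'v" and m
  assumes fr: "frame scale B K \<pi> W F N m"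
begin

interpretation fr: frame scale B K \<pi> W F N m by (rule fr)

lemma exN_ex: "fr.exN s = ex s" unfolding fr.exN_def by (rule ex_eq[symmetric]) (rule fr.nilN)

context
  fixes z :: complex assumes z: "Im z > \<alpha>"
begin

lemma frame_opposed: "fr.opposed (z - cnj z)"
  unfolding fr.opposed_def exN_ex fr.Fb_def
proof (intro conjI allI impI)
  show "x \<in> W (k - 1)" if "p + q = k + 1" "x \<in> F p" "x \<in> W k" "y \<in> vconj ` F q" "y \<in> W k"
    "x - ex (- (z - cnj z)) y \<in> W (k - 1)" for k p q x y
    using orbit_opposed_zero[OF z that] .
  show "\<exists>x y. x \<in> F p \<and> x \<in> W k \<and> y \<in> vconj ` F q \<and> y \<in> W k \<and> v - x - ex (- (z - cnj z)) y \<in> W (k - 1)"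
    if "p + q = k + 1" "v \<in> W k" for k p q v
    using orbit_opposed_sum[OF z that] .
qed

lemma frame_fY: "fr.supp {\<delta>. fst \<delta> \<le> - 1 \<and> fst (snd \<delta>) \<ge> 0} (\<lambda>v. psi z v - fr.Y v)"
proof (rule fr.suppI[OF endo_minus[OF endo_psi[OF z] fr.endo_Y]])
  fix i j :: "int \<times> int \<times> int" and v assume d: "j - i \<notin> {\<delta>. fst \<delta> \<le> - 1 \<and> fst (snd \<delta>) \<ge> 0}"
  let ?v = "\<pi> i v"
  have v: "?v \<in> W (fst i)" "?v \<in> F (fst (snd i))" using fr.pi_E fr.E_W fr.pi_F by blast+
  have "psi z ?v - fr.Y ?v \<in> W (fst i - 1)" unfolding fr.Y_pi by (rule psi_W[OF z v(1)])
  moreover have "psi z ?v - fr.Y ?v \<in> F (fst (snd i))"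
    unfolding fr.Y_pi by (intro subspace_diff[OF subF] subspace_scale[OF subF] psi_F[OF z] v)
  moreover have "fst j > fst i - 1 \<or> fst (snd j) < fst (snd i)" using d by auto
  ultimately show "\<pi> j (psi z ?v - fr.Y ?v) = 0" unfolding fr.W_iff fr.F_iff by blast
qed

text \<open>The correction term of index \<open>i\<close> lowers the weight by at least
  \<open>i + 1\<close> and the conjugate index by at most \<open>i\<close>, which gives the bound on
  degrees; the main term does not lower the conjugate index at all.\<close>

lemma frame_hY: "fr.supp {\<delta>. fst \<delta> \<le> - 1 \<and> snd (snd \<delta>) \<ge> 1 + fst \<delta>}
  (\<lambda>v. ex (z - cnj z) (psi z (ex (- (z - cnj z)) v)) - fr.Y v)"
proof (rule fr.suppI[OF endo_minus[OF endo_comp[OF endo_ex endo_comp[OF endo_psi[OF z] endo_ex]] fr.endo_Y]])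
  fix i j :: "int \<times> int \<times> int" and v
  assume d: "j - i \<notin> {\<delta>. fst \<delta> \<le> - 1 \<and> snd (snd \<delta>) \<ge> 1 + fst \<delta>}"
  let ?v = "\<pi> i v" and ?k = "fst i" and ?q = "snd (snd i)"
  let ?h = "ex (z - cnj z) (psi z (ex (- (z - cnj z)) ?v))"
  have v: "?v \<in> W ?k" "?v \<in> vconj ` F ?q" using fr.pi_E fr.E_W fr.pi_Fb unfolding fr.Fb_def by blast+
  have "ex (z - cnj z) (psi z (ex (- (z - cnj z)) ?v) - of_int ?k *\<^sub>C ex (- (z - cnj z)) ?v) \<in> W (?k - 1)"
    by (intro ex_W psi_W[OF z] v)
  then have hW: "?h - fr.Y ?v \<in> W (?k - 1)"
    by (simp add: fr.Y_pi endo_diff[OF endo_ex] endo_scale[OF endo_ex] ex_add)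
  show "\<pi> j (?h - fr.Y ?v) = 0"
  proof (cases "fst j > ?k - 1")
    case True
    then show ?thesis using hW unfolding fr.W_iff by blast
  next
    case False
    then have j: "fst j \<le> ?k - 1" "snd (snd j) < ?q + 1 + fst j - ?k" using d by auto
    have "\<pi> j ?h \<in> {0}"
    proof (rule endo_span_subset[OF fr.endo_pi subspace_single_0 _ psi_conj[OF z v(2,1)]])
      fix u assume "u \<in> vconj ` F ?q \<inter> W ?k \<union> (\<Union>i\<in>{1..}. vconj ` F (?q - i) \<inter> W (?k - i - 1))"
      then consider "u \<in> vconj ` F ?q" | l where "1 \<le> l" "u \<in> vconj ` F (?q - l)" "u \<in> W (?k - l - 1)"
        by blast
      \<comment> \<open>The value \<open>l = 0\<close> stands for the main term, so that both kinds
        of summands are treated at once.\<close>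
      then obtain l where l: "l \<ge> 0" "u \<in> vconj ` F (?q - l)" "l = 0 \<or> u \<in> W (?k - l - 1)"
      proof cases
        case 1
        then show ?thesis using that[of 0] by simp
      next
        case (2 l)
        then show ?thesis using that[of l] by simp
      qed
      show "\<pi> j u \<in> {0}"
      proof (cases "snd (snd j) < ?q - l")
        case True
        then show ?thesis using l(2) unfolding fr.Fb_iff by blast
      next
        case False
        then have "l \<noteq> 0" "fst j > ?k - l - 1" using j l(1) by auto
        then show ?thesis using l(3) unfolding fr.W_iff by blast
      qed
    qed
    moreover have "j \<noteq> i" using j by auto
    ultimately show ?thesis by (simp add: fr.pi_diff fr.Y_pi fr.pi_scale fr.pi_pi)
  qed
qed

end

end

end


section \<open>Bigradings of the limits on the graded pieces\<close>

lemma int_bottom_induct: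
  fixes k k0 :: int
  assumes "\<And>k. k \<le> k0 \<Longrightarrow> P k" and "\<And>k. P (k - 1) \<Longrightarrow> P k"
  shows "P k"
proof (cases "k \<le> k0")
  case False
  then have "k0 \<le> k" by simp
  then show ?thesis
  proof (induction k rule: int_ge_induct)
    case (step i)
    then show ?case using assms(2)[of "i + 1"] by simp
  qed (simp add: assms(1))
qed (rule assms(1))

context orbit
begin

abbreviation GrF :: "int \<Rightarrow> int \<Rightarrow> 'v set" where "GrF k \<equiv> Gr_filtration F W k"

abbreviation GrL :: "int \<Rightarrow> int \<Rightarrow> 'v set" where "GrL k \<equiv> Gr_limit_weight_filtration N W k"

text \<open>Deligne's bigrading of the limit on \<open>Gr k\<close>; its summands appear as their
  preimages in \<open>W k\<close>, hence all contain \<open>W (k - 1)\<close>.\<close>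

definition DG :: "int \<Rightarrow> int \<Rightarrow> int \<Rightarrow> 'v set" where
  "DG k = deligne_bigrading (W (k - 1)) (W k) (GrF k) (GrL k)"

lemma W_bottom: "\<exists>k0. \<forall>k\<le>k0. W k = {0}" and W_top: "\<exists>k. W k = UNIV"
proof -
  obtain k0 where k0: "W k0 = {0}" using incW unfolding increasing_filtration_def by blast
  have "W k = {0}" if "k \<le> k0" for k using W_mono[OF that] k0 subspace_0[OF W_sub, of k] by blast
  then show "\<exists>k0. \<forall>k\<le>k0. W k = {0}" by blast
  show "\<exists>k. W k = UNIV" using incW unfolding increasing_filtration_def by blast
qed

lemma GrF_alt: "GrF k p = subspace_sum (F p \<inter> W k) (W (k - 1))"
  unfolding Gr_filtration_def induced_filtration_def ..

lemma mhs_Gr: "mixed_hodge_structure (W (k - 1)) (W k) (GrF k) (GrL k)"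
  and conj_DG: "vconj ` DG k p q = DG k q p"
  using Gr_split[of k] unfolding Gr_split_orbit_def split_over_R_def DG_def by blast+

lemma subDG: "subspace (DG k p q)" and W_DG: "W (k - 1) \<subseteq> DG k p q" and DG_W: "DG k p q \<subseteq> W k"
  and DG_F: "DG k p q \<subseteq> GrF k p" and DG_L: "DG k p q \<subseteq> GrL k (p + q)"
  and F_DG: "GrF k p = bispan (W (k - 1)) (DG k) {(a, b). a \<ge> p}"
  and L_DG: "GrL k l = bispan (W (k - 1)) (DG k) {(a, b). a + b \<le> l}"
  and W_DG_span: "W k = bispan (W (k - 1)) (DG k) UNIV"
  and DG_indep: "finite P \<Longrightarrow> (\<And>i. i \<in> P \<Longrightarrow> u i \<in> DG k (fst i) (snd i)) \<Longrightarrow> (\<Sum>i\<in>P. u i) \<in> W (k - 1) \<Longrightarrow>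
    \<forall>i\<in>P. u i \<in> W (k - 1)"
proof -
  interpret m: mhs scale B "W (k - 1)" "W k" "GrF k" "GrL k" by unfold_locales (rule mhs_Gr)
  have D: "DG k = m.D" unfolding DG_def by (rule m.deligne_eq_D)
  show "subspace (DG k p q)" "W (k - 1) \<subseteq> DG k p q" unfolding D by (rule m.subD, rule m.A'D)
  show "DG k p q \<subseteq> W k" "DG k p q \<subseteq> GrF k p" "DG k p q \<subseteq> GrL k (p + q)"
    unfolding D using m.FA unfolding m.D_def by blast+
  show "GrF k p = bispan (W (k - 1)) (DG k) {(a, b). a \<ge> p}"
    "GrL k l = bispan (W (k - 1)) (DG k) {(a, b). a + b \<le> l}"
    "W k = bispan (W (k - 1)) (DG k) UNIV"
    unfolding D by (rule m.F_span, rule m.W_span, rule m.A_span)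
  show "\<forall>i\<in>P. u i \<in> W (k - 1)" if "finite P" "\<And>i. i \<in> P \<Longrightarrow> u i \<in> DG k (fst i) (snd i)" "(\<Sum>i\<in>P. u i) \<in> W (k - 1)"
    using that unfolding D by (rule m.D_indep)
qed

text \<open>A use of splitness of the graded orbits: the exact symmetry \<open>conj_DG\<close> turns
  membership in \<open>F q\<close> for the conjugate class into a representative in the conjugate
  filtration.\<close>

lemma DG_Fb:
  assumes "x \<in> DG k p q"
  obtains y where "y \<in> vconj ` F q" "y \<in> W k" "x - y \<in> W (k - 1)"
proof -
  have "vconj x \<in> DG k q p" using assms conj_DG[of k p q] by blast
  then have "vconj x \<in> subspace_sum (F q \<inter> W k) (W (k - 1))" using DG_F GrF_alt by blast
  then obtain f w where f: "f \<in> F q \<inter> W k" "w \<in> W (k - 1)" "vconj x = f + w" by (elim subspace_sumE) blast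
  have "x = vconj f + vconj w" using arg_cong[OF f(3), of vconj] by (simp add: vconj_add)
  moreover have "vconj f \<in> W k" "vconj w \<in> W (k - 1)" using f conjW by blast+
  ultimately show thesis using f by (intro that[of "vconj f"]) auto
qed

lemma FW_DG: "F p \<inter> W k \<subseteq> bispan (W (k - 1)) (DG k) {(a, b). a \<ge> p}"
  using subspace_sum_upper1[OF W_sub, of "F p \<inter> W k" "k - 1"] F_DG GrF_alt by simp

lemma FbW_DG: "vconj ` F q \<inter> W k \<subseteq> bispan (W (k - 1)) (DG k) {(a, b). b \<ge> q}"
proof
  fix v assume v: "v \<in> vconj ` F q \<inter> W k"
  then have "vconj v \<in> F q \<inter> W k" using conjW[of k] by (auto simp: mem_vconj_image)
  then have "v \<in> vconj ` bispan (W (k - 1)) (DG k) {(a, b). a \<ge> q}"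
    unfolding mem_vconj_image using FW_DG by blast
  also have "\<dots> = bispan (W (k - 1)) (DG k) (prod.swap ` {(a, b). a \<ge> q})"
    unfolding vconj_bispan[OF conjW] conj_DG ..
  also have "prod.swap ` {(a, b). a \<ge> q} = {(a, b). b \<ge> q}" by force
  finally show "v \<in> bispan (W (k - 1)) (DG k) {(a, b). b \<ge> q}" .
qed

end

text \<open>
  A grading of \<open>W\<close> that preserves \<open>F\<close> and its conjugate lifts the Deligne bigradings of the limits
  on the graded pieces to a trigrading of the whole space.
\<close>

locale lifting = orbit scale B W F N \<alpha>
  for scale :: "complex \<Rightarrow> 'v::ab_group_add \<Rightarrow> 'v" (infixr "*\<^sub>C" 75) and B :: "'v set"
    and W F N \<alpha> +
  fixes Y0 :: "'v \<Rightarrow> 'v"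
  assumes endoY0: "endomorphism Y0" and Y0_W: "v \<in> W k \<Longrightarrow> Y0 v - of_int k *\<^sub>C v \<in> W (k - 1)"
    and Y0_F: "Y0 ` F p \<subseteq> F p" and Y0_Fb: "Y0 ` (vconj ` F p) \<subseteq> vconj ` F p"
begin

abbreviation Ek :: "int \<Rightarrow> 'v set" where "Ek k \<equiv> eigenspace Y0 (of_int k)"

lemma mem_Ek: "v \<in> Ek k \<longleftrightarrow> Y0 v = of_int k *\<^sub>C v" by (simp add: eigenspace_def)

lemma sub_Ek: "subspace (Ek k)"
  unfolding subspace_def Ball_def mem_Ek
  by (simp add: endo_zero[OF endoY0] endo_add[OF endoY0] endo_scale[OF endoY0] scale_right_distrib mult.commute)

text \<open>On \<open>Gr l\<close> with \<open>l < k\<close> the operator \<open>Y0\<close> acts as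
  \<open>l\<close>, so an eigenvector for \<open>k\<close> can be divided by the nonzero difference
  \<open>k - l\<close> and drops through all weights to zero.\<close>

lemma Ek_W_zero: "v \<in> Ek k \<Longrightarrow> v \<in> W (k - 1) \<Longrightarrow> v = 0"
proof -
  assume v: "v \<in> Ek k" "v \<in> W (k - 1)"
  have "v \<in> W (k - 1 - int n)" for n
  proof (induction n)
    case (Suc n)
    have "Y0 v - of_int (k - 1 - int n) *\<^sub>C v \<in> W (k - 1 - int n - 1)" by (rule Y0_W[OF Suc])
    also have "Y0 v - of_int (k - 1 - int n) *\<^sub>C v = of_int (1 + int n) *\<^sub>C v"
      using v(1) unfolding mem_Ek by (simp flip: scale_left_diff_distrib)
    finally have "(1 / of_int (1 + int n)) *\<^sub>C of_int (1 + int n) *\<^sub>C v \<in> W (k - 1 - int n - 1)"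
      by (rule subspace_scale[OF W_sub])
    moreover have "(1 / of_int (1 + int n)) *\<^sub>C of_int (1 + int n) *\<^sub>C v = v"
    proof -
      have "1 + int n \<noteq> 0" by simp
      then have "complex_of_int (1 + int n) \<noteq> 0" by (simp only: of_int_eq_0_iff not_False_eq_True)
      then have "1 / of_int (1 + int n) * of_int (1 + int n) = (1 :: complex)" by (rule nonzero_eq_divide_eq[THEN iffD1, OF _ refl])
      then show ?thesis by (simp only: scale_scale scale_one)
    qed
    ultimately show ?case by (simp only: of_nat_Suc diff_diff_eq add_ac)
  qed (use v in simp)
  moreover obtain k0 where k0: "\<forall>k\<le>k0. W k = {0}" using W_bottom by blast
  ultimately have "v \<in> W (k - 1 - int (nat (k - 1 - k0)))" by blast
  moreover have "k - 1 - int (nat (k - 1 - k0)) \<le> k0 \<or> k - 1 \<le> k0" by linarith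
  ultimately show ?thesis using k0 v(2) by blast
qed

text \<open>Subtracting \<open>r / (l - k)\<close> moves the error \<open>r = (Y0 - k) e\<close> from \<open>W l\<close> to \<open>W (l - 1)\<close>.\<close>

lemma Ek_lift:
  assumes T: "subspace T" "Y0 ` T \<subseteq> T" and v: "v \<in> T" "v \<in> W k"
  obtains e where "e \<in> T" "e \<in> Ek k" "v - e \<in> W (k - 1)"
proof -
  have ex: "\<exists>e\<in>T. v - e \<in> W (k - 1) \<and> Y0 e - of_int k *\<^sub>C e \<in> W (k - 1 - int n)" for n
  proof (induction n)
    case 0
    then show ?case using v Y0_W[OF v(2)] subspace_0[OF W_sub] by (intro bexI[of _ v]) auto
  next
    case (Suc n)
    let ?l = "k - 1 - int n"
    obtain e where e: "e \<in> T" "v - e \<in> W (k - 1)" "Y0 e - of_int k *\<^sub>C e \<in> W ?l" using Suc by blast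
    define r where "r = Y0 e - of_int k *\<^sub>C e"
    define c where "c = 1 / complex_of_int (?l - k)"
    have c: "c * of_int (?l - k) = 1"
    proof -
      have "?l - k \<noteq> 0" by linarith
      then have "complex_of_int (?l - k) \<noteq> 0" by (simp only: of_int_eq_0_iff not_False_eq_True)
      then show ?thesis unfolding c_def by simp
    qed
    have rT: "r \<in> T" unfolding r_def using T e(1) by (intro subspace_diff subspace_scale) auto
    have rW: "r \<in> W ?l" using e(3) unfolding r_def .
    let ?e = "e - c *\<^sub>C r"
    have "Y0 ?e - of_int k *\<^sub>C ?e = r - c *\<^sub>C (Y0 r - of_int k *\<^sub>C r)"
      by (simp add: r_def endo_add[OF endoY0] endo_diff[OF endoY0] endo_scale[OF endoY0] algebra_simps)
    also have "\<dots> = (c * of_int (?l - k)) *\<^sub>C r - c *\<^sub>C (Y0 r - of_int k *\<^sub>C r)" unfolding c by simp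
    also have "\<dots> = (- c) *\<^sub>C (Y0 r - of_int ?l *\<^sub>C r)"
      by (simp add: algebra_simps)
    also have "\<dots> \<in> W (?l - 1)" by (rule subspace_scale[OF W_sub Y0_W[OF rW]])
    finally have 1: "Y0 ?e - of_int k *\<^sub>C ?e \<in> W (k - 1 - int (Suc n))" by (simp add: algebra_simps)
    have "r \<in> W (k - 1)" using rW W_mono[of ?l "k - 1"] by auto
    then have "(v - e) + c *\<^sub>C r \<in> W (k - 1)" by (intro subspace_add[OF W_sub] subspace_scale[OF W_sub] e(2))
    then have 2: "v - ?e \<in> W (k - 1)" by (simp add: algebra_simps)
    have "?e \<in> T" using T e(1) rT by (intro subspace_diff subspace_scale) auto
    then show ?case using 1 2 by blast
  qed
  obtain k0 where k0: "\<forall>k\<le>k0. W k = {0}" using W_bottom by blast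
  have "W (k - 1 - int (nat (k - 1 - k0))) = {0}" using k0 by (intro k0[rule_format]) linarith
  then obtain e where "e \<in> T" "v - e \<in> W (k - 1)" "Y0 e - of_int k *\<^sub>C e = 0"
    using ex[of "nat (k - 1 - k0)"] by auto
  then show thesis using that mem_Ek by simp
qed

text \<open>Eigenvectors of \<open>Y0\<close> whose class on \<open>Gr k\<close> has type
  \<open>(p, q)\<close>: the bigradings \<open>DG\<close> lifted along \<open>Y0\<close>.\<close>

definition V :: "int \<times> int \<times> int \<Rightarrow> 'v set" where
  "V i = DG (fst i) (fst (snd i)) (snd (snd i)) \<inter> Ek (fst i)"

lemma subV: "subspace (V i)" unfolding V_def by (rule subspace_inter[OF subDG sub_Ek])

lemma V_W: "V i \<subseteq> W (fst i)" unfolding V_def using DG_W by blast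

text \<open>An eigenvector is determined by its class on the graded piece. If the class has a
  representative in a \<open>Y0\<close>-stable subspace, then it also has an eigenvector there,
  which must be the given one.\<close>

lemma V_in:
  assumes T: "subspace T" "Y0 ` T \<subseteq> T" and x: "x \<in> V i" and f: "f \<in> T" "f \<in> W (fst i)" "x - f \<in> W (fst i - 1)"
  shows "x \<in> T"
proof -
  obtain e where e: "e \<in> T" "e \<in> Ek (fst i)" "f - e \<in> W (fst i - 1)" using Ek_lift[OF T f(1,2)] .
  have "(x - f) + (f - e) \<in> W (fst i - 1)" by (rule subspace_add[OF W_sub f(3) e(3)])
  moreover have "x - e \<in> Ek (fst i)" using x e(2) unfolding V_def by (intro subspace_diff[OF sub_Ek]) auto
  ultimately have "x - e = 0" by (intro Ek_W_zero) auto
  then show ?thesis using e(1) by simp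
qed

lemma V_F: "V i \<subseteq> F (fst (snd i))"
proof
  fix x assume x: "x \<in> V i"
  then have "x \<in> subspace_sum (F (fst (snd i)) \<inter> W (fst i)) (W (fst i - 1))" unfolding V_def using DG_F GrF_alt by blast
  then obtain f w where "f \<in> F (fst (snd i)) \<inter> W (fst i)" "w \<in> W (fst i - 1)" "x = f + w" by (elim subspace_sumE) blast
  then show "x \<in> F (fst (snd i))" by (intro V_in[OF subF Y0_F x, of f]) auto
qed

lemma V_Fb: "V i \<subseteq> vconj ` F (snd (snd i))"
proof
  fix x assume x: "x \<in> V i"
  then obtain y where "y \<in> vconj ` F (snd (snd i))" "y \<in> W (fst i)" "x - y \<in> W (fst i - 1)"
    unfolding V_def using DG_Fb by blast
  then show "x \<in> vconj ` F (snd (snd i))" by (rule V_in[OF subspace_vconj[OF subF] Y0_Fb x])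
qed

lemma DG_V:
  assumes "x \<in> DG k p q"
  obtains v where "v \<in> V (k, p, q)" "x - v \<in> W (k - 1)"
proof -
  have "x \<in> W k" using assms DG_W by blast
  then obtain e where e: "e \<in> Ek k" "x - e \<in> W (k - 1)" using Ek_lift[of UNIV x k] by auto
  have "x - (x - e) \<in> DG k p q" by (rule subspace_diff[OF subDG assms subsetD[OF W_DG e(2)]])
  then have "e \<in> DG k p q" by simp
  then show thesis using e by (intro that[of e]) (auto simp: V_def)
qed

lemma bispan_V: "bispan (W (k - 1)) (DG k) P \<subseteq> subspace_sum (span (\<Union>i\<in>{k} \<times> P. V i)) (W (k - 1))" (is "_ \<subseteq> ?S")
proof (rule bispan_least)
  show S: "subspace ?S" by (intro subspace_subspace_sum subspace_span W_sub)
  show "W (k - 1) \<subseteq> ?S" by (rule subspace_sum_upper2[OF subspace_span])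
  fix a b assume ab: "(a, b) \<in> P"
  show "DG k a b \<subseteq> ?S"
  proof
    fix x assume "x \<in> DG k a b"
    then obtain v where v: "v \<in> V (k, a, b)" "x - v \<in> W (k - 1)" by (rule DG_V)
    have "v \<in> span (\<Union>i\<in>{k} \<times> P. V i)" using v(1) ab by (intro span_base) blast
    from subspace_sumI[OF this v(2)] show "x \<in> ?S" by simp
  qed
qed

text \<open>The class on \<open>Gr k\<close> of a vector in \<open>T\<close> is represented by a sum
  from those \<open>V i\<close> that lie in \<open>T\<close>; after its subtraction the rest is in
  \<open>T\<close> and in \<open>W (k - 1)\<close>.\<close>

lemma stratify:
  assumes T: "subspace T" "\<And>k. T \<inter> W k \<subseteq> bispan (W (k - 1)) (DG k) P" "\<And>i. snd i \<in> P \<Longrightarrow> V i \<subseteq> T"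
  shows "T \<inter> W k \<subseteq> span (\<Union>i\<in>{..k} \<times> P. V i)"
proof -
  obtain k0 where k0: "\<forall>k\<le>k0. W k = {0}" using W_bottom by blast
  show ?thesis
  proof (rule int_bottom_induct[of k0 "\<lambda>k. T \<inter> W k \<subseteq> span (\<Union>i\<in>{..k} \<times> P. V i)"])
    show "T \<inter> W k \<subseteq> span (\<Union>i\<in>{..k} \<times> P. V i)" if "k \<le> k0" for k
      using k0 that span_zero by auto
    fix k assume IH: "T \<inter> W (k - 1) \<subseteq> span (\<Union>i\<in>{..k - 1} \<times> P. V i)"
    show "T \<inter> W k \<subseteq> span (\<Union>i\<in>{..k} \<times> P. V i)"
    proof
      fix v assume v: "v \<in> T \<inter> W k"
      then have "v \<in> subspace_sum (span (\<Union>i\<in>{k} \<times> P. V i)) (W (k - 1))" using T(2) bispan_V by blast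
      then obtain s w where sw: "s \<in> span (\<Union>i\<in>{k} \<times> P. V i)" "w \<in> W (k - 1)" "v = s + w" by (elim subspace_sumE) blast
      have "span (\<Union>i\<in>{k} \<times> P. V i) \<subseteq> T"
      proof (rule span_minimal[OF _ T(1)], rule UN_least)
        fix i assume "i \<in> {k} \<times> P"
        then show "V i \<subseteq> T" by (intro T(3)) auto
      qed
      then have "v - s \<in> T" using sw v by (intro subspace_diff[OF T(1)]) auto
      then have "w \<in> T \<inter> W (k - 1)" using sw by simp
      then have "w \<in> span (\<Union>i\<in>{..k - 1} \<times> P. V i)" using IH by blast
      moreover have "span (\<Union>i\<in>{..k - 1} \<times> P. V i) \<subseteq> span (\<Union>i\<in>{..k} \<times> P. V i)"
        by (intro span_mono UN_mono) auto
      ultimately have "w \<in> span (\<Union>i\<in>{..k} \<times> P. V i)" by blast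
      moreover have "span (\<Union>i\<in>{k} \<times> P. V i) \<subseteq> span (\<Union>i\<in>{..k} \<times> P. V i)"
        by (intro span_mono UN_mono) auto
      then have "s \<in> span (\<Union>i\<in>{..k} \<times> P. V i)" using sw(1) by blast
      ultimately show "v \<in> span (\<Union>i\<in>{..k} \<times> P. V i)" unfolding sw(3) by (intro span_add)
    qed
  qed
qed

lemma W_V: "UNIV \<inter> W k \<subseteq> span (\<Union>i\<in>{..k} \<times> UNIV. V i)"
proof (rule stratify)
  show "UNIV \<inter> W k \<subseteq> bispan (W (k - 1)) (DG k) UNIV" for k using W_DG_span[of k] by blast
qed simp_all

lemma V_span: "span (\<Union>i. V i) = UNIV"
proof -
  obtain k where k: "W k = UNIV" using W_top by blast
  have "UNIV \<inter> W k \<subseteq> span (\<Union>i\<in>{..k} \<times> UNIV. V i)" by (rule W_V)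
  also have "\<dots> \<subseteq> span (\<Union>i. V i)" by (rule span_mono) blast
  finally show ?thesis using k by blast
qed

text \<open>The summands of largest weight \<open>k\<close> have sum in \<open>W (k - 1)\<close>. By
  independence on \<open>Gr k\<close> each of them lies in \<open>W (k - 1)\<close>, and as an
  eigenvector for \<open>k\<close> it is zero.\<close>

lemma V_indep:
  assumes "finite P" "\<And>i. i \<in> P \<Longrightarrow> u i \<in> V i" "(\<Sum>i\<in>P. u i) = 0"
  shows "\<forall>i\<in>P. u i = 0"
  using assms
proof (induction "card P" arbitrary: P rule: less_induct)
  case less
  show ?case
  proof (cases "P = {}")
    case False
    define k where "k = Max (fst ` P)"
    let ?Q = "{i\<in>P. fst i = k}"
    have kP: "k \<in> fst ` P" and le: "\<And>i. i \<in> P \<Longrightarrow> fst i \<le> k"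
      unfolding k_def using False less.prems(1) by (auto intro!: Max_in)
    have split: "(\<Sum>i\<in>P. u i) = (\<Sum>i\<in>?Q. u i) + (\<Sum>i\<in>P - ?Q. u i)"
      using sum.subset_diff[of ?Q P u] less.prems(1) by (simp add: add.commute)
    have "(\<Sum>i\<in>P - ?Q. u i) \<in> W (k - 1)"
    proof (rule module.subspace_sum[OF module_axioms W_sub])
      fix i assume i: "i \<in> P - ?Q"
      then have "fst i \<le> k - 1" using le[of i] by auto
      then show "u i \<in> W (k - 1)" using less.prems(2)[of i] i V_W[of i] W_mono[of "fst i" "k - 1"] by blast
    qed
    moreover have "(\<Sum>i\<in>?Q. u i) = - (\<Sum>i\<in>P - ?Q. u i)" using split less.prems(3) by (simp add: eq_neg_iff_add_eq_0)
    ultimately have "(\<Sum>i\<in>?Q. u i) \<in> W (k - 1)" by (simp add: subspace_neg[OF W_sub])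
    moreover have "(\<Sum>i\<in>?Q. u i) = (\<Sum>j\<in>snd ` ?Q. u (k, j))"
      by (subst sum.reindex) (auto simp: inj_on_def intro!: sum.cong)
    ultimately have *: "(\<Sum>j\<in>snd ` ?Q. u (k, j)) \<in> W (k - 1)" by simp
    have "\<forall>j\<in>snd ` ?Q. u (k, j) \<in> W (k - 1)"
    proof (rule DG_indep[OF _ _ *])
      show "finite (snd ` ?Q)" using less.prems(1) by simp
      fix j assume "j \<in> snd ` ?Q"
      then have "(k, j) \<in> P" by auto
      from less.prems(2)[OF this] show "u (k, j) \<in> DG k (fst j) (snd j)" by (simp add: V_def)
    qed
    then have Q0: "u i = 0" if "i \<in> ?Q" for i
    proof -
      define j where "j = snd i"
      have j: "i = (k, j)" using that by (auto simp: j_def prod_eq_iff)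
      then have "j \<in> snd ` ?Q" using that unfolding j_def by (rule_tac imageI)
      then have "u i \<in> W (k - 1)" unfolding j using \<open>\<forall>j\<in>snd ` ?Q. u (k, j) \<in> W (k - 1)\<close> by (rule bspec[rotated])
      moreover have "u i \<in> Ek k" using less.prems(2)[of i] that by (simp add: V_def)
      ultimately show ?thesis by (intro Ek_W_zero)
    qed
    have "\<forall>i\<in>P - ?Q. u i = 0"
    proof (rule less.hyps)
      obtain i where "i \<in> P" "fst i = k" using kP by blast
      then have "P - ?Q \<subset> P" by blast
      then show "card (P - ?Q) < card P" using less.prems(1) by (intro psubset_card_mono)
      show "(\<Sum>i\<in>P - ?Q. u i) = 0" using split less.prems(3) Q0 by simp
    qed (use less.prems in auto)
    then show ?thesis using Q0 by blast
  qed simp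
qed

lemma obtain_projections:
  obtains K \<pi> where "projections scale B K \<pi>" "\<And>i v. \<pi> i v \<in> V i" "\<And>i v. v \<in> V i \<Longrightarrow> \<pi> i v = v"
proof -
  obtain K \<pi> where "projections scale B K \<pi>" "\<And>i v. \<pi> i v \<in> V i" "\<And>i v. v \<in> V i \<Longrightarrow> \<pi> i v = v"
    by (rule direct_family_projections[of V]) (use subV V_span V_indep in blast)+
  then show thesis by (rule that)
qed

context
  fixes K \<pi>
  assumes pr: "projections scale B K \<pi>" and pi_V: "\<And>i v. \<pi> i v \<in> V i" and V_pi: "\<And>i v. v \<in> V i \<Longrightarrow> \<pi> i v = v"
begin

interpretation pr: projections scale B K \<pi> by (rule pr)

lemma pi_V_other: "v \<in> V i \<Longrightarrow> j \<noteq> i \<Longrightarrow> \<pi> j v = 0"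
  using pr.pi_pi[of j i v] V_pi[of v i] by simp

lemma zero_set: "subspace {v. \<forall>i. P i \<longrightarrow> \<pi> i v = 0}"
  by (auto simp: subspace_def pr.pi_add pr.pi_scale)

lemma span_V_iff: "v \<in> span (\<Union>i\<in>Q. V i) \<longleftrightarrow> (\<forall>i. i \<notin> Q \<longrightarrow> \<pi> i v = 0)"
proof
  assume "v \<in> span (\<Union>i\<in>Q. V i)"
  moreover have "span (\<Union>i\<in>Q. V i) \<subseteq> {v. \<forall>i. i \<notin> Q \<longrightarrow> \<pi> i v = 0}"
  proof (rule span_minimal[OF _ zero_set], rule UN_least, rule subsetI)
    fix i x assume i: "i \<in> Q" "x \<in> V i"
    have "\<pi> j x = 0" if "j \<notin> Q" for j using pi_V_other[OF i(2), of j] i(1) that by blast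
    then show "x \<in> {v. \<forall>i. i \<notin> Q \<longrightarrow> \<pi> i v = 0}" by blast
  qed
  ultimately show "\<forall>i. i \<notin> Q \<longrightarrow> \<pi> i v = 0" by blast
next
  assume 0: "\<forall>i. i \<notin> Q \<longrightarrow> \<pi> i v = 0"
  have "(\<Sum>i\<in>K. \<pi> i v) \<in> span (\<Union>i\<in>Q. V i)"
  proof (rule module.subspace_sum[OF module_axioms subspace_span])
    fix i
    show "\<pi> i v \<in> span (\<Union>i\<in>Q. V i)"
    proof (cases "i \<in> Q")
      case True
      then show ?thesis using pi_V by (intro span_base) blast
    next
      case False
      then have "\<pi> i v = 0" using 0 by blast
      then show ?thesis using span_zero by simp
    qed
  qed
  then show "v \<in> span (\<Union>i\<in>Q. V i)" unfolding pr.pi_total .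
qed

lemma lift_W_iff: "v \<in> W k \<longleftrightarrow> (\<forall>i. fst i > k \<longrightarrow> \<pi> i v = 0)"
proof -
  have "UNIV \<inter> W k \<subseteq> span (\<Union>i\<in>{..k} \<times> UNIV. V i)" by (rule W_V)
  moreover have "span (\<Union>i\<in>{..k} \<times> UNIV. V i) \<subseteq> W k"
  proof (rule span_minimal[OF _ W_sub], rule UN_least)
    fix i :: "int \<times> int \<times> int" assume "i \<in> {..k} \<times> UNIV"
    then have "W (fst i) \<subseteq> W k" by (intro W_mono) auto
    then show "V i \<subseteq> W k" using V_W by blast
  qed
  ultimately have "W k = span (\<Union>i\<in>{..k} \<times> UNIV. V i)" by blast
  then have "v \<in> W k \<longleftrightarrow> (\<forall>i. i \<notin> {..k} \<times> UNIV \<longrightarrow> \<pi> i v = 0)" using span_V_iff by blast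
  also have "\<dots> \<longleftrightarrow> (\<forall>i. fst i > k \<longrightarrow> \<pi> i v = 0)" by auto
  finally show ?thesis .
qed

lemma stratified_iff:
  assumes T: "subspace T" "\<And>k. T \<inter> W k \<subseteq> bispan (W (k - 1)) (DG k) P" "\<And>i. snd i \<in> P \<Longrightarrow> V i \<subseteq> T"
  shows "v \<in> T \<longleftrightarrow> (\<forall>i. snd i \<notin> P \<longrightarrow> \<pi> i v = 0)"
proof -
  obtain k where k: "W k = UNIV" using W_top by blast
  have "T \<subseteq> span (\<Union>i\<in>{..k} \<times> P. V i)" using stratify[OF T, of k] k by simp
  also have "\<dots> \<subseteq> span (\<Union>i\<in>UNIV \<times> P. V i)" by (rule span_mono) blast
  finally have 1: "T \<subseteq> span (\<Union>i\<in>UNIV \<times> P. V i)" .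
  have "span (\<Union>i\<in>UNIV \<times> P. V i) \<subseteq> T"
  proof (rule span_minimal[OF _ T(1)], rule UN_least)
    fix i :: "int \<times> int \<times> int" assume "i \<in> UNIV \<times> P"
    then show "V i \<subseteq> T" by (intro T(3)) auto
  qed
  with 1 have "T = span (\<Union>i\<in>UNIV \<times> P. V i)" by (rule subset_antisym)
  then have "v \<in> T \<longleftrightarrow> (\<forall>i. i \<notin> UNIV \<times> P \<longrightarrow> \<pi> i v = 0)" using span_V_iff by blast
  also have "\<dots> \<longleftrightarrow> (\<forall>i. snd i \<notin> P \<longrightarrow> \<pi> i v = 0)" by auto
  finally show ?thesis .
qed

lemma lift_F_iff: "v \<in> F p \<longleftrightarrow> (\<forall>i. fst (snd i) < p \<longrightarrow> \<pi> i v = 0)"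
proof -
  have "v \<in> F p \<longleftrightarrow> (\<forall>i. snd i \<notin> {(a, b). a \<ge> p} \<longrightarrow> \<pi> i v = 0)"
  proof (rule stratified_iff[OF subF FW_DG])
    fix i :: "int \<times> int \<times> int" assume "snd i \<in> {(a, b). a \<ge> p}"
    then have "F (fst (snd i)) \<subseteq> F p" by (intro antiF) auto
    then show "V i \<subseteq> F p" using V_F by blast
  qed
  then show ?thesis by (auto simp: not_le)
qed

lemma lift_Fb_iff: "v \<in> vconj ` F q \<longleftrightarrow> (\<forall>i. snd (snd i) < q \<longrightarrow> \<pi> i v = 0)"
proof -
  have "v \<in> vconj ` F q \<longleftrightarrow> (\<forall>i. snd i \<notin> {(a, b). b \<ge> q} \<longrightarrow> \<pi> i v = 0)"
  proof (rule stratified_iff[OF subspace_vconj[OF subF] FbW_DG])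
    fix i :: "int \<times> int \<times> int" assume "snd i \<in> {(a, b). b \<ge> q}"
    then have "F (snd (snd i)) \<subseteq> F q" by (intro antiF) auto
    then show "V i \<subseteq> vconj ` F q" using V_Fb by blast
  qed
  then show ?thesis by (auto simp: not_le)
qed

lemma pi_bispan:
  assumes y: "y \<in> bispan (W (k - 1)) (DG k) P" and ab: "(a, b) \<notin> P"
  shows "\<pi> (k, a, b) y = 0"
proof -
  have "y \<in> subspace_sum (span (\<Union>i\<in>{k} \<times> P. V i)) (W (k - 1))" using y bispan_V by blast
  then obtain s w where sw: "s \<in> span (\<Union>i\<in>{k} \<times> P. V i)" "w \<in> W (k - 1)" "y = s + w" by (elim subspace_sumE) blast
  have "\<pi> (k, a, b) s = 0" using sw(1) ab unfolding span_V_iff by blast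
  moreover have "\<pi> (k, a, b) w = 0" using sw(2) unfolding lift_W_iff by simp
  ultimately show ?thesis using sw(3) pr.pi_add by simp
qed

text \<open>Transversality for \<open>F\<close> and its conjugate bounds both Hodge degrees of
  \<open>N\<close> below by \<open>-1\<close>. In weight zero the limit weight filtration of
  \<open>Gr k\<close> drops by two, which leaves only \<open>(-1, -1)\<close>.\<close>

lemma lift_frame: "\<exists>m. (\<forall>v. (N ^^ m) v = 0) \<and> frame scale B K \<pi> W F N m"
proof -
  interpret graded scale B K \<pi> by unfold_locales
  obtain m0 where m0: "\<And>v. (N ^^ m0) v = 0" using obtain_nil by blast
  \<comment> \<open>Larger than every difference of first Hodge indices, as \<open>big\<close>
    demands; the maximum with \<open>m0\<close> also serves as a nilpotency bound.\<close>
  define m1 where "m1 = nat (Max (insert 0 ((\<lambda>(i, j). \<bar>fst (snd i) - fst (snd j)\<bar>) ` (K \<times> K)))) + 1"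
  have m1: "\<bar>fst (snd i) - fst (snd j)\<bar> < int m1" if "i \<in> K" "j \<in> K" for i j
  proof -
    have "\<bar>fst (snd i) - fst (snd j)\<bar> \<le> Max (insert 0 ((\<lambda>(i, j). \<bar>fst (snd i) - fst (snd j)\<bar>) ` (K \<times> K)))"
      using pr.finK that by (intro Max_ge) (auto intro!: image_eqI[of _ _ "(i, j)"])
    then show ?thesis unfolding m1_def by linarith
  qed
  have nil': "(N ^^ max m0 m1) v = 0" for v by (rule funpow_zero_ge[OF endoN m0]) simp
  have "frame scale B K \<pi> W F N (max m0 m1)"
  proof
    show "v \<in> W k \<longleftrightarrow> (\<forall>i. fst i > k \<longrightarrow> \<pi> i v = 0)" for v k by (rule lift_W_iff)
    show "v \<in> F p \<longleftrightarrow> (\<forall>i. fst (snd i) < p \<longrightarrow> \<pi> i v = 0)" for v p by (rule lift_F_iff)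
    show "v \<in> vconj ` F q \<longleftrightarrow> (\<forall>i. snd (snd i) < q \<longrightarrow> \<pi> i v = 0)" for v q by (rule lift_Fb_iff)
    show "(N ^^ max m0 m1) v = 0" for v by (rule nil')
    show "\<bar>fst (snd i) - fst (snd j)\<bar> < int (max m0 m1)" if "i \<in> K" "j \<in> K" for i j
      using m1[OF that] by linarith
    show "supp (insert (0, - 1, - 1) {(l, a, b). l \<le> - 1 \<and> a \<ge> - 1 \<and> b \<ge> - 1}) N"
    proof (rule suppI[OF endoN])
      fix i j :: "int \<times> int \<times> int" and v
      assume d: "j - i \<notin> insert (0, - 1, - 1) {(l, a, b). l \<le> - 1 \<and> a \<ge> - 1 \<and> b \<ge> - 1}"
      obtain k p q where i: "i = (k, p, q)" by (cases i) auto
      obtain k' p' q' where j: "j = (k', p', q')" by (cases j) auto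
      have x: "\<pi> i v \<in> W k" "\<pi> i v \<in> F p" "\<pi> i v \<in> vconj ` F q" "\<pi> i v \<in> DG k p q"
        using pi_V[of i v] V_W[of i] V_F[of i] V_Fb[of i] unfolding i V_def by auto
      have NW': "N (\<pi> i v) \<in> W k" and NF': "N (\<pi> i v) \<in> F (p - 1)" using x NW NF by blast+
      have "vconj (N (\<pi> i v)) \<in> F (q - 1)" using x(3) NF[of q] unfolding mem_vconj_image realN[symmetric] by blast
      then have NFb: "N (\<pi> i v) \<in> vconj ` F (q - 1)" unfolding mem_vconj_image .
      have "N (\<pi> i v) \<in> GrL k (p + q - 2)"
        using x(4) DG_L Gr_limit_N[OF incW nil NW] by blast
      then have NL: "N (\<pi> i v) \<in> bispan (W (k - 1)) (DG k) {(a, b). a + b \<le> p + q - 2}" unfolding L_DG .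
      consider "k' > k" | "p' < p - 1" | "q' < q - 1" | "k' = k" "p' + q' > p + q - 2"
        using d unfolding i j by force
      then show "\<pi> j (N (\<pi> i v)) = 0"
      proof cases
        case 1
        then show ?thesis using NW' unfolding lift_W_iff j by simp
      next
        case 2
        then show ?thesis using NF' unfolding lift_F_iff j by simp
      next
        case 3
        then show ?thesis using NFb unfolding lift_Fb_iff j by simp
      next
        case 4
        then show ?thesis unfolding j 4(1) by (intro pi_bispan[OF NL]) simp
      qed
    qed
  qed
  then show ?thesis using nil' by blast
qed

lemma lift_Y: "(\<Sum>i\<in>K. of_int (fst i) *\<^sub>C \<pi> i v) = Y0 v"
proof -
  have "Y0 v = Y0 (\<Sum>i\<in>K. \<pi> i v)" unfolding pr.pi_total ..
  also have "\<dots> = (\<Sum>i\<in>K. of_int (fst i) *\<^sub>C \<pi> i v)"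
    unfolding endo_sum[OF endoY0] using pi_V mem_Ek unfolding V_def by (intro sum.cong refl) blast
  finally show ?thesis ..
qed

lemma pi_Y0: "\<pi> j (Y0 v) = of_int (fst j) *\<^sub>C \<pi> j v"
proof -
  have "\<pi> j (Y0 v) = (\<Sum>i\<in>K. if i = j then of_int (fst j) *\<^sub>C \<pi> j v else 0)"
    unfolding lift_Y[symmetric] pr.pi_sum pr.pi_scale pr.pi_pi by (rule sum.cong) auto
  then show ?thesis using pr.finK pr.pi_outside[of j v] by auto
qed

lemma lift_grading: "grading W Y0"
  unfolding grading_def semisimple_def
proof (intro conjI allI impI)
  show "endomorphism Y0" by (rule endoY0)
  have VE: "V i \<subseteq> Ek (fst i)" for i unfolding V_def by blast
  have "span (\<Union>i. V i) \<subseteq> span (\<Union>c. eigenspace Y0 c)" using VE by (intro span_mono) blast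
  then show "span (\<Union>c. eigenspace Y0 c) = UNIV" unfolding V_span by blast
next
  fix c assume "eigenspace Y0 c \<noteq> {0}"
  moreover have "0 \<in> eigenspace Y0 c" by (simp add: eigenspace_def endo_zero[OF endoY0])
  ultimately obtain v where v: "Y0 v = c *\<^sub>C v" "v \<noteq> 0" by (auto simp: eigenspace_def)
  obtain j where j: "\<pi> j v \<noteq> 0" using pr.pi_eqI[of v 0] v(2) pr.pi_zero by metis
  have "of_int (fst j) *\<^sub>C \<pi> j v = c *\<^sub>C \<pi> j v" using pi_Y0[of j v] unfolding v(1) pr.pi_scale by metis
  then have "c = of_int (fst j)" using j by simp
  then show "c \<in> \<int>" by simp
next
  fix k
  show "W k = span (\<Union>j\<in>{..k}. Ek j)"
  proof
    have "W k \<subseteq> span (\<Union>i\<in>{..k} \<times> UNIV. V i)" using W_V[of k] by simp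
    also have "\<dots> \<subseteq> span (\<Union>j\<in>{..k}. Ek j)"
    proof (rule span_mono, rule UN_least)
      fix i :: "int \<times> int \<times> int" assume "i \<in> {..k} \<times> UNIV"
      then have "fst i \<in> {..k}" by auto
      then show "V i \<subseteq> (\<Union>j\<in>{..k}. Ek j)" unfolding V_def by blast
    qed
    finally show "W k \<subseteq> span (\<Union>j\<in>{..k}. Ek j)" .
    show "span (\<Union>j\<in>{..k}. Ek j) \<subseteq> W k"
    proof (rule span_minimal[OF _ W_sub], rule UN_least, rule subsetI)
      fix l v assume l: "l \<in> {..k}" "v \<in> Ek l"
      have "\<pi> i v = 0" if "fst i > k" for i
      proof -
        have "of_int (fst i) *\<^sub>C \<pi> i v = of_int l *\<^sub>C \<pi> i v"
          using pi_Y0[of i v] l(2) unfolding mem_Ek by (metis pr.pi_scale)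
        then show ?thesis using that l(1) by simp
      qed
      then show "v \<in> W k" unfolding lift_W_iff by blast
    qed
  qed
qed

end

end

text \<open>Conjugation carries eigenvectors of \<open>Y1\<close> to eigenvectors of
  \<open>Y2\<close> and swaps \<open>DG k p q\<close> with \<open>DG k q p\<close>, so it permutes
  the summands \<open>V\<close>. Taking \<open>Y2 = Y1\<close> gives the symmetry of the frame of a
  real grading.\<close>

lemma (in orbit) lift_conj:
  assumes l1: "lifting scale B W F N \<alpha> Y1" and l2: "lifting scale B W F N \<alpha> Y2"
    and Y: "\<And>v. Y2 (vconj v) = vconj (Y1 v)"
    and p1: "projections scale B K1 \<pi>1" "\<And>i v. \<pi>1 i v \<in> lifting.V scale B W F N Y1 i"
    and p2: "projections scale B K2 \<pi>2" "\<And>i v. v \<in> lifting.V scale B W F N Y2 i \<Longrightarrow> \<pi>2 i v = v"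
  shows "vconj (\<pi>1 (k, p, q) v) = \<pi>2 (k, q, p) (vconj v)"
proof -
  interpret l1: lifting scale B W F N \<alpha> Y1 by (rule l1)
  interpret l2: lifting scale B W F N \<alpha> Y2 by (rule l2)
  interpret p1: projections scale B K1 \<pi>1 by (rule p1)
  interpret p2: projections scale B K2 \<pi>2 by (rule p2)
  let ?s = "\<lambda>i :: int \<times> int \<times> int. (fst i, snd (snd i), fst (snd i))"
  have sw: "vconj x \<in> l2.V (?s i)" if "x \<in> l1.V i" for x i
    using that conj_DG[of "fst i" "fst (snd i)" "snd (snd i)"] Y[of x]
    by (auto simp: l1.V_def l2.V_def l1.mem_Ek l2.mem_Ek vconj_scale)
  have comp: "\<pi>2 j (vconj (\<pi>1 i v)) = (if ?s i = j then vconj (\<pi>1 i v) else 0)" for i j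
  proof -
    have "vconj (\<pi>1 i v) = \<pi>2 (?s i) (vconj (\<pi>1 i v))" using p2(2)[OF sw[OF p1(2)]] by simp
    then show ?thesis using p2.pi_pi[of j "?s i" "vconj (\<pi>1 i v)"] by metis
  qed
  have "\<pi>2 (k, q, p) (vconj v) = \<pi>2 (k, q, p) (vconj (\<Sum>i\<in>K1. \<pi>1 i v))" unfolding p1.pi_total ..
  also have "\<dots> = (\<Sum>i\<in>K1. if ?s i = (k, q, p) then vconj (\<pi>1 i v) else 0)"
    unfolding vconj_sum p2.pi_sum comp ..
  also have "\<dots> = (\<Sum>i\<in>K1. if i = (k, p, q) then vconj (\<pi>1 (k, p, q) v) else 0)"
    by (rule sum.cong) auto
  also have "\<dots> = vconj (\<pi>1 (k, p, q) v)" using p1.finK p1.pi_outside[of "(k, p, q)" v] by auto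
  finally show ?thesis ..
qed


section \<open>Conjugate gradings and their frames\<close>

context rational_structure
begin

definition cj :: "('v \<Rightarrow> 'v) \<Rightarrow> 'v \<Rightarrow> 'v" where "cj X v = vconj (X (vconj v))"

lemma br_pow_cj: "(br (cj A) ^^ n) (cj X) = cj ((br A ^^ n) X)"
proof (induction n)
  case (Suc n)
  then show ?case by (simp add: br_def cj_def vconj_diff fun_eq_iff)
qed simp

end

context orbit
begin

lemma cj_N: "cj N = N" by (simp add: cj_def realN fun_eq_iff)

context
  fixes Y1 K1 \<pi>1 m1 K2 \<pi>2 m2
  assumes l1: "lifting scale B W F N \<alpha> Y1" and l2: "lifting scale B W F N \<alpha> (cj Y1)"
    and p1: "projections scale B K1 \<pi>1" "\<And>i v. \<pi>1 i v \<in> lifting.V scale B W F N Y1 i"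
    and p2: "projections scale B K2 \<pi>2" "\<And>i v. v \<in> lifting.V scale B W F N (cj Y1) i \<Longrightarrow> \<pi>2 i v = v"
    and f1: "frame scale B K1 \<pi>1 W F N m1" and f2: "frame scale B K2 \<pi>2 W F N m2"
begin

interpretation f1: frame scale B K1 \<pi>1 W F N m1 by (rule f1)
interpretation f2: frame scale B K2 \<pi>2 W F N m2 by (rule f2)

lemma frame_conj_pi: "vconj (\<pi>1 (k, p, q) v) = \<pi>2 (k, q, p) (vconj v)"
  by (rule lift_conj[OF l1 l2 _ p1 p2]) (simp add: cj_def)

lemma frame_conj_cmp:
  assumes X: "endomorphism X"
  shows "f2.cmp (l, b, a) (cj X) = cj (f1.cmp (l, a, b) X)"
proof
  fix v
  have eX: "endomorphism (cj X)" unfolding cj_def[abs_def] by (rule endo_vconj[OF X])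
  show "f2.cmp (l, b, a) (cj X) v = cj (f1.cmp (l, a, b) X) v"
  proof (rule f2.pi_eqI)
    fix j :: "int \<times> int \<times> int"
    obtain k p q where j: "j = (k, q, p)" by (cases j) auto
    have "\<pi>2 j (f2.cmp (l, b, a) (cj X) v) = \<pi>2 (k, q, p) (cj X (\<pi>2 (k - l, q - b, p - a) v))"
      unfolding f2.pi_cmp[OF eX] j by simp
    also have "\<dots> = \<pi>2 (k, q, p) (vconj (X (\<pi>1 (k - l, p - a, q - b) (vconj v))))"
      using frame_conj_pi[of "k - l" "p - a" "q - b" "vconj v"] by (simp add: cj_def) (metis vconj_vconj)
    also have "\<dots> = vconj (\<pi>1 (k, p, q) (X (\<pi>1 (k - l, p - a, q - b) (vconj v))))"
      unfolding frame_conj_pi ..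
    also have "\<dots> = vconj (\<pi>1 (k, p, q) (f1.cmp (l, a, b) X (vconj v)))"
      unfolding f1.pi_cmp[OF X] by simp
    also have "\<dots> = \<pi>2 j (cj (f1.cmp (l, a, b) X) v)" unfolding frame_conj_pi j cj_def ..
    finally show "\<pi>2 j (f2.cmp (l, b, a) (cj X) v) = \<pi>2 j (cj (f1.cmp (l, a, b) X) v)" .
  qed
qed

text \<open>Goodness is symmetric in the two Hodge degrees, and conjugation exchanges the two
  frames. It thus passes to the conjugate grading before anything is known about its
  reality.\<close>

lemma frame_conj_good:
  assumes "f1.good i"
  shows "f2.good i"
proof -
  have c: "f2.cmp (l, b, a) N = cj (f1.cmp (l, a, b) N)" for l a b
    using frame_conj_cmp[OF endoN, of l b a] unfolding cj_N .
  have z: "cj (\<lambda>v. 0) = (\<lambda>v. 0)" by (simp add: cj_def fun_eq_iff)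
  have 1: "f2.cmp (- i, a, b) N = (\<lambda>v. 0)" if "(a, b) \<noteq> (- 1, - 1)" for a b
  proof -
    have "(b, a) \<noteq> (- 1, - 1)" using that by blast
    then have "f1.cmp (- i, b, a) N = (\<lambda>v. 0)" using assms unfolding f1.good_def by blast
    then show ?thesis unfolding c z by (simp add: z)
  qed
  have 2: "(br f2.N0 ^^ nat (i - 1)) (f2.cmp (- i, - 1, - 1) N) = (\<lambda>v. 0)"
  proof -
    have "(br f1.N0 ^^ nat (i - 1)) (f1.cmp (- i, - 1, - 1) N) = (\<lambda>v. 0)"
      using assms unfolding f1.good_def by blast
    then show ?thesis unfolding f2.N0_def c br_pow_cj by (simp only: f1.N0_def[symmetric] z)
  qed
  show ?thesis unfolding f2.good_def using 1 2 by blast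
qed

end

section \<open>From a split admissible orbit to a real limit\<close>

context
  fixes M
  assumes rel: "is_relative_weight_filtration N W M" and split: "split_over_R {0} UNIV F M"
begin

interpretation m: mhs scale B "{0}" UNIV F M
  using split unfolding split_over_R_def by unfold_locales blast

lemma conj_D: "vconj ` m.D p q = m.D q p"
  using split unfolding split_over_R_def m.deligne_eq_D by blast

lemma rel_M: "N ` M k \<subseteq> M (k - 2)" and M_Gr: "subspace_sum (M l \<inter> W k) (W (k - 1)) = GrL k l"
  using rel_N[OF incW nil NW rel] rel_Gr[OF incW nil NW rel] by blast+

context
  fixes R \<rho>
  assumes pR: "projections scale B R \<rho>" and rho_D: "\<And>i v. \<rho> i v \<in> m.D (fst i) (snd i)"
    and D_rho: "\<And>i v. v \<in> m.D (fst i) (snd i) \<Longrightarrow> \<rho> i v = v"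
begin

interpretation R: projections scale B R \<rho> by (rule pR)

lemma rho_bispan:
  assumes v: "v \<in> bispan {0} m.D P" and i: "i \<notin> P"
  shows "\<rho> i v = 0"
proof -
  have "bispan {0} m.D P \<subseteq> {v. \<rho> i v = 0}"
  proof (rule bispan_least)
    show "subspace {v. \<rho> i v = 0}" by (auto simp: subspace_def R.pi_add R.pi_scale)
    fix a b assume "(a, b) \<in> P"
    then have ne: "i \<noteq> (a, b)" using i by blast
    show "m.D a b \<subseteq> {v. \<rho> i v = 0}"
    proof
      fix x assume "x \<in> m.D a b"
      then have "\<rho> (a, b) x = x" by (intro D_rho) simp
      then show "x \<in> {v. \<rho> i v = 0}" using R.pi_pi[of i "(a, b)" x] ne by simp
    qed
  qed simp
  then show ?thesis using v by blast
qed

lemma rho_F: "v \<in> F p \<Longrightarrow> fst i < p \<Longrightarrow> \<rho> i v = 0"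
  using m.F_span[of p] by (intro rho_bispan[of v "{(a, b). a \<ge> p}"]) auto

lemma rho_M: "v \<in> M l \<Longrightarrow> fst i + snd i > l \<Longrightarrow> \<rho> i v = 0"
  using m.W_span[of l] by (intro rho_bispan[of v "{(a, b). a + b \<le> l}"]) auto

lemma rho_Fb: "v \<in> vconj ` F q \<Longrightarrow> snd i < q \<Longrightarrow> \<rho> i v = 0"
proof -
  have "vconj ` F q = vconj ` bispan {0} m.D {(a, b). a \<ge> q}" using m.F_span[of q] by simp
  also have "\<dots> = bispan {0} m.D (prod.swap ` {(a, b). a \<ge> q})"
    by (subst vconj_bispan) (simp_all add: conj_D)
  also have "prod.swap ` {(a, b). a \<ge> q} = {(a, b). b \<ge> q}" by force
  finally show "v \<in> vconj ` F q \<Longrightarrow> snd i < q \<Longrightarrow> \<rho> i v = 0"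
    by (intro rho_bispan[of v "{(a, b). b \<ge> q}"]) auto
qed

lemma rho_in_F: "\<rho> i v \<in> F (fst i)" and rho_in_M: "\<rho> i v \<in> M (fst i + snd i)"
  and rho_in_Fb: "\<rho> i v \<in> vconj ` F (snd i)"
proof -
  have DF: "x \<in> F p \<and> x \<in> M (p + q)" if "x \<in> m.D p q" for x p q using that unfolding m.D_def by blast
  then show "\<rho> i v \<in> F (fst i)" "\<rho> i v \<in> M (fst i + snd i)" using rho_D by blast+
  have "vconj (\<rho> i v) \<in> m.D (snd i) (fst i)" using rho_D conj_D by blast
  then show "\<rho> i v \<in> vconj ` F (snd i)" unfolding mem_vconj_image using DF by blast
qed

text \<open>Transversality for \<open>F\<close> and for its conjugate bounds each degree from below,
  the relative weight filtration bounds their sum from above, and only \<open>(-1, -1)\<close> is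
  left.\<close>

lemma rho_N: "x \<in> m.D p q \<Longrightarrow> N x \<in> m.D (p - 1) (q - 1)"
proof -
  assume "x \<in> m.D p q"
  then have x: "\<rho> (p, q) x = x" by (intro D_rho) simp
  have "N x \<in> F (p - 1)" "N x \<in> M (p + q - 2)" using rho_in_F[of "(p, q)" x] rho_in_M[of "(p, q)" x] NF rel_M unfolding x fst_conv snd_conv by blast+
  moreover have "vconj (N x) \<in> F (q - 1)"
    using rho_in_Fb[of "(p, q)" x] NF[of q] unfolding x snd_conv mem_vconj_image realN[symmetric] by blast
  then have "N x \<in> vconj ` F (q - 1)" unfolding mem_vconj_image .
  ultimately have 0: "\<rho> i (N x) = 0" if "i \<noteq> (p - 1, q - 1)" for i
  proof -
    have "fst i \<noteq> p - 1 \<or> snd i \<noteq> q - 1" using that by (auto simp: prod_eq_iff)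
    then consider "fst i < p - 1" | "snd i < q - 1" | "fst i + snd i > p + q - 2" by linarith
    then show ?thesis
      using rho_F \<open>N x \<in> F (p - 1)\<close> rho_M \<open>N x \<in> M (p + q - 2)\<close> rho_Fb \<open>N x \<in> vconj ` F (q - 1)\<close>
      by cases blast+
  qed
  have "\<rho> (p - 1, q - 1) (N x) = N x"
    by (rule R.pi_eqI) (use 0 in \<open>auto simp: R.pi_pi\<close>)
  then show "N x \<in> m.D (p - 1) (q - 1)" using rho_D[of "(p - 1, q - 1)" "N x"] by simp
qed

text \<open>Modulo \<open>W (k - 1)\<close> a class of type \<open>(p, q)\<close> has
  representatives in \<open>F p\<close>, in the conjugate of \<open>F q\<close> and in
  \<open>M (p + q)\<close>. Every other index is excluded by one of the three.\<close>

lemma rho_DG_W: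
  assumes IH: "\<And>i v. v \<in> W (k - 1) \<Longrightarrow> \<rho> i v \<in> W (k - 1)"
    and x: "x \<in> DG k p q" and i: "i \<noteq> (p, q)"
  shows "\<rho> i x \<in> W (k - 1)"
proof -
  have *: "\<rho> i x \<in> W (k - 1)" if "\<rho> i f = 0" "x - f \<in> W (k - 1)" for f
    using IH[OF that(2), of i] that(1) by (simp add: R.pi_diff)
  obtain f where f: "f \<in> F p" "x - f \<in> W (k - 1)"
  proof -
    have "x \<in> subspace_sum (F p \<inter> W k) (W (k - 1))" using x DG_F GrF_alt by blast
    then obtain f w where "f \<in> F p \<inter> W k" "w \<in> W (k - 1)" "x = f + w" by (elim subspace_sumE) blast
    then show thesis by (intro that[of f]) auto
  qed
  obtain g where g: "g \<in> M (p + q)" "x - g \<in> W (k - 1)"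
  proof -
    have "x \<in> subspace_sum (M (p + q) \<inter> W k) (W (k - 1))" using x DG_L M_Gr by blast
    then obtain f w where "f \<in> M (p + q) \<inter> W k" "w \<in> W (k - 1)" "x = f + w" by (elim subspace_sumE) blast
    then show thesis by (intro that[of f]) auto
  qed
  obtain y where y: "y \<in> vconj ` F q" "x - y \<in> W (k - 1)" using DG_Fb[OF x] by blast
  have "fst i \<noteq> p \<or> snd i \<noteq> q" using i by (auto simp: prod_eq_iff)
  then consider "fst i < p" | "snd i < q" | "fst i + snd i > p + q" by linarith
  then show ?thesis
  proof cases
    case 1
    then show ?thesis by (intro *[OF rho_F[OF f(1)] f(2)])
  next
    case 2
    then show ?thesis by (intro *[OF rho_Fb[OF y(1)] y(2)])
  next
    case 3
    then show ?thesis by (intro *[OF rho_M[OF g(1)] g(2)])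
  qed
qed

text \<open>Compatibility of the bigrading of \<open>(F, M)\<close> with \<open>W\<close>.
  Components of the wrong type are covered by \<open>rho_DG_W\<close>, and the remaining one is the
  vector minus the others.\<close>

lemma rho_W: "v \<in> W k \<Longrightarrow> \<rho> i v \<in> W k"
proof -
  obtain k0 where k0: "\<forall>k\<le>k0. W k = {0}" using W_bottom by blast
  have "\<forall>v\<in>W k. \<forall>i. \<rho> i v \<in> W k"
  proof (rule int_bottom_induct[of k0])
    show "\<forall>v\<in>W k. \<forall>i. \<rho> i v \<in> W k" if "k \<le> k0" for k using k0 that by simp
    fix k assume IH: "\<forall>v\<in>W (k - 1). \<forall>i. \<rho> i v \<in> W (k - 1)"
    have le: "W (k - 1) \<subseteq> W k" by (rule W_mono) simp
    have sub: "bispan (W (k - 1)) (DG k) UNIV \<subseteq> {v. \<forall>i. \<rho> i v \<in> W k}"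
    proof (rule bispan_least)
      show "subspace {v. \<forall>i. \<rho> i v \<in> W k}"
        using W_sub[of k] unfolding subspace_def by (simp add: R.pi_add R.pi_scale)
      show "W (k - 1) \<subseteq> {v. \<forall>i. \<rho> i v \<in> W k}" using IH le by blast
      fix p q
      show "DG k p q \<subseteq> {v. \<forall>i. \<rho> i v \<in> W k}"
      proof (intro subsetI CollectI allI)
        fix x i assume x: "x \<in> DG k p q"
        have ne: "\<rho> j x \<in> W k" if "j \<noteq> (p, q)" for j
          using rho_DG_W[OF _ x that] IH le by blast
        show "\<rho> i x \<in> W k"
        proof (cases "i = (p, q) \<and> i \<in> R")
          case True
          then have "i \<in> R" by blast
          from sum.remove[OF R.finK this, of "\<lambda>j. \<rho> j x"]
          have "x = \<rho> i x + (\<Sum>j\<in>R - {i}. \<rho> j x)" unfolding R.pi_total .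
          then have "\<rho> i x = x - (\<Sum>j\<in>R - {i}. \<rho> j x)" by (simp add: eq_diff_eq)
          moreover have "(\<Sum>j\<in>R - {i}. \<rho> j x) \<in> W k"
            using ne True by (intro module.subspace_sum[OF module_axioms W_sub]) auto
          moreover have "x \<in> W k" using x DG_W by blast
          ultimately show ?thesis by (simp only: subspace_diff[OF W_sub])
        next
          case False
          then consider "i \<noteq> (p, q)" | "i \<notin> R" by blast
          then show ?thesis using ne[of i] R.pi_outside[of i x] subspace_0[OF W_sub, of k] by cases simp_all
        qed
      qed
    qed
    show "\<forall>v\<in>W k. \<forall>i. \<rho> i v \<in> W k" using sub W_DG_span[of k] by blast
  qed
  then show "v \<in> W k \<Longrightarrow> \<rho> i v \<in> W k" by blast
qed

context
  fixes z0 assumes z0: "Im z0 > \<alpha>"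
begin

text \<open>The diagonal part of \<open>psi z0\<close> for the bigrading of \<open>(F, M)\<close>.
  It preserves \<open>F\<close> and its conjugate, and still acts as \<open>k\<close> on
  \<open>Gr k\<close> because the projections respect \<open>W\<close>.\<close>

definition Yr :: "'v \<Rightarrow> 'v" where "Yr v = (\<Sum>i\<in>R. \<rho> i (psi z0 (\<rho> i v)))"

lemma rho_Yr: "\<rho> j (Yr v) = \<rho> j (psi z0 (\<rho> j v))"
proof -
  have "\<rho> j (Yr v) = (\<Sum>i\<in>R. if i = j then \<rho> j (psi z0 (\<rho> j v)) else 0)"
    unfolding Yr_def R.pi_sum R.pi_pi by (rule sum.cong) auto
  then show ?thesis using R.finK R.pi_outside[of j "psi z0 (\<rho> j v)"] by auto
qed

lemma Yr_rho: "Yr (\<rho> j v) = \<rho> j (Yr v)"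
proof (rule R.pi_eqI)
  fix i
  show "\<rho> i (Yr (\<rho> j v)) = \<rho> i (\<rho> j (Yr v))"
    unfolding R.pi_pi[of i j] rho_Yr R.pi_pi[of i j v]
    by (simp add: endo_zero[OF endo_psi[OF z0]])
qed

lemma lifting_Yr: "lifting scale B W F N \<alpha> Yr"
proof
  show "endomorphism Yr" unfolding Yr_def[abs_def]
    by (rule endo_sum_fun, rule endo_comp[OF R.endo_pi endo_comp[OF endo_psi[OF z0] R.endo_pi]])
  show "Yr v - of_int k *\<^sub>C v \<in> W (k - 1)" if v: "v \<in> W k" for v k
  proof -
    have "Yr v - of_int k *\<^sub>C v = Yr v - of_int k *\<^sub>C (\<Sum>i\<in>R. \<rho> i v)" unfolding R.pi_total ..
    also have "\<dots> = (\<Sum>i\<in>R. \<rho> i (psi z0 (\<rho> i v) - of_int k *\<^sub>C \<rho> i v))"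
      unfolding Yr_def scale_sum_right sum_subtractf[symmetric]
      by (rule sum.cong) (simp_all add: R.pi_diff R.pi_scale R.pi_pi)
    also have "\<dots> \<in> W (k - 1)"
      by (intro module.subspace_sum[OF module_axioms W_sub] rho_W psi_W[OF z0] v)
    finally show ?thesis .
  qed
  show "Yr ` F p \<subseteq> F p" for p
  proof (rule image_subsetI)
    fix v assume v: "v \<in> F p"
    show "Yr v \<in> F p" unfolding Yr_def
    proof (rule module.subspace_sum[OF module_axioms subF])
      fix i
      show "\<rho> i (psi z0 (\<rho> i v)) \<in> F p"
      proof (cases "fst i < p")
        case True
        then have "\<rho> i v = 0" by (rule rho_F[OF v])
        then show ?thesis by (simp add: endo_zero[OF endo_psi[OF z0]] subspace_0[OF subF])
      next
        case False
        then show ?thesis using rho_in_F[of i "psi z0 (\<rho> i v)"] antiF[of p "fst i"] by auto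
      qed
    qed
  qed
  show "Yr ` (vconj ` F p) \<subseteq> vconj ` F p" for p
  proof (rule image_subsetI)
    fix v assume v: "v \<in> vconj ` F p"
    show "Yr v \<in> vconj ` F p" unfolding Yr_def
    proof (rule module.subspace_sum[OF module_axioms subspace_vconj[OF subF]])
      fix i
      show "\<rho> i (psi z0 (\<rho> i v)) \<in> vconj ` F p"
      proof (cases "snd i < p")
        case True
        then have "\<rho> i v = 0" by (rule rho_Fb[OF v])
        then show ?thesis by (simp add: endo_zero[OF endo_psi[OF z0]] subspace_0[OF subspace_vconj[OF subF]])
      next
        case False
        then have "vconj ` F (snd i) \<subseteq> vconj ` F p" using antiF[of p "snd i"] by (intro image_mono) simp
        then show ?thesis using rho_in_Fb by blast
      qed
    qed
  qed
qed

interpretation Yr: lifting scale B W F N \<alpha> Yr by (rule lifting_Yr)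

text \<open>As \<open>Yr\<close> commutes with each \<open>\<rho> j\<close>, a component of an
  eigenvector is an eigenvector of the same weight. A component of the wrong type lies in lower
  weight, so it vanishes.\<close>

lemma V_D: "Yr.V i \<subseteq> m.D (fst (snd i)) (snd (snd i))"
proof
  fix x assume x: "x \<in> Yr.V i"
  obtain k p q where i: "i = (k, p, q)" by (cases i) auto
  have x': "x \<in> DG k p q" "x \<in> Yr.Ek k" using x by (auto simp: Yr.V_def i)
  have "\<rho> j x = 0" if "j \<noteq> (p, q)" for j
  proof (rule Yr.Ek_W_zero)
    show "\<rho> j x \<in> Yr.Ek k" using x'(2) unfolding Yr.mem_Ek Yr_rho by (simp add: R.pi_scale)
    show "\<rho> j x \<in> W (k - 1)" by (rule rho_DG_W[OF rho_W x'(1) that])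
  qed
  note other = this
  have "x = \<rho> (p, q) x"
  proof (rule R.pi_eqI)
    fix j
    show "\<rho> j x = \<rho> j (\<rho> (p, q) x)"
      unfolding R.pi_pi by (cases "j = (p, q)") (simp_all only: other if_True if_False refl not_False_eq_True)
  qed
  then show "x \<in> m.D (fst (snd i)) (snd (snd i))" using rho_D[of "(p, q)" x] by (simp add: i)
qed

context
  fixes K \<pi> n
  assumes pr: "projections scale B K \<pi>" and pi_V: "\<And>i v. \<pi> i v \<in> Yr.V i" and V_pi: "\<And>i v. v \<in> Yr.V i \<Longrightarrow> \<pi> i v = v"
    and fr: "frame scale B K \<pi> W F N n" and Im0: "Im z0 \<noteq> 0"
begin

interpretation fr: frame scale B K \<pi> W F N n by (rule fr)

lemma fr_Y: "fr.Y = Yr"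
proof
  show "fr.Y v = Yr v" for v unfolding fr.Y_def by (rule Yr.lift_Y[OF pr pi_V V_pi])
qed

lemma pi_rho: "\<pi> j (\<rho> (snd j) u) = \<pi> j u"
proof -
  have *: "\<rho> c (\<pi> i u) = (if snd i = c then \<pi> i u else 0)" for c i
  proof -
    have e: "\<rho> (snd i) (\<pi> i u) = \<pi> i u" using pi_V[of i u] V_D[of i] by (intro D_rho) blast
    show ?thesis using R.pi_pi[of c "snd i" "\<pi> i u"] unfolding e by (cases "c = snd i") simp_all
  qed
  have "\<pi> j (\<rho> (snd j) u) = \<pi> j (\<rho> (snd j) (\<Sum>i\<in>K. \<pi> i u))" unfolding fr.pi_total ..
  also have "\<dots> = (\<Sum>i\<in>K. if snd i = snd j then \<pi> j (\<pi> i u) else 0)"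
    unfolding R.pi_sum fr.pi_sum * by (rule sum.cong[OF refl]) (simp only: fr.pi_zero if_distrib[of "\<pi> j"])
  also have "\<dots> = (\<Sum>i\<in>K. if i = j then \<pi> j u else 0)"
    by (rule sum.cong[OF refl]) (simp add: fr.pi_pi)
  also have "\<dots> = \<pi> j u" using fr.finK fr.pi_outside[of j u] by auto
  finally show ?thesis .
qed

text \<open>The frame of \<open>Yr\<close> refines the bigrading of \<open>(F, M)\<close>, so
  \<open>N\<close> has type \<open>(-1, -1)\<close> by \<open>rho_N\<close>, and
  \<open>psi z0 - Yr\<close> has no component of type \<open>(0, 0)\<close> by the choice of
  \<open>Yr\<close>.\<close>

lemma all_good_Yr: "i \<ge> 1 \<Longrightarrow> fr.good i"
proof (rule fr.all_good[OF endo_psi[OF z0] _ frame_fY[OF fr z0] frame_hY[OF fr z0] frame_opposed[OF fr z0]])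
  show "ex (z0 - cnj z0) (psi z0 (ex (- (z0 - cnj z0)) v))
      = fr.exN (z0 - cnj z0) (psi z0 (fr.exN (- (z0 - cnj z0)) v))" for v
    unfolding exN_ex[OF fr] ..
  show "z0 - cnj z0 \<noteq> 0" using Im0 by (simp add: complex_eq_iff)
  show "fr.cmp (- j, a, b) N = (\<lambda>v. 0)" if "(a, b) \<noteq> (- 1, - 1)" for j a b
  proof
    fix v
    have "\<pi> (i + (- j, a, b)) (N (\<pi> i v)) = 0" for i
    proof -
      obtain k p q where i: "i = (k, p, q)" by (cases i) auto
      have "\<pi> i v \<in> m.D p q" using pi_V[of i v] V_D[of i] by (auto simp: i)
      then have "N (\<pi> i v) \<in> m.D (p - 1) (q - 1)" by (rule rho_N)
      then have "\<rho> (p - 1, q - 1) (N (\<pi> i v)) = N (\<pi> i v)" by (intro D_rho) simp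
      moreover have ne: "\<not> (p + a, q + b) = (p - 1, q - 1)" using that by auto
      ultimately have "\<rho> (p + a, q + b) (N (\<pi> i v)) = 0"
        using R.pi_pi[of "(p + a, q + b)" "(p - 1, q - 1)" "N (\<pi> i v)"] unfolding if_not_P[OF ne] by (simp only:)
      then show ?thesis using pi_rho[of "i + (- j, a, b)" "N (\<pi> i v)"] by (simp add: i)
    qed
    then show "fr.cmp (- j, a, b) N v = 0" unfolding fr.cmp_def by (intro sum.neutral) blast
  qed
  show "fr.cmp (- j, 0, 0) (\<lambda>v. psi z0 v - fr.Y v) v = 0" for j v
  proof -
    have "\<pi> (i + (- j, 0, 0)) (psi z0 (\<pi> i v) - fr.Y (\<pi> i v)) = 0" for i
    proof -
      have "\<rho> (snd i) (\<pi> i v) = \<pi> i v" using pi_V[of i v] V_D[of i] by (intro D_rho) blast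
      then have "\<rho> (snd i) (psi z0 (\<pi> i v) - fr.Y (\<pi> i v)) = 0"
        unfolding fr_Y by (simp add: R.pi_diff rho_Yr)
      moreover have "snd (i + (- j, 0, 0)) = snd i" by (cases i) auto
      ultimately show ?thesis using pi_rho[of "i + (- j, 0, 0)" "psi z0 (\<pi> i v) - fr.Y (\<pi> i v)"] by simp
    qed
    then show ?thesis unfolding fr.cmp_def by (intro sum.neutral) blast
  qed
qed

end

lemma lifting_cj: "lifting scale B W F N \<alpha> (cj Yr)"
proof
  show "endomorphism (cj Yr)" unfolding cj_def[abs_def] by (rule endo_vconj[OF Yr.endoY0])
  show "cj Yr v - of_int k *\<^sub>C v \<in> W (k - 1)" if v: "v \<in> W k" for v k
  proof -
    have "vconj v \<in> W k" using v conjW by blast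
    then have "vconj (Yr (vconj v) - of_int k *\<^sub>C vconj v) \<in> W (k - 1)" using Yr.Y0_W conjW by blast
    then show ?thesis by (simp add: cj_def vconj_diff vconj_scale)
  qed
  show "cj Yr ` F p \<subseteq> F p" for p
  proof (rule image_subsetI)
    fix v assume "v \<in> F p"
    then have "vconj v \<in> vconj ` F p" by blast
    then have "Yr (vconj v) \<in> vconj ` F p" using Yr.Y0_Fb by blast
    then show "cj Yr v \<in> F p" by (simp add: cj_def mem_vconj_image)
  qed
  show "cj Yr ` (vconj ` F p) \<subseteq> vconj ` F p" for p
    using Yr.Y0_F[of p] by (auto simp: cj_def)
qed

text \<open>Goodness is a property of \<open>N\<close> and the frame and does not refer to a point
  of the orbit, so information won at \<open>z0\<close> applies at every \<open>z\<close>.\<close>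

lemma psi_frame:
  assumes fr: "frame scale B K \<pi> W F N n" and g: "\<And>i. i \<ge> 1 \<Longrightarrow> frame.good K \<pi> N i"
    and z: "Im z > \<alpha>" "Im z \<noteq> 0"
  shows "psi z v = frame.Y scale K \<pi> v"
proof -
  interpret fr: frame scale B K \<pi> W F N n by (rule fr)
  have *: "ex (z - cnj z) (psi z (ex (- (z - cnj z)) v))
      = fr.exN (z - cnj z) (psi z (fr.exN (- (z - cnj z)) v))" for v
    unfolding exN_ex[OF fr] ..
  have "z - cnj z \<noteq> 0" using z(2) by (simp add: complex_eq_iff)
  from fr.good_zero[OF endo_psi[OF z(1)] * frame_fY[OF fr z(1)] frame_hY[OF fr z(1)] frame_opposed[OF fr z(1)] this g]
  show ?thesis .
qed

text \<open>The frames of \<open>Yr\<close> and of its conjugate are both good, so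
  \<open>psi z0\<close> equals both gradings. This is how reality of \<open>Yr\<close> is
  obtained.\<close>

lemma Yr_limit:
  assumes Im0: "Im z0 \<noteq> 0"
  shows "grading W Yr" "Yr (vconj v) = vconj (Yr v)" "Im z > \<alpha> \<Longrightarrow> Im z \<noteq> 0 \<Longrightarrow> psi z v = Yr v"
proof -
  interpret Yc: lifting scale B W F N \<alpha> "cj Yr" by (rule lifting_cj)
  obtain K \<pi> where p: "projections scale B K \<pi>" "\<And>i v. \<pi> i v \<in> Yr.V i" "\<And>i v. v \<in> Yr.V i \<Longrightarrow> \<pi> i v = v"
    by (rule Yr.obtain_projections) blast
  obtain K' \<pi>' where p': "projections scale B K' \<pi>'" "\<And>i v. \<pi>' i v \<in> Yc.V i" "\<And>i v. v \<in> Yc.V i \<Longrightarrow> \<pi>' i v = v"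
    by (rule Yc.obtain_projections) blast
  obtain n where fr: "frame scale B K \<pi> W F N n" using Yr.lift_frame[OF p] by blast
  obtain n' where fr': "frame scale B K' \<pi>' W F N n'" using Yc.lift_frame[OF p'] by blast
  have g: "frame.good K \<pi> N i" if "i \<ge> 1" for i using all_good_Yr[OF p fr Im0 that] .
  have g': "frame.good K' \<pi>' N i" if "i \<ge> 1" for i
    by (rule frame_conj_good[OF lifting_Yr lifting_cj p(1,2) p'(1,3) fr fr' g[OF that]])
  interpret fr': frame scale B K' \<pi>' W F N n' by (rule fr')
  have Y': "fr'.Y = cj Yr"
    proof
    show "fr'.Y v = cj Yr v" for v unfolding fr'.Y_def by (rule Yc.lift_Y[OF p'])
  qed
  show "grading W Yr" by (rule Yr.lift_grading[OF p])
  show z: "psi z v = Yr v" if "Im z > \<alpha>" "Im z \<noteq> 0" for z v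
    using psi_frame[OF fr g that, of v] fr_Y[OF p fr Im0] by simp
  have "psi z0 v = cj Yr v" for v using psi_frame[OF fr' g' z0 Im0, of v] Y' by simp
  then have "Yr v = cj Yr v" for v using z[OF z0 Im0] by simp
  from this[of "vconj v"] show "Yr (vconj v) = vconj (Yr v)" by (simp add: cj_def)
qed

end

end

text \<open>The limit is that of a constant: \<open>psi z\<close> equals \<open>Yr\<close> at every
  point of sufficiently large imaginary part.\<close>

lemma split_limit:
  "\<exists>Y. grading W Y \<and> defined_over_R Y \<and> end_tendsto psi Y (filtercomap Im at_top)"
proof -
  let ?D = "\<lambda>i. m.D (fst i) (snd i)"
  obtain R \<rho> where R: "projections scale B R \<rho>" "\<And>i v. \<rho> i v \<in> ?D i" "\<And>i v. v \<in> ?D i \<Longrightarrow> \<rho> i v = v"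
  proof (rule direct_family_projections[of ?D])
    show "subspace (?D i)" for i by (rule m.subD)
    have "UNIV = span ({0} \<union> (\<Union>i. ?D i))" using m.A_span unfolding bispan_alt by simp
    then show "span (\<Union>i. ?D i) = UNIV" by (simp add: span_insert_0)
    show "\<forall>i\<in>P. u i = 0" if "finite P" "\<And>i. i \<in> P \<Longrightarrow> u i \<in> ?D i" "(\<Sum>i\<in>P. u i) = 0" for P u
      using m.D_indep[of P u] that by simp
  qed blast
  \<comment> \<open>A point whose imaginary part exceeds \<open>\<alpha>\<close>, so that it is on
    the orbit, and is positive, so that \<open>z0 - cnj z0\<close> is nonzero.\<close>
  define z0 where "z0 = \<i> * complex_of_real (max \<alpha> 0 + 1)"
  have z0: "Im z0 > \<alpha>" "Im z0 \<noteq> 0" by (auto simp: z0_def)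
  note Y = Yr_limit[OF R z0]
  define Y where "Y = Yr R \<rho> z0"
  have gr: "grading W Y" unfolding Y_def by (rule Y(1))
  then have "endomorphism Y" unfolding grading_def semisimple_def by blast
  then have "defined_over_R Y" unfolding Y_def using Y(2) by (subst defined_over_R_iff) auto
  moreover have "end_tendsto psi Y (filtercomap Im at_top)"
    unfolding end_tendsto_def
  proof (intro allI ballI tendsto_eventually)
    fix v b
    have "eventually (\<lambda>z. Im z > max \<alpha> 0) (filtercomap Im at_top)"
      by (rule eventually_filtercomapI[OF eventually_gt_at_top])
    then show "eventually (\<lambda>z. representation B (psi z v) b = representation B (Y v) b) (filtercomap Im at_top)"
      by eventually_elim (use Y(3) in \<open>auto simp: Y_def\<close>)
  qed
  ultimately show ?thesis using gr by blast
qed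

end

end


section \<open>From a real limit to a split admissible orbit\<close>

context orbit
begin

text \<open>Subspaces are closed, so the limit inherits invariance of \<open>F\<close>, and reality
  adds invariance of the conjugate. Thus \<open>Y\<close> satisfies the conditions of
  \<open>lifting\<close>, and its frame supplies the relative weight filtration.\<close>

lemma limit_split:
  assumes gr: "grading W Y" and real: "defined_over_R Y" and lim: "end_tendsto psi Y (filtercomap Im at_top)"
  shows "admissible N W \<and> split_orbit W F N"
proof -
  have endoY: "endomorphism Y" using gr unfolding grading_def semisimple_def by blast
  have Y_conj: "Y (vconj v) = vconj (Y v)" for v using real unfolding defined_over_R_iff[OF endoY] by blast
  \<comment> \<open>The limit is evaluated along the imaginary axis, where \<open>z - cnj z\<close>
    is \<open>2 * \<i> * y\<close>.\<close>
  have imag: "filterlim (\<lambda>y. \<i> * complex_of_real y) (filtercomap Im at_top) at_top"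
    unfolding filterlim_filtercomap_iff by (simp add: comp_def filterlim_ident)
  have lim_y: "((\<lambda>y. representation B (psi (\<i> * complex_of_real y) v) b) \<longlongrightarrow> representation B (Y v) b) at_top"
    if "b \<in> B" for v b
    using filterlim_compose[OF _ imag] lim that unfolding end_tendsto_def by blast
  have Y_F: "Y ` F p \<subseteq> F p" for p
  proof (rule image_subsetI)
    fix v assume v: "v \<in> F p"
    show "Y v \<in> F p"
    proof (rule subspace_limit[OF subF _ lim_y])
      show "eventually (\<lambda>y. psi (\<i> * complex_of_real y) v \<in> F p) at_top"
        using eventually_gt_at_top[of \<alpha>] by eventually_elim (rule psi_F[OF _ v], simp)
    qed simp_all
  qed
  have Y_Fb: "Y ` (vconj ` F p) \<subseteq> vconj ` F p" for p
    using Y_F[of p] by (auto simp: Y_conj)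
  have Y_W: "Y v - of_int k *\<^sub>C v \<in> W (k - 1)" if "v \<in> W k" for v k
  proof -
    have W_eq: "W k = span (\<Union>j\<in>{..k}. eigenspace Y (of_int j))" for k using gr unfolding grading_def by blast
    show ?thesis
    proof (rule endo_span_subset[OF endo_minus[OF endoY endo_scaled[OF endo_id]] W_sub])
      show "v \<in> span (\<Union>j\<in>{..k}. eigenspace Y (of_int j))" using that W_eq by blast
      fix x assume "x \<in> (\<Union>j\<in>{..k}. eigenspace Y (of_int j))"
      then obtain j where j: "j \<le> k" "x \<in> eigenspace Y (of_int j)" by blast
      then have Yx: "Y x = of_int j *\<^sub>C x" by (simp add: eigenspace_def)
      show "Y x - of_int k *\<^sub>C x \<in> W (k - 1)"
      proof (cases "j = k")
        case True
        then show ?thesis using Yx subspace_0[OF W_sub] by simp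
      next
        case False
        then have "x \<in> W (k - 1)" unfolding W_eq using j by (intro span_base) auto
        then show ?thesis unfolding Yx by (intro subspace_diff subspace_scale W_sub)
      qed
    qed
  qed
  interpret L: lifting scale B W F N \<alpha> Y
    by unfold_locales (use endoY Y_W Y_F Y_Fb in blast)+
  have lift: "lifting scale B W F N \<alpha> Y" by (rule L.lifting_axioms)
  obtain K \<pi> where p: "projections scale B K \<pi>" "\<And>i v. \<pi> i v \<in> L.V i" "\<And>i v. v \<in> L.V i \<Longrightarrow> \<pi> i v = v"
    by (rule L.obtain_projections) blast
  obtain n where fr: "frame scale B K \<pi> W F N n" using L.lift_frame[OF p] by blast
  interpret fr: frame scale B K \<pi> W F N n by (rule fr)
  have conj_pi: "vconj (\<pi> (k, p, q) v) = \<pi> (k, q, p) (vconj v)" for k p q v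
    by (rule lift_conj[OF lift lift Y_conj p(1,2) p(1,3)])
  have frY: "fr.Y = Y"
  proof
    show "fr.Y v = Y v" for v unfolding fr.Y_def by (rule L.lift_Y[OF p])
  qed
  let ?z = "\<lambda>y. \<i> * complex_of_real y" and ?S = "\<lambda>y. 2 * \<i> * complex_of_real y"
  have zS: "?z y - cnj (?z y) = ?S y" for y by simp
  have gt: "Im (?z y) > \<alpha>" if "y \<ge> max \<alpha> 0 + 1" for y using that by simp
  interpret rf: real_frame scale B K \<pi> W F N n "\<lambda>y. psi (?z y)"
    "\<lambda>y v. ex (?S y) (psi (?z y) (ex (- ?S y) v))" "max \<alpha> 0 + 1"
  proof
    show "N (vconj v) = vconj (N v)" for v by (rule realN)
    show "vconj (\<pi> (k, p, q) v) = \<pi> (k, q, p) (vconj v)" for k p q v by (rule conj_pi)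
    show "max \<alpha> 0 + 1 > 0" by simp
    fix y assume y: "y \<ge> max \<alpha> 0 + 1"
    show "fr.opposed (?S y)" using frame_opposed[OF fr gt[OF y]] unfolding zS .
    show "endomorphism (psi (?z y))" by (rule endo_psi[OF gt[OF y]])
    show "ex (?S y) (psi (?z y) (ex (- ?S y) v)) = fr.exN (?S y) (psi (?z y) (fr.exN (- ?S y) v))" for v
      unfolding exN_ex[OF fr] ..
    show "fr.supp {\<delta>. fst \<delta> \<le> - 1 \<and> fst (snd \<delta>) \<ge> 0} (\<lambda>v. psi (?z y) v - fr.Y v)"
      by (rule frame_fY[OF fr gt[OF y]])
    show "fr.supp {\<delta>. fst \<delta> \<le> - 1 \<and> snd (snd \<delta>) \<ge> 1 + fst \<delta>}
        (\<lambda>v. ex (?S y) (psi (?z y) (ex (- ?S y) v)) - fr.Y v)"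
      using frame_hY[OF fr gt[OF y]] unfolding zS .
  next
    show "((\<lambda>y. representation B (psi (?z y) v) b) \<longlongrightarrow> representation B (fr.Y v) b) at_top" if "b \<in> B" for b v
      unfolding frY by (rule lim_y[OF that])
  qed
  \<comment> \<open>Weight zero is settled by the axioms of the frame, negative weights by the
    convergence argument.\<close>
  have N_type: "\<pi> j (N (\<pi> i v)) = 0" if ne: "snd j \<noteq> snd i - (1, 1)" for i j v
  proof -
    obtain l a b where d: "j - i = (l, a, b)" by (cases "j - i") auto
    have ab: "(a, b) \<noteq> (- 1, - 1)"
    proof
      assume "(a, b) = (- 1, - 1)"
      then have "snd j - snd i = (- 1, - 1)" using d by (metis snd_conv snd_diff)
      then show False using ne by (auto simp: prod_eq_iff)
    qed
    show ?thesis
    proof (cases "l \<le> - 1")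
      case False
      then have "j - i \<notin> insert (0, - 1, - 1) {(l, a, b). l \<le> - 1 \<and> a \<ge> - 1 \<and> b \<ge> - 1}"
        using ab unfolding d by auto
      then show ?thesis by (rule fr.suppD[OF fr.suppN])
    next
      case True
      then have "fr.cmp (- (- l), a, b) N = (\<lambda>v. 0)" by (intro rf.N_type ab) simp
      then have "fr.cmp (j - i) N (\<pi> i v) = 0" unfolding d by simp
      then show ?thesis unfolding fr.cmp_pi[OF endoN] by simp
    qed
  qed
  have M_N: "N ` fr.M l \<subseteq> fr.M (l - 2)" for l
  proof (rule image_subsetI)
    fix v assume v: "v \<in> fr.M l"
    have "\<pi> j (N v) = 0" if j: "fst (snd j) + snd (snd j) > l - 2" for j
    proof -
      have "N v = N (\<Sum>i\<in>K. \<pi> i v)" unfolding fr.pi_total ..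
      then have "\<pi> j (N v) = (\<Sum>i\<in>K. \<pi> j (N (\<pi> i v)))"
        unfolding endo_sum[OF endoN] by (simp only: fr.pi_sum)
      also have "\<dots> = 0"
      proof (rule sum.neutral, rule ballI)
        fix i
        show "\<pi> j (N (\<pi> i v)) = 0"
        proof (cases "snd j = snd i - (1, 1)")
          case True
          then have "fst (snd i) + snd (snd i) > l" using j by simp
          then have "\<pi> i v = 0" using v unfolding fr.M_iff by blast
          then show ?thesis by (simp add: endo_zero[OF endoN])
        qed (rule N_type)
      qed
      finally show ?thesis .
    qed
    then show "N v \<in> fr.M (l - 2)" unfolding fr.M_iff by blast
  qed
  \<comment> \<open>On \<open>Gr k\<close> both filtrations consist of the types with
    \<open>a + b \<le> l\<close>, described once through the lifted summands and once through
    \<open>DG\<close>.\<close>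
  have M_Gr: "Gr_filtration fr.M W k = GrL k" for k
  proof
    fix l
    have "Gr_filtration fr.M W k l = subspace_sum (fr.M l \<inter> W k) (W (k - 1))" (is "_ = ?G")
      unfolding Gr_filtration_def induced_filtration_def ..
    also have "?G = bispan (W (k - 1)) (DG k) {(a, b). a + b \<le> l}" (is "_ = ?R")
    proof
      show "?R \<subseteq> ?G"
      proof (rule bispan_least)
        show "subspace ?G" by (intro subspace_subspace_sum subspace_inter fr.subM W_sub)
        show "W (k - 1) \<subseteq> ?G" by (intro subspace_sum_upper2 subspace_inter fr.subM W_sub)
        fix a b assume ab: "(a, b) \<in> {(a, b). a + b \<le> l}"
        show "DG k a b \<subseteq> ?G"
        proof
          fix x assume "x \<in> DG k a b"
          then obtain v where v: "v \<in> L.V (k, a, b)" "x - v \<in> W (k - 1)" by (rule L.DG_V)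
          have "v \<in> W k" using v(1) L.V_W[of "(k, a, b)"] by auto
          moreover have "\<pi> i v = 0" if "fst (snd i) + snd (snd i) > l" for i :: "int \<times> int \<times> int"
          proof -
            have "i \<noteq> (k, a, b)" using that ab by auto
            then show ?thesis using L.pi_V_other[OF p v(1)] by blast
          qed
          then have "v \<in> fr.M l" unfolding fr.M_iff by blast
          ultimately show "x \<in> ?G" using subspace_sumI[of v "fr.M l \<inter> W k" "x - v"] v(2) by simp
        qed
      qed
      show "?G \<subseteq> ?R"
      proof (rule subspace_sum_least[OF subspace_bispan])
        show "W (k - 1) \<subseteq> ?R" using bispan_bottom by blast
        show "fr.M l \<inter> W k \<subseteq> ?R"
        proof
          fix v assume v: "v \<in> fr.M l \<inter> W k"
          have "(\<Sum>i\<in>K. \<pi> i v) \<in> ?R"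
          proof (rule module.subspace_sum[OF module_axioms subspace_bispan])
            fix i :: "int \<times> int \<times> int"
            obtain c a b where i: "i = (c, a, b)" by (cases i) auto
            show "\<pi> i v \<in> ?R"
            proof (cases "\<pi> i v = 0")
              case False
              then have ab: "\<not> a + b > l" and c: "\<not> c > k" using v unfolding Int_iff fr.M_iff fr.W_iff i by auto
              have V: "\<pi> i v \<in> DG c a b" using p(2)[of i v] by (simp add: L.V_def i)
              show ?thesis
              proof (cases "c = k")
                case True
                then show ?thesis using V ab by (intro bispan_base[of a b]) auto
              next
                case False
                then have "W c \<subseteq> W (k - 1)" using c by (intro W_mono) simp
                then show ?thesis using V DG_W bispan_bottom by blast
              qed
            qed (simp add: subspace_0[OF subspace_bispan])
          qed
          then show "v \<in> ?R" unfolding fr.pi_total .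
        qed
      qed
    qed
    also have "\<dots> = GrL k l" unfolding L_DG ..
    finally show "Gr_filtration fr.M W k l = GrL k l" .
  qed
  have rel: "is_relative_weight_filtration N W fr.M"
    unfolding is_relative_weight_filtration_def using fr.M_increasing M_N M_Gr by blast
  have "relative_weight_filtration N W = fr.M" by (rule relative_weight_filtration_eq[OF incW nil NW rel])
  then have "split_orbit W F N" unfolding split_orbit_def using fr.split_M[OF conj_pi decF] by simp
  then show ?thesis unfolding admissible_def using rel by blast
qed

end

section \<open>Infinitesimal consequences and conclusion\<close>

context rational_structure
begin

text \<open>\<open>N v\<close> is the coefficient of \<open>t\<close> in the polynomial
  \<open>exp(t N) v\<close>, so a property shared by all group elements \<open>exp(t N)\<close>
  passes to \<open>N\<close>. Only real \<open>t\<close> are available.\<close>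

lemma exp_mult_stable:
  assumes nil: "nilpotent N"
    and add: "\<And>x y. x \<in> S \<Longrightarrow> y \<in> S \<Longrightarrow> x + y \<in> S"
    and sc: "\<And>r x. x \<in> S \<Longrightarrow> complex_of_real r *\<^sub>C x \<in> S"
    and ex: "\<And>t::real. exp_mult (of_real t) N v \<in> S"
  shows "N v \<in> S"
proof -
  have eN: "endomorphism N" using nil unfolding nilpotent_def by blast
  obtain m0 where m0: "\<And>v. (N ^^ m0) v = 0" using nil unfolding nilpotent_def by blast
  \<comment> \<open>Two is added so that the coefficient of index \<open>1\<close> belongs to the
    truncated series.\<close>
  define m where "m = m0 + 2"
  have m: "(N ^^ m) v = 0" for v by (rule funpow_zero_ge[OF eN m0]) (simp add: m_def)
  have eq: "exp_mult z N = nexp m (\<lambda>v. z *\<^sub>C N v)" for z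
    unfolding exp_mult_def
    by (rule exp_end_eq_nexp[OF endo_scaled[OF eN]]) (simp add: nilpotent_scaled[OF eN] m)
  have "(1 / fact 1) *\<^sub>C (N ^^ 1) v \<in> S"
  proof (rule subspace_poly_coeff[OF add sc])
    fix t :: real
    show "(\<Sum>n<m. complex_of_real t ^ n *\<^sub>C (1 / fact n) *\<^sub>C (N ^^ n) v) \<in> S"
      using ex[of t] unfolding eq nexp_def nilpotent_scaled[OF eN] by (simp add: mult.commute)
    show "1 < m" by (simp add: m_def)
  qed
  then show ?thesis by simp
qed

end

theorem mainTheorem2:
  fixes scale :: "complex \<Rightarrow> 'v::ab_group_add \<Rightarrow> 'v" and B :: "'v set"
    and W F :: "int \<Rightarrow> 'v set" and S :: "int \<Rightarrow> 'v \<Rightarrow> 'v \<Rightarrow> complex"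
    and h :: "int \<Rightarrow> int \<Rightarrow> nat" and N :: "'v \<Rightarrow> 'v"
  assumes "rational_structure scale B"
    and "rational_structure.increasing_filtration scale {0} UNIV W"
    and "rational_structure.filtration_over_Q scale B W"
    and "rational_structure.graded_forms scale B W S"
    and "finite {(p, q). h p q \<noteq> 0}"
    and "rational_structure.nilpotent_orbit scale B W S h F N"
    and "\<And>k. rational_structure.Gr_split_orbit scale B W F N k"
  shows "rational_structure.admissible scale N W \<and> rational_structure.split_orbit scale B W F N
    \<longleftrightarrow> (\<exists>Y. rational_structure.grading scale W Y \<and>
             rational_structure.defined_over_R scale B Y \<and>
             rational_structure.end_tendsto scale B
               (\<lambda>z. rational_structure.Ad (rational_structure.exp_mult scale B (- z) N)
                      (rational_structure.hodge_grading scale B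
                        (rational_structure.act (rational_structure.exp_mult scale B z N) F) W))
               Y (filtercomap Im at_top))"
proof -
  interpret rational_structure scale B by (rule assms(1))
  have W: "subspace (W k)" for k using assms(2) unfolding increasing_filtration_def by blast
  have nil: "nilpotent N" and Lie: "N \<in> Lie (G_R W S)" and NF: "\<And>p. N ` F p \<subseteq> F (p - 1)"
    and decF: "decreasing_filtration {0} UNIV F"
    using assms(6) unfolding nilpotent_orbit_def compact_dual_def by blast+
  obtain \<alpha> where \<alpha>: "\<And>z. Im z > \<alpha> \<Longrightarrow> mixed_hodge_structure {0} UNIV (act (exp_mult z N) F) W"
    using assms(6) unfolding nilpotent_orbit_def classifying_space_def by blast
  have endoN: "endomorphism N" using nil unfolding nilpotent_def by blast
  have G: "exp_mult (of_real t) N ` V_R = V_R" "exp_mult (of_real t) N ` W k = W k" for t :: real and k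
    using Lie unfolding Lie_def G_R_def by blast+
  have NW: "N ` W k \<subseteq> W k" for k
  proof (rule image_subsetI)
    fix v assume v: "v \<in> W k"
    show "N v \<in> W k"
    proof (rule exp_mult_stable[OF nil])
      show "exp_mult (of_real t) N v \<in> W k" for t using imageI[OF v, of "exp_mult (of_real t) N"] unfolding G(2) .
    qed (simp_all add: subspace_add[OF W] subspace_scale[OF W])
  qed
  have "defined_over_R N"
    unfolding defined_over_R_def
  proof (rule image_subsetI)
    fix v assume v: "v \<in> V_R"
    show "N v \<in> V_R"
    proof (rule exp_mult_stable[OF nil])
      show "exp_mult (of_real t) N v \<in> V_R" for t using G(1) v by blast
    qed (simp_all add: V_R_iff vconj_add vconj_scale)
  qed
  then have realN: "N (vconj v) = vconj (N v)" for v unfolding defined_over_R_iff[OF endoN] by blast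
  interpret orbit scale B W F N \<alpha>
    by unfold_locales (use assms(2,7) decF nil NW realN NF \<alpha> in blast)+
  show ?thesis
  proof
    assume "admissible N W \<and> split_orbit W F N"
    then obtain M where rel: "is_relative_weight_filtration N W M" and split: "split_orbit W F N"
      unfolding admissible_def by blast
    have "split_over_R {0} UNIV F M"
      using split unfolding split_orbit_def relative_weight_filtration_eq[OF incW nil NW rel] .
    from split_limit[OF rel this]
    show "\<exists>Y. grading W Y \<and> defined_over_R Y \<and> end_tendsto (\<lambda>z. Ad (exp_mult (- z) N)
        (hodge_grading (act (exp_mult z N) F) W)) Y (filtercomap Im at_top)"
      unfolding psi_def[abs_def] .
  next
    assume "\<exists>Y. grading W Y \<and> defined_over_R Y \<and> end_tendsto (\<lambda>z. Ad (exp_mult (- z) N)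
        (hodge_grading (act (exp_mult z N) F) W)) Y (filtercomap Im at_top)"
    then show "admissible N W \<and> split_orbit W F N"
      unfolding psi_def[abs_def, symmetric] using limit_split by blast
  qed
qed

end
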